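(* Suppose that $A$ is a unital, simple, and separable $C^*$-algebra with the local weak comparison property and with $QT(A)=T(A)\neq\emptyset$. Then every nuclear completely positive map $\varphi\colon A\to A$ can be excised in small central sequences.
   Context: A completely positive map is nuclear if it is a point-norm limit of maps of the form $V\circ U$ with $U\colon A\to M_n$, $V\colon M_n\to A$ completely positive. $T(A)$ is the set of tracial states of $A$ and $QT(A)$ the set of unital $2$-quasi-traces (functions $\tau\colon A\to\mathbb{C}$ with $\tau(1)=1$, $\tau(x^*x)=\tau(xx^* )\geq0$, $\tau(a+ib)=\tau(a)+i\tau(b)$ for self-adjoint $a,b$, linear on commutative sub-$C^*$-algebras, and extending to $M_2(A)$ with the same properties apart from normalization). For positive $a$, $d_\tau(a)=\lim_{n\to\infty}\tau(a^{1/n})$. Write $a\precsim b$ if there are $r_n\in A$ with $r_n^*br_n\to a$. $A$ has local weak comparison if there is a constant $\gamma(A)\in[1,\infty)$ such that for all positive $a,b\in A$: if $\gamma(A)\cdot\sup_{\tau\in QT(A)}d_\tau(a)<\inf_{\tau\in QT(A)}d_\tau(b)$, then $a\precsim b$. Fix a free ultrafilter $\omega$ on $\mathbb{N}$; $A_\omega=\ell^\infty(A)/\{(a_n):\lim_{n\to\omega}\|a_n\|=0\}$ with quotient map $\pi_\omega$; $A\subseteq A_\omega$ via constant sequences; $F(A)=A_\omega\cap A'$. For $a\in A$, $\|a\|_2=\sup_{\tau\in T(A)}\tau(a^*a)^{1/2}$; $\|\pi_\omega(a_1,a_2,\dots)\|_{2,\omega}=\lim_{n\to\omega}\|a_n\|_2$;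 $J_A=\{a\in A_\omega:\|a\|_{2,\omega}=0\}$. A completely positive map $\varphi\colon A\to A$ can be excised in small central sequences if for all positive contractions $e,f\in F(A)$ with $e\in J_A$ and $\sup_{n\ge1}\|1-f^n\|_{2,\omega}<1$ there exists $s\in A_\omega$ with $fs=s$ and $s^*as=\varphi(a)e$ for all $a\in A$. *)

theory Defs
  imports "HOL-Analysis.Analysis" "HOL-Algebra.QuotRing" "HOL-Algebra.Module"
begin

text \<open>
  Several algebras occur at once (\<open>A\<close>, \<open>M\<^sub>n\<close>, \<open>M\<^sub>n(A)\<close>, \<open>\<ell>\<^sup>\<infinity>(A)\<close>, \<open>A\<^sub>\<omega>\<close>), so they are records with
  explicit carriers, extending the ring and module records of HOL-Algebra.
\<close>

section \<open>Unital C*-algebras\<close>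

record 'a star_alg = "(complex, 'a) module" +
  star :: "'a \<Rightarrow> 'a"
  nrm :: "'a \<Rightarrow> real"

definition complex_ring :: "complex ring" where
  "complex_ring = \<lparr>carrier = UNIV, mult = (*), one = 1, zero = 0, add = (+)\<rparr>"

definition complex_alg :: "complex star_alg" where
  "complex_alg = \<lparr>carrier = UNIV, mult = (*), one = 1, zero = 0, add = (+),
     smult = (*), star = cnj, nrm = cmod\<rparr>"

text \<open>The locale \<^locale>\<open>Metric_space\<close> constrains the distance also outside the carrier, hence the
  default value 0.\<close>

definition alg_dist :: "'a star_alg \<Rightarrow> 'a \<Rightarrow> 'a \<Rightarrow> real" where
  "alg_dist A x y = (if x \<in> carrier A \<and> y \<in> carrier A then nrm A (x \<ominus>\<^bsub>A\<^esub> y) else 0)"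

definition alg_top :: "'a star_alg \<Rightarrow> 'a topology" where
  "alg_top A = Metric_space.mtopology (carrier A) (alg_dist A)"

locale cstar_algebra = module complex_ring A + ring A for A :: "'a star_alg" (structure) +
  assumes smult_mult_left:
      "\<lbrakk>x \<in> carrier A; y \<in> carrier A\<rbrakk> \<Longrightarrow> (z \<odot> x) \<otimes> y = z \<odot> (x \<otimes> y)"
    and smult_mult_right:
      "\<lbrakk>x \<in> carrier A; y \<in> carrier A\<rbrakk> \<Longrightarrow> x \<otimes> (z \<odot> y) = z \<odot> (x \<otimes> y)"
    and star_closed: "x \<in> carrier A \<Longrightarrow> star A x \<in> carrier A"
    and star_star: "x \<in> carrier A \<Longrightarrow> star A (star A x) = x"
    and star_add:
      "\<lbrakk>x \<in> carrier A; y \<in> carrier A\<rbrakk> \<Longrightarrow> star A (x \<oplus> y) = star A x \<oplus> star A y"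
    and star_smult: "x \<in> carrier A \<Longrightarrow> star A (z \<odot> x) = cnj z \<odot> star A x"
    and star_mult:
      "\<lbrakk>x \<in> carrier A; y \<in> carrier A\<rbrakk> \<Longrightarrow> star A (x \<otimes> y) = star A y \<otimes> star A x"
    and nrm_nonneg: "x \<in> carrier A \<Longrightarrow> 0 \<le> nrm A x"
    and nrm_eq_0_iff: "x \<in> carrier A \<Longrightarrow> nrm A x = 0 \<longleftrightarrow> x = \<zero>"
    and nrm_triangle:
      "\<lbrakk>x \<in> carrier A; y \<in> carrier A\<rbrakk> \<Longrightarrow> nrm A (x \<oplus> y) \<le> nrm A x + nrm A y"
    and nrm_smult: "x \<in> carrier A \<Longrightarrow> nrm A (z \<odot> x) = cmod z * nrm A x"
    and nrm_mult:
      "\<lbrakk>x \<in> carrier A; y \<in> carrier A\<rbrakk> \<Longrightarrow> nrm A (x \<otimes> y) \<le> nrm A x * nrm A y"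
    and nrm_star_mult: "x \<in> carrier A \<Longrightarrow> nrm A (star A x \<otimes> x) = (nrm A x)\<^sup>2"
    and complete: "Metric_space.mcomplete (carrier A) (alg_dist A)"

definition simple_alg :: "'a star_alg \<Rightarrow> bool" where
  "simple_alg A \<longleftrightarrow> carrier A \<noteq> {\<zero>\<^bsub>A\<^esub>} \<and>
     (\<forall>I. ideal I A \<and> closedin (alg_top A) I \<longrightarrow> I = {\<zero>\<^bsub>A\<^esub>} \<or> I = carrier A)"

definition separable_alg :: "'a star_alg \<Rightarrow> bool" where
  "separable_alg A \<longleftrightarrow> separable_space (alg_top A)"

definition self_adjoint :: "'a star_alg \<Rightarrow> 'a \<Rightarrow> bool" where
  "self_adjoint A a \<longleftrightarrow> a \<in> carrier A \<and> star A a = a"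

definition alg_spectrum :: "'a star_alg \<Rightarrow> 'a \<Rightarrow> complex set" where
  "alg_spectrum A a = {z. (z \<odot>\<^bsub>A\<^esub> \<one>\<^bsub>A\<^esub>) \<ominus>\<^bsub>A\<^esub> a \<notin> Units A}"

definition positive :: "'a star_alg \<Rightarrow> 'a \<Rightarrow> bool" where
  "positive A a \<longleftrightarrow> self_adjoint A a \<and> alg_spectrum A a \<subseteq> \<real>\<^sub>\<ge>\<^sub>0"

definition positive_contraction :: "'a star_alg \<Rightarrow> 'a \<Rightarrow> bool" where
  "positive_contraction A a \<longleftrightarrow> positive A a \<and> nrm A a \<le> 1"

text \<open>The unique positive \<open>n\<close>-th root \<open>a\<^sup>1\<^sup>/\<^sup>n\<close> of a positive element (\<open>n \<ge> 1\<close>).\<close>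

definition alg_root :: "'a star_alg \<Rightarrow> nat \<Rightarrow> 'a \<Rightarrow> 'a" where
  "alg_root A n a = (THE b. positive A b \<and> b [^]\<^bsub>A\<^esub> n = a)"

definition sub_cstar_algebra :: "'a set \<Rightarrow> 'a star_alg \<Rightarrow> bool" where
  "sub_cstar_algebra C A \<longleftrightarrow> C \<subseteq> carrier A \<and> \<zero>\<^bsub>A\<^esub> \<in> C \<and>
     (\<forall>x\<in>C. \<forall>y\<in>C. x \<oplus>\<^bsub>A\<^esub> y \<in> C \<and> x \<otimes>\<^bsub>A\<^esub> y \<in> C) \<and>
     (\<forall>x\<in>C. star A x \<in> C \<and> (\<forall>z. z \<odot>\<^bsub>A\<^esub> x \<in> C)) \<and>
     closedin (alg_top A) C"


section \<open>Matrix algebras and completely positive maps\<close>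

text \<open>The C*-norm on \<open>M\<^sub>n(B)\<close> is the operator norm for the action on the Hilbert \<open>B\<close>-module
  \<open>B\<^sup>n\<close>, whose norm is \<open>\<parallel>v\<parallel> = \<parallel>\<Sum>\<^sub>i v\<^sub>i\<^sup>* v\<^sub>i\<parallel>\<^sup>1\<^sup>/\<^sup>2\<close>.\<close>

definition column_norm :: "nat \<Rightarrow> 'b star_alg \<Rightarrow> (nat \<Rightarrow> 'b) \<Rightarrow> real" where
  "column_norm n B v = sqrt (nrm B (\<Oplus>\<^bsub>B\<^esub>i\<in>{..<n}. star B (v i) \<otimes>\<^bsub>B\<^esub> v i))"

definition mat_alg :: "nat \<Rightarrow> 'b star_alg \<Rightarrow> (nat \<Rightarrow> nat \<Rightarrow> 'b) star_alg" where
  "mat_alg n B =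
    \<lparr>carrier = {..<n} \<rightarrow>\<^sub>E ({..<n} \<rightarrow>\<^sub>E carrier B),
     mult = (\<lambda>x y. \<lambda>i\<in>{..<n}. \<lambda>j\<in>{..<n}. \<Oplus>\<^bsub>B\<^esub>k\<in>{..<n}. x i k \<otimes>\<^bsub>B\<^esub> y k j),
     one = (\<lambda>i\<in>{..<n}. \<lambda>j\<in>{..<n}. if i = j then \<one>\<^bsub>B\<^esub> else \<zero>\<^bsub>B\<^esub>),
     zero = (\<lambda>i\<in>{..<n}. \<lambda>j\<in>{..<n}. \<zero>\<^bsub>B\<^esub>),
     add = (\<lambda>x y. \<lambda>i\<in>{..<n}. \<lambda>j\<in>{..<n}. x i j \<oplus>\<^bsub>B\<^esub> y i j),
     smult = (\<lambda>z x. \<lambda>i\<in>{..<n}. \<lambda>j\<in>{..<n}. z \<odot>\<^bsub>B\<^esub> x i j),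
     star = (\<lambda>x. \<lambda>i\<in>{..<n}. \<lambda>j\<in>{..<n}. star B (x j i)),
     nrm = (\<lambda>x. SUP v\<in>{v \<in> {..<n} \<rightarrow>\<^sub>E carrier B. column_norm n B v \<le> 1}.
              column_norm n B (\<lambda>i\<in>{..<n}. \<Oplus>\<^bsub>B\<^esub>j\<in>{..<n}. x i j \<otimes>\<^bsub>B\<^esub> v j))\<rparr>"

definition mat_map :: "nat \<Rightarrow> ('a \<Rightarrow> 'b) \<Rightarrow> (nat \<Rightarrow> nat \<Rightarrow> 'a) \<Rightarrow> nat \<Rightarrow> nat \<Rightarrow> 'b" where
  "mat_map n \<phi> x = (\<lambda>i\<in>{..<n}. \<lambda>j\<in>{..<n}. \<phi> (x i j))"

definition linear_map :: "'a star_alg \<Rightarrow> 'b star_alg \<Rightarrow> ('a \<Rightarrow> 'b) \<Rightarrow> bool" where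
  "linear_map A B \<phi> \<longleftrightarrow> \<phi> \<in> carrier A \<rightarrow> carrier B \<and>
     (\<forall>x\<in>carrier A. \<forall>y\<in>carrier A. \<phi> (x \<oplus>\<^bsub>A\<^esub> y) = \<phi> x \<oplus>\<^bsub>B\<^esub> \<phi> y) \<and>
     (\<forall>x\<in>carrier A. \<forall>z. \<phi> (z \<odot>\<^bsub>A\<^esub> x) = z \<odot>\<^bsub>B\<^esub> \<phi> x)"

definition completely_positive :: "'a star_alg \<Rightarrow> 'b star_alg \<Rightarrow> ('a \<Rightarrow> 'b) \<Rightarrow> bool" where
  "completely_positive A B \<phi> \<longleftrightarrow> linear_map A B \<phi> \<and>
     (\<forall>k\<ge>1. \<forall>x. positive (mat_alg k A) x \<longrightarrow> positive (mat_alg k B) (mat_map k \<phi> x))"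

definition nuclear_map :: "'a star_alg \<Rightarrow> ('a \<Rightarrow> 'a) \<Rightarrow> bool" where
  "nuclear_map A \<phi> \<longleftrightarrow>
     (\<forall>F \<epsilon>. finite F \<and> F \<subseteq> carrier A \<and> \<epsilon> > 0 \<longrightarrow>
       (\<exists>n\<ge>1. \<exists>U V. completely_positive A (mat_alg n complex_alg) U \<and>
          completely_positive (mat_alg n complex_alg) A V \<and>
          (\<forall>a\<in>F. nrm A (\<phi> a \<ominus>\<^bsub>A\<^esub> V (U a)) < \<epsilon>)))"


section \<open>Traces, quasi-traces and comparison\<close>

text \<open>Functionals are extensional, so that \<open>T(A)\<close> and \<open>QT(A)\<close> are sets of functions on \<open>A\<close>.\<close>

definition tracial_states :: "'a star_alg \<Rightarrow> ('a \<Rightarrow> complex) set" where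
  "tracial_states A = {\<tau> \<in> extensional (carrier A).
     linear_map A complex_alg \<tau> \<and> \<tau> \<one>\<^bsub>A\<^esub> = 1 \<and>
     (\<forall>a. positive A a \<longrightarrow> \<tau> a \<in> \<real>\<^sub>\<ge>\<^sub>0) \<and>
     (\<forall>x\<in>carrier A. \<forall>y\<in>carrier A. \<tau> (x \<otimes>\<^bsub>A\<^esub> y) = \<tau> (y \<otimes>\<^bsub>A\<^esub> x))}"

definition quasi_trace :: "'a star_alg \<Rightarrow> ('a \<Rightarrow> complex) \<Rightarrow> bool" where
  "quasi_trace A \<tau> \<longleftrightarrow>
     (\<forall>x\<in>carrier A. \<tau> (star A x \<otimes>\<^bsub>A\<^esub> x) = \<tau> (x \<otimes>\<^bsub>A\<^esub> star A x) \<and>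
        \<tau> (star A x \<otimes>\<^bsub>A\<^esub> x) \<in> \<real>\<^sub>\<ge>\<^sub>0) \<and>
     (\<forall>a b. self_adjoint A a \<and> self_adjoint A b \<longrightarrow>
        \<tau> (a \<oplus>\<^bsub>A\<^esub> (\<i> \<odot>\<^bsub>A\<^esub> b)) = \<tau> a + \<i> * \<tau> b) \<and>
     (\<forall>C. sub_cstar_algebra C A \<and> (\<forall>x\<in>C. \<forall>y\<in>C. x \<otimes>\<^bsub>A\<^esub> y = y \<otimes>\<^bsub>A\<^esub> x) \<longrightarrow>
        (\<forall>x\<in>C. \<forall>y\<in>C. \<tau> (x \<oplus>\<^bsub>A\<^esub> y) = \<tau> x + \<tau> y) \<and>
        (\<forall>x\<in>C. \<forall>z. \<tau> (z \<odot>\<^bsub>A\<^esub> x) = z * \<tau> x))"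

text \<open>\<open>A\<close> sits in \<open>M\<^sub>2(A)\<close> as the upper left corner.\<close>

definition corner :: "'a star_alg \<Rightarrow> 'a \<Rightarrow> nat \<Rightarrow> nat \<Rightarrow> 'a" where
  "corner A a = (\<lambda>i\<in>{..<2}. \<lambda>j\<in>{..<2}. if i = 0 \<and> j = 0 then a else \<zero>\<^bsub>A\<^esub>)"

definition quasi_traces :: "'a star_alg \<Rightarrow> ('a \<Rightarrow> complex) set" where
  "quasi_traces A = {\<tau> \<in> extensional (carrier A).
     quasi_trace A \<tau> \<and> \<tau> \<one>\<^bsub>A\<^esub> = 1 \<and>
     (\<exists>\<tau>\<^sub>2. quasi_trace (mat_alg 2 A) \<tau>\<^sub>2 \<and> (\<forall>a\<in>carrier A. \<tau>\<^sub>2 (corner A a) = \<tau> a))}"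

text \<open>Quasi-traces are complex-valued functions that are real on positive elements; hence \<open>Re\<close>.\<close>

definition dim_fun :: "'a star_alg \<Rightarrow> ('a \<Rightarrow> complex) \<Rightarrow> 'a \<Rightarrow> real" where
  "dim_fun A \<tau> a = lim (\<lambda>n. Re (\<tau> (alg_root A n a)))"

definition cuntz_below :: "'a star_alg \<Rightarrow> 'a \<Rightarrow> 'a \<Rightarrow> bool" where
  "cuntz_below A a b \<longleftrightarrow>
     (\<exists>r. range r \<subseteq> carrier A \<and>
        limitin (alg_top A) (\<lambda>n. star A (r n) \<otimes>\<^bsub>A\<^esub> b \<otimes>\<^bsub>A\<^esub> r n) a sequentially)"

definition local_weak_comparison :: "'a star_alg \<Rightarrow> bool" where
  "local_weak_comparison A \<longleftrightarrow>
     (\<exists>\<gamma>::real. \<gamma> \<ge> 1 \<and>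
        (\<forall>a b. positive A a \<and> positive A b \<and>
           ereal \<gamma> * (SUP \<tau>\<in>quasi_traces A. ereal (dim_fun A \<tau> a))
             < (INF \<tau>\<in>quasi_traces A. ereal (dim_fun A \<tau> b)) \<longrightarrow>
           cuntz_below A a b))"


section \<open>Ultrapowers and central sequences\<close>

definition free_ultrafilter :: "nat filter \<Rightarrow> bool" where
  "free_ultrafilter \<omega> \<longleftrightarrow> \<omega> \<noteq> bot \<and>
     (\<forall>P. eventually P \<omega> \<or> eventually (\<lambda>n. \<not> P n) \<omega>) \<and>
     (\<forall>m. eventually (\<lambda>n. n \<noteq> m) \<omega>)"

definition ell_infty :: "'a star_alg \<Rightarrow> (nat \<Rightarrow> 'a) star_alg" where
  "ell_infty A =
    \<lparr>carrier = {a. range a \<subseteq> carrier A \<and> bdd_above (range (\<lambda>n. nrm A (a n)))},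
     mult = (\<lambda>a b n. a n \<otimes>\<^bsub>A\<^esub> b n),
     one = (\<lambda>n. \<one>\<^bsub>A\<^esub>),
     zero = (\<lambda>n. \<zero>\<^bsub>A\<^esub>),
     add = (\<lambda>a b n. a n \<oplus>\<^bsub>A\<^esub> b n),
     smult = (\<lambda>z a n. z \<odot>\<^bsub>A\<^esub> a n),
     star = (\<lambda>a n. star A (a n)),
     nrm = (\<lambda>a. SUP n. nrm A (a n))\<rparr>"

definition null_seqs :: "nat filter \<Rightarrow> 'a star_alg \<Rightarrow> (nat \<Rightarrow> 'a) set" where
  "null_seqs \<omega> A = {a \<in> carrier (ell_infty A). ((\<lambda>n. nrm A (a n)) \<longlongrightarrow> 0) \<omega>}"

text \<open>The quotient ring \<open>B Quot I\<close> with the induced scalar multiplication and involution and with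
  the quotient norm. The scalar multiple and adjoint of a coset are formed in the same way as the
  product in \<^const>\<open>rcoset_mult\<close>.\<close>

definition quot_alg :: "'b star_alg \<Rightarrow> 'b set \<Rightarrow> 'b set star_alg" where
  "quot_alg B I =
    \<lparr>carrier = carrier (B Quot I), mult = mult (B Quot I), one = one (B Quot I),
     zero = zero (B Quot I), add = add (B Quot I),
     smult = (\<lambda>z X. \<Union>x\<in>X. I +>\<^bsub>B\<^esub> (z \<odot>\<^bsub>B\<^esub> x)),
     star = (\<lambda>X. \<Union>x\<in>X. I +>\<^bsub>B\<^esub> star B x),
     nrm = (\<lambda>X. INF x\<in>X. nrm B x)\<rparr>"

definition ultrapower :: "nat filter \<Rightarrow> 'a star_alg \<Rightarrow> (nat \<Rightarrow> 'a) set star_alg" where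
  "ultrapower \<omega> A = quot_alg (ell_infty A) (null_seqs \<omega> A)"

definition ultra_proj :: "nat filter \<Rightarrow> 'a star_alg \<Rightarrow> (nat \<Rightarrow> 'a) \<Rightarrow> (nat \<Rightarrow> 'a) set" where
  "ultra_proj \<omega> A a = null_seqs \<omega> A +>\<^bsub>ell_infty A\<^esub> a"

definition ultra_const :: "nat filter \<Rightarrow> 'a star_alg \<Rightarrow> 'a \<Rightarrow> (nat \<Rightarrow> 'a) set" where
  "ultra_const \<omega> A a = ultra_proj \<omega> A (\<lambda>n. a)"

definition central_seq_alg :: "nat filter \<Rightarrow> 'a star_alg \<Rightarrow> (nat \<Rightarrow> 'a) set set" where
  "central_seq_alg \<omega> A = {x \<in> carrier (ultrapower \<omega> A). \<forall>a\<in>carrier A.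
     x \<otimes>\<^bsub>ultrapower \<omega> A\<^esub> ultra_const \<omega> A a = ultra_const \<omega> A a \<otimes>\<^bsub>ultrapower \<omega> A\<^esub> x}"

definition norm2 :: "'a star_alg \<Rightarrow> 'a \<Rightarrow> real" where
  "norm2 A a = (SUP \<tau>\<in>tracial_states A. sqrt (Re (\<tau> (star A a \<otimes>\<^bsub>A\<^esub> a))))"

text \<open>The limit does not depend on the representative of the class \<open>x\<close>.\<close>

definition norm2_ultra :: "nat filter \<Rightarrow> 'a star_alg \<Rightarrow> (nat \<Rightarrow> 'a) set \<Rightarrow> real" where
  "norm2_ultra \<omega> A x =
     (THE l. \<exists>a\<in>carrier (ell_infty A). x = ultra_proj \<omega> A a \<and> ((\<lambda>n. norm2 A (a n)) \<longlongrightarrow> l) \<omega>)"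

definition trace_kernel :: "nat filter \<Rightarrow> 'a star_alg \<Rightarrow> (nat \<Rightarrow> 'a) set set" where
  "trace_kernel \<omega> A = {x \<in> carrier (ultrapower \<omega> A). norm2_ultra \<omega> A x = 0}"

text \<open>Positive contractions of \<open>F(A)\<close> are those of \<open>A\<^sub>\<omega>\<close> that lie in \<open>F(A)\<close>, since positivity and norm
  of an element of a unital C*-subalgebra do not depend on the ambient algebra.\<close>

definition excised_in_small_central_sequences ::
    "nat filter \<Rightarrow> 'a star_alg \<Rightarrow> ('a \<Rightarrow> 'a) \<Rightarrow> bool" where
  "excised_in_small_central_sequences \<omega> A \<phi> \<longleftrightarrow>
     (let U = ultrapower \<omega> A; \<iota> = ultra_const \<omega> A in
      \<forall>e f. e \<in> central_seq_alg \<omega> A \<and> f \<in> central_seq_alg \<omega> A \<and>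
        positive_contraction U e \<and> positive_contraction U f \<and> e \<in> trace_kernel \<omega> A \<and>
        (SUP n\<in>{1..}. norm2_ultra \<omega> A (\<one>\<^bsub>U\<^esub> \<ominus>\<^bsub>U\<^esub> (f [^]\<^bsub>U\<^esub> (n::nat)))) < 1 \<longrightarrow>
        (\<exists>s\<in>carrier U. f \<otimes>\<^bsub>U\<^esub> s = s \<and>
           (\<forall>a\<in>carrier A. star U s \<otimes>\<^bsub>U\<^esub> \<iota> a \<otimes>\<^bsub>U\<^esub> s = \<iota> (\<phi> a) \<otimes>\<^bsub>U\<^esub> e)))"

end

theory Submission
 imports Defs "HOL-Computational_Algebra.Fundamental_Theorem_Algebra"
begin

text \<open>The algebra is embedded as a corner, cut out by a central projection, of a C*-algebra living on a
type. Positivity of the Choi matrix and Gaussian elimination in matrix algebras, which are again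
C*-algebras, turn a map factoring through \<open>M\<^sub>n\<close> into \<open>\<Sum> u\<^sub>i\<^sub>j(a) c\<^sub>i\<^sup>* c\<^sub>j\<close> with completely positive
coefficients \<open>u\<close>. A separation argument approximates these coefficients by compressions
\<open>h x\<^sub>i\<^sup>* a x\<^sub>j h \<approx> u\<^sub>i\<^sub>j(a) h\<^sup>2\<close> with a norm-one bump \<open>h\<close>: pure states can be excised, and simplicity
moves the bumps of finitely many states under a single one. The traces of \<open>h f\<^sup>n h\<close> stay away from \<open>0\<close>,
while the traces of \<open>e\<close> tend to \<open>0\<close>; local weak comparison therefore yields \<open>t\<close> supported under \<open>f\<close> and
\<open>h\<close> with \<open>t\<^sup>* t \<approx> e\<close>. Then \<open>\<Sum> x\<^sub>i t c\<^sub>i\<close> excises the map approximately, and a diagonal sequence along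
the ultrafilter is exact.\<close>

section \<open>C*-algebras as a type class\<close>

text \<open>No Hilbert space, state or representation occurs: positivity is handled through
  \<open>norm (of_real t - a) <= t\<close>, and pure states appear only as bumps. A bump on which
  the compressed norm of \<open>c\<close> is almost minimal contains a smaller one on which
  \<open>c\<close> is almost scalar. Simplicity is used as an inequality: a nonzero positive
  \<open>g\<close> satisfies \<open>\<Sum> adj w * g * w >= p\<close> for finitely many
  \<open>w\<close>. Adding two excised families needs almost orthogonal bumps, hence bumps of
  arbitrarily small trace; if there are none, \<open>e\<close> tends to 0 in norm and
  \<open>s = 0\<close> works. So the proof splits on \<open>small\<close>. The hypothesis on all
  powers of \<open>f\<close> dictates the order of the constants: the lower bound \<open>c\<close>
  for the traces of \<open>g * f n ^ (2 * l) * g\<close> is found before \<open>l\<close>, since the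
  cut-off \<open>\<theta>\<close> is a fraction of \<open>c\<close> and only then is
  \<open>l\<close> taken so large that \<open>t ^ (2 * l)\<close> exceeds \<open>\<theta>\<close>
  only for \<open>t\<close> near 1. The comparison element must also be bounded independently of
  \<open>n\<close>, because it is multiplied by commutators that are merely small along the
  ultrafilter.\<close>

class cstar = real_normed_algebra_1 + banach +
 fixes adj :: "'a => 'a" and imag :: 'a
 assumes imag_sq: "imag * imag = - 1" and imag_comm: "imag * x = x * imag"
  and adj_imag: "adj imag = - imag"
  and adj_add: "adj (x + y) = adj x + adj y" and adj_mult: "adj (x * y) = adj y * adj x"
  and adj_adj [simp]: "adj (adj x) = x" and adj_scaleR: "adj (scaleR r x) = scaleR r (adj x)"
  and norm_adj_mult: "norm (adj x * x) = norm x ^ 2"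

instantiation complex :: cstar begin
definition "adj_complex = cnj"
definition "imag_complex = \<i>"
instance
 by standard (auto simp: adj_complex_def imag_complex_def norm_mult power2_eq_square)
end

lemma adj_zero [simp]: "adj (0::'a::cstar) = 0"
 using adj_scaleR[of 0 "0::'a"] by simp

lemma adj_one [simp]: "adj (1::'a::cstar) = 1"
 by (metis adj_adj adj_mult mult_1)

lemma adj_minus [simp]: "adj (- x) = - adj (x::'a::cstar)"
 using adj_scaleR[of "-1" x] by simp

lemma adj_diff: "adj (x - y) = adj x - adj (y::'a::cstar)"
 using adj_add[of x "-y"] by simp

lemma adj_of_real [simp]: "adj (of_real r :: 'a::cstar) = of_real r"
 by (simp add: of_real_def adj_scaleR)

lemma norm_adj [simp]: "norm (adj x) = norm (x::'a::cstar)"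
proof -
 have *: "norm x <= norm (adj x)" for x :: 'a
 proof (cases "x = 0")
  case False
  have "norm x * norm x <= norm (adj x) * norm x"
   by (metis norm_adj_mult norm_mult_ineq power2_eq_square)
  then show ?thesis using False by simp
 qed auto
 show ?thesis using *[of x] *[of "adj x"] by simp
qed

lemma norm_mult_adj: "norm (x * adj x) = norm (x::'a::cstar) ^ 2"
 using norm_adj_mult[of "adj x"] by simp

lemma bounded_linear_adj: "bounded_linear (adj :: 'a::cstar => 'a)"
 by (rule bounded_linear_intro[where K = 1]) (auto simp: adj_add adj_scaleR)

lemmas tendsto_adj [tendsto_intros] = bounded_linear.tendsto[OF bounded_linear_adj]

lemma adj_power: "adj (x ^ n) = adj (x::'a::cstar) ^ n"
 by (induction n) (auto simp: adj_mult power_commutes)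

lemma adj_sum: "adj (sum f A) = (\<Sum>i\<in>A. adj (f i :: 'a::cstar))"
 by (induction A rule: infinite_finite_induct) (auto simp: adj_add)

lemma norm_sa_sq: "adj x = x ==> norm (x * x) = norm (x::'a::cstar) ^ 2"
 using norm_adj_mult[of x] by simp

lemma mult_of_real_left: "of_real r * x = scaleR r (x::'a::real_algebra_1)"
 by (simp add: scaleR_conv_of_real)

lemma mult_of_real_right: "x * of_real r = scaleR r (x::'a::real_algebra_1)"
 by (simp add: of_real_def)

text \<open>The class has real scalars only; complex ones are central elements built from
  \<open>imag\<close>, a central skew-adjoint square root of -1.\<close>

definition cx :: "complex => 'a::cstar" where
 "cx z = of_real (Re z) + scaleR (Im z) imag"

lemma cx_add: "cx (z + w) = cx z + cx w"
 by (simp add: cx_def algebra_simps scaleR_add_left)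

lemma cx_mult: "cx (z * w) = cx z * cx w"
 by (simp add: cx_def algebra_simps scaleR_add_left imag_sq of_real_def)

lemma cx_of_real: "cx (of_real r) = of_real r"
 by (simp add: cx_def)

lemma cx_0 [simp]: "cx 0 = 0" and cx_1 [simp]: "cx 1 = 1" and cx_i: "cx \<i> = imag"
 by (simp_all add: cx_def)

lemma cx_comm: "cx z * x = x * cx z"
 by (simp add: cx_def algebra_simps imag_comm of_real_def)

lemma cx_uminus: "cx (- z) = - cx z"
 by (simp add: cx_def)

lemma cx_diff: "cx (z - w) = cx z - cx w"
 using cx_add[of z "-w"] by (simp add: cx_uminus)

lemma adj_cx: "adj (cx z) = cx (cnj z)"
 by (simp add: cx_def adj_add adj_scaleR adj_imag)

text \<open>No axiom bounds \<open>imag\<close>; the C*-identity does, because \<open>cx z\<close>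
  is central and \<open>cx (cnj z) * cx z\<close> is the real scalar
  \<open>(cmod z)^2\<close>.\<close>

lemma norm_cx_mult: "norm (cx z * x) = cmod z * norm (x::'a::cstar)"
proof -
 have "norm (cx z * x)^2 = norm (adj (cx z * x) * (cx z * x))"
  by (simp add: norm_adj_mult)
 also have "adj (cx z * x) * (cx z * x) = cx (cnj z * z) * (adj x * x)"
 proof -
  have "adj x * cx (cnj z) * (cx z * x) = cx (cnj z) * adj x * (cx z * x)" by (simp add: cx_comm)
  also have "... = cx (cnj z) * (adj x * cx z) * x" by (simp add: mult.assoc)
  also have "adj x * cx z = cx z * adj x" by (simp add: cx_comm)
  finally show ?thesis by (simp add: adj_mult adj_cx cx_mult mult.assoc)
 qed
 also have "cnj z * z = of_real ((cmod z)^2)"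
  by (metis complex_norm_square mult.commute)
 also have "norm (cx (of_real ((cmod z)^2)) * (adj x * x)) = (cmod z * norm x)^2"
  by (simp only: cx_of_real mult_of_real_left norm_scaleR) (simp add: norm_adj_mult power_mult_distrib)
 finally show ?thesis by (simp add: power2_eq_iff_nonneg)
qed

section \<open>Positive elements\<close>

text \<open>Squares of self-adjoint elements rather than \<open>adj x * x\<close>: square roots then
  come with the definition, and that \<open>adj x * x\<close> is positive becomes the theorem
  \<open>psd_adj_mult\<close>.\<close>

definition psd :: "'a::cstar => bool" where
 "psd a \<longleftrightarrow> (\<exists>b. adj b = b \<and> a = b * b)"

lemma psd_sa: "psd a ==> adj a = a"
 by (auto simp: psd_def adj_mult)

lemma psd_sq: "adj b = b ==> psd (b * b)"
 by (auto simp: psd_def)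

text \<open>The binomial series of \<open>sqrt (1 - y)\<close> converges absolutely also for \<open>norm y = 1\<close>, because
 its partial sums at \<open>y = 1\<close> are nonnegative and all but its first coefficients are nonpositive.\<close>

lemma gbinomial_half_sign: "(-1) ^ Suc k * ((1/2::real) gchoose Suc k) <= 0"
proof (induction k)
 case (Suc k)
 have "((1/2::real) gchoose Suc (Suc k)) = ((1/2) gchoose Suc k) * (1/2 - real (Suc k)) / real (Suc (Suc k))"
  by (simp add: gbinomial_mult_1[of "1/2::real" "Suc k"] field_simps)
   (use gbinomial_mult_1[of "1/2::real" "Suc k"] in \<open>simp add: algebra_simps\<close>)
 then have "(-1) ^ Suc (Suc k) * ((1/2::real) gchoose Suc (Suc k))
   = ((-1) ^ Suc k * ((1/2) gchoose Suc k)) * ((real (Suc k) - 1/2) / real (Suc (Suc k)))"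
  by (simp only:) (simp add: divide_simps, simp add: algebra_simps)
 also have "... <= 0"
  by (intro mult_nonpos_nonneg Suc) auto
 finally show ?case .
qed auto

lemma gbinomial_half_minus_sign: "(-1) ^ k * ((1/2 - 1::real) gchoose k) >= 0"
proof (induction k)
 case (Suc k)
 have "((1/2-1::real) gchoose Suc k) = ((1/2-1) gchoose k) * (1/2 -1- real k) / real (Suc k)"
  using gbinomial_mult_1[of "1/2-1::real" "k"] by (simp add: field_simps)
 then have "(-1) ^ Suc k * ((1/2-1::real) gchoose Suc k)
   = ((-1) ^ k * ((1/2-1) gchoose k)) * ((real k + 1/2) / real (Suc k))"
  by (simp only:) (simp add: divide_simps, simp add: algebra_simps)
 also have "... >= 0"
  by (intro mult_nonneg_nonneg Suc) auto
 finally show ?case .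
qed auto

definition sqc :: "nat => real" where "sqc k = (-1) ^ k * ((1/2::real) gchoose k)"

lemma summable_sqc: "summable (%k. \<bar>sqc k\<bar>)"
proof (rule summableI_nonneg_bounded)
 fix n
 have neg: "sqc (Suc k) <= 0" for k using gbinomial_half_sign[of k] by (simp add: sqc_def)
 have "(\<Sum>k\<le>n. sqc k) = (-1) ^ n * ((1/2-1::real) gchoose n)"
  using gbinomial_sum_lower_neg[of "1/2::real" n] by (simp add: sqc_def mult.commute)
 then have nn: "(\<Sum>k\<le>n. sqc k) >= 0" using gbinomial_half_minus_sign[of n] by simp
 have "(\<Sum>k\<le>n. \<bar>sqc k\<bar>) = 2 * sqc 0 - (\<Sum>k\<le>n. sqc k)"
 proof (induction n)
  case (Suc n)
  then show ?case using neg[of n] by simp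
 qed (simp add: sqc_def)
 also have "... <= 2" using nn by (simp add: sqc_def)
 finally have "(\<Sum>k\<le>n. \<bar>sqc k\<bar>) <= 2" .
 moreover have "(\<Sum>k<n. \<bar>sqc k\<bar>) <= (\<Sum>k\<le>n. \<bar>sqc k\<bar>)" by (intro sum_mono2) auto
 ultimately show "(\<Sum>k<n. \<bar>sqc k\<bar>) <= 2" by simp
qed auto

lemma sqrt_one_minus:
 fixes y :: "'a::cstar"
 assumes "adj y = y" "norm y <= 1"
 shows "\<exists>b. adj b = b \<and> b * b = 1 - y \<and> (\<forall>z. z * y = y * z --> z * b = b * z)"
proof -
 define g where "g k = sqc k *\<^sub>R y ^ k" for k
 have ng: "norm (g k) <= \<bar>sqc k\<bar>" for k
 proof -
  have "norm (y ^ k) <= 1"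
   using norm_power_ineq[of y k] power_le_one[of "norm y" k] assms(2) by simp
  then show ?thesis by (simp add: g_def mult_left_le)
 qed
 have sn: "summable (%k. norm (g k))"
  by (rule summable_comparison_test'[OF summable_sqc, where N = 0]) (use ng in simp)
 then have sg: "summable g" by (rule summable_norm_cancel)
 \<comment> \<open>Vandermonde turns the convolution of the coefficients of
   \<open>sqrt (1 - y)\<close> with themselves into \<open>1 gchoose k\<close> up to sign, which
   vanishes from \<open>k = 2\<close> on.\<close>
 have vand: "(\<Sum>i\<le>k. sqc i * sqc (k - i)) = (if k = 0 then 1 else if k = 1 then -1 else 0)" for k
 proof -
  have "(\<Sum>i\<le>k. sqc i * sqc (k - i)) = (\<Sum>i\<le>k. (-1)^k * (((1/2) gchoose i) * ((1/2::real) gchoose (k - i))))"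
   by (intro sum.cong refl) (simp add: sqc_def flip: power_add mult.assoc)
  also have "... = (-1)^k * ((1/2 + 1/2 :: real) gchoose k)"
   by (subst gbinomial_Vandermonde[symmetric]) (simp add: sum_distrib_left atLeast0AtMost)
  also have "(1/2 + 1/2 :: real) gchoose k = real (1 choose k)"
   by (simp add: binomial_gbinomial)
  finally show ?thesis by (cases k rule: nat.exhaust; cases "k - 1") auto
 qed
 have "(%k. \<Sum>i\<le>k. g i * g (k - i)) sums ((\<Sum>k. g k) * (\<Sum>k. g k))"
  by (rule Cauchy_product_sums[OF sn sn])
 moreover have "(\<Sum>i\<le>k. g i * g (k - i)) = (\<Sum>i\<le>k. sqc i * sqc (k - i)) *\<^sub>R y ^ k" for k
  unfolding scaleR_sum_left by (intro sum.cong refl) (simp add: g_def flip: power_add)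
 ultimately have 1: "(%k. (if k = 0 then 1 else if k = 1 then -1 else 0) *\<^sub>R y ^ k) sums ((\<Sum>k. g k) * (\<Sum>k. g k))"
  by (simp only: vand)
 have 2: "(%k. (if k = 0 then 1 else if k = 1 then -1 else 0) *\<^sub>R y ^ k) sums (\<Sum>k\<in>{0,1}. (if k = 0 then 1 else if k = 1 then -1 else 0) *\<^sub>R y ^ k)"
  by (rule sums_finite) auto
 have "(\<Sum>k. g k) * (\<Sum>k. g k) = 1 - y"
  using sums_unique2[OF 1 2] by simp
 moreover have "adj (\<Sum>k. g k) = (\<Sum>k. g k)"
  unfolding bounded_linear.suminf[OF bounded_linear_adj sg]
  by (simp add: g_def adj_scaleR adj_power assms(1))
 moreover have "z * (\<Sum>k. g k) = (\<Sum>k. g k) * z" if "z * y = y * z" for z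
 proof -
  have "z * y ^ k = y ^ k * z" for k using that by (metis power_commuting_commutes)
  then have "z * g k = g k * z" for k by (simp add: g_def)
  then show ?thesis
   unfolding suminf_mult[OF sg, symmetric] suminf_mult2[OF sg] by simp
 qed
 ultimately show ?thesis by blast
qed

text \<open>The norm condition says that \<open>1 - a / t\<close> is a contraction, so the series
  applies. It is the working criterion for positivity, since it visibly passes to sums and limits,
  which the definition by squares does not. The commutation clause lets square roots of commuting
  elements commute.\<close>

lemma psd_sqrt_aux:
 fixes a :: "'a::cstar"
 assumes "adj a = a" "norm (of_real t - a) <= t"
 shows "\<exists>b. adj b = b \<and> b * b = a \<and> (\<forall>z. z * a = a * z --> z * b = b * z)"
proof (cases "t = 0")
 case True
 then have "a = 0" using assms by simp
 then show ?thesis by (intro exI[of _ 0]) auto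
next
 case False
 have t: "t > 0" using False assms(2) norm_ge_zero[of "of_real t - a"] by linarith
 define y where "y = 1 - (1/t) *\<^sub>R a"
 have y: "y = (1/t) *\<^sub>R (of_real t - a)" using t by (simp add: y_def algebra_simps of_real_def)
 have "norm y <= 1" using assms(2) t by (simp add: y)
 moreover have "adj y = y" by (simp add: y_def adj_diff adj_scaleR assms)
 ultimately obtain b where b: "adj b = b" "b * b = 1 - y" "\<forall>z. z * y = y * z --> z * b = b * z"
  using sqrt_one_minus by blast
 have "sqrt t *\<^sub>R b * sqrt t *\<^sub>R b = a" using t b(2) by (simp add: y_def)
 moreover have "z * (sqrt t *\<^sub>R b) = (sqrt t *\<^sub>R b) * z" if "z * a = a * z" for z
 proof -
  have "z * y = y * z" using that by (simp add: y_def algebra_simps)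
  then have "z * b = b * z" using b(3) by blast
  then show ?thesis by simp
 qed
 ultimately show ?thesis using b(1) by (intro exI[of _ "sqrt t *\<^sub>R b"]) (auto simp: adj_scaleR)
qed

lemma psdI: "adj a = a ==> norm (of_real t - a) <= t ==> psd a"
 using psd_sqrt_aux unfolding psd_def by metis

text \<open>For \<open>u = b + imag * c\<close>, commutation gives
  \<open>adj u * u = b * b + c * c\<close>, and \<open>b\<close> is the real part of
  \<open>u\<close>. This replaces an order estimate before sums of positive elements are known to be
  positive.\<close>

lemma norm_commuting_squares:
 fixes b c :: "'a::cstar"
 assumes "adj b = b" "adj c = c" "b * c = c * b"
 shows "norm b ^ 2 <= norm (b * b + c * c)"
proof -
 define u where "u = b + imag * c"
 have au: "adj u = b - imag * c"
  by (simp add: u_def adj_add adj_mult adj_imag assms imag_comm)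
 have ii: "imag * (c * (imag * c)) = - (c * c)"
 proof -
  have "c * (imag * c) = (c * imag) * c" by (simp only: mult.assoc)
  also have "... = imag * (c * c)" by (simp only: imag_comm[of c, symmetric] mult.assoc)
  finally have "c * (imag * c) = imag * (c * c)" .
  then have "imag * (c * (imag * c)) = imag * imag * (c * c)" by (simp only: mult.assoc)
  then show ?thesis by (simp add: imag_sq)
 qed
 have "adj u * u = b * b + c * c"
 proof -
  have "b * (imag * c) = (imag * b) * c" by (simp only: imag_comm[of b] mult.assoc)
  then have "b * (imag * c) = imag * (c * b)" by (simp only: mult.assoc assms(3))
  then have "(b - imag * c) * (b + imag * c) = b * b + c * c"
   by (simp add: right_diff_distrib left_diff_distrib distrib_left distrib_right mult.assoc ii assms(3))
  then show ?thesis by (simp only: au) (simp only: u_def)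
 qed
 then have n: "norm u ^ 2 = norm (b * b + c * c)" by (metis norm_adj_mult)
 have "u + adj u = b + b" unfolding au by (simp add: u_def)
 then have "norm (b + b) <= norm u + norm u"
  by (metis norm_adj norm_triangle_ineq)
 moreover have "norm (b + b) = 2 * norm b" by (simp flip: scaleR_2)
 ultimately have "norm b <= norm u" by simp
 then show ?thesis using n power_mono[of "norm b" "norm u" 2] by simp
qed

text \<open>The converse of \<open>psdI\<close>. After scaling, \<open>1 - y = c * c\<close> and
  \<open>y = b' * b'\<close> with \<open>b'\<close> and \<open>c\<close> commuting; their squares
  add up to 1, so \<open>c\<close> is a contraction and \<open>of_real t - a\<close> is
  \<open>t\<close> times its square.\<close>

lemma psd_norm:
 fixes a :: "'a::cstar"
 assumes "psd a" "norm a <= t"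
 shows "norm (of_real t - a) <= t"
proof (cases "t = 0")
 case True
 then show ?thesis using assms by simp
next
 case False
 then have t: "t > 0" using assms(2) norm_ge_zero[of a] by linarith
 from assms(1) obtain b where b: "adj b = b" "a = b * b" by (auto simp: psd_def)
 define y where "y = (1/t) *\<^sub>R a"
 have "norm y <= 1" "adj y = y" using assms t by (auto simp: y_def adj_scaleR psd_sa)
 then obtain c where c: "adj c = c" "c * c = 1 - y" "\<forall>z. z * y = y * z --> z * c = c * z"
  using sqrt_one_minus by blast
 define b' where "b' = sqrt (1/t) *\<^sub>R b"
 have b': "b' * b' = y" "adj b' = b'" using t b by (auto simp: b'_def y_def adj_scaleR real_sqrt_divide simp flip: real_sqrt_mult)
 have "b' * y = y * b'" by (simp add: b'(1)[symmetric] mult.assoc)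
 then have "c * b' = b' * c" using c by metis
 then have "norm c ^ 2 <= norm (c * c + b' * b')" using norm_commuting_squares c(1) b'(2) by blast
 also have "c * c + b' * b' = 1" by (simp add: c b')
 finally have "norm (c * c) <= 1" by (simp only: norm_sa_sq[OF c(1)]) simp
 moreover have "of_real t - a = t *\<^sub>R (c * c)" using t by (simp add: c y_def algebra_simps of_real_def)
 ultimately show ?thesis using t by (simp add: mult_left_le)
qed

lemma psd_sqrt:
 "psd a ==> \<exists>b. adj b = b \<and> b * b = a \<and> (\<forall>z. z * a = a * z --> z * b = b * z)"
 by (rule psd_sqrt_aux[OF psd_sa psd_norm[OF _ order_refl]])

lemma psd_add:
 assumes "psd a" "psd b" shows "psd (a + b)"
proof (rule psdI)
 show "adj (a + b) = a + b" using assms by (simp add: adj_add psd_sa)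
 have "of_real (norm a + norm b) - (a + b) = (of_real (norm a) - a) + (of_real (norm b) - b)"
  by simp
 then show "norm (of_real (norm a + norm b) - (a + b)) <= norm a + norm b"
  using psd_norm[OF assms(1) order_refl] psd_norm[OF assms(2) order_refl]
  by (metis add_mono norm_triangle_ineq order_trans)
qed

lemma psd_0 [simp]: "psd 0" and psd_1 [simp]: "psd 1"
 using psd_sq[of 0] psd_sq[of 1] by auto

lemma psd_scaleR: "psd a ==> r >= 0 ==> psd (r *\<^sub>R a)"
proof -
 assume "psd a" "r >= 0"
 then obtain b where "adj b = b" "a = b * b" by (auto simp: psd_def)
 then show ?thesis using psd_sq[of "sqrt r *\<^sub>R b"] \<open>r >= 0\<close> by (simp add: adj_scaleR)
qed

lemma psd_of_real: "r >= 0 ==> psd (of_real r)"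
 using psd_scaleR[OF psd_1, of r] by (simp add: of_real_def)

lemma psd_sum: "(!!i. i \<in> I ==> psd (f i)) ==> psd (sum f I)"
 by (induction I rule: infinite_finite_induct) (auto intro: psd_add)

lemma psd_limit:
 fixes x :: "'b => 'a::cstar"
 assumes "(x \<longlongrightarrow> l) F" "F ~= bot" "eventually (%n. psd (x n)) F"
 shows "psd l"
proof (rule psdI)
 have "((%n. adj (x n)) \<longlongrightarrow> adj l) F" by (intro tendsto_intros assms)
 moreover have "eventually (%n. adj (x n) = x n) F" using assms(3) by eventually_elim (rule psd_sa)
 ultimately have "(x \<longlongrightarrow> adj l) F" by (simp add: tendsto_cong)
 then show "adj l = l" using assms(1,2) tendsto_unique by blast
 let ?t = "norm l + 1"
 have "eventually (%n. norm (x n) < ?t) F"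
  using order_tendstoD(2)[OF tendsto_norm[OF assms(1)], of ?t] by simp
 then have "eventually (%n. norm (of_real ?t - x n) <= ?t) F"
  using assms(3) by eventually_elim (intro psd_norm, auto)
 moreover have "((%n. norm (of_real ?t - x n)) \<longlongrightarrow> norm (of_real ?t - l)) F"
  by (intro tendsto_intros assms)
 ultimately show "norm (of_real ?t - l) <= ?t"
  using assms(2) tendsto_upperbound by blast
qed

text \<open>Writing \<open>a = b * b\<close> and \<open>- a = c * c\<close> with commuting roots,
  the two squares sum to 0, which bounds \<open>norm b\<close> by 0.\<close>

lemma psd_antisym: "psd a ==> psd (- a) ==> a = (0::'a::cstar)"
proof -
 assume a: "psd a" "psd (- a)"
 then obtain b where b: "adj b = b" "a = b * b" by (auto simp: psd_def)
 obtain c where c: "adj c = c" "c * c = - a" "\<forall>z. z * (- a) = - a * z --> z * c = c * z"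
  using psd_sqrt[OF a(2)] by blast
 have "b * (- a) = - a * b" by (simp add: b(2) mult.assoc)
 then have "b * c = c * b" using c(3) by blast
 then have "norm b ^ 2 <= norm (b * b + c * c)" using norm_commuting_squares b c by blast
 then show ?thesis by (simp add: b(2)[symmetric] c(2))
  (simp add: b(2))
qed

lemma psd_of_real_iff [simp]: "psd (of_real r :: 'a::cstar) \<longleftrightarrow> r >= 0"
proof
 assume *: "psd (of_real r :: 'a)"
 show "r >= 0"
 proof (rule ccontr)
  assume "\<not> r >= 0"
  then have "psd (- of_real r :: 'a)" using psd_of_real[of "-r", where 'a='a] by simp
  then have "of_real r = (0::'a)" using psd_antisym * by blast
  then show False using \<open>\<not> r >= 0\<close> by simp
 qed
qed (rule psd_of_real)

lemma psd_mult:
 assumes "psd a" "psd b" "a * b = b * a" shows "psd (a * b)"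
proof -
 obtain c where c: "adj c = c" "c * c = a" "\<forall>z. z * a = a * z --> z * c = c * z"
  using psd_sqrt[OF assms(1)] by blast
 obtain d where d: "adj d = d" "d * d = b" "\<forall>z. z * b = b * z --> z * d = d * z"
  using psd_sqrt[OF assms(2)] by blast
 have "c * b = b * c" using c(3)[rule_format, of b] assms(3) by simp
 then have cd: "c * d = d * c" using d(3) by blast
 have "(c * d) * (c * d) = c * (d * c) * d" by (simp only: mult.assoc)
 also have "... = a * b" by (simp only: cd[symmetric] mult.assoc c(2)[symmetric] d(2)[symmetric])
 finally show ?thesis using psd_sq[of "c * d"] by (simp add: adj_mult c(1) d(1) cd)
qed

text \<open>\<open>(M - y) * (M + y) = M^2 - y * y\<close> is a product of commuting positive
  elements, hence a square \<open>v * v\<close> with \<open>v\<close> commuting with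
  \<open>y\<close>; now \<open>y * y + v * v = M^2\<close>.\<close>

lemma norm_le_of_psd:
 fixes y :: "'a::cstar"
 assumes "adj y = y" "psd (of_real M - y)" "psd (of_real M + y)"
 shows "norm y <= M"
proof -
 have "psd (of_real M - y + (of_real M + y))" using psd_add assms by blast
 also have "of_real M - y + (of_real M + y) = of_real (2 * M)" by (simp only: mult_2 of_real_add) simp
 finally have M: "M >= 0" by (simp only: psd_of_real_iff zero_le_mult_iff) linarith
 have cm: "of_real M * y = y * of_real M" by (simp add: of_real_def)
 have "(of_real M - y) * (of_real M + y) = (of_real M + y) * (of_real M - y)"
  by (simp add: algebra_simps cm)
 then have "psd ((of_real M - y) * (of_real M + y))" using psd_mult assms by blast
 also have "(of_real M - y) * (of_real M + y) = of_real (M^2) - y * y"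
  by (simp add: algebra_simps cm power2_eq_square)
 finally obtain v where v: "adj v = v" "v * v = of_real (M^2) - y * y"
   "\<forall>z. z * (of_real (M^2) - y * y) = (of_real (M^2) - y * y) * z --> z * v = v * z"
  using psd_sqrt by blast
 have "y * (of_real (M^2) - y * y) = (of_real (M^2) - y * y) * y"
  by (simp add: algebra_simps of_real_def)
 then have "y * v = v * y" using v by blast
 then have "norm y ^ 2 <= norm (y * y + v * v)" using norm_commuting_squares assms v by blast
 also have "y * y + v * v = of_real (M^2)" by (simp add: v(2))
 also have "norm (of_real (M^2) :: 'a) = M^2" by (simp only: norm_of_real) simp
 finally show ?thesis using M by (simp add: power2_le_iff_abs_le)
qed

lemma psd_norm_minus: "adj a = a ==> norm a <= t ==> psd (of_real t - a)"
 by (rule psdI[where t = t]) (auto simp: adj_diff)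

lemma psd_norm_plus: "adj a = a ==> norm a <= t ==> psd (of_real t + a)"
 using psd_norm_minus[of "-a" t] by simp

lemma psd_norm_mono:
 assumes "psd a" "psd (b - a)" shows "norm a <= norm b"
proof (rule norm_le_of_psd)
 have b: "adj b = b" using psd_sa[OF psd_add[OF assms]] by simp
 have "psd (of_real (norm b) - b + (b - a))"
  by (intro psd_add assms psd_norm_minus b order_refl)
 then show "psd (of_real (norm b) - a)" by simp
 show "psd (of_real (norm b) + a)" by (intro psd_add assms psd_of_real) auto
qed (use assms psd_sa in blast)

section \<open>Continuous functional calculus\<close>

definition peval :: "real poly => 'a::real_algebra_1 => 'a" where
 "peval p a = fold_coeffs (%c x. of_real c + a * x) p 0"

lemma peval_0 [simp]: "peval 0 a = 0" by (simp add: peval_def)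

lemma peval_pCons [simp]: "peval (pCons c p) a = of_real c + a * peval p a"
 by (cases "p = 0 \<and> c = 0") (auto simp: peval_def)

lemma peval_add: "peval (p + q) a = peval p a + peval q a"
 by (induction p q rule: poly_induct2) (auto simp: algebra_simps)

lemma peval_uminus: "peval (- p) a = - peval p a"
 by (induction p) (auto simp: algebra_simps)

lemma peval_diff: "peval (p - q) a = peval p a - peval q a"
 using peval_add[of p "-q" a] by (simp add: peval_uminus)

lemma peval_smult: "peval (Polynomial.smult c p) a = of_real c * peval p a"
 by (induction p) (auto simp: algebra_simps of_real_def)

lemma peval_mult: "peval (p * q) a = peval p a * peval q a"
 by (induction p) (auto simp: algebra_simps peval_add peval_smult)

lemma peval_commute: "x * a = a * x ==> x * peval p a = peval p a * x"
proof (induction p)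
 case (pCons c p)
 then have "x * (a * peval p a) = (a * peval p a) * x"
  by (metis mult.assoc)
 then show ?case by (simp add: algebra_simps of_real_def)
qed auto

lemma adj_peval: "adj a = a ==> adj (peval p a) = peval p (a::'a::cstar)"
 by (induction p) (auto simp: adj_add adj_mult peval_commute[of a a, symmetric])

lemma peval_pcompose: "peval (pcompose p q) a = peval p (peval q a)"
 by (induction p) (auto simp: pcompose_pCons peval_add peval_mult)

text \<open>Induction on the degree by splitting off roots. A real root lies outside
  \<open>{l..u}\<close>, so its linear factor is definite on \<open>a\<close>; a nonreal pair
  contributes \<open>(t - \<alpha>)^2 + \<beta>^2\<close>. The fundamental theorem of algebra thus
  stands in for spectral mapping.\<close>

lemma peval_poly_pos:
 fixes a :: "'a::cstar"
 assumes lu: "psd (a - of_real l)" "psd (of_real u - a)"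
  and "\<forall>t\<in>{l..u}. poly p t > 0"
 shows "psd (peval p a)"
 using assms(3)
proof (induction "degree p" arbitrary: p rule: less_induct)
 case less
 have "psd (a - of_real l + (of_real u - a))" using psd_add lu by blast
 then have "psd (of_real (u - l) :: 'a)" by simp
 then have lu': "l <= u" by (simp only: psd_of_real_iff)
 have aa: "adj a = a" using psd_sa[OF lu(1)] by (simp add: adj_diff)
 show ?case
 proof (cases "degree p = 0")
  case True
  then obtain c where "p = [:c:]" by (metis degree_eq_zeroE)
  then show ?thesis using less.prems lu' by (auto intro!: psd_of_real dest!: bspec[of _ _ l])
 next
  case False
  let ?P = "map_poly complex_of_real p"
  have "degree ?P = degree p" by (simp add: degree_map_poly)
  then have "\<not> constant (poly ?P)" using False by (metis constant_degree)
  then obtain z where z: "poly ?P z = 0" using fundamental_theorem_of_algebra by blast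
  have p0: "p ~= 0" using False by auto
  have comm: "a * peval q a = peval q a * a" for q by (rule peval_commute) simp
  show ?thesis
  proof (cases "Im z = 0")
   case True
   define r where "r = Re z"
   have "z = complex_of_real r" using True by (simp add: r_def complex_eq_iff)
   moreover have "poly ?P (complex_of_real r) = complex_of_real (poly p r)"
    by (induction p) (auto simp: map_poly_pCons)
   ultimately have "complex_of_real (poly p r) = 0" using z by simp
   then have r: "poly p r = 0" by simp
   then obtain q where q: "p = [:-r, 1:] * q" by (metis dvd_def poly_eq_0_iff_dvd)
   have q0: "q ~= 0" using q p0 by auto
   have dq: "degree q < degree p" unfolding q using q0 by (subst degree_mult_eq) auto
   have rn: "r \<notin> {l..u}" using less.prems r by force
   show ?thesis
   proof (cases "r < l")
    case True
    have "\<forall>t\<in>{l..u}. poly q t > 0"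
    proof
     fix t assume t: "t \<in> {l..u}"
     then have "0 < (t - r) * poly q t" using less.prems unfolding q by (auto simp: algebra_simps)
     then show "poly q t > 0" using t True by (auto simp: zero_less_mult_iff)
    qed
    then have "psd (peval q a)" using less.hyps dq by blast
    moreover have "psd (a - of_real l + of_real (l - r))"
     using True by (intro psd_add lu psd_of_real) auto
    ultimately have "psd ((a - of_real r) * peval q a)"
     by (intro psd_mult) (auto simp: algebra_simps comm of_real_def)
    then show ?thesis by (simp add: q peval_mult algebra_simps peval_diff peval_smult)
   next
    case False
    then have ur: "u < r" using rn by auto
    have "poly q t < 0" if "t \<in> {l..u}" for t
    proof -
     have "0 < (t - r) * poly q t" using less.prems that unfolding q by (auto simp: algebra_simps)
     moreover have "t - r < 0" using that ur by auto
     ultimately show ?thesis by (simp add: zero_less_mult_iff)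
    qed
    then have "\<forall>t\<in>{l..u}. poly (-q) t > 0" by auto
    then have "psd (peval (-q) a)" using less.hyps[of "-q"] dq by simp
    moreover have "psd (of_real u - a + of_real (r - u))"
     using ur by (intro psd_add lu psd_of_real) auto
    ultimately have "psd ((of_real r - a) * peval (-q) a)"
     by (intro psd_mult) (auto simp: algebra_simps comm of_real_def peval_uminus)
    then show ?thesis by (simp add: q peval_mult algebra_simps peval_diff peval_uminus peval_smult)
   qed
  next
   case False
   define \<alpha> \<beta> where "\<alpha> = Re z" "\<beta> = Im z"
   \<comment> \<open>The real quadratic with roots \<open>z\<close> and its conjugate. The remainder
     of \<open>p\<close> modulo \<open>m\<close> is real, of degree at most 1, and vanishes at the
     nonreal \<open>z\<close>, hence is 0.\<close>
   define m where "m = [:\<alpha>^2 + \<beta>^2, - 2 * \<alpha>, 1:]"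
   have m2: "degree m = 2" by (simp add: m_def)
   have zz: "z = complex_of_real \<alpha> + \<i> * complex_of_real \<beta>" by (simp add: \<alpha>_\<beta>_def complex_eq_iff)
   have mz: "poly (map_poly complex_of_real m) z = 0"
    by (simp add: m_def map_poly_pCons zz complex_eq_iff power2_eq_square algebra_simps)
   define rr where "rr = p mod m"
   have rd: "degree rr < 2" using degree_mod_less'[of m p] m2 unfolding rr_def
    by (metis degree_0 degree_mod_less m2 pos2 zero_neq_numeral)
   have pm: "p = m * (p div m) + rr" by (simp add: rr_def)
   have mph: "map_poly complex_of_real (p1 * p2) = map_poly complex_of_real p1 * map_poly complex_of_real p2"
    "map_poly complex_of_real (p1 + p2) = map_poly complex_of_real p1 + map_poly complex_of_real p2" for p1 p2
    by (auto intro!: poly_eqI simp: coeff_map_poly coeff_mult)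
   have "poly ?P z = poly (map_poly complex_of_real rr) z"
    by (subst pm) (simp add: mph mz)
   then have "poly (map_poly complex_of_real rr) z = 0" using z by simp
   moreover obtain c d where cd: "rr = [:c, d:]"
   proof
    show "rr = [:coeff rr 0, coeff rr 1:]"
     using rd by (intro poly_eqI) (auto simp: coeff_pCons coeff_eq_0 split: nat.splits)
   qed
   ultimately have "c + \<alpha> * d = 0" "\<beta> * d = 0"
    by (auto simp: map_poly_pCons zz complex_eq_iff)
   then have "rr = 0" using False cd by (auto simp: \<alpha>_\<beta>_def)
   then have pq: "p = m * (p div m)" using pm by simp
   define q where "q = p div m"
   have q: "p = m * q" using pq q_def by simp
   have q0: "q ~= 0" using q p0 by auto
   have dq: "degree q < degree p" unfolding q using q0 m2 by (subst degree_mult_eq) (auto simp: m_def)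
   have mt: "poly m t = (t - \<alpha>)^2 + \<beta>^2" for t by (simp add: m_def power2_eq_square algebra_simps)
   have mp: "poly m t > 0" for t unfolding mt
    using False by (intro add_nonneg_pos) (auto simp: \<alpha>_\<beta>_def)
   have "\<forall>t\<in>{l..u}. poly q t > 0"
    using less.prems unfolding q poly_mult by (meson mp zero_less_mult_pos)
   then have "psd (peval q a)" using less.hyps dq by blast
   moreover have "peval m a = (a - of_real \<alpha>) * (a - of_real \<alpha>) + of_real (\<beta>^2)"
    by (simp add: m_def algebra_simps power2_eq_square of_real_def scaleR_2 flip: scaleR_add_left)
   then have "psd (peval m a)"
    by (simp only:) (intro psd_add psd_sq psd_of_real, auto simp: adj_diff aa)
   ultimately show ?thesis unfolding q peval_mult
    by (intro psd_mult peval_commute comm[symmetric])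
  qed
 qed
qed

lemma peval_norm_le:
 fixes a :: "'a::cstar"
 assumes "psd (a - of_real l)" "psd (of_real u - a)" "\<forall>t\<in>{l..u}. \<bar>poly p t\<bar> <= M"
 shows "norm (peval p a) <= M"
proof (rule field_le_epsilon)
 fix e :: real assume e: "e > 0"
 have aa: "adj a = a" using psd_sa[OF assms(1)] by (simp add: adj_diff)
 have "\<forall>t\<in>{l..u}. poly ([:M + e:] - p) t > 0" "\<forall>t\<in>{l..u}. poly ([:M + e:] + p) t > 0"
  using assms(3) e by (force simp: abs_le_iff)+
 from this[THEN peval_poly_pos[OF assms(1,2)]]
 show "norm (peval p a) <= M + e"
  by (intro norm_le_of_psd) (auto simp: adj_peval aa peval_add peval_diff)
qed

lemma psd_norm_bounds:
 assumes "adj a = a"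
 shows "psd (a - of_real (- norm a))" "psd (of_real (norm a) - (a::'a::cstar))"
 using psd_norm_plus[OF assms order_refl] psd_norm_minus[OF assms order_refl] by (auto simp: add.commute)

lemma weierstrass_poly:
 fixes f :: "real => real"
 assumes "continuous_on UNIV f" "e > 0"
 shows "\<exists>q. \<forall>t\<in>{-R..R}. \<bar>f t - poly q t\<bar> < e"
proof -
 obtain g where g: "real_polynomial_function g" "!!t. t \<in> {-R..R} ==> \<bar>f t - g t\<bar> < e"
  using Stone_Weierstrass_real_polynomial_function[of "{-R..R}" f e] assms
   continuous_on_subset[OF assms(1)] by (metis compact_Icc subset_UNIV)
 obtain c n where "g = (%x. \<Sum>i\<le>n. c i * x ^ i)" using g(1) real_polynomial_function_iff_sum by blast
 then have "g = poly (\<Sum>i\<le>n. monom (c i) i)" by (simp add: poly_sum poly_monom fun_eq_iff)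
 then show ?thesis using g(2) by metis
qed

lemma weierstrass_poly_seq:
 fixes f :: "real => real"
 assumes "continuous_on UNIV f"
 shows "\<exists>q. \<forall>n. \<forall>t\<in>{-R..R}. \<bar>f t - poly (q n) t\<bar> <= 1 / Suc n"
 using weierstrass_poly[OF assms, of "1 / Suc n" for n] by (intro choice allI) (meson less_imp_le of_nat_0_less_iff zero_less_Suc zero_less_divide_1_iff)

definition cfc_approx :: "(real => real) => 'a::cstar => nat => real poly" where
 "cfc_approx f a = (SOME q. \<forall>n. \<forall>t\<in>{-norm a..norm a}. \<bar>f t - poly (q n) t\<bar> <= 1 / Suc n)"

text \<open>Total, but meaningful for self-adjoint \<open>a\<close> and \<open>f\<close> continuous
  on the whole line: the polynomials approximate \<open>f\<close> on
  \<open>{- norm a..norm a}\<close>, which plays the part of the spectrum, so no spectrum has to be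
  known.\<close>

definition cfc :: "(real => real) => 'a::cstar => 'a" where
 "cfc f a = lim (%n. peval (cfc_approx f a n) a)"

lemma cfc_approx:
 "continuous_on UNIV f ==> t \<in> {-norm a..norm a} ==> \<bar>f t - poly (cfc_approx f a n) t\<bar> <= 1 / Suc n"
 using someI_ex[OF weierstrass_poly_seq[of f "norm a"]] unfolding cfc_approx_def by blast

lemma peval_dist_le:
 fixes a :: "'a::cstar"
 assumes "adj a = a" "!!t. t \<in> {-norm a..norm a} ==> \<bar>f t - poly q t\<bar> <= \<eta>"
  "!!t. t \<in> {-norm a..norm a} ==> \<bar>f t - poly r t\<bar> <= \<delta>"
 shows "norm (peval q a - peval r a) <= \<eta> + \<delta>"
 unfolding peval_diff[symmetric]
proof (rule peval_norm_le[OF psd_norm_bounds[OF assms(1)]], rule ballI)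
 fix t assume "t \<in> {- norm a..norm a}"
 from assms(2)[OF this] assms(3)[OF this] show "\<bar>poly (q - r) t\<bar> <= \<eta> + \<delta>"
  by (auto simp: abs_le_iff)
qed

lemma cfc_LIMSEQ:
 fixes a :: "'a::cstar"
 assumes f: "continuous_on UNIV f" and a: "adj a = a"
 shows "(%n. peval (cfc_approx f a n) a) \<longlonglongrightarrow> cfc f a"
proof -
 have "Cauchy (%n. peval (cfc_approx f a n) a)"
 proof (rule CauchyI)
  fix e :: real assume "e > 0"
  then obtain M where M: "1 / Suc M < e / 2" by (meson half_gt_zero nat_approx_posE)
  have "norm (peval (cfc_approx f a m) a - peval (cfc_approx f a n) a) < e" if "m >= M" "n >= M" for m n
  proof -
   have "norm (peval (cfc_approx f a m) a - peval (cfc_approx f a n) a) <= 1 / Suc m + 1 / Suc n"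
    by (rule peval_dist_le[OF a cfc_approx[OF f] cfc_approx[OF f]])
   moreover have "1 / real (Suc m) <= 1 / Suc M" "1 / real (Suc n) <= 1 / Suc M"
    using that by (auto intro!: divide_left_mono)
   ultimately show ?thesis using M by linarith
  qed
  then show "\<exists>M. \<forall>m\<ge>M. \<forall>n\<ge>M. norm (peval (cfc_approx f a m) a - peval (cfc_approx f a n) a) < e" by blast
 qed
 then show ?thesis unfolding cfc_def by (simp add: Cauchy_convergent_iff convergent_LIMSEQ_iff)
qed

lemma inverse_Suc_tendsto: "(%n. c / real (Suc n)) \<longlonglongrightarrow> 0"
 using tendsto_mult_left[OF LIMSEQ_inverse_real_of_nat, of c] by (simp add: divide_inverse)

lemma cfc_peval_dist:
 fixes a :: "'a::cstar"
 assumes f: "continuous_on UNIV f" and a: "adj a = a"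
  and q: "!!t. t \<in> {-norm a..norm a} ==> \<bar>f t - poly q t\<bar> <= \<eta>"
 shows "norm (cfc f a - peval q a) <= \<eta>"
proof (rule LIMSEQ_le)
 show "(%n. norm (peval (cfc_approx f a n) a - peval q a)) \<longlonglongrightarrow> norm (cfc f a - peval q a)"
  by (intro tendsto_intros cfc_LIMSEQ f a)
 show "(%n. 1 / real (Suc n) + \<eta>) \<longlonglongrightarrow> \<eta>"
  using tendsto_add[OF inverse_Suc_tendsto tendsto_const] by force
 show "\<exists>N. \<forall>n\<ge>N. norm (peval (cfc_approx f a n) a - peval q a) <= 1 / real (Suc n) + \<eta>"
  using peval_dist_le[OF a cfc_approx[OF f] q] by blast
qed

lemma cfc_tendsto:
 fixes a :: "'a::cstar"
 assumes f: "continuous_on UNIV f" and a: "adj a = a"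
  and q: "!!n t. t \<in> {-norm a..norm a} ==> \<bar>f t - poly (q n) t\<bar> <= \<eta> n" and \<eta>: "\<eta> \<longlonglongrightarrow> 0"
 shows "(%n. peval (q n) a) \<longlonglongrightarrow> cfc f a"
proof (rule LIM_zero_cancel, rule Lim_null_comparison[OF _ \<eta>])
 show "\<forall>\<^sub>F n in sequentially. norm (peval (q n) a - cfc f a) <= \<eta> n"
  using cfc_peval_dist[OF f a q] by (intro always_eventually) (simp add: norm_minus_commute)
qed

lemma cfc_poly: "adj a = a ==> cfc (poly q) a = peval q (a::'a::cstar)"
 using cfc_peval_dist[of "poly q" a q 0] by (simp add: continuous_on_poly)

lemma cfc_const: "adj a = a ==> cfc (%t. c) a = of_real c"
 using cfc_poly[of a "[:c:]"] by (simp add: poly_pCons[abs_def])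

lemma cfc_id: "adj a = a ==> cfc (%t. t) a = a"
 using cfc_poly[of a "[:0,1:]"] by (simp add: poly_pCons[abs_def])

lemma adj_cfc:
 assumes "continuous_on UNIV f" "adj a = a" shows "adj (cfc f a) = cfc f a"
 using tendsto_adj[OF cfc_LIMSEQ[OF assms]] cfc_LIMSEQ[OF assms]
 by (simp add: adj_peval assms LIMSEQ_unique)

lemma cfc_commute:
 assumes f: "continuous_on UNIV f" and a: "adj a = a" and x: "x * a = a * x"
 shows "x * cfc f a = cfc f a * x"
proof (rule LIMSEQ_unique)
 show "(%n. x * peval (cfc_approx f a n) a) \<longlonglongrightarrow> x * cfc f a" by (intro tendsto_intros cfc_LIMSEQ f a)
 show "(%n. x * peval (cfc_approx f a n) a) \<longlonglongrightarrow> cfc f a * x"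
  unfolding peval_commute[OF x] by (intro tendsto_intros cfc_LIMSEQ f a)
qed

lemma cfc_add:
 fixes a :: "'a::cstar"
 assumes f: "continuous_on UNIV f" and g: "continuous_on UNIV g" and a: "adj a = a"
 shows "cfc (%t. f t + g t) a = cfc f a + cfc g a"
proof (rule LIMSEQ_unique)
 let ?q = "%n. cfc_approx f a n + cfc_approx g a n"
 show "(%n. peval (?q n) a) \<longlonglongrightarrow> cfc f a + cfc g a"
  unfolding peval_add by (intro tendsto_intros cfc_LIMSEQ f g a)
 show "(%n. peval (?q n) a) \<longlonglongrightarrow> cfc (%t. f t + g t) a"
 proof (rule cfc_tendsto)
  fix n t assume t: "t \<in> {- norm a..norm a}"
  show "\<bar>f t + g t - poly (?q n) t\<bar> <= 2 / Suc n"
   using cfc_approx[OF f t, of n] cfc_approx[OF g t, of n] by (simp add: abs_le_iff)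
 qed (intro continuous_intros f g a inverse_Suc_tendsto)+
qed

lemma cfc_mult:
 fixes a :: "'a::cstar"
 assumes f: "continuous_on UNIV f" and g: "continuous_on UNIV g" and a: "adj a = a"
 shows "cfc (%t. f t * g t) a = cfc f a * cfc g a"
proof (rule LIMSEQ_unique)
 let ?q = "%n. cfc_approx f a n * cfc_approx g a n"
 let ?I = "{- norm a..norm a}"
 show "(%n. peval (?q n) a) \<longlonglongrightarrow> cfc f a * cfc g a"
  unfolding peval_mult by (intro tendsto_intros cfc_LIMSEQ f g a)
 have "compact (f ` ?I)" "compact (g ` ?I)"
  by (intro compact_continuous_image continuous_on_subset[OF f] continuous_on_subset[OF g]; simp)+
 then have "bounded (f ` ?I)" "bounded (g ` ?I)" by (simp_all add: compact_imp_bounded)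
 then obtain B1 B2 where B: "\<forall>t\<in>?I. \<bar>f t\<bar> <= B1" "\<forall>t\<in>?I. \<bar>g t\<bar> <= B2"
  unfolding bounded_iff real_norm_def by (meson imageI)
 show "(%n. peval (?q n) a) \<longlonglongrightarrow> cfc (%t. f t * g t) a"
 proof (rule cfc_tendsto)
  fix n t assume t: "t \<in> ?I"
  let ?p = "poly (cfc_approx f a n) t" and ?r = "poly (cfc_approx g a n) t"
  have 1: "\<bar>f t - ?p\<bar> <= 1 / Suc n" "\<bar>g t - ?r\<bar> <= 1 / Suc n" "\<bar>f t\<bar> <= B1" "\<bar>g t\<bar> <= B2"
   using cfc_approx[OF f t, of n] cfc_approx[OF g t, of n] B t by auto
  have "1 / real (Suc n) <= 1" by simp
  then have 2: "\<bar>?r\<bar> <= B2 + 1" using 1 by linarith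
  have "f t * g t - poly (?q n) t = f t * (g t - ?r) + (f t - ?p) * ?r" by (simp add: algebra_simps)
  also have "\<bar>...\<bar> <= \<bar>f t\<bar> * \<bar>g t - ?r\<bar> + \<bar>f t - ?p\<bar> * \<bar>?r\<bar>"
   by (metis abs_mult abs_triangle_ineq)
  also have "... <= B1 * (1 / Suc n) + (1 / Suc n) * (B2 + 1)"
   using 1 2 by (intro add_mono mult_mono) auto
  also have "... = (B1 + B2 + 1) / Suc n" by (simp add: add_divide_distrib)
  finally show "\<bar>f t * g t - poly (?q n) t\<bar> <= (B1 + B2 + 1) / Suc n" .
 qed (intro continuous_intros f g a inverse_Suc_tendsto)+
qed

lemma cfc_scale:
 "continuous_on UNIV f ==> adj a = a ==> cfc (%t. c * f t) a = c *\<^sub>R cfc f a"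
 by (simp add: cfc_mult cfc_const mult_of_real_left)

lemma cfc_uminus: "continuous_on UNIV f ==> adj a = a ==> cfc (%t. - f t) a = - cfc f a"
 using cfc_scale[of f a "-1"] by simp

lemma cfc_diff:
 assumes "continuous_on UNIV f" "continuous_on UNIV g" "adj a = a"
 shows "cfc (%t. f t - g t) a = cfc f a - cfc g a"
 using cfc_add[OF assms(1) continuous_on_minus[OF assms(2)] assms(3)] assms by (simp add: cfc_uminus)

lemma cfc_power: "continuous_on UNIV f ==> adj a = a ==> cfc (%t. f t ^ n) a = cfc f a ^ n"
 by (induction n) (auto simp: cfc_const cfc_mult continuous_on_power)

text \<open>A polynomial inner function is all that uniqueness of \<open>n\<close>-th roots
  requires, where it is \<open>t ^ n\<close>.\<close>

lemma cfc_pcompose: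
 fixes a :: "'a::cstar"
 assumes f: "continuous_on UNIV f" and a: "adj a = a"
 shows "cfc f (peval q a) = cfc (%t. f (poly q t)) a"
proof -
 let ?I = "{- norm a..norm a}"
 have "compact (poly q ` ?I)" by (intro compact_continuous_image continuous_intros) auto
 then have "bounded (poly q ` ?I)" by (rule compact_imp_bounded)
 then obtain B where B: "\<forall>t\<in>?I. \<bar>poly q t\<bar> <= B"
  unfolding bounded_iff real_norm_def by (meson imageI)
 \<comment> \<open>One interval has to contain the values of \<open>q\<close> as well as
   \<open>{- norm (peval q a)..norm (peval q a)}\<close>.\<close>
 define R where "R = max B (norm (peval q a))"
 obtain r where r: "\<forall>n. \<forall>t\<in>{-R..R}. \<bar>f t - poly (r n) t\<bar> <= 1 / Suc n"
  using weierstrass_poly_seq[OF f] by blast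
 have "(%n. peval (r n) (peval q a)) \<longlonglongrightarrow> cfc f (peval q a)"
  by (rule cfc_tendsto[OF f _ _ inverse_Suc_tendsto[of 1]]) (use r in \<open>force simp: adj_peval a R_def\<close>)+
 moreover have "(%n. peval (r n \<circ>\<^sub>p q) a) \<longlonglongrightarrow> cfc (%t. f (poly q t)) a"
 proof (rule cfc_tendsto[OF _ a _ inverse_Suc_tendsto])
  show "continuous_on UNIV (%t. f (poly q t))"
   by (rule continuous_on_compose2[OF f]) (auto intro: continuous_intros)
  fix n t assume "t \<in> ?I"
  then have "poly q t \<in> {-R..R}" using B unfolding R_def by (auto simp: abs_le_iff max_def) force+
  then show "\<bar>f (poly q t) - poly (r n \<circ>\<^sub>p q) t\<bar> <= 1 / Suc n" using r by (simp add: poly_pcompose)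
 qed
 ultimately show ?thesis unfolding peval_pcompose using LIMSEQ_unique by blast
qed

text \<open>The two order bounds stand for the spectrum lying in \<open>{l..u}\<close>. The interval
  is cut down to the range where the approximants are good, and adding \<open>2 / Suc n\<close>
  makes them strictly positive there.\<close>

lemma cfc_nonneg:
 fixes a :: "'a::cstar"
 assumes f: "continuous_on UNIV f" and lu: "psd (a - of_real l)" "psd (of_real u - a)"
  and pos: "!!t. l <= t ==> t <= u ==> f t >= 0"
 shows "psd (cfc f a)"
proof -
 have a: "adj a = a" using psd_sa[OF lu(1)] by (simp add: adj_diff)
 define l' u' where "l' = max l (- norm a)" "u' = min u (norm a)"
 have lu': "psd (a - of_real l')" "psd (of_real u' - a)"
  using lu psd_norm_bounds[OF a] by (auto simp: l'_u'_def max_def min_def)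
 have "psd (peval (cfc_approx f a n + [:2 / Suc n:]) a)" for n
 proof (rule peval_poly_pos[OF lu'], rule ballI)
  fix t assume t: "t \<in> {l'..u'}"
  then have "f t >= 0" using pos by (auto simp: l'_u'_def)
  moreover have "\<bar>f t - poly (cfc_approx f a n) t\<bar> <= 1 / Suc n"
   using t by (intro cfc_approx[OF f]) (auto simp: l'_u'_def)
  moreover have "1 / Suc n > 0" "2 / real (Suc n) = 1 / Suc n + 1 / Suc n" by auto
  ultimately have "poly (cfc_approx f a n) t + 2 / Suc n > 0" by linarith
  then show "poly (cfc_approx f a n + [:2 / Suc n:]) t > 0" by simp
 qed
 moreover have "(%n. peval (cfc_approx f a n) a + of_real (2 / Suc n)) \<longlonglongrightarrow> cfc f a + of_real 0"
  by (intro tendsto_add cfc_LIMSEQ f a tendsto_of_real inverse_Suc_tendsto)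
 ultimately show ?thesis
  by (intro psd_limit[of _ "cfc f a" sequentially]) (auto simp: peval_add)
qed

lemma cfc_mono:
 fixes a :: "'a::cstar"
 assumes f: "continuous_on UNIV f" and g: "continuous_on UNIV g"
  and lu: "psd (a - of_real l)" "psd (of_real u - a)"
  and pos: "!!t. l <= t ==> t <= u ==> f t <= g t"
 shows "psd (cfc g a - cfc f a)"
proof -
 have a: "adj a = a" using psd_sa[OF lu(1)] by (simp add: adj_diff)
 have "psd (cfc (%t. g t - f t) a)"
  by (rule cfc_nonneg[OF _ lu]) (use pos in \<open>auto intro!: continuous_intros f g\<close>)
 then show ?thesis using cfc_diff[OF g f a] by simp
qed

lemma cfc_cong:
 fixes a :: "'a::cstar"
 assumes f: "continuous_on UNIV f" and g: "continuous_on UNIV g"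
  and lu: "psd (a - of_real l)" "psd (of_real u - a)"
  and eq: "!!t. l <= t ==> t <= u ==> f t = g t"
 shows "cfc f a = cfc g a"
proof -
 have "psd (cfc g a - cfc f a)" "psd (- (cfc g a - cfc f a))"
  using cfc_mono[OF f g lu] cfc_mono[OF g f lu] eq by auto
 then show ?thesis using psd_antisym by fastforce
qed

lemma cfc_norm_le:
 fixes a :: "'a::cstar"
 assumes f: "continuous_on UNIV f" and lu: "psd (a - of_real l)" "psd (of_real u - a)"
  and b: "!!t. l <= t ==> t <= u ==> \<bar>f t\<bar> <= M"
 shows "norm (cfc f a) <= M"
proof -
 have a: "adj a = a" using psd_sa[OF lu(1)] by (simp add: adj_diff)
 have c: "continuous_on UNIV (%t::real. M)" "continuous_on UNIV (%t. - f t)" by (intro continuous_intros f)+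
 have "psd (of_real M - cfc f a)" "psd (of_real M - - cfc f a)"
  using cfc_mono[OF f c(1) lu] cfc_mono[OF c(2,1) lu] b
  by (force simp: cfc_const[OF a] cfc_uminus[OF f a] abs_le_iff)+
 then show ?thesis by (intro norm_le_of_psd) (auto simp: adj_cfc f a)
qed

text \<open>A polynomial in \<open>a\<close> acts on such a \<open>z\<close> by its constant term.
  With \<open>f 0 = 0\<close> it follows that every local unit of \<open>a\<close> is one for
  \<open>cfc f a\<close>, which keeps such functions inside corners.\<close>

lemma cfc_annihilated:
 fixes a :: "'a::cstar"
 assumes f: "continuous_on UNIV f" and a: "adj a = a"
 shows "z * a = 0 ==> z * cfc f a = f 0 *\<^sub>R z" "a * z = 0 ==> cfc f a * z = f 0 *\<^sub>R z"
proof -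
 have p: "(%n. poly (cfc_approx f a n) 0) \<longlonglongrightarrow> f 0"
  by (rule LIM_zero_cancel, rule Lim_null_comparison[OF _ inverse_Suc_tendsto[of 1]])
   (use cfc_approx[OF f, of 0 a] in \<open>auto simp: abs_minus_commute\<close>)
 {
  assume z: "z * a = 0"
  have q: "z * peval q a = poly q 0 *\<^sub>R z" for q
   by (induction q) (auto simp: algebra_simps of_real_def z simp flip: mult.assoc)
  have "(%n. z * peval (cfc_approx f a n) a) \<longlonglongrightarrow> z * cfc f a" by (intro tendsto_intros cfc_LIMSEQ f a)
  then have "(%n. poly (cfc_approx f a n) 0 *\<^sub>R z) \<longlonglongrightarrow> z * cfc f a" by (simp only: q)
  moreover have "(%n. poly (cfc_approx f a n) 0 *\<^sub>R z) \<longlonglongrightarrow> f 0 *\<^sub>R z" by (intro tendsto_intros p)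
  ultimately show "z * cfc f a = f 0 *\<^sub>R z" by (rule LIMSEQ_unique)
 }
 {
  assume z: "a * z = 0"
  have q: "peval q a * z = poly q 0 *\<^sub>R z" for q
  proof (induction q)
   case (pCons c q)
   have "a * peval q a * z = a * (peval q a * z)" by (simp add: mult.assoc)
   also have "... = 0" by (simp add: pCons z)
   finally show ?case by (simp add: algebra_simps of_real_def)
  qed auto
  have "(%n. peval (cfc_approx f a n) a * z) \<longlonglongrightarrow> cfc f a * z" by (intro tendsto_intros cfc_LIMSEQ f a)
  then have "(%n. poly (cfc_approx f a n) 0 *\<^sub>R z) \<longlonglongrightarrow> cfc f a * z" by (simp only: q)
  moreover have "(%n. poly (cfc_approx f a n) 0 *\<^sub>R z) \<longlonglongrightarrow> f 0 *\<^sub>R z" by (intro tendsto_intros p)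
  ultimately show "cfc f a * z = f 0 *\<^sub>R z" by (rule LIMSEQ_unique)
 }
qed

lemma cfc_unit_left:
 assumes "continuous_on UNIV f" "adj a = a" "f 0 = 0" "h * a = a"
 shows "h * cfc f a = cfc f (a::'a::cstar)"
 using cfc_annihilated(1)[OF assms(1,2), of "h - 1"] assms by (simp add: algebra_simps)

section \<open>Inverses, and positivity deduced from invertibility\<close>

lemma psd_upper: "psd a ==> norm a <= t ==> psd (of_real t - a)"
 by (rule psd_norm_minus[OF psd_sa])

lemma psd_inverse:
 fixes c :: "'a::cstar"
 assumes "psd (c - of_real \<delta>)" "\<delta> > 0"
 shows "\<exists>d. psd d \<and> d * c = 1 \<and> c * d = 1 \<and> (\<forall>z. z * c = c * z --> z * d = d * z)"
proof -
 have sa: "adj c = c" using psd_sa[OF assms(1)] by (simp add: adj_diff)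
 note lu = assms(1) psd_norm_minus[OF sa order_refl]
 \<comment> \<open>Agrees with \<open>1 / t\<close> where \<open>c\<close> has its spectrum, and is
   continuous on the whole line as \<open>cfc\<close> demands.\<close>
 define k where "k t = 1 / max \<delta> t" for t
 have k: "continuous_on UNIV k" unfolding k_def using assms(2) by (intro continuous_intros) (metis less_max_iff_disj less_irrefl)
 have id: "continuous_on UNIV (%t::real. t)" by (intro continuous_intros)
 have "cfc (%t. k t * t) c = cfc (%t. 1) c"
  by (rule cfc_cong[OF continuous_on_mult[OF k id] continuous_on_const lu]) (use assms(2) in \<open>auto simp: k_def max_def\<close>)
 then have 1: "cfc k c * c = 1" using cfc_mult[OF k id sa] by (simp add: cfc_id cfc_const sa)
 have "c * cfc k c = cfc k c * c" by (rule cfc_commute[OF k sa]) simp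
 moreover have "psd (cfc k c)" by (rule cfc_nonneg[OF k lu]) (use assms(2) in \<open>auto simp: k_def\<close>)
 moreover have "\<forall>z. z * c = c * z --> z * cfc k c = cfc k c * z" using cfc_commute[OF k sa] by blast
 ultimately show ?thesis using 1 by metis
qed

lemma neumann:
 fixes s :: "'a::{real_normed_algebra_1,banach}"
 assumes "norm s < 1"
 shows "\<exists>b. (1 + s) * b = 1 \<and> norm b <= 1 / (1 - norm s)"
proof -
 have ns: "norm ((- s) ^ k) <= norm s ^ k" for k using norm_power_ineq[of "-s" k] by simp
 have sg: "summable (%k. norm s ^ k)" using assms by (intro summable_geometric) auto
 have sn: "summable (%k. norm ((- s) ^ k))"
  by (rule summable_comparison_test'[OF sg, where N = 0]) (use ns in simp)
 have sm: "summable (%k. (- s) ^ k)" by (rule summable_norm_cancel[OF sn])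
 let ?b = "\<Sum>k. (- s) ^ k"
 have "?b = 1 + (\<Sum>k. (- s) ^ Suc k)" using suminf_split_head[OF sm] by simp
 also have "(\<Sum>k. (- s) ^ Suc k) = - s * ?b" unfolding power_Suc by (rule suminf_mult[OF sm])
 finally have "(1 + s) * ?b = 1" by (simp add: algebra_simps)
 moreover have "norm ?b <= 1 / (1 - norm s)"
 proof -
  have "norm ?b <= (\<Sum>k. norm ((- s) ^ k))" by (rule summable_norm[OF sn])
  also have "... <= (\<Sum>k. norm s ^ k)" by (rule suminf_le[OF _ sn sg]) (use ns in simp)
  also have "... = 1 / (1 - norm s)" using assms by (intro suminf_geometric) auto
  finally show ?thesis .
 qed
 ultimately show ?thesis by blast
qed

text \<open>A bounded net of self-adjoint elements whose shifts by \<open>t > 0\<close> are asymptotically invertible is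
 asymptotically positive: the set of shifts making it asymptotically positive is open and closed.\<close>

lemma eventually_psd_of_invertible:
 fixes x :: "'b => 'a::cstar"
 assumes sa: "!!n. adj (x n) = x n" and R: "!!n. norm (x n) <= R" "R >= 0"
  and inv: "!!t. t > 0 ==> \<exists>C y. (\<forall>n. norm (y n) <= C) \<and>
    eventually (%n. norm ((of_real t + x n) * y n - 1) <= 1/2) F"
  and "\<delta> > 0"
 shows "eventually (%n. psd (x n + of_real \<delta>)) F"
proof -
 define S where "S = {t. t >= 0 \<and> (\<forall>\<delta>>0. eventually (%n. psd (x n + of_real (t + \<delta>))) F)}"
 have RS: "R \<in> S"
 proof -
  have "psd (x n + of_real (R + \<delta>))" if "\<delta> > 0" for \<delta> n
   using psd_norm_plus[OF sa, of n "R + \<delta>"] R(1)[of n] that by (simp add: add.commute)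
  then show ?thesis using R(2) by (simp add: S_def)
 qed
 define t0 where "t0 = Inf S"
 have bdd: "bdd_below S" by (rule bdd_belowI[of _ 0]) (auto simp: S_def)
 have t0: "t0 >= 0" unfolding t0_def by (rule cInf_greatest) (use RS in \<open>auto simp: S_def\<close>)
 have t0S: "t0 \<in> S"
 proof -
  have "eventually (%n. psd (x n + of_real (t0 + \<delta>))) F" if "\<delta> > 0" for \<delta>
  proof -
   have "\<exists>t\<in>S. t < t0 + \<delta>/2"
    unfolding t0_def by (rule cInf_lessD) (use RS that in auto)
   then obtain t where t: "t \<in> S" "t < t0 + \<delta>/2" by blast
   have "eventually (%n. psd (x n + of_real (t + \<delta>/2))) F" using t(1) that by (simp add: S_def)
   then show ?thesis
   proof eventually_elim
    case (elim n)
    have "psd (x n + of_real (t + \<delta>/2) + of_real (t0 + \<delta>/2 - t))"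
     by (intro psd_add elim psd_of_real) (use t in simp)
    also have "x n + of_real (t + \<delta>/2) + of_real (t0 + \<delta>/2 - t) = x n + of_real (t0 + \<delta>)"
     unfolding add.assoc of_real_add[symmetric] by (simp add: algebra_simps)
    finally show ?case .
   qed
  qed
  then show ?thesis using t0 by (simp add: S_def)
 qed
 have "t0 = 0"
 proof (rule ccontr)
  assume "t0 ~= 0"
  then have t0p: "t0 > 0" using t0 by simp
  from inv[OF this] obtain C y where C: "\<forall>n. norm (y n) <= C"
   and ev: "eventually (%n. norm ((of_real t0 + x n) * y n - 1) <= 1/2) F" by blast
  \<comment> \<open>The approximate inverses are bounded by \<open>max C 1\<close> and the Neumann
    correction by 2, so the exact inverses have norm at most \<open>1 / \<rho>\<close>.\<close>
  define \<rho> where "\<rho> = 1 / (2 * max C 1)"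
  have \<rho>: "\<rho> > 0" by (simp add: \<rho>_def)
  have ev2: "eventually (%n. psd (x n + of_real (t0 + \<rho>/2))) F" using t0S \<rho> by (simp add: S_def)
  have ev3: "eventually (%n. psd (x n + of_real (t0 - \<rho>))) F"
   using ev ev2
  proof eventually_elim
   case (elim n)
   define u where "u = of_real t0 + x n"
   have u: "adj u = u" by (simp add: u_def adj_add sa)
   obtain b where b: "(1 + (u * y n - 1)) * b = 1" "norm b <= 1 / (1 - norm (u * y n - 1))"
    using neumann[of "u * y n - 1"] elim(1) by (auto simp: u_def)
   have "1 / (1 - norm (u * y n - 1)) <= 1 / (1/2)"
    using elim(1) by (intro divide_left_mono) (auto simp: u_def)
   then have b2: "norm b <= 2" using b(2) by simp
   define w where "w = y n * b"
   have uw: "u * w = 1" using b(1) by (simp add: w_def mult.assoc)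
   have wu: "adj w * u = 1" using arg_cong[OF uw, of adj] by (simp add: adj_mult u)
   have w: "adj w = w" by (metis uw wu mult.assoc mult_1 mult_1_right)
   have "norm w <= max C 1 * 2"
    unfolding w_def using C[rule_format, of n] b2
    by (intro order_trans[OF norm_mult_ineq] mult_mono) auto
   then have nw: "norm (w * w) <= (1 / \<rho>)^2"
    unfolding norm_sa_sq[OF w] by (intro power_mono) (auto simp: \<rho>_def)
   \<comment> \<open>From \<open>w * w <= (1/\<rho>)^2\<close> for the inverse \<open>w\<close> of
     \<open>u\<close>, multiplication by the commuting \<open>u * u\<close> yields
     \<open>u * u >= \<rho>^2\<close>.\<close>
   have "psd ((u * u) * (of_real ((1/\<rho>)^2) - w * w))"
   proof (rule psd_mult[OF psd_sq[OF u]])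
    show "psd (of_real ((1/\<rho>)^2) - w * w)" by (rule psd_upper[OF psd_sq[OF w] nw])
    have wu': "w * u = 1" using wu w by simp
    have "(u * u) * (w * w) = u * (u * w) * w" "(w * w) * (u * u) = w * (w * u) * u" by (simp_all add: mult.assoc)
    then have "(u * u) * (w * w) = (w * w) * (u * u)" by (simp add: uw wu')
    then show "u * u * (of_real ((1 / \<rho>)\<^sup>2) - w * w) = (of_real ((1 / \<rho>)\<^sup>2) - w * w) * (u * u)"
     by (simp add: right_diff_distrib left_diff_distrib mult_of_real_left mult_of_real_right del: of_real_power of_real_divide)
   qed
   also have "(u * u) * (of_real ((1/\<rho>)^2) - w * w) = (1/\<rho>)^2 *\<^sub>R (u * u) - u * (u * w) * w"
    by (simp add: right_diff_distrib mult_of_real_right mult.assoc del: of_real_power of_real_divide)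
   finally have "psd (\<rho>^2 *\<^sub>R ((1/\<rho>)^2 *\<^sub>R (u * u) - 1))" using \<rho> by (intro psd_scaleR) (auto simp: uw)
   then have q: "psd (u * u - of_real (\<rho>^2))" using \<rho>
    by (simp add: scaleR_diff_right of_real_def power_mult_distrib[symmetric])
   have "psd (u + of_real (\<rho>/2))" using elim(2) by (simp add: u_def algebra_simps)
   then have "psd (u + of_real \<rho> - of_real (\<rho>/2))"
   proof -
    have "of_real \<rho> = (of_real (\<rho>/2) + of_real (\<rho>/2) :: 'a)" unfolding of_real_add[symmetric] by simp
    then have "u + of_real \<rho> - of_real (\<rho>/2) = u + of_real (\<rho>/2)" by (simp only: add.assoc[symmetric] add_diff_cancel)
    then show ?thesis using \<open>psd (u + of_real (\<rho>/2))\<close> by (simp only:)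
   qed
   \<comment> \<open>Now \<open>u * u - \<rho>^2 = (u + \<rho>) * (u - \<rho>)\<close>, and
     \<open>u + \<rho> >= \<rho> / 2\<close> has a positive inverse; cancelling it leaves
     \<open>u >= \<rho>\<close>. So the shift can be lowered by \<open>\<rho>\<close>, against the
     choice of \<open>t0\<close>.\<close>
   then obtain d where d: "psd d" "d * (u + of_real \<rho>) = 1"
     "\<forall>z. z * (u + of_real \<rho>) = (u + of_real \<rho>) * z --> z * d = d * z"
    using psd_inverse[of "u + of_real \<rho>" "\<rho>/2"] \<rho> by auto
   have "u * d = d * u" using d(3) by (simp add: algebra_simps of_real_def)
   then have "(u * u - of_real (\<rho>^2)) * d = d * (u * u - of_real (\<rho>^2))"
    by (simp add: algebra_simps of_real_def) (metis mult.assoc)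
   then have "psd (d * (u * u - of_real (\<rho>^2)))" using psd_mult[OF d(1) q] by simp
   also have "u * u - of_real (\<rho>^2) = (u + of_real \<rho>) * (u - of_real \<rho>)"
    by (simp add: algebra_simps of_real_def power2_eq_square)
   also have "d * ... = u - of_real \<rho>" using d(2) by (simp flip: mult.assoc)
   finally show ?case by (simp add: u_def algebra_simps)
  qed
  have "max 0 (t0 - \<rho>) \<in> S"
  proof -
   have "eventually (%n. psd (x n + of_real (max 0 (t0 - \<rho>) + \<delta>))) F" if "\<delta> > 0" for \<delta>
    using ev3
   proof eventually_elim
    case (elim n)
    have "psd (x n + of_real (t0 - \<rho>) + of_real (max 0 (t0 - \<rho>) + \<delta> - (t0 - \<rho>)))"
     using that by (intro psd_add elim psd_of_real) auto
    then show ?case unfolding add.assoc of_real_add[symmetric] by simp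
   qed
   then show ?thesis by (simp add: S_def)
  qed
  then have "t0 <= max 0 (t0 - \<rho>)" unfolding t0_def using bdd by (rule cInf_lower)
  then show False using t0p \<rho> by simp
 qed
 then show ?thesis using t0S assms(5) by (simp add: S_def)
qed

lemma psd_of_psd_add: "(!!\<delta>. \<delta> > 0 ==> psd (a + of_real \<delta>)) ==> psd (a::'a::cstar)"
proof -
 assume *: "!!\<delta>. \<delta> > 0 ==> psd (a + of_real \<delta>)"
 have "(%n. a + of_real (1 / Suc n)) \<longlonglongrightarrow> a + of_real 0"
  by (intro tendsto_intros inverse_Suc_tendsto)
 then show "psd a" by (intro psd_limit[of _ a sequentially]) (use * in \<open>auto simp del: of_real_divide\<close>)
qed

text \<open>The constant sequence in the preceding lemma. One-sided inverses of the positive shifts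
  are enough, as \<open>a\<close> is self-adjoint.\<close>

lemma psd_of_invertible:
 fixes a :: "'a::cstar"
 assumes "adj a = a" "!!t. t > 0 ==> \<exists>y. (of_real t + a) * y = 1"
 shows "psd a"
proof (rule psd_of_psd_add)
 fix \<delta> :: real assume \<delta>: "\<delta> > 0"
 have "eventually (%n::nat. psd (a + of_real \<delta>)) sequentially"
 proof (rule eventually_psd_of_invertible[OF assms(1) order_refl norm_ge_zero _ \<delta>])
  fix t :: real assume "t > 0"
  then obtain y where "(of_real t + a) * y = 1" using assms(2) by blast
  then show "\<exists>C y. (\<forall>n. norm (y n) <= C) \<and> (\<forall>\<^sub>F n::nat in sequentially. norm ((of_real t + a) * y n - 1) <= 1/2)"
   by (intro exI[of _ "norm y"] exI[of _ "%_. y"]) auto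
 qed
 then show "psd (a + of_real \<delta>)" by simp
qed

lemma psd_invertible:
 fixes a :: "'a::cstar"
 assumes "psd a" "t > 0" shows "\<exists>y. (of_real t + a) * y = 1 \<and> y * (of_real t + a) = 1"
 using psd_inverse[of "of_real t + a" t] assms by auto

text \<open>Let \<open>n\<close> be the negative part of \<open>adj c * c\<close> and
  \<open>y = c * n\<close>. Then \<open>- (adj y * y) >= 0\<close>, while
  \<open>y * adj y + adj y * y\<close> is a sum of two squares (real and imaginary part), so
  \<open>y * adj y >= 0\<close>. Since \<open>adj y * y\<close> and \<open>y * adj y\<close> have
  the same resolvent points away from 0, both signs hold for \<open>adj y * y\<close>; it vanishes,
  hence so does \<open>n\<close>.\<close>

lemma psd_adj_mult: "psd (adj c * (c::'a::cstar))"
proof -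
 define a where "a = adj c * c"
 have a: "adj a = a" by (simp add: a_def adj_mult)
 note lu = psd_norm_bounds[OF a]
 let ?f = "%t::real. max 0 (- t)"
 have f: "continuous_on UNIV ?f" and id: "continuous_on UNIV (%t::real. t)" by (intro continuous_intros)+
 define n where "n = cfc ?f a"
 have n: "adj n = n" unfolding n_def by (rule adj_cfc[OF f a])
 define y where "y = c * n"
 have yy: "adj y * y = n * a * n" by (simp add: y_def adj_mult n a_def mult.assoc)
 have nan: "n * a * n = cfc (%t. ?f t * t * ?f t) a"
  unfolding n_def using f id a by (simp add: cfc_mult cfc_id continuous_on_mult)
 have "psd (cfc (%t. - (?f t * t * ?f t)) a)"
 proof (rule cfc_nonneg[OF _ lu])
  show "0 <= - (?f t * t * ?f t)" for t
   by (cases "t <= 0") (auto simp: mult_nonneg_nonpos mult_nonpos_nonpos)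
 qed (intro continuous_intros)
 then have neg: "psd (- (adj y * y))" using f id a
  by (simp add: yy nan cfc_uminus continuous_on_mult)
 have "psd ((y + adj y) * (y + adj y) + (imag * (y - adj y)) * (imag * (y - adj y)))"
  by (intro psd_add psd_sq) (auto simp: adj_add adj_mult adj_imag adj_diff imag_comm algebra_simps)
 also have "(imag * (y - adj y)) * (imag * (y - adj y)) = imag * imag * ((y - adj y) * (y - adj y))"
  by (metis imag_comm mult.assoc)
 also have "... = - ((y - adj y) * (y - adj y))" by (simp add: imag_sq)
 also have "(y + adj y) * (y + adj y) + - ((y - adj y) * (y - adj y)) = 2 *\<^sub>R (y * adj y + adj y * y)"
  by (simp add: algebra_simps scaleR_2)
 finally have "psd ((1/2) *\<^sub>R (2 *\<^sub>R (y * adj y + adj y * y)))" by (rule psd_scaleR) simp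
 then have "psd (y * adj y + adj y * y + - (adj y * y))" using psd_add neg by force
 then have pos: "psd (y * adj y)" by simp
 have "psd (adj y * y)"
 proof (rule psd_of_invertible)
  fix t :: real assume t: "t > 0"
  then obtain z where z: "(of_real t + y * adj y) * z = 1" using psd_invertible[OF pos] by blast
  \<comment> \<open>The usual exchange of factors in a resolvent: \<open>z\<close> inverts
    \<open>t + y * adj y\<close>, and \<open>(1 - adj y * z * y) / t\<close> inverts
    \<open>t + adj y * y\<close>.\<close>
  have "(of_real t + adj y * y) * ((1/t) *\<^sub>R (1 - adj y * z * y))
    = (1/t) *\<^sub>R (of_real t + adj y * y - adj y * ((of_real t + y * adj y) * z) * y)"
   by (simp add: algebra_simps mult_of_real_left)
  also have "... = 1" using t unfolding z by (simp add: of_real_def)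
  finally show "\<exists>w. (of_real t + adj y * y) * w = 1" by blast
 qed (simp add: adj_mult)
 then have "n * a * n = 0" using psd_antisym[OF _ neg] by (simp add: yy)
 moreover have "n * n * n = - (n * a * n)"
 proof -
  have "n * n * n = cfc (%t. ?f t * ?f t * ?f t) a"
   unfolding n_def using f a by (simp add: cfc_mult continuous_on_mult)
  also have "(%t. ?f t * ?f t * ?f t) = (%t. - (?f t * t * ?f t))" by (auto simp: max_def)
  also have "cfc ... a = - (n * a * n)" unfolding nan using f id a
   by (subst cfc_uminus) (auto intro!: continuous_intros)
  finally show ?thesis .
 qed
 ultimately have "(n * n) * (n * n) = 0" by (simp flip: mult.assoc)
 moreover have "norm ((n * n) * (n * n)) = (norm n ^ 2) ^ 2"
  by (simp add: norm_sa_sq adj_mult n)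
 ultimately have "n = 0" by simp
 moreover have "a = cfc (%t. max 0 t - ?f t) a"
  by (subst cfc_id[OF a, symmetric], rule arg_cong[where f = "%f. cfc f a"]) (auto simp: max_def)
 moreover have "cfc (%t. max 0 t - ?f t) a = cfc (max 0) a - n"
  unfolding n_def by (intro cfc_diff a continuous_intros)
 moreover have "psd (cfc (max 0) a)"
  by (rule cfc_nonneg[OF _ lu]) (auto intro!: continuous_intros)
 ultimately show ?thesis by (simp add: a_def)
qed

lemma psd_mult_adj: "psd (c * adj (c::'a::cstar))"
 using psd_adj_mult[of "adj c"] by simp

lemma psd_conj: "psd a ==> psd (adj x * a * (x::'a::cstar))"
proof -
 assume "psd a"
 then obtain b where "adj b = b" "a = b * b" by (auto simp: psd_def)
 then have "adj x * a * x = adj (b * x) * (b * x)" by (simp add: adj_mult mult.assoc)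
 then show ?thesis by (simp only: psd_adj_mult)
qed

lemma norm_le_of_sq: "psd (of_real (t^2) - adj x * x) ==> t >= 0 ==> norm (x::'a::cstar) <= t"
 using psd_norm_mono[OF psd_adj_mult, of "of_real (t^2)" x]
 by (simp add: norm_adj_mult norm_power power2_le_iff_abs_le del: of_real_power)

lemma psd_conj_norm:
 "psd (norm x ^ 2 *\<^sub>R (adj y * y) - adj (x * y) * (x * (y::'a::cstar)))"
proof -
 have "psd (adj y * (of_real (norm x ^ 2) - adj x * x) * y)"
  by (intro psd_conj psd_upper psd_adj_mult) (simp add: norm_adj_mult)
 then show ?thesis
  by (simp add: algebra_simps adj_mult mult_of_real_left mult_of_real_right del: of_real_power)
qed

lemma psd_trans: "psd (b - a) ==> psd (c - b) ==> psd (c - (a::'a::cstar))"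
 using psd_add[of "b - a" "c - b"] by simp

text \<open>Negative \<open>z\<close> is a positive shift. For nonreal \<open>z\<close> the product
  of \<open>z - s\<close> with its conjugate partner is \<open>u * u + (Im z)^2\<close>, which is
  bounded below and hence invertible.\<close>

lemma psd_resolvent:
 fixes s :: "'a::cstar"
 assumes s: "psd s" and z: "z \<notin> \<real>\<^sub>\<ge>\<^sub>0"
 shows "\<exists>y. (cx z - s) * y = 1 \<and> y * (cx z - s) = 1"
proof (cases "Im z = 0")
 case True
 then have t: "- Re z > 0" using z by (auto simp: complex_nonneg_Reals_iff)
 obtain y where y: "(of_real (- Re z) + s) * y = 1" "y * (of_real (- Re z) + s) = 1"
  using psd_invertible[OF s t] by blast
 have "cx z - s = - (of_real (- Re z) + s)" using True by (simp add: cx_def)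
 then show ?thesis using y by (intro exI[of _ "- y"]) (simp only: minus_mult_minus)
next
 case False
 have sa: "adj s = s" by (rule psd_sa[OF s])
 define u where "u = s - of_real (Re z)"
 have u: "adj u = u" by (simp add: u_def adj_diff sa)
 define c where "c = u * u + of_real (Im z ^ 2)"
 have "psd (c - of_real (Im z ^ 2))" using psd_sq[OF u] by (simp add: c_def)
 then obtain d where d: "d * c = 1" "c * d = 1" "\<forall>x. x * c = c * x --> x * d = d * x"
  using psd_inverse[of c "Im z ^ 2"] False by auto
 have iu: "imag * u = u * imag" by (rule imag_comm)
 define v :: 'a where "v = Im z *\<^sub>R imag"
 have v: "v * v = - of_real (Im z ^ 2)" by (simp add: v_def imag_sq power2_eq_square of_real_def)
 have vu: "v * u = u * v" by (simp add: v_def iu)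
 have c1: "c = (v - u) * (- v - u)" "c = (- v - u) * (v - u)"
  by (simp_all add: c_def algebra_simps v vu)
 have cxz: "cx z - s = v - u" by (simp add: cx_def u_def v_def)
 have "(v - u) * c = c * (v - u)" using c1 by (metis mult.assoc)
 then have "(v - u) * d = d * (v - u)" using d(3) by blast
 have "(- v - u) * c = c * (- v - u)" using c1 by (metis mult.assoc)
 then have e: "(- v - u) * d = d * (- v - u)" using d(3) by blast
 show ?thesis unfolding cxz
 proof (intro exI conjI)
  show "(v - u) * ((- v - u) * d) = 1" using d(2) by (simp only: c1(1) mult.assoc)
  show "((- v - u) * d) * (v - u) = 1" unfolding e using d(1) by (simp only: c1(2) mult.assoc)
 qed
qed

lemma sum_rotate: "(\<Sum>p\<in>I. \<Sum>k\<in>J. \<Sum>j\<in>L. f p k j) = (\<Sum>k\<in>J. \<Sum>j\<in>L. \<Sum>p\<in>I. f p k j)"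
 by (rule trans[OF sum.swap], intro sum.cong refl, rule sum.swap)

section \<open>Hermitian matrices over a C*-algebra\<close>

definition qform :: "'i set => ('i => 'i => 'a::cstar) => ('i => 'a) => 'a" where
 "qform I Z d = (\<Sum>i\<in>I. \<Sum>j\<in>I. adj (d i) * Z i j * d j)"

definition sqnorm :: "'i set => ('i => 'a::cstar) => 'a" where
 "sqnorm I d = (\<Sum>i\<in>I. adj (d i) * d i)"

lemma psd_sqnorm: "psd (sqnorm I d)"
 unfolding sqnorm_def by (intro psd_sum psd_adj_mult)

lemma qform_insert:
 assumes "finite I" "q \<notin> I"
 shows "qform (insert q I) Z d = adj (d q) * Z q q * d q + adj (d q) * (\<Sum>j\<in>I. Z q j * d j)
  + (\<Sum>i\<in>I. adj (d i) * Z i q) * d q + qform I Z d"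
 using assms by (simp add: qform_def sum.distrib sum_distrib_left sum_distrib_right mult.assoc add.assoc)

text \<open>Gaussian elimination: the Schur complement of a pivot keeps the lower bound of the form.\<close>

lemma hermitian_factorization:
 fixes Z :: "'i => 'i => 'a::cstar"
 assumes "finite I" "\<epsilon> > 0" "!!i j. i \<in> I ==> j \<in> I ==> adj (Z i j) = Z j i"
  and "!!d. psd (qform I Z d - \<epsilon> *\<^sub>R sqnorm I d)"
 shows "\<exists>c. \<forall>i\<in>I. \<forall>j\<in>I. Z i j = (\<Sum>p\<in>I. adj (c p i) * c p j)"
 using assms(1,3,4)
proof (induction I arbitrary: Z rule: finite_induct)
 case (insert q I)
 note her = insert.prems(1) and form = insert.prems(2)
 have "qform (insert q I) Z (%i. if i = q then 1 else 0) = Z q q"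
 proof -
  have "qform I Z (%i. if i = q then 1 else 0) = 0"
   unfolding qform_def using insert.hyps by (intro sum.neutral ballI) auto
  moreover have "(\<Sum>j\<in>I. Z q j * (if j = q then 1 else 0)) = 0" using insert.hyps by (intro sum.neutral) auto
  moreover have "(\<Sum>i\<in>I. adj (if i = q then 1 else 0) * Z i q) = 0" using insert.hyps by (intro sum.neutral) auto
  ultimately show ?thesis unfolding qform_insert[OF insert.hyps(1,2)] by simp
 qed
 moreover have "sqnorm (insert q I) (%i. if i = q then 1 else 0 :: 'a) = 1"
  unfolding sqnorm_def using insert.hyps by (subst sum.insert) (auto intro!: sum.neutral)
 ultimately have "psd (Z q q - of_real \<epsilon>)" using form[of "%i. if i = q then 1 else 0"] by (simp add: of_real_def)
 then obtain w where w: "psd w" "w * Z q q = 1" "Z q q * w = 1"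
  using psd_inverse assms(2) by blast
 obtain v where v: "adj v = v" "v * v = w" using psd_sqrt[OF w(1)] by blast
 define Z' where "Z' i j = Z i j - Z i q * w * Z q j" for i j
 have "\<exists>c. \<forall>i\<in>I. \<forall>j\<in>I. Z' i j = (\<Sum>p\<in>I. adj (c p i) * c p j)"
 proof (rule insert.IH)
  fix i j assume "i \<in> I" "j \<in> I"
  then show "adj (Z' i j) = Z' j i"
   unfolding Z'_def by (simp add: adj_diff adj_mult psd_sa[OF w(1)] her mult.assoc)
 next
  fix d :: "'i => 'a"
  define s where "s = (\<Sum>j\<in>I. Z q j * d j)"
  \<comment> \<open>The entry at \<open>q\<close> minimises the form in that coordinate; the minimum
    is the form of the Schur complement at \<open>d\<close>.\<close>
  define d' where "d' i = (if i = q then - (w * s) else d i)" for i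
  have dI: "d' i = d i" if "i \<in> I" for i using that insert.hyps by (auto simp: d'_def)
  have as: "(\<Sum>i\<in>I. adj (d' i) * Z i q) = adj s"
   unfolding s_def adj_sum by (intro sum.cong refl) (simp add: dI adj_mult her)
  have s': "(\<Sum>j\<in>I. Z q j * d' j) = s" unfolding s_def by (intro sum.cong refl) (simp add: dI)
  have q': "qform I Z d' = qform I Z d" unfolding qform_def by (intro sum.cong refl) (simp add: dI)
  have dq: "d' q = - (w * s)" by (simp add: d'_def)
  have "qform (insert q I) Z d' = adj s * (w * Z q q) * w * s - adj s * w * s - adj s * w * s + qform I Z d"
   unfolding qform_insert[OF insert.hyps(1,2)] as s' q' dq
   by (simp add: adj_mult psd_sa[OF w(1)] mult.assoc)
  also have "... = qform I Z d - adj s * w * s" by (simp add: w)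
  also have "... = qform I Z' d"
  proof -
   have "adj s * w = (\<Sum>i\<in>I. adj (d i) * Z i q * w)"
    unfolding as[symmetric] sum_distrib_right by (intro sum.cong refl) (simp add: dI)
   then have "adj s * w * s = (\<Sum>i\<in>I. \<Sum>j\<in>I. adj (d i) * Z i q * w * (Z q j * d j))"
    unfolding s_def by (simp only: sum_product)
   then show ?thesis unfolding qform_def Z'_def
    by (simp add: algebra_simps sum_subtractf)
  qed
  finally have 1: "qform (insert q I) Z d' = qform I Z' d" .
  have "sqnorm (insert q I) d' = adj (d' q) * d' q + sqnorm I d"
   unfolding sqnorm_def using insert.hyps by (simp add: dI)
  then have "psd (sqnorm (insert q I) d' - sqnorm I d)" by (simp add: psd_adj_mult)
  then have "psd (\<epsilon> *\<^sub>R (sqnorm (insert q I) d' - sqnorm I d))" using assms(2) by (intro psd_scaleR) auto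
  then show "psd (qform I Z' d - \<epsilon> *\<^sub>R sqnorm I d)"
   using psd_add[OF form[of d']] unfolding 1 by (fastforce simp: scaleR_diff_right)
 qed
 then obtain c where c: "\<forall>i\<in>I. \<forall>j\<in>I. Z' i j = (\<Sum>p\<in>I. adj (c p i) * c p j)" by blast
 \<comment> \<open>Row \<open>q\<close> uses the square root \<open>v\<close> of the inverse pivot;
   the rows of the Schur complement get the entry 0 in column \<open>q\<close>.\<close>
 define c' where "c' p i = (if p = q then v * Z q i else if i = q then 0 else c p i)" for p i
 have vv: "x * v * (v * y) = x * w * y" for x y by (simp flip: v(2) add: mult.assoc)
 have "Z i j = (\<Sum>p\<in>insert q I. adj (c' p i) * c' p j)" if ij: "i \<in> insert q I" "j \<in> insert q I" for i j
 proof -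
  have "(\<Sum>p\<in>insert q I. adj (c' p i) * c' p j) = Z i q * w * Z q j + (\<Sum>p\<in>I. adj (c' p i) * c' p j)"
   using insert.hyps ij by (simp add: c'_def adj_mult v(1) her vv)
  also have "(\<Sum>p\<in>I. adj (c' p i) * c' p j) = (if i = q \<or> j = q then 0 else Z' i j)"
   using insert.hyps ij c by (auto simp: c'_def intro!: sum.neutral sum.cong)
  finally have e: "(\<Sum>p\<in>insert q I. adj (c' p i) * c' p j)
    = Z i q * w * Z q j + (if i = q \<or> j = q then 0 else Z' i j)" .
  have "Z q q * w * Z q j = Z q j" "Z i q * w * Z q q = Z i q" using w by (simp_all add: mult.assoc)
  then show ?thesis unfolding e by (auto simp: Z'_def)
 qed
 then show ?case by blast
qed auto

definition mone :: "'i => 'i => 'a::ring_1" where "mone i j = (if i = j then 1 else 0)"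

lemma sum_mone: "(j::nat) < n ==> (\<Sum>k<n. b k * mone k j) = (b j :: 'b::ring_1)"
 "i < n ==> (\<Sum>k<n. mone i k * b k) = (b i :: 'b::ring_1)"
 by (simp_all add: mone_def if_distrib[of "%x. x * _"] if_distrib[of "%x. _ * x"] cong: if_cong)

lemma qform_add_scalar:
 assumes "finite I"
 shows "qform I (%i j. Z i j + t *\<^sub>R mone i j) d = qform I Z d + t *\<^sub>R sqnorm I (d :: 'i => 'a::cstar)"
proof -
 have "(\<Sum>j\<in>I. adj (d i) * (t *\<^sub>R mone i j) * d j) = t *\<^sub>R (adj (d i) * d i)" if "i \<in> I" for i
 proof -
  have "(\<Sum>j\<in>I. adj (d i) * (t *\<^sub>R mone i j) * d j) = (\<Sum>j\<in>I. if i = j then t *\<^sub>R (adj (d i) * d j) else 0)"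
   by (intro sum.cong) (auto simp: mone_def)
  then show ?thesis using that assms by simp
 qed
 then show ?thesis
  by (simp add: qform_def sqnorm_def algebra_simps sum.distrib scaleR_sum_right)
qed

section \<open>Cut-downs of positive elements\<close>

text \<open>Zero up to \<open>1 - \<delta>\<close>, then linear with value 1 at 1. Applied to a
  norm-one positive \<open>h\<close> it gives a norm-one element living where \<open>h\<close> is
  within \<open>\<delta>\<close> of 1.\<close>

definition tent :: "real => real => real" where "tent \<delta> t = max 0 (t - (1 - \<delta>)) / \<delta>"

lemma continuous_tent: "continuous_on UNIV (tent \<delta>)"
 unfolding tent_def divide_inverse by (intro continuous_intros)

lemma tent_0: "0 < \<delta> ==> \<delta> <= 1 ==> tent \<delta> 0 = 0"
 by (simp add: tent_def)

lemma tent_nonneg: "0 < \<delta> ==> tent \<delta> t >= 0"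
 by (simp add: tent_def)

lemma tent_zero_iff: "0 < \<delta> ==> t <= 1 - \<delta> ==> tent \<delta> t = 0"
 by (simp add: tent_def)

lemma tent_le_1: "0 < \<delta> ==> t <= 1 ==> tent \<delta> t <= 1"
 by (simp add: tent_def divide_le_eq)

lemma tent_le: "0 < \<delta> ==> \<delta> <= 1 ==> 0 <= t ==> t <= 1 ==> tent \<delta> t <= t"
proof -
 assume a: "0 < \<delta>" "\<delta> <= 1" "0 <= t" "t <= 1"
 have "t - (1 - \<delta>) <= t * \<delta>"
  using mult_nonneg_nonneg[of "1 - t" "1 - \<delta>"] a by (simp add: algebra_simps)
 then show ?thesis using a by (simp add: tent_def divide_le_eq)
qed

lemma cfc_psd:
 assumes "continuous_on UNIV f" "psd (h::'a::cstar)" "!!t. 0 <= t ==> t <= norm h ==> f t >= 0"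
 shows "psd (cfc f h)"
 using cfc_nonneg[OF assms(1), of h 0 "norm h"] psd_upper[OF assms(2) order_refl] assms by simp

lemma cfc_psd_mono:
 assumes "continuous_on UNIV f" "continuous_on UNIV g" "psd (h::'a::cstar)"
  "!!t. 0 <= t ==> t <= norm h ==> f t <= g t"
 shows "psd (cfc g h - cfc f h)"
 using cfc_mono[OF assms(1,2), of h 0 "norm h"] psd_upper[OF assms(3) order_refl] assms by simp

lemma cfc_psd_cong:
 assumes "continuous_on UNIV f" "continuous_on UNIV g" "psd (h::'a::cstar)"
  "!!t. 0 <= t ==> t <= norm h ==> f t = g t"
 shows "cfc f h = cfc g h"
 using cfc_cong[OF assms(1,2), of h 0 "norm h"] psd_upper[OF assms(3) order_refl] assms by simp

lemma cfc_psd_norm_le: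
 assumes "continuous_on UNIV f" "psd (h::'a::cstar)" "!!t. 0 <= t ==> t <= norm h ==> \<bar>f t\<bar> <= M"
 shows "norm (cfc f h) <= M"
 using cfc_norm_le[OF assms(1), of h 0 "norm h"] psd_upper[OF assms(2) order_refl] assms by simp

lemma norm_one_minus_le: "psd h ==> norm h <= 1 ==> norm (1 - h) <= 1"
 using psd_norm[of h 1] by simp

text \<open>On the support of \<open>f\<close> one has \<open>1 - t <= \<delta>\<close>, so
  \<open>f^2 * (1 - t)^2 <= \<delta>^2 * f^2\<close>. The factor \<open>x\<close> is carried along
  because a bound relative to \<open>norm (cfc f h * x)\<close> survives normalisation.\<close>

lemma norm_bump_mult:
 fixes h x :: "'a::cstar"
 assumes f: "continuous_on UNIV f" and h: "psd h" "norm h <= 1" and \<delta>: "0 <= \<delta>"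
  and z: "!!t. t <= 1 - \<delta> ==> f t = 0"
 shows "norm ((1 - h) * (cfc f h * x)) <= \<delta> * norm (cfc f h * x)"
proof -
 let ?k = "cfc f h"
 have sa: "adj h = h" by (rule psd_sa[OF h(1)])
 have ak: "adj ?k = ?k" by (rule adj_cfc[OF f sa])
 have c1: "continuous_on UNIV (%t. 1 - t :: real)" by (intro continuous_intros)
 have 1: "cfc (%t. 1 - t) h = 1 - h"
  using cfc_diff[OF continuous_on_const continuous_on_id sa, of 1] by (simp add: cfc_const cfc_id sa id_def)
 have "psd (cfc (%t. \<delta>^2 * (f t * f t)) h - cfc (%t. f t * (1 - t) * ((1 - t) * f t)) h)"
 proof (rule cfc_psd_mono[OF _ _ h(1)])
  fix t assume t: "0 <= t" "t <= norm h"
  show "f t * (1 - t) * ((1 - t) * f t) <= \<delta>^2 * (f t * f t)"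
  proof (cases "t <= 1 - \<delta>")
   case False
   then have "(1 - t)^2 <= \<delta>^2" using t h by (intro power_mono) auto
   then have "(1 - t)^2 * (f t)^2 <= \<delta>^2 * (f t)^2" by (rule mult_right_mono) simp
   then show ?thesis by (simp add: power2_eq_square mult_ac)
  qed (simp add: z)
 qed (intro continuous_intros f)+
 then have "psd (\<delta>^2 *\<^sub>R (?k * ?k) - adj ((1 - h) * ?k) * ((1 - h) * ?k))" using sa c1 f
  by (simp add: cfc_scale cfc_mult continuous_on_mult 1 adj_mult adj_diff adj_cfc mult.assoc)
 then have "psd (adj x * (\<delta>^2 *\<^sub>R (?k * ?k) - adj ((1 - h) * ?k) * ((1 - h) * ?k)) * x)"
  by (rule psd_conj)
 also have "adj x * (\<delta>^2 *\<^sub>R (?k * ?k) - adj ((1 - h) * ?k) * ((1 - h) * ?k)) * x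
  = \<delta>^2 *\<^sub>R (adj (?k * x) * (?k * x)) - adj ((1 - h) * (?k * x)) * ((1 - h) * (?k * x))"
  unfolding adj_mult[of ?k x] adj_mult[of "1 - h" "?k * x"] adj_mult[of "1 - h" ?k]
  by (simp add: ak left_diff_distrib right_diff_distrib mult.assoc)
 finally have "norm (adj ((1 - h) * (?k * x)) * ((1 - h) * (?k * x))) <= norm (\<delta>^2 *\<^sub>R (adj (?k * x) * (?k * x)))"
  by (intro psd_norm_mono psd_adj_mult)
 then have "norm ((1 - h) * (?k * x)) ^ 2 <= (\<delta> * norm (?k * x)) ^ 2"
  by (simp add: norm_adj_mult power_mult_distrib)
 then show ?thesis using \<delta> by (simp add: power2_le_iff_abs_le)
qed

context
 fixes h :: "'a::cstar" and \<delta> :: real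
 assumes h: "psd h" "norm h = 1" and \<delta>: "0 < \<delta>" "\<delta> <= 1"
begin

lemma psd_tent: "psd (cfc (tent \<delta>) h)"
 by (rule cfc_psd[OF continuous_tent h(1)]) (simp add: tent_nonneg \<delta>)

lemma tent_le_id: "psd (h - cfc (tent \<delta>) h)"
 using cfc_psd_mono[OF continuous_tent continuous_on_id h(1)] tent_le[OF \<delta>] h
 by (simp add: cfc_id psd_sa id_def)

lemma norm_tent: "norm (cfc (tent \<delta>) h) = 1"
proof (rule antisym)
 show "norm (cfc (tent \<delta>) h) <= 1"
  by (rule cfc_psd_norm_le[OF continuous_tent h(1)])
   (use tent_nonneg[OF \<delta>(1)] tent_le_1[OF \<delta>(1)] h(2) in simp)
 \<comment> \<open>The inequality \<open>t <= (1 - \<delta>) + \<delta> * tent \<delta> t\<close>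
   turns \<open>norm h = 1\<close> into the lower bound for the tent.\<close>
 have c: "continuous_on UNIV (%t. (1 - \<delta>) + \<delta> * tent \<delta> t)" by (intro continuous_intros continuous_tent)
 have "psd (cfc (%t. (1 - \<delta>) + \<delta> * tent \<delta> t) h - cfc (%t. t) h)"
  by (rule cfc_psd_mono[OF continuous_on_id c h(1)]) (use \<delta> in \<open>auto simp: tent_def\<close>)
 also have "cfc (%t. (1 - \<delta>) + \<delta> * tent \<delta> t) h = of_real (1 - \<delta>) + \<delta> *\<^sub>R cfc (tent \<delta>) h"
  using h continuous_tent by (subst cfc_add) (auto simp: cfc_const cfc_scale psd_sa intro!: continuous_intros)
 finally have "norm h <= norm (of_real (1 - \<delta>) + \<delta> *\<^sub>R cfc (tent \<delta>) h)"
  using h by (intro psd_norm_mono) (auto simp: cfc_id psd_sa)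
 also have "... <= (1 - \<delta>) + \<delta> * norm (cfc (tent \<delta>) h)"
  using \<delta> by (intro order_trans[OF norm_triangle_ineq]) (simp del: of_real_diff)
 finally have "\<delta> * 1 <= \<delta> * norm (cfc (tent \<delta>) h)" using h by simp
 then show "norm (cfc (tent \<delta>) h) >= 1" using \<delta> by simp
qed

lemma norm_tent_mult: "norm ((1 - h) * (cfc (tent \<delta>) h * x)) <= \<delta> * norm (cfc (tent \<delta>) h * x)"
 by (rule norm_bump_mult[OF continuous_tent h(1)]) (use h \<delta> in \<open>auto simp: tent_zero_iff\<close>)

lemma norm_one_minus_tent: "norm ((1 - h) * cfc (tent \<delta>) h) <= \<delta>"
 using norm_tent_mult[of 1] norm_tent by simp

end

text \<open>Here and below, a small \<open>norm ((1 - h) * k)\<close> expresses that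
  \<open>k\<close> lies approximately under \<open>h\<close>. The lemma inserts \<open>h1\<close>
  and \<open>h2\<close> next to elements that lie under them.\<close>

lemma cut_diff:
 fixes a b h1 h2 y :: "'a::cstar"
 assumes "adj h1 = h1" "norm h1 <= 1" "norm a <= 1" "norm b <= 1"
 shows "norm (adj a * y * b - adj a * h1 * y * h2 * b) <= (norm ((1 - h1) * a) + norm ((1 - h2) * b)) * norm y"
proof -
 have "adj a * y * b - adj a * h1 * y * h2 * b = adj ((1 - h1) * a) * y * b + adj a * h1 * y * ((1 - h2) * b)"
  by (simp add: adj_mult adj_diff assms algebra_simps)
 also have "norm ... <= norm (adj ((1 - h1) * a) * y * b) + norm (adj a * h1 * y * ((1 - h2) * b))"
  by (rule norm_triangle_ineq)
 also have "norm (adj ((1 - h1) * a) * y * b) <= norm ((1 - h1) * a) * norm y"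
 proof -
  have "norm (adj ((1 - h1) * a) * y) <= norm ((1 - h1) * a) * norm y"
   using norm_mult_ineq[of "adj ((1 - h1) * a)" y] by (simp only: norm_adj)
  then show ?thesis using norm_mult_ineq[of "adj ((1 - h1) * a) * y" b]
   mult_left_le[OF assms(4) norm_ge_zero[of "adj ((1 - h1) * a) * y"]] by linarith
 qed
 also have "norm (adj a * h1 * y * ((1 - h2) * b)) <= norm y * norm ((1 - h2) * b)"
 proof -
  have "norm (adj a * h1) <= 1 * 1"
   by (rule order_trans[OF norm_mult_ineq], rule mult_mono) (use assms in auto)
  then have "norm (adj a * h1 * y) <= 1 * norm y"
   by (intro order_trans[OF norm_mult_ineq[of "adj a * h1" y]] mult_right_mono) auto
  then show ?thesis
   by (intro order_trans[OF norm_mult_ineq[of "adj a * h1 * y" "(1 - h2) * b"]] mult_right_mono) auto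
 qed
 finally show ?thesis by (simp add: algebra_simps)
qed

lemma cut_norm:
 fixes a b h1 h2 y :: "'a::cstar"
 assumes "adj h1 = h1" "norm h1 <= 1" "norm a <= 1" "norm b <= 1"
 shows "norm (adj a * y * b) <= norm (h1 * y * h2) + (norm ((1 - h1) * a) + norm ((1 - h2) * b)) * norm y"
proof -
 have "norm (adj a * y * b) <= norm (adj a * h1 * y * h2 * b) + norm (adj a * y * b - adj a * h1 * y * h2 * b)"
  by (rule norm_triangle_sub)
 moreover have "norm (adj a * h1 * y * h2 * b) <= norm (h1 * y * h2)"
 proof -
  have "adj a * h1 * y * h2 * b = adj a * (h1 * y * h2) * b" by (simp add: mult.assoc)
  moreover have "norm (adj a * (h1 * y * h2)) <= 1 * norm (h1 * y * h2)"
   by (rule order_trans[OF norm_mult_ineq], rule mult_right_mono) (use assms in auto)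
  ultimately show ?thesis
   using norm_mult_ineq[of "adj a * (h1 * y * h2)" b] mult_left_le[OF assms(4), of "norm (adj a * (h1 * y * h2))"]
   by simp
 qed
 ultimately show ?thesis using cut_diff[OF assms, of y h2] by linarith
qed

lemma near_trans:
 fixes h k l :: "'a::cstar"
 assumes "psd h" "norm h <= 1" "norm l <= 1" "norm ((1 - h) * k) <= \<eta>" "norm ((1 - k) * l) <= \<eta>'"
 shows "norm ((1 - h) * l) <= \<eta> + \<eta>'"
proof -
 have "(1 - h) * l = (1 - h) * k * l + (1 - h) * ((1 - k) * l)" by (simp add: algebra_simps)
 also have "norm ... <= norm ((1 - h) * k * l) + norm ((1 - h) * ((1 - k) * l))" by (rule norm_triangle_ineq)
 also have "norm ((1 - h) * k * l) <= \<eta>"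
  using norm_mult_ineq[of "(1 - h) * k" l] mult_left_le[OF assms(3), of "norm ((1 - h) * k)"] assms(4) by simp
 also have "norm ((1 - h) * ((1 - k) * l)) <= \<eta>'"
  using norm_mult_ineq[of "1 - h" "(1 - k) * l"] assms(5)
   mult_right_mono[OF norm_one_minus_le[OF assms(1,2)], of "norm ((1 - k) * l)"] by simp
 finally show ?thesis by simp
qed

section \<open>Corners\<close>

text \<open>As \<open>p\<close> is central, \<open>Ac\<close> is an ideal with unit \<open>p\<close>
  of the ambient algebra. Square roots, inverses and \<open>1 - h\<close> may be formed outside and
  multiplied back in.\<close>

locale corner_algebra =
 fixes p :: "'a::cstar"
 assumes pp: "p * p = p" and ap: "adj p = p" and pc: "x * p = p * x"
begin

definition Ac :: "'a set" where "Ac = {x. p * x = x}"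

lemma Ac_left: "x \<in> Ac ==> p * x = x" and Ac_right: "x \<in> Ac ==> x * p = x"
 by (auto simp: Ac_def pc)

lemma Ac_p [simp]: "p \<in> Ac" and Ac_0 [simp]: "0 \<in> Ac"
 by (auto simp: Ac_def pp)

lemma Ac_add [intro]: "x \<in> Ac ==> y \<in> Ac ==> x + y \<in> Ac"
 and Ac_diff [intro]: "x \<in> Ac ==> y \<in> Ac ==> x - y \<in> Ac"
 and Ac_uminus [intro]: "x \<in> Ac ==> - x \<in> Ac"
 and Ac_scaleR [intro]: "x \<in> Ac ==> r *\<^sub>R x \<in> Ac"
 and Ac_mult_left: "x \<in> Ac ==> x * y \<in> Ac"
 and Ac_mult_right: "x \<in> Ac ==> y * x \<in> Ac"
 by (auto simp: Ac_def algebra_simps) (metis mult.assoc pc)+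

lemma Ac_mult [intro]: "x \<in> Ac ==> y \<in> Ac ==> x * y \<in> Ac"
 by (rule Ac_mult_left)

lemma Ac_cx: "x \<in> Ac ==> cx z * x \<in> Ac"
 by (rule Ac_mult_right)

lemma Ac_adj [intro]: "x \<in> Ac ==> adj x \<in> Ac"
 unfolding Ac_def using adj_mult[of p x] by (simp add: ap pc)

lemma Ac_sum: "(!!i. i \<in> I ==> f i \<in> Ac) ==> sum f I \<in> Ac"
 by (induction I rule: infinite_finite_induct) auto

lemma Ac_cfc: "continuous_on UNIV f ==> adj x = x ==> f 0 = 0 ==> x \<in> Ac ==> cfc f x \<in> Ac"
 unfolding Ac_def using cfc_unit_left by blast

lemma Ac_tent: "psd h ==> h \<in> Ac ==> 0 < \<delta> ==> \<delta> <= 1 ==> cfc (tent \<delta>) h \<in> Ac"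
 by (rule Ac_cfc[OF continuous_tent psd_sa tent_0])

lemma psd_p: "psd p"
 using psd_sq[OF ap] pp by simp

lemma psd_corner_upper: "x \<in> Ac ==> adj x = x ==> norm x <= r ==> psd (r *\<^sub>R p - x)"
proof -
 assume x: "x \<in> Ac" "adj x = x" "norm x <= r"
 have "psd (p * (of_real r - x))"
  by (intro psd_mult psd_p psd_norm_minus x) (simp add: pc)
 then show ?thesis by (simp add: algebra_simps Ac_left x mult_of_real_right)
qed

end

text \<open>\<open>comparison\<close> is local weak comparison freed from dimension functions: for
  contractions, a positive contractive unit \<open>q\<close> of \<open>a\<close> bounds the
  dimension of \<open>a\<close> from above by \<open>t q\<close>, and \<open>t b\<close> bounds that
  of \<open>b\<close> from below. \<open>full\<close> is what simplicity supplies.\<close>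

locale tracial_core = corner_algebra +
 fixes T :: "('a => real) set" and \<gamma> :: real
 assumes T_ne: "T ~= {}"
  and T_add: "[|t \<in> T; x \<in> Ac; y \<in> Ac|] ==> t (x + y) = t x + t y"
  and T_scale: "[|t \<in> T; x \<in> Ac|] ==> t (r *\<^sub>R x) = r * t x"
  and T_comm: "[|t \<in> T; x \<in> Ac; y \<in> Ac|] ==> t (x * y) = t (y * x)"
  and T_pos: "[|t \<in> T; x \<in> Ac; psd x|] ==> t x >= 0"
  and T_one: "t \<in> T ==> t p = 1"
  and full: "[|g \<in> Ac; psd g; g ~= 0|] ==>
    \<exists>n w. (\<forall>i<n::nat. w i \<in> Ac) \<and> psd ((\<Sum>i<n. adj (w i) * g * w i) - p)"
  and gamma: "\<gamma> >= 1"
  and comparison: "[|a \<in> Ac; b \<in> Ac; q \<in> Ac; psd a; psd b; psd q; norm a <= 1; norm b <= 1; norm q <= 1; q * a = a;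
    !!t. t \<in> T ==> t q <= k1; !!t. t \<in> T ==> t b >= k2; \<gamma> * k1 < k2; \<epsilon> > 0|] ==>
    \<exists>r\<in>Ac. norm (adj r * b * r - a) <= \<epsilon>"
begin

lemma T_diff: "[|t \<in> T; x \<in> Ac; y \<in> Ac|] ==> t (x - y) = t x - t y"
 using T_add[of t x "-y"] T_scale[of t y "-1"] by auto

lemma T_mono: "[|t \<in> T; x \<in> Ac; y \<in> Ac; psd (y - x)|] ==> t x <= t y"
 using T_pos[of t "y - x"] T_diff[of t y x] by auto

lemma T_sum: "[|t \<in> T; !!i. i \<in> I ==> f i \<in> Ac|] ==> t (sum f I) = (\<Sum>i\<in>I. t (f i))"
proof (induction I rule: infinite_finite_induct)
 case (insert x F)
 then show ?case by (simp add: T_add Ac_sum)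
qed (use T_scale[of t 0 0] in auto)

lemma T_le_norm: "[|t \<in> T; x \<in> Ac; adj x = x; norm x <= r|] ==> t x <= r"
 using T_mono[OF _ _ Ac_scaleR[OF Ac_p] psd_corner_upper] by (simp add: T_scale T_one)

lemma T_conj_le:
 assumes "t \<in> T" "x \<in> Ac" "y \<in> Ac"
 shows "t (adj (x * y) * (x * y)) <= norm x ^ 2 * t (adj y * y)"
proof -
 have A: "adj (x * y) * (x * y) \<in> Ac" "adj y * y \<in> Ac" using assms Ac_mult_right by auto
 show ?thesis using T_mono[OF assms(1) A(1) Ac_scaleR[OF A(2)] psd_conj_norm]
  by (simp only: T_scale[OF assms(1) A(2)])
qed

text \<open>Apply \<open>t\<close> to \<open>p <= \<Sum> adj (w i) * g * w i\<close>; by the trace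
  property each term is at most \<open>norm (w i) ^ 2 * t g\<close>.\<close>

lemma T_full_lower:
 assumes g: "g \<in> Ac" "psd g" "g ~= 0"
 shows "\<exists>c>0. \<forall>t\<in>T. t g >= c"
proof -
 obtain n w where w: "\<forall>i<n::nat. w i \<in> Ac" "psd ((\<Sum>i<n. adj (w i) * g * w i) - p)"
  using full[OF g] by blast
 define W where "W = (\<Sum>i<n. norm (w i) ^ 2) + 1"
 have W: "W > 0" by (simp add: W_def add_nonneg_pos sum_nonneg)
 have "1 <= W * t g" if t: "t \<in> T" for t
 proof -
  obtain b where b: "adj b = b" "b * b = g" "\<forall>z. z * g = g * z --> z * b = b * z"
   using psd_sqrt[OF g(2)] by blast
  \<comment> \<open>The root of \<open>g\<close> is found in the ambient algebra; multiplying by the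
    central \<open>p\<close> moves it into the corner, where traces may be used.\<close>
  have "p * b * (p * b) = p * (b * p) * b" by (simp only: mult.assoc)
  also have "... = p * p * (b * b)" unfolding pc[of b] by (simp only: mult.assoc)
  finally have bb: "(p * b) * (p * b) = g" using b(2) g(1) by (simp add: pp Ac_left)
  have ab: "adj (p * b) = p * b" by (simp add: adj_mult ap b(1) pc[of b])
  have bA: "p * b \<in> Ac" by (simp add: Ac_mult_left)
  have 1: "t (adj (w i) * g * w i) <= norm (w i) ^ 2 * t g" if "i < n" for i
  proof -
   have wi: "w i \<in> Ac" using w that by blast
   have "adj (w i) * g * w i = (adj (w i) * (p * b)) * ((p * b) * w i)" by (simp only: bb[symmetric] mult.assoc)
   then have "t (adj (w i) * g * w i) = t (((p * b) * w i) * (adj (w i) * (p * b)))"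
    using T_comm[OF t, of "adj (w i) * (p * b)" "(p * b) * w i"] wi bA by auto
   also have "((p * b) * w i) * (adj (w i) * (p * b)) = adj (adj (w i) * (p * b)) * (adj (w i) * (p * b))"
    unfolding adj_mult[of "adj (w i)" "p * b"] ab adj_adj ..
   also have "t ... <= norm (adj (w i)) ^ 2 * t (adj (p * b) * (p * b))"
    using T_conj_le[OF t] wi bA by blast
   finally show ?thesis by (simp only: ab bb norm_adj)
  qed
  have wA: "adj (w i) * g * w i \<in> Ac" if "i < n" for i using w that g by blast
  have "1 = t p" using T_one t by simp
  also have "... <= t (\<Sum>i<n. adj (w i) * g * w i)"
   by (rule T_mono[OF t _ _ w(2)]) (auto intro!: Ac_sum wA)
  also have "... = (\<Sum>i<n. t (adj (w i) * g * w i))" by (rule T_sum[OF t]) (simp add: wA)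
  also have "... <= (\<Sum>i<n. norm (w i) ^ 2 * t g)" by (intro sum_mono 1) simp
  also have "... <= W * t g" using T_pos[OF t g(1,2)] by (simp add: W_def sum_distrib_left sum_distrib_right algebra_simps)
  finally show ?thesis .
 qed
 then show ?thesis using W by (intro exI[of _ "1/W"]) (auto simp: field_simps)
qed

text \<open>Primeness: if all \<open>h * z * k\<close> vanish, compressing
  \<open>p <= \<Sum> adj (w i) * (h * h) * w i\<close> by \<open>k\<close> gives
  \<open>k * k <= 0\<close>.\<close>

lemma mult_nonzero:
 assumes h: "h \<in> Ac" "adj h = h" "h ~= 0" and k: "k \<in> Ac" "adj k = k" "k ~= 0"
 shows "\<exists>z\<in>Ac. h * z * k ~= 0"
proof (rule ccontr)
 assume "\<not> ?thesis"
 then have 0: "h * z * k = 0" if "z \<in> Ac" for z using that by blast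
 have "norm (h * h) = norm h ^ 2" by (rule norm_sa_sq[OF h(2)])
 then have hh: "h * h \<in> Ac" "psd (h * h)" "h * h ~= 0"
  using h(1,3) psd_sq[OF h(2)] by (auto intro: Ac_mult)
 obtain n w where w: "\<forall>i<n::nat. w i \<in> Ac" "psd ((\<Sum>i<n. adj (w i) * (h * h) * w i) - p)"
  using full[OF hh] by blast
 have "psd (k * ((\<Sum>i<n. adj (w i) * (h * h) * w i) - p) * k)" using psd_conj[OF w(2), of k] k by simp
 also have "k * ((\<Sum>i<n. adj (w i) * (h * h) * w i) - p) * k
   = (\<Sum>i<n. (k * adj (w i) * h) * (h * w i * k)) - k * k"
  unfolding right_diff_distrib left_diff_distrib sum_distrib_left sum_distrib_right Ac_right[OF k(1)]
  by (simp only: mult.assoc)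
 also have "(\<Sum>i<n. (k * adj (w i) * h) * (h * w i * k)) = 0" using w 0 by (intro sum.neutral) auto
 finally have "k * k = 0" using psd_antisym[OF psd_sq[OF k(2)]] by simp
 then show False using norm_sa_sq[OF k(2)] k(3) by simp
qed

text \<open>Simplicity transports a bump below \<open>h\<close> isometrically under \<open>h'\<close>.\<close>

lemma move:
 assumes h: "h \<in> Ac" "psd h" "norm h = 1" and h': "h' \<in> Ac" "psd h'" "norm h' = 1"
  and \<eta>: "0 < \<eta>" "\<eta> <= 1"
 shows "\<exists>w k. w \<in> Ac \<and> k \<in> Ac \<and> psd k \<and> norm k = 1 \<and> norm w = 1 \<and> norm ((1 - h) * k) <= \<eta>
  \<and> norm ((1 - h') * w) <= \<eta> \<and> norm ((1 - adj w * w) * k) <= \<eta>"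
proof -
 define \<delta> where "\<delta> = \<eta> / 2"
 have \<delta>: "0 < \<delta>" "\<delta> <= 1" using \<eta> by (auto simp: \<delta>_def)
 define kh kh' where "kh = cfc (tent \<delta>) h" "kh' = cfc (tent \<delta>) h'"
 have kh: "kh \<in> Ac" "psd kh" "norm kh = 1" "kh' \<in> Ac" "psd kh'" "norm kh' = 1"
  unfolding kh_kh'_def using h h' \<delta> by (auto simp: Ac_tent psd_tent norm_tent)
 then obtain z where z: "z \<in> Ac" "kh' * z * kh ~= 0"
  using mult_nonzero[of kh' kh] psd_sa by fastforce
 \<comment> \<open>The tents on both sides put the range of \<open>y\<close> near the top of
   \<open>h'\<close> and its source near the top of \<open>h\<close>; only the norm is adjusted
   afterwards.\<close>
 define y where "y = kh' * z * kh"
 define w where "w = (1 / norm y) *\<^sub>R y"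
 have w: "w \<in> Ac" "norm w = 1" using z kh unfolding w_def y_def by auto
 have wl: "w = kh' * ((1 / norm y) *\<^sub>R (z * kh))" by (simp add: w_def y_def mult.assoc)
 have "norm ((1 - h') * w) <= \<delta> * norm w"
  unfolding wl kh_kh'_def by (rule norm_tent_mult[OF h'(2,3) \<delta>])
 then have 1: "norm ((1 - h') * w) <= \<eta>" using w \<delta> by (simp add: \<delta>_def)
 have wr: "adj w = kh * ((1 / norm y) *\<^sub>R (adj z * kh'))"
  using kh by (simp add: w_def y_def mult.assoc adj_mult adj_scaleR psd_sa)
 have "norm ((1 - h) * adj w) <= \<delta> * norm (adj w)"
  unfolding wr kh_kh'_def by (rule norm_tent_mult[OF h(2,3) \<delta>])
 then have 2: "norm ((1 - h) * adj w) <= \<delta>" using w by simp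
 define b where "b = adj w * w"
 have b: "psd b" "norm b = 1" "b \<in> Ac" using w by (auto simp: b_def psd_adj_mult norm_adj_mult)
 \<comment> \<open>At the top of \<open>adj w * w\<close> the element \<open>w\<close> acts almost
   isometrically.\<close>
 define k where "k = cfc (tent \<delta>) b"
 have k: "psd k" "norm k = 1" "k \<in> Ac" "norm ((1 - b) * k) <= \<delta>"
  unfolding k_def using b \<delta> by (auto simp: Ac_tent psd_tent norm_tent norm_one_minus_tent)
 have "norm ((1 - h) * b) <= \<delta> * 1"
  unfolding b_def mult.assoc[symmetric] using 2 w \<delta> by (intro order_trans[OF norm_mult_ineq]) simp
 then have "norm ((1 - h) * k) <= \<delta> + \<delta>"
  using near_trans[of h k b \<delta> \<delta>] h k by simp
 then show ?thesis using w k 1 \<delta> \<eta> unfolding b_def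
  by (rule_tac exI[of _ w], rule_tac exI[of _ k]) (auto simp: \<delta>_def)
qed

text \<open>This fails for full matrix algebras: a norm-one positive \<open>n\<close> by
  \<open>n\<close> matrix has normalised trace at least \<open>1 / n\<close>.\<close>

definition small :: bool where
 "small \<longleftrightarrow> (\<forall>\<delta>>0. \<exists>b\<in>Ac. psd b \<and> norm b = 1 \<and> (\<forall>t\<in>T. t b <= \<delta>))"

text \<open>An element \<open>b\<close> of tiny trace is carried under \<open>k\<close>: fullness
  gives a \<open>w i\<close> for which \<open>kd * w i * b\<close> has norm bounded below, and the
  trace property transfers the smallness from source to range.\<close>

lemma small_below:
 assumes small and k: "k \<in> Ac" "psd k" "norm k = 1" and \<eta>: "0 < \<eta>" "\<eta> <= 1" and "\<delta> > 0"
 shows "\<exists>l\<in>Ac. psd l \<and> norm l = 1 \<and> norm ((1 - k) * l) <= \<eta> \<and> (\<forall>t\<in>T. t (l * l) <= \<delta>)"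
proof -
 define \<theta> where "\<theta> = \<eta> / 2"
 have \<theta>: "0 < \<theta>" "\<theta> <= 1" using \<eta> by (auto simp: \<theta>_def)
 define kd where "kd = cfc (tent \<theta>) k"
 have kd: "kd \<in> Ac" "psd kd" "norm kd = 1" unfolding kd_def using k \<theta> by (auto simp: Ac_tent psd_tent norm_tent)
 have akd: "adj kd = kd" using kd psd_sa by blast
 have nk: "norm (kd * kd) = norm kd ^ 2" by (rule norm_sa_sq[OF akd])
 have kk: "kd * kd \<in> Ac" "psd (kd * kd)" "kd * kd ~= 0" using kd nk psd_sq[OF akd] by auto
 obtain n w where w: "\<forall>i<n::nat. w i \<in> Ac" "psd ((\<Sum>i<n. adj (w i) * (kd * kd) * w i) - p)"
  using full[OF kk] by blast
 \<comment> \<open>If all \<open>n\<close> norms squared were below \<open>1 / (n + 1)\<close>,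
   their sum would stay below 1, which is \<open>norm (b * b)\<close>. \<open>W\<close> bounds the
   norms squared of the \<open>w i\<close>; the trace bound asked of \<open>b\<close> is divided by
   \<open>M * W\<close>.\<close>
 define M where "M = real n + 1"
 define W where "W = (\<Sum>i<n. norm (w i) ^ 2) + 1"
 have MW: "M > 0" "W > 0" by (auto simp: M_def W_def add_nonneg_pos sum_nonneg)
 obtain b where b: "b \<in> Ac" "psd b" "norm b = 1" "\<forall>t\<in>T. t b <= \<delta> / (M * W)"
  using \<open>small\<close> \<open>\<delta> > 0\<close> MW unfolding small_def by (metis divide_pos_pos mult_pos_pos)
 have ab: "adj b = b" using b psd_sa by blast
 have "\<exists>i<n. norm (kd * w i * b) ^ 2 >= 1 / M"
 proof (rule ccontr)
  assume "\<not> ?thesis"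
  then have lt: "norm (kd * w i * b) ^ 2 < 1 / M" if "i < n" for i using that by force
  have "psd (b * ((\<Sum>i<n. adj (w i) * (kd * kd) * w i) - p) * b)" using psd_conj[OF w(2), of b] ab by simp
  also have "b * ((\<Sum>i<n. adj (w i) * (kd * kd) * w i) - p) * b
    = (\<Sum>i<n. adj (kd * w i * b) * (kd * w i * b)) - b * b"
   using b by (simp add: algebra_simps sum_distrib_left sum_distrib_right Ac_left adj_mult ab akd)
  finally have "norm (b * b) <= norm (\<Sum>i<n. adj (kd * w i * b) * (kd * w i * b))"
   using psd_norm_mono psd_sq[OF ab] by blast
  also have "... <= (\<Sum>i<n. norm (kd * w i * b) ^ 2)"
   by (rule order_trans[OF norm_sum]) (simp add: norm_adj_mult)
  also have "... <= (\<Sum>i<n. 1 / M)" by (intro sum_mono) (use lt in force)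
  also have "... < 1" by (simp add: M_def)
  finally show False using b by (simp add: norm_sa_sq ab)
 qed
 then obtain i where i: "i < n" "norm (kd * w i * b) ^ 2 >= 1 / M" by blast
 define y where "y = kd * w i * b"
 have wi: "w i \<in> Ac" using w i by blast
 have y: "y \<in> Ac" "norm y ^ 2 >= 1 / M" using wi kd b i by (auto simp: y_def)
 then have yn: "norm y > 0" using MW by (metis divide_pos_pos less_le_trans zero_less_one norm_ge_zero order_le_less power_zero_numeral not_less)
 define v where "v = (1 / norm y) *\<^sub>R y"
 have v: "v \<in> Ac" "norm v = 1" using y yn by (auto simp: v_def)
 have vl: "v = kd * ((1 / norm y) *\<^sub>R (w i * b))" by (simp add: v_def y_def mult.assoc)
 have "norm ((1 - k) * v) <= \<theta> * norm v" unfolding vl kd_def by (rule norm_tent_mult[OF k(2,3) \<theta>])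
 then have nv: "norm ((1 - k) * v) <= \<theta>" using v by simp
 define c where "c = v * adj v"
 have c: "psd c" "norm c = 1" "c \<in> Ac" using v by (auto simp: c_def psd_mult_adj norm_mult_adj)
 define l where "l = cfc (tent \<theta>) c"
 have l: "psd l" "norm l = 1" "l \<in> Ac" "norm ((1 - c) * l) <= \<theta>" "psd (c - l)"
  unfolding l_def using c \<theta> by (auto simp: Ac_tent psd_tent norm_tent norm_one_minus_tent tent_le_id)
 have "norm ((1 - k) * c) <= \<theta> * 1"
  unfolding c_def mult.assoc[symmetric] using nv v \<theta> by (intro order_trans[OF norm_mult_ineq]) simp
 then have near: "norm ((1 - k) * l) <= \<eta>"
  using near_trans[of k l c \<theta> \<theta>] k l by (simp add: \<theta>_def)
 have "t (l * l) <= \<delta>" if t: "t \<in> T" for t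
 proof -
  have sub: "t (x * x) <= t x" if x: "x \<in> Ac" "psd x" "norm x = 1" for x
  proof -
   have "psd (x * (1 - x))" using psd_upper[OF x(2), of 1] x by (intro psd_mult) (auto simp: algebra_simps)
   then have "psd (x - x * x)" by (simp add: algebra_simps)
   then show ?thesis using x by (intro T_mono t) auto
  qed
  have "t (l * l) <= t l" using l sub by blast
  also have "t l <= t c" using l c by (intro T_mono t) auto
  also have "t c = t (adj v * v)" unfolding c_def using v by (intro T_comm t) auto
  also have "adj v * v = (1 / norm y ^ 2) *\<^sub>R (adj y * y)" by (simp add: v_def adj_scaleR power2_eq_square)
  also have "t ... = (1 / norm y ^ 2) * t (adj y * y)" using y by (intro T_scale t) auto
  also have "... <= M * (W * (\<delta> / (M * W)))"
  proof (rule mult_mono)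
   show "1 / norm y ^ 2 <= M" using y(2) MW yn by (simp add: field_simps)
   have "norm (kd * w i) <= norm (w i)" using norm_mult_ineq[of kd "w i"] kd by simp
   then have "norm (kd * w i) ^ 2 <= norm (w i) ^ 2" by (intro power_mono) auto
   also have "... <= (\<Sum>i<n. norm (w i) ^ 2)" using i by (intro member_le_sum) auto
   finally have 1: "norm (kd * w i) ^ 2 <= W" by (simp add: W_def)
   have 2: "t (adj b * b) <= \<delta> / (M * W)" using sub[OF b(1-3)] b(4) t ab by force
   have "t (adj y * y) <= norm (kd * w i) ^ 2 * t (adj b * b)"
    unfolding y_def using kd wi b by (intro T_conj_le t) auto
   also have "... <= W * (\<delta> / (M * W))"
    using 1 2 MW T_pos[OF t, of "adj b * b"] b by (intro mult_mono) (auto simp: psd_adj_mult)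
   finally show "t (adj y * y) <= W * (\<delta> / (M * W))" .
   show "0 <= t (adj y * y)" using T_pos[OF t, of "adj y * y"] y by (auto simp: psd_adj_mult)
  qed (use MW in auto)
  also have "... = \<delta>" using MW by simp
  finally show ?thesis .
 qed
 then show ?thesis using l near by blast
qed

text \<open>If \<open>kd * S * kd >= \<eta>^2 *\<^sub>R (kd * kd)\<close> held, traces would force
  \<open>t S >= \<eta>^2 * c\<close>, against the bound \<open>c * \<eta>^2 / 2\<close>. So the
  difference \<open>d\<close> has a nonzero negative part, and a bump built over it compresses
  \<open>S\<close> strongly.\<close>

lemma small_compression:
 assumes k: "k \<in> Ac" "psd k" "norm k = 1" and \<eta>: "0 < \<eta>" "\<eta> <= 1"
 shows "\<exists>\<delta>>0. \<forall>S\<in>Ac. psd S \<and> (\<forall>t\<in>T. t S <= \<delta>) -->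
  (\<exists>l\<in>Ac. psd l \<and> norm l = 1 \<and> norm ((1 - k) * l) <= \<eta> \<and> norm (l * S * l) <= \<eta>^2)"
proof -
 define kd where "kd = cfc (tent \<eta>) k"
 have kd: "kd \<in> Ac" "psd kd" "norm kd = 1" unfolding kd_def using k \<eta> by (auto simp: Ac_tent psd_tent norm_tent)
 have akd: "adj kd = kd" using kd psd_sa by blast
 have nk: "norm (kd * kd) = norm kd ^ 2" by (rule norm_sa_sq[OF akd])
 have kk: "kd * kd \<in> Ac" "psd (kd * kd)" "kd * kd ~= 0" using kd nk psd_sq[OF akd] by auto
 obtain c where c: "c > 0" "\<forall>t\<in>T. t (kd * kd) >= c" using T_full_lower[OF kk] by blast
 show ?thesis
 proof (intro exI[of _ "c * \<eta>^2 / 2"] conjI ballI impI)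
  show "c * \<eta>^2 / 2 > 0" using c \<eta> by simp
  fix S assume S: "S \<in> Ac" and "psd S \<and> (\<forall>t\<in>T. t S <= c * \<eta>^2 / 2)"
  then have pS: "psd S" and tS: "\<forall>t\<in>T. t S <= c * \<eta>^2 / 2" by auto
  define d where "d = kd * S * kd - \<eta>^2 *\<^sub>R (kd * kd)"
  have d: "d \<in> Ac" "adj d = d" unfolding d_def using kd S akd
   by (auto simp: adj_diff adj_scaleR adj_mult psd_sa[OF pS] mult.assoc Ac_mult_left)
  obtain t where t: "t \<in> T" using T_ne by blast
  obtain r where r: "adj r = r" "r * r = S" "\<forall>z. z * S = S * z --> z * r = r * z" using psd_sqrt[OF pS] by blast
  have "p * r * (p * r) = p * (r * p) * r" by (simp only: mult.assoc)
  also have "... = p * p * (r * r)" unfolding pc[of r] by (simp only: mult.assoc)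
  finally have rr: "(p * r) * (p * r) = S" using r(2) S by (simp add: pp Ac_left)
  have ar: "adj (p * r) = p * r" by (simp add: adj_mult ap r(1) pc[of r])
  have rA: "p * r \<in> Ac" by (simp add: Ac_mult_left)
  have "t (kd * S * kd) = t (adj (p * r * kd) * (p * r * kd))"
   unfolding adj_mult[of "p * r" kd] ar akd by (simp only: rr[symmetric] mult.assoc)
  also have "... = t ((p * r * kd) * adj (p * r * kd))" using rA kd by (intro T_comm t) auto
  also have "(p * r * kd) * adj (p * r * kd) = adj (kd * (p * r)) * (kd * (p * r))"
  proof -
   have x1: "adj (p * r * kd) = kd * (p * r)" unfolding adj_mult[of "p * r" kd] ar akd ..
   have x2: "adj (kd * (p * r)) = p * r * kd" unfolding adj_mult[of kd "p * r"] ar akd ..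
   show ?thesis unfolding x1 x2 ..
  qed
  also have "t ... <= norm kd ^ 2 * t (adj (p * r) * (p * r))" using rA kd by (intro T_conj_le t) auto
  also have "... = t S" by (simp add: kd ar rr)
  finally have "t d <= c * \<eta>^2 / 2 - \<eta>^2 * c"
  proof -
   assume a: "t (kd * S * kd) <= t S"
   have "t d = t (kd * S * kd) - \<eta>^2 * t (kd * kd)"
    unfolding d_def using T_diff[OF t, of "kd * S * kd" "\<eta>^2 *\<^sub>R (kd * kd)"] T_scale[OF t kk(1)] kd S kk by auto
   moreover have "\<eta>^2 * c <= \<eta>^2 * t (kd * kd)" using c t by (intro mult_left_mono) auto
   moreover have "t S <= c * \<eta>^2 / 2" using tS t by blast
   ultimately show ?thesis using a by (simp add: mult.commute)
  qed
  moreover have "c * \<eta>^2 > 0" using c \<eta> by simp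
  ultimately have "t d < 0" by simp
  then have nd: "\<not> psd d" using T_pos[OF t d(1)] by fastforce
  let ?f = "%t::real. max 0 (- t)"
  have f: "continuous_on UNIV ?f" and f0: "?f 0 = 0" by (auto intro!: continuous_intros)
  define h where "h = cfc ?f d"
  have h: "h \<in> Ac" "adj h = h" unfolding h_def using Ac_cfc[OF f d(2) f0 d(1)] adj_cfc[OF f d(2)] by auto
  note lu = psd_norm_bounds[OF d(2)]
  have hdh: "h * d * h = cfc (%t. ?f t * t * ?f t) d"
   unfolding h_def using f d by (simp add: cfc_mult cfc_id continuous_on_mult)
  have "psd (cfc (%t. - (?f t * t * ?f t)) d)"
  proof (rule cfc_nonneg[OF _ lu])
   show "0 <= - (?f t * t * ?f t)" for t by (cases "t <= 0") (auto simp: mult_nonneg_nonpos mult_nonpos_nonpos)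
  qed (intro continuous_intros)
  then have neg: "psd (- (h * d * h))" using f d by (simp add: hdh cfc_uminus continuous_on_mult)
  have kh: "kd * h ~= 0"
  proof
   assume "kd * h = 0"
   then have "d * h = 0" by (simp add: d_def left_diff_distrib mult.assoc)
   moreover have "h * h = - (d * h)"
   proof -
    have "h * h = cfc (%t. ?f t * ?f t) d" unfolding h_def using f d by (simp add: cfc_mult)
    also have "(%t. ?f t * ?f t) = (%t. - (t * ?f t))" by (auto simp: max_def)
    also have "cfc ... d = - (d * h)" unfolding h_def using f d
     by (subst cfc_uminus) (auto intro!: continuous_intros simp: cfc_mult cfc_id)
    finally show ?thesis .
   qed
   ultimately have "h * h = 0" by simp
   then have "h = 0" using norm_sa_sq[OF h(2)] by simp
   moreover have "d = cfc (%t. max 0 t - ?f t) d"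
    by (subst cfc_id[OF d(2), symmetric], rule arg_cong[where f = "%f. cfc f d"]) (auto simp: max_def)
   moreover have "cfc (%t. max 0 t - ?f t) d = cfc (max 0) d - h"
    unfolding h_def by (intro cfc_diff d continuous_intros)
   moreover have "psd (cfc (max 0) d)"
    by (rule cfc_nonneg[OF _ lu]) (auto intro!: continuous_intros)
   ultimately show False using nd by simp
  qed
  \<comment> \<open>Positive and under \<open>k\<close>, since it starts with \<open>kd\<close>.
    From \<open>h * d * h <= 0\<close> one gets
    \<open>m * S * m <= \<eta>^2 *\<^sub>R (m * m)\<close>.\<close>
  define m where "m = (kd * h) * adj (kd * h)"
  have m: "m \<in> Ac" "psd m" "norm m = norm (kd * h) ^ 2"
   unfolding m_def using kd by (simp_all only: psd_mult_adj norm_mult_adj Ac_mult_left)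
  have am: "adj m = m" by (rule psd_sa[OF m(2)])
  have mp: "norm m > 0" using kh m by simp
  have "psd (- ((kd * h) * (h * d * h) * adj (kd * h)))"
   using psd_conj[OF neg, of "adj (kd * h)"] by simp
  moreover have "(kd * h) * (h * d * h) * adj (kd * h) = m * S * m - \<eta>^2 *\<^sub>R (m * m)"
   by (simp add: m_def d_def adj_mult akd h right_diff_distrib left_diff_distrib mult.assoc)
  ultimately have ms: "psd (\<eta>^2 *\<^sub>R (m * m) - m * S * m)" by simp
  define l where "l = (1 / norm m) *\<^sub>R m"
  have l: "l \<in> Ac" "psd l" "norm l = 1" using m mp unfolding l_def by (auto intro: psd_scaleR)
  have al: "adj l = l" using l psd_sa by blast
  have "norm (m * S * m) <= norm (\<eta>^2 *\<^sub>R (m * m))"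
   using psd_norm_mono[OF _ ms] psd_conj[OF pS, of m] am by simp
  also have "... = \<eta>^2 * norm m ^ 2" by (simp add: norm_sa_sq am)
  finally have "norm (l * S * l) <= \<eta>^2" using mp by (simp add: l_def field_simps power2_eq_square)
  moreover have "norm ((1 - k) * l) <= \<eta>"
  proof -
   have "norm ((1 - k) * (kd * h)) <= \<eta> * norm (kd * h)" unfolding kd_def by (rule norm_tent_mult[OF k(2,3) \<eta>])
   then have "norm ((1 - k) * (kd * h)) * norm (adj (kd * h)) <= \<eta> * norm m"
    unfolding m norm_adj power2_eq_square by (metis mult.assoc mult_right_mono norm_ge_zero)
   then have "norm ((1 - k) * m) <= \<eta> * norm m"
    unfolding m_def mult.assoc[symmetric, of "1 - k"] using norm_mult_ineq order_trans by blast
   moreover have "(1 - k) * l = (1 / norm m) *\<^sub>R ((1 - k) * m)" by (simp add: l_def)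
   ultimately show ?thesis using mp by (simp only: norm_scaleR) (simp add: field_simps)
  qed
  ultimately show "\<exists>l\<in>Ac. psd l \<and> norm l = 1 \<and> norm ((1 - k) * l) <= \<eta> \<and> norm (l * S * l) <= \<eta>^2"
   using l by blast
 qed
qed

text \<open>\<open>k'\<close> is taken with so small a trace that
  \<open>S = \<Sum> (y * k') * adj (y * k')\<close> also has small traces; then some
  \<open>k\<close> under \<open>h\<close> compresses \<open>S\<close>, and
  \<open>norm (k * y * k') ^ 2 <= norm (k * S * k)\<close> for every \<open>y\<close>.\<close>

lemma orthogonal_bumps:
 assumes small and h: "h \<in> Ac" "psd h" "norm h = 1" and h': "h' \<in> Ac" "psd h'" "norm h' = 1"
  and \<eta>: "0 < \<eta>" "\<eta> <= 1" and Y: "finite Y" "Y \<subseteq> Ac"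
 shows "\<exists>k\<in>Ac. \<exists>k'\<in>Ac. psd k \<and> norm k = 1 \<and> psd k' \<and> norm k' = 1 \<and> norm ((1 - h) * k) <= \<eta> \<and>
  norm ((1 - h') * k') <= \<eta> \<and> (\<forall>y\<in>Y. norm (k * y * k') <= \<eta>)"
proof -
 obtain \<delta> where \<delta>: "\<delta> > 0" and comp: "\<forall>S\<in>Ac. psd S \<and> (\<forall>t\<in>T. t S <= \<delta>) -->
  (\<exists>l\<in>Ac. psd l \<and> norm l = 1 \<and> norm ((1 - h) * l) <= \<eta> \<and> norm (l * S * l) <= \<eta>^2)"
  using small_compression[OF h \<eta>] by blast
 define M where "M = (\<Sum>y\<in>Y. norm y ^ 2) + 1"
 have M: "M > 0" by (simp add: M_def add_nonneg_pos sum_nonneg)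
 obtain k' where k': "k' \<in> Ac" "psd k'" "norm k' = 1" "norm ((1 - h') * k') <= \<eta>" "\<forall>t\<in>T. t (k' * k') <= \<delta> / M"
  using small_below[OF assms(1) h' \<eta>, of "\<delta> / M"] \<delta> M by auto
 have ak': "adj k' = k'" using k' psd_sa by blast
 define S where "S = (\<Sum>y\<in>Y. (y * k') * adj (y * k'))"
 have SA: "S \<in> Ac" unfolding S_def using k' by (intro Ac_sum Ac_mult_right Ac_adj)
 have pS: "psd S" unfolding S_def by (intro psd_sum psd_mult_adj)
 have "t S <= \<delta>" if t: "t \<in> T" for t
 proof -
  have "t S = (\<Sum>y\<in>Y. t ((y * k') * adj (y * k')))" unfolding S_def
   using k' by (intro T_sum t Ac_mult_right Ac_adj)
  also have "... <= (\<Sum>y\<in>Y. norm y ^ 2 * (\<delta> / M))"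
  proof (rule sum_mono)
   fix y assume "y \<in> Y"
   then have y: "y \<in> Ac" using Y by blast
   have "t ((y * k') * adj (y * k')) = t (adj (y * k') * (y * k'))" using y k' by (intro T_comm t) auto
   also have "... <= norm y ^ 2 * t (adj k' * k')" using y k' by (intro T_conj_le t) auto
   also have "... <= norm y ^ 2 * (\<delta> / M)" using k'(5) t ak' by (intro mult_left_mono) auto
   finally show "t ((y * k') * adj (y * k')) <= norm y ^ 2 * (\<delta> / M)" .
  qed
  also have "... = (M - 1) * (\<delta> / M)" unfolding sum_distrib_right[symmetric] by (simp add: M_def)
  also have "... <= \<delta>" using M \<delta> by (simp add: field_simps)
  finally show ?thesis .
 qed
 then obtain k where k: "k \<in> Ac" "psd k" "norm k = 1" "norm ((1 - h) * k) <= \<eta>" "norm (k * S * k) <= \<eta>^2"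
  using comp SA pS by blast
 have ak: "adj k = k" using k psd_sa by blast
 have "norm (k * y * k') <= \<eta>" if y: "y \<in> Y" for y
 proof -
  have "psd (S - (y * k') * adj (y * k'))"
   unfolding S_def using Y(1) y by (simp add: sum.remove psd_sum psd_mult_adj)
  then have "psd (adj k * (S - (y * k') * adj (y * k')) * k)" by (rule psd_conj)
  then have "psd (k * S * k - (k * y * k') * adj (k * y * k'))"
   by (simp add: ak adj_mult right_diff_distrib left_diff_distrib mult.assoc)
  then have "norm (k * y * k') ^ 2 <= norm (k * S * k)"
   using psd_norm_mono[OF psd_mult_adj] norm_mult_adj by metis
  then have "norm (k * y * k') ^ 2 <= \<eta>^2" using k by simp
  then show ?thesis using \<eta> by (simp add: power2_le_iff_abs_le)
 qed
 then show ?thesis using k k' by blast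
qed

section \<open>Excision of pure states by minimising compressed norms\<close>

lemma excise_one:
 assumes c: "c \<in> Ac" "psd (c - p)" and h: "h \<in> Ac" and k: "k \<in> Ac" "psd k" "norm k = 1" "h * k = k"
  and "\<epsilon> > 0"
 shows "\<exists>k' \<mu>. k' \<in> Ac \<and> psd k' \<and> norm k' = 1 \<and> h * k' = k' \<and> norm (k' * (c - of_real \<mu>) * k') <= \<epsilon>"
proof -
 have psc: "psd c" using psd_add[OF c(2) psd_p] by simp
 \<comment> \<open>The infimum \<open>\<Lambda>\<close> is the least norm that bumps fixed by
   \<open>h\<close> can leave of \<open>c\<close>. Near the minimum \<open>c\<close> cannot be
   compressed much further, so on the top of a nearly optimal compression it acts almost like a
   scalar. The hypothesis \<open>c >= p\<close> gives \<open>\<Lambda> >= 1\<close>, which makes the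
   relative errors harmless.\<close>
 define X where "X = {norm (k * c * k) |k. k \<in> Ac \<and> psd k \<and> norm k = 1 \<and> h * k = k}"
 define \<Lambda> where "\<Lambda> = Inf X"
 have X1: "1 <= x" if xX: "x \<in> X" for x
 proof -
  obtain k where k: "x = norm (k * c * k)" "k \<in> Ac" "psd k" "norm k = 1" using xX unfolding X_def by blast
  have ak: "adj k = k" using k psd_sa by blast
  have "psd (k * (c - p) * k)" using psd_conj[OF c(2), of k] ak by simp
  then have "psd (k * c * k - k * k)" by (simp add: algebra_simps Ac_left k)
  then have "norm (k * k) <= x" unfolding k(1) by (rule psd_norm_mono[OF psd_sq[OF ak]])
  then show ?thesis using k ak by (simp add: norm_sa_sq)
 qed
 have Xne: "X ~= {}" using k by (auto simp: X_def)
 have bdd: "bdd_below X" using X1 by (rule bdd_belowI)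
 have \<Lambda>1: "\<Lambda> >= 1" unfolding \<Lambda>_def by (rule cInf_greatest[OF Xne X1])
 \<comment> \<open>The errors at the end are two of \<open>2 * sqrt \<delta> * norm c\<close> and
   one of \<open>\<delta> * norm c\<close>, together at most
   \<open>5 * sqrt \<delta> * norm c\<close>.\<close>
 define \<delta> where "\<delta> = min (1/2) ((\<epsilon> / (5 * (norm c + 1)))^2)"
 have nc: "5 * (norm c + 1) > 0" by (intro mult_pos_pos add_nonneg_pos) auto
 have \<delta>: "0 < \<delta>" "\<delta> <= 1" "\<delta> <= 1/2" using zero_less_power[OF divide_pos_pos[OF \<open>\<epsilon> > 0\<close> nc], of 2]
  unfolding \<delta>_def by linarith+
 have s\<delta>: "5 * sqrt \<delta> * norm c <= \<epsilon>"
 proof -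
  have "sqrt \<delta> <= sqrt ((\<epsilon> / (5 * (norm c + 1)))^2)" by (rule real_sqrt_le_mono) (simp add: \<delta>_def)
  also have "... = \<epsilon> / (5 * (norm c + 1))" using \<open>\<epsilon> > 0\<close> nc by (simp add: abs_of_nonneg)
  finally have "5 * sqrt \<delta> * (norm c + 1) <= \<epsilon>" using nc by (simp add: pos_le_divide_eq mult_ac)
  moreover have "5 * sqrt \<delta> * norm c <= 5 * sqrt \<delta> * (norm c + 1)" using \<delta> by (intro mult_left_mono) auto
  ultimately show ?thesis by linarith
 qed
 have "\<exists>x\<in>X. x < \<Lambda> + \<delta>" unfolding \<Lambda>_def by (rule cInf_lessD[OF Xne]) (use \<delta> in simp)
 then obtain k where k: "k \<in> Ac" "psd k" "norm k = 1" "h * k = k" "norm (k * c * k) < \<Lambda> + \<delta>"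
  by (auto simp: X_def)
 have ak: "adj k = k" using k psd_sa by blast
 \<comment> \<open>\<open>k0 = k * l\<close> equals 1 where \<open>k >= 1 - \<delta>\<close>, so it
   is a unit for the tent \<open>k1\<close>; since \<open>l\<close> is bounded by
   \<open>1 / (1 - \<delta>)\<close>, the norm of \<open>k0 * c * k0\<close> exceeds
   \<open>\<Lambda>\<close> only slightly.\<close>
 let ?l = "%t::real. 1 / max t (1 - \<delta>)"
 have cl: "continuous_on UNIV ?l" using \<delta> by (intro continuous_intros) (auto simp: max_def)
 have ct: "continuous_on UNIV (%t. t * ?l t)" by (intro continuous_on_mult continuous_on_id cl)
 define l where "l = cfc ?l k"
 define k0 where "k0 = k * l"
 define k1 where "k1 = cfc (tent \<delta>) k"
 have k0: "k0 = cfc (%t. t * ?l t) k" unfolding k0_def l_def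
  using cfc_mult[OF continuous_on_id cl ak] by (simp add: cfc_id ak)
 have al: "adj l = l" unfolding l_def by (rule adj_cfc[OF cl ak])
 have ak0: "adj k0 = k0" unfolding k0 by (rule adj_cfc[OF ct ak])
 have nl: "norm l <= 1 / (1 - \<delta>)" unfolding l_def
  by (rule cfc_psd_norm_le[OF cl k(2)]) (use \<delta> in \<open>auto simp: abs_of_nonneg max_def intro!: divide_left_mono\<close>)
 have k1: "k1 \<in> Ac" "psd k1" "norm k1 = 1" unfolding k1_def
  using k \<delta> by (auto simp: Ac_tent psd_tent norm_tent)
 have ak1: "adj k1 = k1" using k1 psd_sa by blast
 have hk1: "h * k1 = k1" unfolding k1_def
  by (rule cfc_unit_left[OF continuous_tent ak tent_0 k(4)]) (use \<delta> in auto)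
 have k01: "k0 * k1 = k1"
 proof -
  have "k0 * k1 = cfc (%t. t * ?l t * tent \<delta> t) k" unfolding k0 k1_def
   by (rule cfc_mult[OF ct continuous_tent ak, symmetric])
  also have "... = cfc (tent \<delta>) k"
   by (rule cfc_psd_cong[OF continuous_on_mult[OF ct continuous_tent] continuous_tent k(2)])
    (use \<delta> in \<open>auto simp: max_def tent_zero_iff\<close>)
  finally show ?thesis by (simp add: k1_def)
 qed
 have k10: "k1 * k0 = k1" using arg_cong[OF k01, of adj] by (simp add: adj_mult ak0 ak1)
 define b where "b = k1 * c * k1"
 define \<Lambda>1 where "\<Lambda>1 = norm b"
 have b: "b \<in> Ac" "psd b" unfolding b_def using k1 c psd_conj[OF psc, of k1] ak1 by auto
 have "\<Lambda>1 \<in> X" unfolding X_def \<Lambda>1_def b_def using k1 hk1 by blast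
 then have \<Lambda>\<Lambda>: "\<Lambda> <= \<Lambda>1" unfolding \<Lambda>_def using bdd by (rule cInf_lower)
 then have \<Lambda>p: "\<Lambda>1 > 0" using \<Lambda>1 by linarith
 have \<Lambda>c: "\<Lambda>1 <= norm c"
  unfolding \<Lambda>1_def b_def using norm_mult_ineq[of "k1 * c" k1] norm_mult_ineq[of k1 c] k1 by simp
 define b' where "b' = (1 / \<Lambda>1) *\<^sub>R b"
 have b': "b' \<in> Ac" "psd b'" "norm b' = 1" unfolding b'_def using b \<Lambda>p by (auto intro: psd_scaleR simp: \<Lambda>1_def)
 define k' where "k' = cfc (tent \<delta>) b'"
 have k': "k' \<in> Ac" "psd k'" "norm k' = 1" "norm ((1 - b') * k') <= \<delta>" unfolding k'_def
  using b' \<delta> by (auto simp: Ac_tent psd_tent norm_tent norm_one_minus_tent)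
 have ak': "adj k' = k'" using k' psd_sa by blast
 have hk': "h * k' = k'" unfolding k'_def
  by (rule cfc_unit_left[OF continuous_tent psd_sa[OF b'(2)] tent_0])
   (use \<delta> hk1 in \<open>auto simp: b'_def b_def simp flip: mult.assoc\<close>)
 have kk'k': "norm (k' * k') = 1" using norm_sa_sq[OF ak'] k' by simp
 have 1: "norm (k' * b * k' - \<Lambda>1 *\<^sub>R (k' * k')) <= \<delta> * norm c"
 proof -
  have "k' * b * k' - \<Lambda>1 *\<^sub>R (k' * k') = - (\<Lambda>1 *\<^sub>R (k' * ((1 - b') * k')))"
   using \<Lambda>p by (simp add: b'_def algebra_simps)
  also have "norm ... <= \<Lambda>1 * (1 * \<delta>)"
   using k' \<Lambda>p norm_mult_ineq[of k' "(1 - b') * k'"] by (simp add: mult_left_mono)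
  also have "... <= norm c * \<delta>" using \<Lambda>c \<delta> by (simp add: mult_right_mono)
  finally show ?thesis by (simp add: mult.commute)
 qed
 have 2: "psd (k' * b' * k' - (1 - \<delta>) *\<^sub>R (k' * k'))"
 proof -
  have sb: "adj b' = b'" using b' psd_sa by blast
  have "psd (cfc (%t. tent \<delta> t * t * tent \<delta> t) b' - cfc (%t. (1 - \<delta>) * (tent \<delta> t * tent \<delta> t)) b')"
  proof (rule cfc_psd_mono[OF _ _ b'(2)])
   fix t
   show "(1 - \<delta>) * (tent \<delta> t * tent \<delta> t) <= tent \<delta> t * t * tent \<delta> t"
   proof (cases "t <= 1 - \<delta>")
    case False
    then have "(1 - \<delta>) * (tent \<delta> t)^2 <= t * (tent \<delta> t)^2" by (intro mult_right_mono) auto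
    then show ?thesis by (simp add: power2_eq_square mult_ac)
   qed (simp add: tent_zero_iff \<delta>)
  qed (intro continuous_intros continuous_tent)+
  then show ?thesis unfolding k'_def using continuous_tent sb
   by (simp add: cfc_scale cfc_mult cfc_id continuous_on_mult)
 qed
 define U where "U = (\<Lambda> + \<delta>) / (1 - \<delta>)^2"
 have U: "norm (k0 * c * k0) <= U"
 proof -
  have "k0 * c * k0 = l * (k * c * k) * l"
  proof -
   have "k0 = l * k" using arg_cong[OF k0_def, of adj] by (simp add: ak0 adj_mult al ak)
   then have "k0 * c * k0 = (l * k) * c * (k * l)" using k0_def by metis
   then show ?thesis by (simp add: mult.assoc)
  qed
  also have "norm ... <= (1 / (1 - \<delta>)) * (\<Lambda> + \<delta>) * (1 / (1 - \<delta>))"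
  proof -
   have "norm (l * (k * c * k)) <= (1 / (1 - \<delta>)) * (\<Lambda> + \<delta>)"
    using nl k(5) \<delta> by (intro order_trans[OF norm_mult_ineq[of l "k * c * k"]] mult_mono) auto
   then show ?thesis using nl \<delta> \<Lambda>1
    by (intro order_trans[OF norm_mult_ineq[of "l * (k * c * k)" l]] mult_mono) auto
  qed
  finally show ?thesis by (simp add: U_def power2_eq_square)
 qed
 have Up: "U > 0" using \<Lambda>1 \<delta> by (auto simp: U_def intro!: divide_pos_pos)
 \<comment> \<open>An upper bound for \<open>k' * b * k'\<close> by \<open>k1 * k1\<close>. With the
   lower bound \<open>\<Lambda>1 * (1 - \<delta>)\<close> from 2 it forces \<open>k1 * k1\<close> to
   be at least \<open>\<rho>\<close>, almost 1, on \<open>k'\<close>.\<close>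
 have 3: "psd (U *\<^sub>R (k' * (k1 * k1) * k') - k' * b * k')"
 proof -
  have "psd (of_real U - k0 * c * k0)"
   by (rule psd_norm_minus[OF _ U]) (simp add: adj_mult ak0 psd_sa[OF psc] mult.assoc)
  then have "psd (adj (k1 * k') * (of_real U - k0 * c * k0) * (k1 * k'))" by (rule psd_conj)
  also have "adj (k1 * k') * (of_real U - k0 * c * k0) * (k1 * k')
    = U *\<^sub>R (k' * (k1 * k1) * k') - k' * ((k1 * k0) * c * (k0 * k1)) * k'"
  proof -
   have x: "adj (k1 * k') = k' * k1" by (simp add: adj_mult ak1 ak')
   show ?thesis unfolding x right_diff_distrib left_diff_distrib mult_of_real_right
    by (simp only: mult.assoc mult_scaleR_left)
  qed
  finally show ?thesis unfolding k10 k01 b_def .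
 qed
 define \<rho> where "\<rho> = \<Lambda>1 * (1 - \<delta>) / U"
 have 4: "psd (k' * (k1 * k1) * k' - \<rho> *\<^sub>R (k' * k'))"
 proof -
  have "psd (\<Lambda>1 *\<^sub>R (k' * b' * k' - (1 - \<delta>) *\<^sub>R (k' * k')))" using 2 \<Lambda>p by (intro psd_scaleR) auto
  then have "psd (k' * b * k' - (\<Lambda>1 * (1 - \<delta>)) *\<^sub>R (k' * k'))" using \<Lambda>p by (simp add: b'_def algebra_simps)
  then have "psd (U *\<^sub>R (k' * (k1 * k1) * k') - (\<Lambda>1 * (1 - \<delta>)) *\<^sub>R (k' * k'))"
   using 3 by (rule psd_trans)
  then have "psd ((1/U) *\<^sub>R (U *\<^sub>R (k' * (k1 * k1) * k') - (\<Lambda>1 * (1 - \<delta>)) *\<^sub>R (k' * k')))"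
   using Up by (intro psd_scaleR) auto
  then show ?thesis using Up by (simp add: \<rho>_def scaleR_diff_right)
 qed
 have \<rho>: "1 - \<rho> <= 4 * \<delta>"
 proof -
  have "(1 - 3 * \<delta>) <= (1 - \<delta>)^3" using \<delta> by (simp add: power3_eq_cube algebra_simps mult_left_le)
  moreover have "(1 - 4 * \<delta>) * (1 + \<delta>) <= 1 - 3 * \<delta>" using \<delta> by (simp add: algebra_simps)
  ultimately have a: "1 - 4 * \<delta> <= (1 - \<delta>)^3 / (1 + \<delta>)" using \<delta> by (simp add: pos_le_divide_eq)
  have "1 / (1 + \<delta>) <= \<Lambda> / (\<Lambda> + \<delta>)" using \<Lambda>1 \<delta> by (simp add: field_simps)
  also have "... <= \<Lambda>1 / (\<Lambda> + \<delta>)" using \<Lambda>\<Lambda> \<Lambda>1 \<delta> by (simp add: divide_right_mono)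
  finally have "(1 - \<delta>)^3 * (1 / (1 + \<delta>)) <= (1 - \<delta>)^3 * (\<Lambda>1 / (\<Lambda> + \<delta>))"
   using \<delta> by (intro mult_left_mono) auto
  also have "... = \<rho>" using \<delta> by (simp add: \<rho>_def U_def power3_eq_cube power2_eq_square)
  finally show ?thesis using a by simp
 qed
 \<comment> \<open>Uses \<open>1 - k1 * k1 - (1 - k1) * (1 - k1) = 2 *\<^sub>R (k1 * (1 - k1)) >=
   0\<close>. Taking a square root of \<open>4 * \<delta>\<close> is what costs the
   \<open>sqrt \<delta>\<close>.\<close>
 have 5: "norm ((1 - k1) * k') <= 2 * sqrt \<delta>"
 proof -
  have "psd (k1 * (1 - k1))" using psd_upper[OF k1(2), of 1] k1 by (intro psd_mult) (auto simp: algebra_simps)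
  then have "psd (adj k' * (2 *\<^sub>R (k1 * (1 - k1))) * k')" by (intro psd_conj psd_scaleR) auto
  also have "adj k' * (2 *\<^sub>R (k1 * (1 - k1))) * k' = (k' * k' - k' * (k1 * k1) * k') - adj ((1 - k1) * k') * ((1 - k1) * k')"
   by (simp add: adj_mult adj_diff ak' ak1 algebra_simps scaleR_2)
  finally have "psd ((k' * k' - \<rho> *\<^sub>R (k' * k')) - adj ((1 - k1) * k') * ((1 - k1) * k'))"
   by (rule psd_trans) (use 4 in simp)
  then have "norm ((1 - k1) * k') ^ 2 <= norm (k' * k' - \<rho> *\<^sub>R (k' * k'))"
   using psd_norm_mono[OF psd_adj_mult] norm_adj_mult by metis
  also have "k' * k' - \<rho> *\<^sub>R (k' * k') = (1 - \<rho>) *\<^sub>R (k' * k')" by (simp add: scaleR_diff_left)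
  also have "norm ... <= 4 * \<delta>"
  proof -
   have "psd ((k' * k' - \<rho> *\<^sub>R (k' * k')) - adj ((1 - k1) * k') * ((1 - k1) * k'))" by fact
   then have "psd ((1 - \<rho>) *\<^sub>R (k' * k'))"
    using psd_add[OF _ psd_adj_mult[of "(1 - k1) * k'"]] by (fastforce simp: scaleR_diff_left)
   moreover have "psd ((4 * \<delta> - (1 - \<rho>)) *\<^sub>R (k' * k'))" using \<rho> by (intro psd_scaleR psd_sq ak') auto
   then have "psd ((4 * \<delta>) *\<^sub>R (k' * k') - (1 - \<rho>) *\<^sub>R (k' * k'))" by (simp add: scaleR_diff_left)
   ultimately have "norm ((1 - \<rho>) *\<^sub>R (k' * k')) <= norm ((4 * \<delta>) *\<^sub>R (k' * k'))" by (rule psd_norm_mono)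
   then show ?thesis using kk'k' \<delta> by simp
  qed
  finally have "norm ((1 - k1) * k') <= sqrt (4 * \<delta>)" by (rule real_le_rsqrt)
  then show ?thesis by (simp add: real_sqrt_mult)
 qed
 have "norm (k' * c * k' - k' * k1 * c * k1 * k') <= (2 * sqrt \<delta> + 2 * sqrt \<delta>) * norm c"
  using cut_diff[OF ak1, of k' k' c k1] k1 k' 5 ak'
  by (smt (verit) mult_right_mono norm_ge_zero)
 also have "k' * k1 * c * k1 * k' = k' * b * k'" by (simp add: b_def mult.assoc)
 finally have "norm ((k' * c * k' - k' * b * k') + (k' * b * k' - \<Lambda>1 *\<^sub>R (k' * k')))
   <= (2 * sqrt \<delta> + 2 * sqrt \<delta>) * norm c + \<delta> * norm c"
  using 1 by (intro order_trans[OF norm_triangle_ineq] add_mono) auto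
 also have "(k' * c * k' - k' * b * k') + (k' * b * k' - \<Lambda>1 *\<^sub>R (k' * k')) = k' * (c - of_real \<Lambda>1) * k'"
  by (simp add: algebra_simps mult_of_real_left)
 also have "(2 * sqrt \<delta> + 2 * sqrt \<delta>) * norm c + \<delta> * norm c <= 5 * sqrt \<delta> * norm c"
 proof -
  have "\<delta> <= sqrt \<delta>" using \<delta> by (metis real_le_rsqrt mult_left_le power2_eq_square less_imp_le)
  then have "\<delta> * norm c <= sqrt \<delta> * norm c" by (rule mult_right_mono) simp
  then show ?thesis by (simp add: algebra_simps)
 qed
 finally show ?thesis using k' hk' s\<delta> by (meson order_trans)
qed

text \<open>Adding \<open>norm c + 1\<close> times \<open>p\<close> brings \<open>c\<close> above
  \<open>p\<close>; on elements of the corner this shift is a scalar, which is subtracted from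
  \<open>\<mu>\<close>.\<close>

lemma excise_self_adjoint:
 assumes c: "c \<in> Ac" "adj c = c" and h: "h \<in> Ac" and k: "k \<in> Ac" "psd k" "norm k = 1" "h * k = k"
  and "\<epsilon> > 0"
 shows "\<exists>k' \<mu>. k' \<in> Ac \<and> psd k' \<and> norm k' = 1 \<and> h * k' = k' \<and> norm (k' * (c - of_real \<mu>) * k') <= \<epsilon>"
proof -
 let ?r = "norm c + 1"
 have "psd (norm c *\<^sub>R p - - c)" by (intro psd_corner_upper) (use c in auto)
 then have "psd (c + ?r *\<^sub>R p - p)" by (simp add: algebra_simps)
 moreover have "c + ?r *\<^sub>R p \<in> Ac" using c by (intro Ac_add Ac_scaleR Ac_p)
 ultimately obtain k' \<mu> where k': "k' \<in> Ac" "psd k'" "norm k' = 1" "h * k' = k'"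
   "norm (k' * (c + ?r *\<^sub>R p - of_real \<mu>) * k') <= \<epsilon>"
  using excise_one[OF _ _ h k \<open>\<epsilon> > 0\<close>] by blast
 moreover have "k' * (c + ?r *\<^sub>R p - of_real \<mu>) * k' = k' * (c - of_real (\<mu> - ?r)) * k'"
  using Ac_left[OF k'(1)] by (simp add: algebra_simps mult_of_real_left of_real_diff)
 ultimately show ?thesis by metis
qed

text \<open>\<open>m\<close> inverts \<open>l\<close> where \<open>l >= 1/2\<close>, and
  \<open>k\<close> lives there, so \<open>l * m\<close> is an exact unit for \<open>k\<close>. A
  bound on \<open>l * y * l\<close> is thereby inherited by everything under \<open>l * m\<close>,
  at the cost of a factor \<open>norm m <= 2\<close> on each side.\<close>

lemma flat_top:
 assumes l: "l \<in> Ac" "psd l" "norm l = 1"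
 shows "\<exists>m k. adj m = m \<and> m * l = l * m \<and> norm m <= 2 \<and> k \<in> Ac \<and> psd k \<and> norm k = 1 \<and> l * m * k = k"
proof -
 have al: "adj l = l" using l psd_sa by blast
 let ?f = "%t::real. 1 / max t (1/2)"
 have cf: "continuous_on UNIV ?f" by (intro continuous_intros) (auto simp: max_def)
 have cid: "continuous_on UNIV (%t::real. t)" by (intro continuous_intros)
 have ct: "continuous_on UNIV (%t. t * ?f t)" by (intro continuous_on_mult cid cf)
 let ?k = "cfc (tent (1/2)) l"
 have k: "?k \<in> Ac" "psd ?k" "norm ?k = 1" using l by (auto simp: Ac_tent psd_tent norm_tent)
 have "l * cfc ?f l * ?k = cfc (%t. t * ?f t * tent (1/2) t) l"
  using cfc_mult[OF ct continuous_tent al] cfc_mult[OF cid cf al] by (simp add: cfc_id al)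
 also have "... = ?k"
  by (rule cfc_psd_cong[OF continuous_on_mult[OF ct continuous_tent] continuous_tent l(2)])
   (auto simp: max_def tent_zero_iff)
 finally have "l * cfc ?f l * ?k = ?k" .
 moreover have "norm (cfc ?f l) <= 2"
  by (rule cfc_psd_norm_le[OF cf l(2)]) (auto simp: max_def divide_le_eq)
 moreover have "cfc ?f l * l = l * cfc ?f l" using cfc_commute[OF cf al, of l] by simp
 ultimately show ?thesis using k adj_cfc[OF cf al] by blast
qed

lemma excise_finite:
 assumes "finite C" "!!c. c \<in> C ==> c \<in> Ac \<and> adj c = c"
  and h: "h \<in> Ac" and k: "k \<in> Ac" "psd k" "norm k = 1" "h * k = k" and e: "\<epsilon> > 0"
 shows "\<exists>k' \<mu>. k' \<in> Ac \<and> psd k' \<and> norm k' = 1 \<and> h * k' = k' \<and> (\<forall>c\<in>C. norm (k' * (c - of_real (\<mu> c)) * k') <= \<epsilon>)"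
 using assms(1,2) e
proof (induction C arbitrary: \<epsilon> rule: finite_induct)
 case empty
 then show ?case using k by auto
next
 case (insert c C)
 \<comment> \<open>A quarter of \<open>\<epsilon>\<close>, because passing to a bump under
   \<open>l0 = l * m\<close> multiplies the error by at most 2 on each side.\<close>
 obtain l \<mu> where l: "l \<in> Ac" "psd l" "norm l = 1" "h * l = l" "\<forall>c\<in>C. norm (l * (c - of_real (\<mu> c)) * l) <= \<epsilon> / 4"
  using insert.IH[of "\<epsilon>/4"] insert.prems by auto
 have al: "adj l = l" using l psd_sa by blast
 obtain m l1 where m: "adj m = m" "m * l = l * m" "norm m <= 2"
  and l1: "l1 \<in> Ac" "psd l1" "norm l1 = 1" "l * m * l1 = l1"
  using flat_top[OF l(1-3)] by blast
 define l0 where "l0 = l * m"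
 have al0: "adj l0 = l0" by (simp add: l0_def adj_mult m al)
 have l0A: "l0 \<in> Ac" using l unfolding l0_def by (simp add: Ac_mult_left)
 have l01: "l0 * l1 = l1" using l1 by (simp add: l0_def)
 obtain k' \<nu> where k': "k' \<in> Ac" "psd k'" "norm k' = 1" "l0 * k' = k'" "norm (k' * (c - of_real \<nu>) * k') <= \<epsilon>"
  using excise_self_adjoint[OF _ _ l0A l1(1-3) l01 insert.prems(2)] insert.prems(1) by blast
 have ak': "adj k' = k'" using k' psd_sa by blast
 have hl0: "h * l0 = l0" unfolding l0_def using l(4) by (simp flip: mult.assoc)
 have "h * k' = k'" using hl0 k'(4) by (metis mult.assoc)
 moreover have "norm (k' * (x - of_real (\<mu> x)) * k') <= \<epsilon>" if x: "x \<in> C" for x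
 proof -
  have "k' = k' * l0" using arg_cong[OF k'(4), of adj] by (simp add: adj_mult ak' al0)
  then have "k' * (x - of_real (\<mu> x)) * k' = k' * l0 * (x - of_real (\<mu> x)) * (l0 * k')" using k'(4) by simp
  also have "... = k' * (l0 * (x - of_real (\<mu> x)) * l0) * k'" by (simp only: mult.assoc)
  also have "l0 * (x - of_real (\<mu> x)) * l0 = m * (l * (x - of_real (\<mu> x)) * l) * m"
  proof -
   have "l0 = m * l" by (simp add: l0_def m)
   then show ?thesis using l0_def by (metis mult.assoc)
  qed
  also have "norm (k' * (m * (l * (x - of_real (\<mu> x)) * l) * m) * k') <= 1 * (2 * (\<epsilon>/4) * 2) * 1"
  proof -
   let ?y = "l * (x - of_real (\<mu> x)) * l"
   have "norm ?y <= \<epsilon>/4" using l(5) x by blast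
   then have "norm (m * ?y) <= 2 * (\<epsilon>/4)"
    using m(3) insert.prems(2) by (intro order_trans[OF norm_mult_ineq[of m ?y]] mult_mono) auto
   then have "norm (m * ?y * m) <= 2 * (\<epsilon>/4) * 2"
    using m(3) insert.prems(2) by (intro order_trans[OF norm_mult_ineq[of "m * ?y" m]] mult_mono) auto
   then have "norm (k' * (m * ?y * m)) <= 1 * (2 * (\<epsilon>/4) * 2)"
    using k' by (intro order_trans[OF norm_mult_ineq[of k' "m * ?y * m"]] mult_mono) auto
   then show ?thesis
    using k' insert.prems(2) by (intro order_trans[OF norm_mult_ineq[of "k' * (m * ?y * m)" k']] mult_mono) auto
  qed
  finally show ?thesis by simp
 qed
 ultimately show ?case using k' insert.hyps
  by (intro exI[of _ k'] exI[of _ "\<mu>(c := \<nu>)"]) auto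
qed
end

section \<open>Limits along an ultrafilter\<close>

text \<open>By compactness the image filter has a cluster point; for an ultrafilter a cluster point
  is a limit.\<close>

lemma ultrafilter_limit:
 fixes X :: "nat => 'b::heine_borel"
 assumes "free_ultrafilter \<omega>" "bounded (range X)"
 shows "\<exists>l. (X \<longlongrightarrow> l) \<omega>"
proof -
 let ?K = "closure (range X)"
 have K: "compact ?K" using assms(2) by (simp only: compact_closure)
 have nb: "filtermap X \<omega> ~= bot" using assms(1) by (simp add: free_ultrafilter_def filtermap_bot_iff)
 have "eventually (%x. x \<in> ?K) (filtermap X \<omega>)"
  unfolding eventually_filtermap
  by (rule always_eventually, rule allI, rule subsetD[OF closure_subset]) (rule rangeI)
 then obtain l where l: "inf (nhds l) (filtermap X \<omega>) ~= bot"
  using K nb unfolding compact_filter by blast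
 have "filtermap X \<omega> <= nhds l"
 proof (rule filter_leI)
  fix P assume P: "eventually P (nhds l)"
  show "eventually P (filtermap X \<omega>)"
  proof (rule ccontr)
   assume "\<not> ?thesis"
   then have "eventually (%x. \<not> P x) (filtermap X \<omega>)"
    using assms(1) unfolding free_ultrafilter_def eventually_filtermap by blast
   then have "eventually (%x. False) (inf (nhds l) (filtermap X \<omega>))"
    using P unfolding eventually_inf by blast
   then show False using l by (simp add: trivial_limit_def)
  qed
 qed
 then show ?thesis by (auto simp: filterlim_def)
qed

lemma free_ultrafilter_le: "free_ultrafilter \<omega> ==> \<omega> <= sequentially"
proof (rule filter_leI)
 fix P :: "nat => bool" assume f: "free_ultrafilter \<omega>" and "eventually P sequentially"
 then obtain N where N: "!!n. n >= N ==> P n" by (auto simp: eventually_sequentially)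
 have "eventually (%n. \<forall>m<N. n ~= m) \<omega>"
  using f eventually_ball_finite[of "{..<N}" "%n m. n ~= m" \<omega>] by (simp add: free_ultrafilter_def Ball_def)
 then show "eventually P \<omega>" by eventually_elim (use N not_le in blast)
qed

lemma free_ultrafilter_inverse_Suc: "free_ultrafilter \<omega> ==> ((%n. c / real (Suc n)) \<longlongrightarrow> 0) \<omega>"
 using tendsto_mono[OF free_ultrafilter_le inverse_Suc_tendsto] .

lemma free_ultrafilter_not_bot: "free_ultrafilter \<omega> ==> \<omega> ~= bot"
 by (simp add: free_ultrafilter_def)

section \<open>Excisable families\<close>

lemma cx_scaleR: "cx (r *\<^sub>R z) = r *\<^sub>R cx z"
 by (simp add: cx_def algebra_simps of_real_def)

lemma cx_mid: "x * cx u * y = cx u * (x * y)" and cx_left: "x * (cx u * y) = cx u * (x * y)"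
 by (simp_all only: cx_comm[of u x, symmetric] mult.assoc[symmetric])

lemma cx_sum: "cx (sum f A) = (\<Sum>i\<in>A. cx (f i))"
 by (induction A rule: infinite_finite_induct) (auto simp: cx_add)

context tracial_core
begin

text \<open>A norm-one bump \<open>h\<close> plays the part of a pure state \<open>\<psi>\<close>,
  and \<open>u a i j\<close> that of \<open>\<psi> (adj (x i) * a * x j)\<close>. As
  \<open>h\<close> and \<open>x\<close> may depend on \<open>\<epsilon>\<close>, limits of such
  families are included; the next lemmas show that they form a cone.\<close>

definition excisable :: "'a set => 'i set => ('a => 'i => 'i => complex) => bool" where
 "excisable F I u \<longleftrightarrow> (\<forall>\<epsilon>>0. \<exists>h x. h \<in> Ac \<and> psd h \<and> norm h = 1 \<and> (\<forall>i. x i \<in> Ac) \<and>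
  (\<forall>a\<in>F. \<forall>i\<in>I. \<forall>j\<in>I. norm (h * (adj (x i) * a * x j - cx (u a i j)) * h) <= \<epsilon>))"

lemma norm_p: "norm p = 1"
proof -
 obtain t where t: "t \<in> T" using T_ne by blast
 have "p ~= 0" using T_one[OF t] T_scale[OF t Ac_0, of 0] by auto
 moreover have "norm p = norm p ^ 2" using norm_sa_sq[OF ap] pp by simp
 ultimately show ?thesis by (simp add: power2_eq_square)
qed

lemma excisable_0: "excisable F I (%a i j. 0)"
 unfolding excisable_def
 by (intro allI impI exI[of _ p] exI[of _ "%i. 0"]) (auto simp: psd_p norm_p)

lemma excisable_scale:
 assumes "excisable F I u" "r >= 0"
 shows "excisable F I (%a i j. of_real r * u a i j)"
 unfolding excisable_def
proof (intro allI impI)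
 fix \<epsilon> :: real assume \<epsilon>: "\<epsilon> > 0"
 have "\<epsilon> / (r + 1) > 0" using \<epsilon> assms(2) by simp
 then obtain h x where h: "h \<in> Ac" "psd h" "norm h = 1" "\<forall>i. x i \<in> Ac"
  "\<forall>a\<in>F. \<forall>i\<in>I. \<forall>j\<in>I. norm (h * (adj (x i) * a * x j - cx (u a i j)) * h) <= \<epsilon> / (r + 1)"
  using assms(1) unfolding excisable_def by meson
 have "norm (h * (adj (sqrt r *\<^sub>R x i) * a * (sqrt r *\<^sub>R x j) - cx (of_real r * u a i j)) * h) <= \<epsilon>"
  if "a \<in> F" "i \<in> I" "j \<in> I" for a i j
 proof -
  have "h * (adj (sqrt r *\<^sub>R x i) * a * (sqrt r *\<^sub>R x j) - cx (of_real r * u a i j)) * h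
    = r *\<^sub>R (h * (adj (x i) * a * x j - cx (u a i j)) * h)"
   using assms(2) by (simp add: adj_scaleR cx_scaleR algebra_simps flip: scaleR_conv_of_real)
  also have "norm ... = r * norm (h * (adj (x i) * a * x j - cx (u a i j)) * h)" using assms(2) by simp
  also have "... <= r * (\<epsilon> / (r + 1))" using h(5) that assms(2) by (intro mult_left_mono) auto
  also have "... <= \<epsilon>" using assms(2) \<epsilon> by (simp add: field_simps)
  finally show ?thesis .
 qed
 then show "\<exists>h x. h \<in> Ac \<and> psd h \<and> norm h = 1 \<and> (\<forall>i. x i \<in> Ac) \<and>
   (\<forall>a\<in>F. \<forall>i\<in>I. \<forall>j\<in>I. norm (h * (adj (x i) * a * x j - cx (of_real r * u a i j)) * h) <= \<epsilon>)"
  using h by (intro exI[of _ h] exI[of _ "%i. sqrt r *\<^sub>R x i"]) auto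
qed

text \<open>\<open>l\<close> lies under \<open>h'\<close> and \<open>v\<close> carries it under
  \<open>k\<close>, hence under \<open>h\<close>. So \<open>y1\<close> and \<open>y2\<close> are
  small by excision, the mixed terms by orthogonality of \<open>k\<close> and \<open>k'\<close>, and
  the scalar \<open>u\<close> survives since \<open>v\<close> is almost isometric on
  \<open>l\<close>. The 15 is 4 + 4 + 2 + 2 + 1, plus two bare \<open>\<eta>\<close> absorbed by
  \<open>M >= 1\<close>.\<close>

lemma excisable_add_step:
 fixes h h' k k' l v y1 y2 y3 y4 :: 'a
 assumes h: "psd h" "norm h = 1" and h': "psd h'" "norm h' = 1"
  and k: "adj k = k" "norm k = 1" "norm ((1 - h) * k) <= \<eta>" and k': "norm ((1 - h') * k') <= \<eta>"
  and l: "adj l = l" "norm l = 1" "norm ((1 - k') * l) <= \<eta>"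
  and v: "norm v = 1" "norm ((1 - k) * v) <= \<eta>" "norm ((1 - adj v * v) * l) <= \<eta>"
  and \<eta>: "\<eta> >= 0" "norm (k * y3 * k') <= \<eta>" "norm (k * y4 * k') <= \<eta>"
  and M: "M >= 1" "norm y1 <= M" "norm y2 <= M" "norm y3 <= M" "norm y4 <= M" "cmod u <= M"
  and y: "norm (h * y1 * h) <= \<theta>" "norm (h' * y2 * h') <= \<theta>"
 shows "norm (l * (adj v * (y1 + cx u) * v + (y2 + cx u') + adj v * y3 + adj y4 * v - cx (u + u')) * l)
  <= 2 * \<theta> + 15 * (\<eta> * M)"
proof -
 have sa: "adj h = h" "adj h' = h'" using h h' psd_sa by auto
 have vl: "norm (v * l) <= 1" using norm_mult_ineq[of v l] v l by simp
 have q: "norm ((1 - h) * (v * l)) <= 2 * \<eta>" "norm ((1 - k) * (v * l)) <= \<eta>"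
 proof -
  have *: "norm (x * (v * l)) <= norm (x * v)" for x
   using norm_mult_ineq[of "x * v" l] l by (simp add: mult.assoc)
  show "norm ((1 - k) * (v * l)) <= \<eta>" using *[of "1 - k"] v by linarith
  have "norm ((1 - h) * v) <= \<eta> + \<eta>" using near_trans[OF h(1) _ _ k(3) v(2)] h v by simp
  then show "norm ((1 - h) * (v * l)) <= 2 * \<eta>" using *[of "1 - h"] by linarith
 qed
 have ql: "norm ((1 - h') * l) <= 2 * \<eta>" using near_trans[OF h'(1) _ _ k' l(3)] h' l by simp
 have pr: "(s + t) * norm z <= s' * M" if "s + t <= s'" "norm z <= M" "s' >= 0" for s t s' :: real and z :: 'a
  using that M by (meson mult_mono mult_right_mono norm_ge_zero order_trans mult_left_mono)
 have 1: "norm (adj (v * l) * y1 * (v * l)) <= \<theta> + 4 * \<eta> * M"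
  using cut_norm[OF sa(1) _ vl vl, of y1 h] h y(1) pr[of "norm ((1 - h) * (v * l))" "norm ((1 - h) * (v * l))" "4 * \<eta>" y1] q M \<eta> by linarith
 have 2: "norm (adj l * y2 * l) <= \<theta> + 4 * \<eta> * M"
  using cut_norm[OF sa(2) _ _ _, of l l y2 h'] h' l y(2) pr[of "norm ((1 - h') * l)" "norm ((1 - h') * l)" "4 * \<eta>" y2] ql M \<eta> by linarith
 have c: "norm (adj (v * l) * z * l) <= \<eta> + 2 * \<eta> * M" if "norm (k * z * k') <= \<eta>" "norm z <= M" for z
  using cut_norm[OF k(1) _ vl _, of l z k'] k l that pr[of "norm ((1 - k) * (v * l))" "norm ((1 - k') * l)" "2 * \<eta>" z] q \<eta> by linarith
 have 5: "norm (cx u * (l * ((1 - adj v * v) * l))) <= M * \<eta>"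
 proof -
  have "norm (l * ((1 - adj v * v) * l)) <= \<eta>" using norm_mult_ineq[of l "(1 - adj v * v) * l"] l v by simp
  then show ?thesis unfolding norm_cx_mult using M by (intro mult_mono) auto
 qed
 have a4: "norm (adj (adj (v * l) * y4 * l)) <= \<eta> + 2 * \<eta> * M" using c[OF \<eta>(3) M(5)] by simp
 have "l * (adj v * (y1 + cx u) * v + (y2 + cx u') + adj v * y3 + adj y4 * v - cx (u + u')) * l
   = adj (v * l) * y1 * (v * l) + adj l * y2 * l + adj (v * l) * y3 * l + adj (adj (v * l) * y4 * l)
    - cx u * (l * ((1 - adj v * v) * l))"
  by (simp add: adj_mult l(1) cx_add distrib_left distrib_right right_diff_distrib left_diff_distrib mult.assoc cx_left)
 also have "norm ... <= (\<theta> + 4 * \<eta> * M) + (\<theta> + 4 * \<eta> * M) + (\<eta> + 2 * \<eta> * M) + (\<eta> + 2 * \<eta> * M) + M * \<eta>"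
  using 1 2 c[OF \<eta>(2) M(4)] a4 5
  by (intro order_trans[OF norm_triangle_ineq4] add_mono order_trans[OF norm_triangle_ineq]) auto
 also have "... <= 2 * \<theta> + 15 * (\<eta> * M)"
  using mult_left_mono[OF M(1) \<eta>(1)] by (simp add: algebra_simps)
 finally show ?thesis .
qed

text \<open>The two families are realised by \<open>x\<close> under \<open>h\<close> and
  \<open>x'\<close> under \<open>h'\<close>; the combination is \<open>x i * v + x' i\<close> with
  \<open>v\<close> moving the common bump from \<open>h'\<close> to \<open>h\<close>.\<close>

lemma excisable_add:
 assumes small and F: "finite F" "F \<subseteq> Ac" and I: "finite I"
  and u: "excisable F I u" and u': "excisable F I u'"
 shows "excisable F I (%a i j. u a i j + u' a i j)"
 unfolding excisable_def
proof (intro allI impI)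
 fix \<epsilon> :: real assume \<epsilon>: "\<epsilon> > 0"
 then have \<epsilon>8: "\<epsilon> / 8 > 0" by simp
 obtain h x where h: "h \<in> Ac" "psd h" "norm h = 1" "\<forall>i. x i \<in> Ac"
  "\<forall>a\<in>F. \<forall>i\<in>I. \<forall>j\<in>I. norm (h * (adj (x i) * a * x j - cx (u a i j)) * h) <= \<epsilon> / 8"
  using u \<epsilon>8 unfolding excisable_def by meson
 obtain h' x' where h': "h' \<in> Ac" "psd h'" "norm h' = 1" "\<forall>i. x' i \<in> Ac"
  "\<forall>a\<in>F. \<forall>i\<in>I. \<forall>j\<in>I. norm (h' * (adj (x' i) * a * x' j - cx (u' a i j)) * h') <= \<epsilon> / 8"
  using u' \<epsilon>8 unfolding excisable_def by meson
 define y1 where "y1 = (%(a, i, j). adj (x i) * a * x j - cx (u a i j))"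
 define y2 where "y2 = (%(a, i, j). adj (x' i) * a * x' j - cx (u' a i j))"
 define y3 where "y3 = (%(a, i, j). adj (x i) * a * x' j)"
 \<comment> \<open>Stated with adjoints, so that both mixed terms have the shape
   \<open>k * y * k'\<close> and one orthogonality statement covers them.\<close>
 define y4 where "y4 = (%(a, i, j). adj (x j) * adj a * x' i)"
 define K where "K = F \<times> I \<times> I"
 define N where "N s = norm (y1 s) + norm (y2 s) + norm (y3 s) + norm (y4 s) + (case s of (a, i, j) => cmod (u a i j))" for s
 define M where "M = 1 + (\<Sum>s\<in>K. N s)"
 have fK: "finite K" using F I by (simp add: K_def)
 have N0: "N s >= 0" for s by (auto simp: N_def split: prod.splits intro!: add_nonneg_nonneg)
 have NM: "N s <= M" if "s \<in> K" for s
  using member_le_sum[of s K N] fK N0 that by (simp add: M_def)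
 have M1: "M >= 1" using N0 by (simp add: M_def sum_nonneg)
 define \<eta> where "\<eta> = min 1 (\<epsilon> / (20 * M))"
 have \<eta>: "0 < \<eta>" "\<eta> <= 1" "15 * (\<eta> * M) <= 3 * \<epsilon> / 4"
 proof -
  show "0 < \<eta>" using \<epsilon> M1 by (simp add: \<eta>_def)
  have "\<eta> * M <= \<epsilon> / (20 * M) * M" using M1 by (intro mult_right_mono) (auto simp: \<eta>_def)
  also have "... = \<epsilon> / 20" using M1 by simp
  finally show "15 * (\<eta> * M) <= 3 * \<epsilon> / 4" by linarith
 qed (simp add: \<eta>_def)
 define Y where "Y = y3 ` K \<union> y4 ` K"
 have Y: "finite Y" "Y \<subseteq> Ac" using fK F h(4) h'(4) by (auto simp: Y_def y3_def y4_def K_def Ac_mult_right)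
 obtain k k' where k: "k \<in> Ac" "psd k" "norm k = 1" "norm ((1 - h) * k) <= \<eta>"
  and k': "k' \<in> Ac" "psd k'" "norm k' = 1" "norm ((1 - h') * k') <= \<eta>"
  and orth: "\<forall>y\<in>Y. norm (k * y * k') <= \<eta>"
  using orthogonal_bumps[OF assms(1) h(1-3) h'(1-3) \<eta>(1,2) Y] by blast
 obtain v l where v: "v \<in> Ac" "norm v = 1" "norm ((1 - k) * v) <= \<eta>" "norm ((1 - adj v * v) * l) <= \<eta>"
  and l: "l \<in> Ac" "psd l" "norm l = 1" "norm ((1 - k') * l) <= \<eta>"
  using move[OF k'(1-3) k(1-3) \<eta>(1,2)] by blast
 have "norm (l * (adj (x i * v + x' i) * a * (x j * v + x' j) - cx (u a i j + u' a i j)) * l) <= \<epsilon>"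
  if a: "a \<in> F" "i \<in> I" "j \<in> I" for a i j
 proof -
  let ?s = "(a, i, j)"
  have s: "?s \<in> K" using a by (simp add: K_def)
  have NN: "norm (y1 ?s) <= M" "norm (y2 ?s) <= M" "norm (y3 ?s) <= M" "norm (y4 ?s) <= M" "cmod (u a i j) <= M"
   using NM[OF s] norm_ge_zero[of "y1 ?s"] norm_ge_zero[of "y2 ?s"] norm_ge_zero[of "y3 ?s"]
    norm_ge_zero[of "y4 ?s"] norm_ge_zero[of "u a i j"] unfolding N_def prod.case by linarith+
  have O: "norm (k * y3 ?s * k') <= \<eta>" "norm (k * y4 ?s * k') <= \<eta>" using orth s by (auto simp: Y_def)
  have yy: "norm (h * y1 ?s * h) <= \<epsilon>/8" "norm (h' * y2 ?s * h') <= \<epsilon>/8"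
   using h(5) h'(5) a by (auto simp: y1_def y2_def)
  have "adj (x i * v + x' i) * a * (x j * v + x' j)
    = adj v * (y1 ?s + cx (u a i j)) * v + (y2 ?s + cx (u' a i j)) + adj v * y3 ?s + adj (y4 ?s) * v"
   by (simp add: y1_def y2_def y3_def y4_def adj_add adj_mult algebra_simps)
  then show ?thesis
   using excisable_add_step[OF h(2,3) h'(2,3) psd_sa[OF k(2)] k(3,4) k'(4) psd_sa[OF l(2)] l(3,4) v(2-4) less_imp_le[OF \<eta>(1)] O M1 NN yy, of "u' a i j"]
    \<eta>(3) by (simp only:)
 qed
 moreover have "\<forall>i. x i * v + x' i \<in> Ac" using h(4) h'(4) v(1) by blast
 ultimately show "\<exists>h x. h \<in> Ac \<and> psd h \<and> norm h = 1 \<and> (\<forall>i. x i \<in> Ac) \<and>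
   (\<forall>a\<in>F. \<forall>i\<in>I. \<forall>j\<in>I. norm (h * (adj (x i) * a * x j - cx (u a i j + u' a i j)) * h) <= \<epsilon>)"
  using l by (intro exI[of _ l] exI[of _ "%i. x i * v + x' i"] conjI) auto
qed

text \<open>The flat top of the normalised negative part of \<open>e\<close>:
  \<open>h = l * m\<close> is an exact unit for \<open>k\<close>, and \<open>h * e * h\<close>
  inherits the sign from the negative part.\<close>

lemma negative_bump:
 assumes e: "e \<in> Ac" "adj e = e" "\<not> psd e"
 shows "\<exists>h k. h \<in> Ac \<and> adj h = h \<and> k \<in> Ac \<and> psd k \<and> norm k = 1 \<and> h * k = k \<and> psd (- (h * e * h))"
proof -
 let ?f = "%t::real. max 0 (- t)"
 have f: "continuous_on UNIV ?f" and f0: "?f 0 = 0" by (auto intro!: continuous_intros)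
 define n where "n = cfc ?f e"
 have n: "n \<in> Ac" "adj n = n" unfolding n_def using Ac_cfc[OF f e(2) f0 e(1)] adj_cfc[OF f e(2)] by auto
 note lu = psd_norm_bounds[OF e(2)]
 have pn: "psd n" unfolding n_def by (rule cfc_nonneg[OF f lu]) auto
 have nen: "n * e * n = cfc (%t. ?f t * t * ?f t) e"
  unfolding n_def using f e by (simp add: cfc_mult cfc_id continuous_on_mult)
 have "psd (cfc (%t. - (?f t * t * ?f t)) e)"
 proof (rule cfc_nonneg[OF _ lu])
  show "0 <= - (?f t * t * ?f t)" for t by (cases "t <= 0") (auto simp: mult_nonneg_nonpos mult_nonpos_nonpos)
 qed (intro continuous_intros)
 then have neg: "psd (- (n * e * n))" using f e by (simp add: nen cfc_uminus continuous_on_mult)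
 have "e = cfc (%t. max 0 t - ?f t) e"
  by (subst cfc_id[OF e(2), symmetric], rule arg_cong[where f = "%f. cfc f e"]) (auto simp: max_def)
 moreover have "cfc (%t. max 0 t - ?f t) e = cfc (max 0) e - n"
  unfolding n_def by (intro cfc_diff e continuous_intros)
 moreover have "psd (cfc (max 0) e)"
  by (rule cfc_nonneg[OF _ lu]) (auto intro!: continuous_intros)
 ultimately have n0: "n ~= 0" using e(3) by auto
 define l where "l = (1 / norm n) *\<^sub>R n"
 have l: "l \<in> Ac" "psd l" "norm l = 1" using n n0 pn by (auto simp: l_def intro: psd_scaleR)
 obtain m k where mk: "adj m = m" "m * l = l * m" "k \<in> Ac" "psd k" "norm k = 1" "l * m * k = k"
  using flat_top[OF l] by blast
 have al: "adj l = l" using l psd_sa by blast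
 have "psd ((1 / norm n ^ 2) *\<^sub>R (adj m * (- (n * e * n)) * m))" by (intro psd_scaleR psd_conj neg) auto
 also have "(1 / norm n ^ 2) *\<^sub>R (adj m * (- (n * e * n)) * m) = - (m * l * e * (l * m))"
  by (simp add: l_def mk power2_eq_square mult.assoc)
 finally have "psd (- (l * m * e * (l * m)))" by (simp only: mk(2))
 moreover have "adj (l * m) = l * m" by (simp add: adj_mult mk al)
 ultimately show ?thesis using mk l by (intro exI[of _ "l * m"] exI[of _ k]) (auto simp: Ac_mult_left)
qed

definition wsum :: "'a set => 'i set => ('a => 'i => 'i => complex) => ('i => 'a) => 'a" where
 "wsum F I z d = (\<Sum>a\<in>F. \<Sum>i\<in>I. \<Sum>j\<in>I. cx (z a i j) * (adj (d i) * a * d j))"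

lemma Ac_wsum: "F \<subseteq> Ac ==> (!!i. d i \<in> Ac) ==> wsum F I z d \<in> Ac"
 unfolding wsum_def by (intro Ac_sum Ac_mult_right) auto

text \<open>Excise the real and imaginary parts of all \<open>adj (d i) * a * d j\<close> at once,
  on a bump where the real part of \<open>wsum\<close> is at most \<open>- \<eta>\<close>. The
  values \<open>u\<close> then satisfy the same inequality up to the excision error.\<close>

lemma excise_vector_approx:
 assumes F: "finite F" "F \<subseteq> Ac" and I: "finite I" and d: "!!i. d i \<in> Ac"
  and neg: "\<not> psd ((1/2) *\<^sub>R (wsum F I z d + adj (wsum F I z d)) + \<eta> *\<^sub>R p)" and \<tau>: "\<tau> > 0"
 shows "\<exists>k u. k \<in> Ac \<and> psd k \<and> norm k = 1 \<and>
  (\<forall>a\<in>F. \<forall>i\<in>I. \<forall>j\<in>I. norm (k * (adj (d i) * a * d j - cx (u a i j)) * k) <= \<tau>) \<and>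
  Re (\<Sum>a\<in>F. \<Sum>i\<in>I. \<Sum>j\<in>I. z a i j * u a i j) <= - \<eta> + \<tau> * (\<Sum>a\<in>F. \<Sum>i\<in>I. \<Sum>j\<in>I. cmod (z a i j))"
proof -
 define X where "X = wsum F I z d"
 define c where "c = (1/2) *\<^sub>R (X + adj X)"
 have X: "X \<in> Ac" unfolding X_def by (rule Ac_wsum[OF F(2) d])
 have c: "c \<in> Ac" "adj c = c" using X by (auto simp: c_def adj_scaleR adj_add add.commute)
 have e: "c + \<eta> *\<^sub>R p \<in> Ac" "adj (c + \<eta> *\<^sub>R p) = c + \<eta> *\<^sub>R p" "\<not> psd (c + \<eta> *\<^sub>R p)"
  using c neg by (auto simp: adj_add adj_scaleR ap c_def[symmetric] X_def[symmetric] intro!: Ac_add Ac_scaleR)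
 obtain h k0 where h: "h \<in> Ac" "adj h = h" and k0: "k0 \<in> Ac" "psd k0" "norm k0 = 1" "h * k0 = k0"
  and hn: "psd (- (h * (c + \<eta> *\<^sub>R p) * h))"
  using negative_bump[OF e] by blast
 define y where "y = (%(a, i, j). adj (d i) * a * d j)"
 define re where "re x = (1/2) *\<^sub>R (x + adj x)" for x :: 'a
 define im where "im x = - ((1/2) *\<^sub>R (imag * (x - adj x)))" for x :: 'a
 have ri: "x = re x + imag * im x" for x
  by (simp add: re_def im_def imag_sq scaleR_add_right scaleR_diff_right flip: mult.assoc scaleR_add_left)
 have are: "adj (re x) = re x" "adj (im x) = im x" for x
  by (auto simp: re_def im_def adj_scaleR adj_add adj_mult adj_diff adj_imag add.commute imag_comm algebra_simps)
 define K where "K = F \<times> I \<times> I"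
 define C where "C = (re \<circ> y) ` K \<union> (im \<circ> y) ` K"
 have yA: "y s \<in> Ac" if "s \<in> K" for s using that F d by (auto simp: y_def K_def Ac_mult_right)
 have C: "finite C" "!!c. c \<in> C ==> c \<in> Ac \<and> adj c = c"
 proof -
  show "finite C" using F I by (simp add: C_def K_def)
  fix c assume "c \<in> C"
  then obtain s where "s \<in> K" "c = re (y s) \<or> c = im (y s)" by (auto simp: C_def)
  then show "c \<in> Ac \<and> adj c = c" using yA[of s] are
   by (auto simp: re_def im_def intro!: Ac_uminus Ac_scaleR Ac_mult_right Ac_diff Ac_add Ac_adj)
 qed
 obtain k \<mu> where k: "k \<in> Ac" "psd k" "norm k = 1" "h * k = k"
  and k\<mu>: "\<forall>c\<in>C. norm (k * (c - of_real (\<mu> c)) * k) <= \<tau>/2"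
  using excise_finite[OF C h(1) k0, of "\<tau>/2"] \<tau> by auto
 have ak: "adj k = k" using k psd_sa by blast
 have kk: "norm (k * k) = 1" using norm_sa_sq[OF ak] k by simp
 define u where "u a i j = Complex (\<mu> (re (y (a, i, j)))) (\<mu> (im (y (a, i, j))))" for a i j
 have ku: "norm (k * (y (a, i, j) - cx (u a i j)) * k) <= \<tau>" if "(a, i, j) \<in> K" for a i j
 proof -
  let ?s = "(a, i, j)"
  have iC: "re (y ?s) \<in> C" "im (y ?s) \<in> C" using that by (auto simp: C_def)
  have "k * (y ?s - cx (u a i j)) * k = k * (re (y ?s) - of_real (\<mu> (re (y ?s)))) * k
    + imag * (k * (im (y ?s) - of_real (\<mu> (im (y ?s)))) * k)"
  proof -
   have ik: "imag * (k * w * k) = k * (imag * w) * k" for w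
    using cx_left[of k \<i> w] by (simp add: cx_i mult.assoc)
   have "y ?s - cx (u a i j) = (re (y ?s) - of_real (\<mu> (re (y ?s)))) + imag * (im (y ?s) - of_real (\<mu> (im (y ?s))))"
    by (subst ri[of "y ?s"]) (simp add: u_def cx_def right_diff_distrib mult_of_real_right algebra_simps)
   then show ?thesis unfolding ik by (simp only: distrib_left distrib_right)
  qed
  also have "norm ... <= \<tau>/2 + cmod \<i> * (\<tau>/2)"
   using k\<mu> iC unfolding cx_i[symmetric]
   by (intro order_trans[OF norm_triangle_ineq] add_mono) (auto simp: norm_cx_mult simp del: norm_ii)
  finally show ?thesis by simp
 qed
 define w where "w = (\<Sum>a\<in>F. \<Sum>i\<in>I. \<Sum>j\<in>I. z a i j * u a i j)"
 define Z where "Z = (\<Sum>a\<in>F. \<Sum>i\<in>I. \<Sum>j\<in>I. cmod (z a i j))"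
 \<comment> \<open>The error of replacing \<open>X\<close> by the scalar \<open>w\<close> on
   \<open>k\<close>. Its real part \<open>R\<close> is compared with
   \<open>- (Re w + \<eta>) *\<^sub>R (k * k)\<close>, whose norm is \<open>Re w + \<eta>\<close>
   when that is nonnegative.\<close>
 define S where "S = k * X * k - cx w * (k * k)"
 have "S = (\<Sum>a\<in>F. \<Sum>i\<in>I. \<Sum>j\<in>I. cx (z a i j) * (k * (y (a, i, j) - cx (u a i j)) * k))"
 proof -
  have "k * X * k = (\<Sum>a\<in>F. \<Sum>i\<in>I. \<Sum>j\<in>I. cx (z a i j) * (k * y (a, i, j) * k))"
   unfolding X_def wsum_def sum_distrib_left sum_distrib_right cx_left
   by (simp only: y_def prod.case mult.assoc)
  moreover have "cx w * (k * k) = (\<Sum>a\<in>F. \<Sum>i\<in>I. \<Sum>j\<in>I. cx (z a i j) * (cx (u a i j) * (k * k)))"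
   unfolding w_def cx_sum sum_distrib_right cx_mult by (simp only: mult.assoc)
  ultimately show ?thesis unfolding S_def
   by (simp only: right_diff_distrib left_diff_distrib cx_mid sum_subtractf)
 qed
 also have "norm ... <= (\<Sum>a\<in>F. \<Sum>i\<in>I. \<Sum>j\<in>I. cmod (z a i j) * \<tau>)"
  using ku by (intro order_trans[OF norm_sum] sum_mono) (auto simp: norm_cx_mult K_def intro!: mult_left_mono)
 also have "... = \<tau> * Z" by (simp add: Z_def sum_distrib_left mult.commute)
 finally have S: "norm S <= \<tau> * Z" .
 have "Re w <= - \<eta> + \<tau> * Z"
 proof (cases "Re w + \<eta> >= 0")
  case True
  define R where "R = (1/2) *\<^sub>R (S + adj S)"
  have nR: "norm R <= \<tau> * Z" unfolding R_def using S norm_triangle_ineq[of S "adj S"] by simp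
  have "adj (cx w * (k * k)) = cx (cnj w) * (k * k)" by (simp add: adj_mult adj_cx ak cx_comm)
  moreover have "adj (k * X * k) = k * adj X * k" by (simp add: adj_mult ak mult.assoc)
  ultimately have "R = k * c * k - (1/2) *\<^sub>R (cx (w + cnj w) * (k * k))"
   by (simp add: R_def S_def c_def adj_diff algebra_simps cx_add)
  also have "w + cnj w = of_real (2 * Re w)" by (simp add: complex_add_cnj)
  finally have R: "R = k * c * k - Re w *\<^sub>R (k * k)" by (simp only: cx_of_real mult_of_real_left) simp
  have "psd (- (k * (h * (c + \<eta> *\<^sub>R p) * h) * k))" using psd_conj[OF hn, of k] by (simp add: ak)
  also have "k * (h * (c + \<eta> *\<^sub>R p) * h) * k = k * (c + \<eta> *\<^sub>R p) * k"
  proof -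
   have "k * h = k" using arg_cong[OF k(4), of adj] by (simp add: adj_mult h ak)
   then show ?thesis using k(4) by (metis mult.assoc)
  qed
  also have "k * (c + \<eta> *\<^sub>R p) * k = R + (Re w + \<eta>) *\<^sub>R (k * k)"
   using Ac_right[OF k(1)] by (simp add: R algebra_simps)
  finally have "psd (- R - (Re w + \<eta>) *\<^sub>R (k * k))" by (simp add: algebra_simps)
  then have "norm ((Re w + \<eta>) *\<^sub>R (k * k)) <= norm (- R)"
   using True by (intro psd_norm_mono psd_scaleR psd_sq ak)
  then show ?thesis using nR kk True by simp
 next
  case False
  have "\<tau> * Z >= 0" using \<tau> by (simp add: Z_def sum_nonneg)
  then show ?thesis using False by simp
 qed
 then show ?thesis using k ku unfolding w_def Z_def K_def y_def by (intro exI[of _ k] exI[of _ u]) auto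
qed

text \<open>The approximate values for precision \<open>1 / Suc n\<close> are bounded by the norms
  of the entries, so they converge along the ultrafilter; the limit is excisable and satisfies the
  inequality exactly.\<close>

lemma excisable_vector:
 assumes \<omega>: "free_ultrafilter \<omega>" and F: "finite F" "F \<subseteq> Ac" and I: "finite I" and d: "!!i. d i \<in> Ac"
  and neg: "\<not> psd ((1/2) *\<^sub>R (wsum F I z d + adj (wsum F I z d)) + \<eta> *\<^sub>R p)"
 shows "\<exists>u. excisable F I u \<and> (\<forall>a\<in>F. \<forall>i\<in>I. \<forall>j\<in>I. cmod (u a i j) <= norm (adj (d i) * a * d j)) \<and>
  Re (\<Sum>a\<in>F. \<Sum>i\<in>I. \<Sum>j\<in>I. z a i j * u a i j) <= - \<eta>"
proof -
 define Z where "Z = (\<Sum>a\<in>F. \<Sum>i\<in>I. \<Sum>j\<in>I. cmod (z a i j))"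
 define P where "P n k u \<longleftrightarrow> k \<in> Ac \<and> psd k \<and> norm k = 1 \<and>
  (\<forall>a\<in>F. \<forall>i\<in>I. \<forall>j\<in>I. norm (k * (adj (d i) * a * d j - cx (u a i j)) * k) <= 1 / real (Suc n)) \<and>
  Re (\<Sum>a\<in>F. \<Sum>i\<in>I. \<Sum>j\<in>I. z a i j * u a i j) <= - \<eta> + (1 / real (Suc n)) * Z" for n k u
 have "\<exists>k u. P n k u" for n
  unfolding P_def Z_def by (rule excise_vector_approx[OF F I d neg]) simp
 then obtain k u where P: "!!n. P n (k n) (u n)" by metis
 have k: "!!n. k n \<in> Ac" "!!n. psd (k n)" "!!n. norm (k n) = 1"
  and ku: "!!n a i j. [|a \<in> F; i \<in> I; j \<in> I|] ==> norm (k n * (adj (d i) * a * d j - cx (u n a i j)) * k n) <= 1 / real (Suc n)"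
  and ku2: "!!n. Re (\<Sum>a\<in>F. \<Sum>i\<in>I. \<Sum>j\<in>I. z a i j * u n a i j) <= - \<eta> + (1 / real (Suc n)) * Z"
  using P unfolding P_def by blast+
 have kk: "norm (k n * k n) = 1" for n using norm_sa_sq[OF psd_sa[OF k(2)]] k(3) by simp
 have un: "cmod (u n a i j) <= norm (adj (d i) * a * d j) + 1 / real (Suc n)" if "a \<in> F" "i \<in> I" "j \<in> I" for n a i j
 proof -
  let ?y = "adj (d i) * a * d j"
  have "cx (u n a i j) * (k n * k n) = k n * ?y * k n - k n * (?y - cx (u n a i j)) * k n"
   by (simp add: right_diff_distrib left_diff_distrib cx_mid)
  then have "cmod (u n a i j) = norm (k n * ?y * k n - k n * (?y - cx (u n a i j)) * k n)"
   using norm_cx_mult[of "u n a i j" "k n * k n"] kk by simp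
  also have "... <= norm (k n * ?y * k n) + 1 / real (Suc n)"
   by (rule order_trans[OF norm_triangle_ineq4 add_left_mono[OF ku[OF that]]])
  also have "norm (k n * ?y * k n) <= norm ?y"
   using norm_mult_ineq[of "k n * ?y" "k n"] norm_mult_ineq[of "k n" ?y] k(3)[of n] by simp
  finally show ?thesis by simp
 qed
 have "\<exists>l. ((%n. u n a i j) \<longlongrightarrow> l) \<omega>" if "a \<in> F" "i \<in> I" "j \<in> I" for a i j
 proof (rule ultrafilter_limit[OF \<omega>], unfold bounded_iff, intro exI ballI)
  fix x assume "x \<in> range (%n. u n a i j)"
  then obtain n where "x = u n a i j" by blast
  moreover have "1 / real (Suc n) <= 1" by simp
  ultimately show "norm x <= norm (adj (d i) * a * d j) + 1" using un[OF that, of n] by (simp only:)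
 qed
 then obtain v where v: "!!a i j. [|a \<in> F; i \<in> I; j \<in> I|] ==> ((%n. u n a i j) \<longlongrightarrow> v a i j) \<omega>"
  by metis
 note nb = free_ultrafilter_not_bot[OF \<omega>] and iS = free_ultrafilter_inverse_Suc[OF \<omega>]
 have "excisable F I v" unfolding excisable_def
 proof (intro allI impI)
  fix \<epsilon> :: real assume \<epsilon>: "\<epsilon> > 0"
  have "eventually (%n. cmod (u n a i j - v a i j) < \<epsilon>/2) \<omega>" if "a \<in> F" "i \<in> I" "j \<in> I" for a i j
   using tendstoD[OF v[OF that], of "\<epsilon>/2"] \<epsilon> by (simp add: dist_norm)
  then have "eventually (%n. \<forall>a\<in>F. \<forall>i\<in>I. \<forall>j\<in>I. cmod (u n a i j - v a i j) < \<epsilon>/2) \<omega>"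
   using F I by (intro eventually_ball_finite ballI)
  moreover have "eventually (%n. 1 / real (Suc n) < \<epsilon>/2) \<omega>"
   using order_tendstoD(2)[OF iS[of 1], of "\<epsilon>/2"] \<epsilon> by simp
  ultimately have "eventually (%n. (\<forall>a\<in>F. \<forall>i\<in>I. \<forall>j\<in>I. cmod (u n a i j - v a i j) < \<epsilon>/2) \<and> 1 / real (Suc n) < \<epsilon>/2) \<omega>"
   by (rule eventually_conj)
  then obtain n where n: "\<forall>a\<in>F. \<forall>i\<in>I. \<forall>j\<in>I. cmod (u n a i j - v a i j) < \<epsilon>/2" "1 / real (Suc n) < \<epsilon>/2"
   using eventually_happens'[OF nb] by blast
  have "norm (k n * (adj (d i) * a * d j - cx (v a i j)) * k n) <= \<epsilon>" if "a \<in> F" "i \<in> I" "j \<in> I" for a i j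
  proof -
   have "k n * (adj (d i) * a * d j - cx (v a i j)) * k n
     = k n * (adj (d i) * a * d j - cx (u n a i j)) * k n + cx (u n a i j - v a i j) * (k n * k n)"
    by (simp add: right_diff_distrib left_diff_distrib cx_diff cx_mid)
   also have "norm ... <= 1 / real (Suc n) + cmod (u n a i j - v a i j) * 1"
    using ku[OF that] kk by (intro order_trans[OF norm_triangle_ineq] add_mono) (auto simp: norm_cx_mult)
   also have "... <= \<epsilon>" using n that by fastforce
   finally show ?thesis .
  qed
  then show "\<exists>h x. h \<in> Ac \<and> psd h \<and> norm h = 1 \<and> (\<forall>i. x i \<in> Ac) \<and>
   (\<forall>a\<in>F. \<forall>i\<in>I. \<forall>j\<in>I. norm (h * (adj (x i) * a * x j - cx (v a i j)) * h) <= \<epsilon>)"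
   using k d by (intro exI[of _ "k n"] exI[of _ d]) auto
 qed
 moreover have "cmod (v a i j) <= norm (adj (d i) * a * d j)" if "a \<in> F" "i \<in> I" "j \<in> I" for a i j
 proof (rule tendsto_le[OF nb])
  show "((%n. cmod (u n a i j)) \<longlongrightarrow> cmod (v a i j)) \<omega>" by (intro tendsto_intros v that)
  show "((%n. norm (adj (d i) * a * d j) + 1 / real (Suc n)) \<longlongrightarrow> norm (adj (d i) * a * d j)) \<omega>"
   using tendsto_add[OF tendsto_const iS] by fastforce
 qed (use un[OF that] in simp)
 moreover have "Re (\<Sum>a\<in>F. \<Sum>i\<in>I. \<Sum>j\<in>I. z a i j * v a i j) <= - \<eta>"
 proof (rule tendsto_le[OF nb])
  show "((%n. Re (\<Sum>a\<in>F. \<Sum>i\<in>I. \<Sum>j\<in>I. z a i j * u n a i j)) \<longlongrightarrow> Re (\<Sum>a\<in>F. \<Sum>i\<in>I. \<Sum>j\<in>I. z a i j * v a i j)) \<omega>"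
   by (intro tendsto_intros v)
  show "((%n. - \<eta> + Z / real (Suc n)) \<longlongrightarrow> - \<eta>) \<omega>"
   using tendsto_add[OF tendsto_const[of "- \<eta>"] iS[of Z]] by simp
 qed (use ku2 in simp)
 ultimately show ?thesis by blast
qed

text \<open>Homogenisation: dividing the column \<open>d\<close> on the right by the square root of
  \<open>sqnorm I d + \<theta>\<close> makes its entries contractions, and multiplying back turns
  \<open>\<eta> *\<^sub>R p\<close> into \<open>\<eta> *\<^sub>R sqnorm I d\<close> as
  \<open>\<theta>\<close> tends to 0.\<close>

lemma wform_psd:
 assumes F: "finite F" "F \<subseteq> Ac" and I: "finite I" and \<eta>: "\<eta> >= 0"
  and bd: "!!d. [|!!i. d i \<in> Ac; !!i. i \<in> I ==> norm (d i) <= 1|] ==>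
   psd ((1/2) *\<^sub>R (wsum F I z d + adj (wsum F I z d)) + \<eta> *\<^sub>R p)"
  and d: "!!i. d i \<in> Ac"
 shows "psd ((1/2) *\<^sub>R (wsum F I z d + adj (wsum F I z d)) + \<eta> *\<^sub>R sqnorm I d)"
proof -
 define X where "X = wsum F I z"
 have *: "psd ((1/2) *\<^sub>R (X d + adj (X d)) + \<eta> *\<^sub>R (sqnorm I d + \<theta> *\<^sub>R p))" if \<theta>: "\<theta> > 0" for \<theta>
 proof -
  define m where "m = sqnorm I d + of_real \<theta>"
  have "psd (m - of_real \<theta>)" by (simp add: m_def psd_sqnorm)
  then obtain w where w: "psd w" "w * m = 1" "m * w = 1" using psd_inverse \<theta> by blast
  obtain v where v: "adj v = v" "v * v = w" "\<forall>y. y * w = w * y --> y * v = v * y"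
   using psd_sqrt[OF w(1)] by blast
  have mv: "m * v = v * m" using v(3) w by metis
  have am: "adj m = m" using psd_sa[OF psd_sqnorm] by (simp add: m_def adj_add)
  \<comment> \<open>\<open>v\<close> and \<open>g\<close> are the powers of \<open>m\<close> with
    exponents \<open>-1/2\<close> and \<open>1/2\<close>.\<close>
  define g where "g = m * v"
  have g: "v * g = 1" "adj g = g" "g * v = 1" "g * g = m"
  proof -
   have "v * g = m * (v * v)" unfolding g_def by (simp only: mult.assoc[symmetric] mv[symmetric])
   then show "v * g = 1" by (simp add: v(2) w(3))
   show "adj g = g" by (simp add: g_def adj_mult am v(1) mv)
   show gv: "g * v = 1" by (simp add: g_def mult.assoc v(2) w(3))
   have "g * g = m * (v * g)" by (simp only: g_def mult.assoc)
   then show "g * g = m" using \<open>v * g = 1\<close> by simp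
  qed
  define d' where "d' i = d i * v" for i
  have d'A: "d' i \<in> Ac" for i unfolding d'_def using d by (rule Ac_mult_left)
  have "norm (d' i) <= 1" if i: "i \<in> I" for i
  proof -
   have "sqnorm I d' = v * (m - of_real \<theta>) * v"
    unfolding sqnorm_def m_def d'_def by (simp add: adj_mult v(1) sum_distrib_left sum_distrib_right mult.assoc)
   also have "... = v * m * v - \<theta> *\<^sub>R w"
    by (simp add: right_diff_distrib left_diff_distrib mult_of_real_right v(2))
   also have "v * m * v = 1" using g(3) by (simp only: g_def mv)
   finally have s: "sqnorm I d' = 1 - \<theta> *\<^sub>R w" .
   have "psd (sqnorm I d' - adj (d' i) * d' i)"
    unfolding sqnorm_def using I i by (simp add: sum.remove psd_sum psd_adj_mult)
   then have "psd ((sqnorm I d' - adj (d' i) * d' i) + \<theta> *\<^sub>R w)" using \<theta> w by (intro psd_add psd_scaleR) auto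
   then have "psd (of_real (1^2) - adj (d' i) * d' i)" by (simp add: s)
   then show ?thesis by (rule norm_le_of_sq) simp
  qed
  then have "psd ((1/2) *\<^sub>R (X d' + adj (X d')) + \<eta> *\<^sub>R p)" unfolding X_def using bd d'A by blast
  then have "psd (adj g * ((1/2) *\<^sub>R (X d' + adj (X d')) + \<eta> *\<^sub>R p) * g)" by (rule psd_conj)
  also have "adj g * ((1/2) *\<^sub>R (X d' + adj (X d')) + \<eta> *\<^sub>R p) * g
    = (1/2) *\<^sub>R (g * X d' * g + adj (g * X d' * g)) + \<eta> *\<^sub>R (g * p * g)"
   by (simp add: adj_mult g(2) distrib_left distrib_right mult.assoc)
  also have "g * X d' * g = X d"
  proof -
   have "g * X d' * g = (\<Sum>a\<in>F. \<Sum>i\<in>I. \<Sum>j\<in>I. cx (z a i j) * (g * (adj (d' i) * a * d' j) * g))"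
    unfolding X_def wsum_def sum_distrib_left sum_distrib_right cx_left by (simp only: mult.assoc)
   moreover have "g * (adj (d' i) * a * d' j) * g = adj (d i) * a * d j" for a i j
   proof -
    have "g * (adj (d' i) * a * d' j) * g = (g * v) * adj (d i) * a * d j * (v * g)"
     by (simp only: d'_def adj_mult v(1) mult.assoc)
    then show ?thesis by (simp add: g)
   qed
   ultimately show ?thesis by (simp only: X_def wsum_def)
  qed
  also have "g * p * g = sqnorm I d + \<theta> *\<^sub>R p"
  proof -
   have "g * p * g = p * (g * g)" unfolding pc[of g] by (simp only: mult.assoc)
   also have "... = p * sqnorm I d + \<theta> *\<^sub>R p" by (simp add: g m_def distrib_left mult_of_real_right)
   also have "p * sqnorm I d = sqnorm I d"
    by (rule Ac_left) (unfold sqnorm_def, intro Ac_sum Ac_mult_right d)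
   finally show ?thesis .
  qed
  finally show ?thesis .
 qed
 have "(%n. (1/2) *\<^sub>R (X d + adj (X d)) + \<eta> *\<^sub>R (sqnorm I d + (1 / Suc n) *\<^sub>R p))
   \<longlonglongrightarrow> (1/2) *\<^sub>R (X d + adj (X d)) + \<eta> *\<^sub>R (sqnorm I d + 0 *\<^sub>R p)"
  by (intro tendsto_intros inverse_Suc_tendsto)
 then show ?thesis unfolding X_def[symmetric] using *
  by (intro psd_limit[where F = sequentially]) auto
qed

end

section \<open>Coefficients of completely positive maps and the separation argument\<close>

lemma sum_in_nonneg_Reals: "(!!i. i \<in> I ==> f i \<in> \<real>\<^sub>\<ge>\<^sub>0) ==> sum f I \<in> (\<real>\<^sub>\<ge>\<^sub>0 :: complex set)"
 by (induction I rule: infinite_finite_induct) (auto intro: nonneg_Reals_add_I)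

text \<open>A completely positive map into matrices, recorded through its matrix coefficients, pairs
 positively with every hermitian matrix over the corner whose form is bounded below.\<close>

locale cp_coeffs = tracial_core +
 fixes I :: "'i set" and U :: "'a => 'i => 'i => complex"
 assumes finI: "finite I"
  and U_add: "[|x \<in> Ac; y \<in> Ac|] ==> U (x + y) i j = U x i j + U y i j"
  and U_cx: "x \<in> Ac ==> U (cx z * x) i j = z * U x i j"
  and U_pos: "(!!i. c i \<in> Ac) ==> (\<Sum>i\<in>I. \<Sum>j\<in>I. U (adj (c i) * c j) i j) \<in> \<real>\<^sub>\<ge>\<^sub>0"
begin

lemma U_0: "U 0 i j = 0"
 using U_cx[OF Ac_0, of 0] by simp

lemma U_sum: "(!!k. k \<in> K ==> f k \<in> Ac) ==> U (sum f K) i j = (\<Sum>k\<in>K. U (f k) i j)"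
 by (induction K rule: infinite_finite_induct) (auto simp: U_0 U_add Ac_sum)

lemma U_scaleR: "x \<in> Ac ==> U (r *\<^sub>R x) i j = of_real r * U x i j"
 using U_cx[of x "of_real r"] by (simp add: cx_of_real mult_of_real_left)

lemma U_pair_real:
 assumes ij: "i \<in> I" "j \<in> I" and x: "x \<in> Ac" and y: "y \<in> Ac"
 shows "Im (U (adj x * x) i i + U (adj x * y) i j + U (adj y * x) j i + U (adj y * y) j j) = 0"
proof -
 define a b where "a k = (if k = i then x else 0)" "b k = (if k = j then y else 0)" for k
 have A: "a k \<in> Ac" "b k \<in> Ac" for k using x y by (auto simp: a_b_def)
 have e: "U (adj (a k + b k) * (a l + b l)) k l
   = U (adj (a k) * a l) k l + U (adj (a k) * b l) k l + U (adj (b k) * a l) k l + U (adj (b k) * b l) k l" for k l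
 proof -
  have "adj (a k + b k) * (a l + b l) = adj (a k) * a l + adj (a k) * b l + adj (b k) * a l + adj (b k) * b l"
   by (simp add: adj_add distrib_left distrib_right)
  then show ?thesis using A by (simp add: U_add Ac_mult_right Ac_add)
 qed
 have s: "(\<Sum>k\<in>I. \<Sum>l\<in>I. U (adj (if k = i' then x' else 0) * (if l = j' then y' else 0)) k l) = U (adj x' * y') i' j'"
  if "i' \<in> I" "j' \<in> I" for i' j' x' y'
 proof -
  have "U (adj (if k = i' then x' else 0) * (if l = j' then y' else 0)) k l
    = (if l = j' then (if k = i' then U (adj x' * y') i' j' else 0) else 0)" for k l by (simp add: U_0)
  then show ?thesis using that finI by simp
 qed
 have "(\<Sum>k\<in>I. \<Sum>l\<in>I. U (adj (a k + b k) * (a l + b l)) k l)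
   = U (adj x * x) i i + U (adj x * y) i j + U (adj y * x) j i + U (adj y * y) j j"
  unfolding e sum.distrib unfolding a_b_def using ij by (simp only: s)
 moreover have "(\<Sum>k\<in>I. \<Sum>l\<in>I. U (adj (a k + b k) * (a l + b l)) k l) \<in> \<real>\<^sub>\<ge>\<^sub>0"
  by (rule U_pos) (use A in auto)
 ultimately show ?thesis by (simp add: complex_nonneg_Reals_iff)
qed

text \<open>Polarisation: positivity yields only that certain sums are real; testing the pairs
  \<open>p, a\<close> and \<open>p, cx \<i> * a\<close> separates real and imaginary part.\<close>

lemma U_adj:
 assumes ij: "i \<in> I" "j \<in> I" and a: "a \<in> Ac"
 shows "U (adj a) j i = cnj (U a i j)"
proof -
 have R: "Im (U (adj x * x) i i) = 0" if "i \<in> I" "x \<in> Ac" for x i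
  using U_pair_real[OF that(1,1,2) Ac_0] by (simp add: U_0)
 define b where "b = cx \<i> * a"
 have b: "b \<in> Ac" unfolding b_def using a by (rule Ac_cx)
 have ab: "adj b = cx (cnj \<i>) * adj a" by (simp only: b_def adj_mult adj_cx cx_comm)
 have ap1: "adj p * x = x" "adj x * p = adj x" if "x \<in> Ac" for x using that Ac_left Ac_right Ac_adj ap by auto
 have 1: "Im (U a i j + U (adj a) j i) = 0"
  using U_pair_real[OF ij Ac_p a] R[OF ij(1) Ac_p] R[OF ij(2) a] a by (simp add: ap1)
 have 2: "Im (\<i> * U a i j + cnj \<i> * U (adj a) j i) = 0"
 proof -
  have "U b i j = \<i> * U a i j" "U (adj b) j i = cnj \<i> * U (adj a) j i"
   unfolding ab unfolding b_def using a by (simp_all only: U_cx Ac_adj)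
  then show ?thesis using U_pair_real[OF ij Ac_p b] R[OF ij(1) Ac_p] R[OF ij(2) b] b by (simp add: ap1)
 qed
 show ?thesis using 1 2 by (simp add: complex_eq_iff)
qed

text \<open>Shifting the matrix by \<open>2 * \<eta>\<close> on the diagonal makes its form at least
  \<open>\<eta>\<close>. Elimination then writes it as a sum of matrices
  \<open>adj (b i) * b j\<close>, on which \<open>U_pos\<close> applies; the shift accounts for the
  trace term.\<close>

lemma wform_pairing:
 assumes F: "finite F" "F \<subseteq> Ac" and \<eta>: "\<eta> > 0"
  and bd: "!!d. [|!!i. d i \<in> Ac; !!i. i \<in> I ==> norm (d i) <= 1|] ==>
   psd ((1/2) *\<^sub>R (wsum F I z d + adj (wsum F I z d)) + \<eta> *\<^sub>R p)"
 shows "Re (\<Sum>a\<in>F. \<Sum>i\<in>I. \<Sum>j\<in>I. z a i j * U a i j) + 2 * \<eta> * Re (\<Sum>i\<in>I. U p i i) >= 0"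
proof -
 \<comment> \<open>The hermitian matrix whose form is the real part of \<open>wsum F I z\<close>, so
   that the bound on columns becomes a bound on \<open>qform I Z\<close>.\<close>
 define Z where "Z i j = (1/2) *\<^sub>R (\<Sum>a\<in>F. cx (z a i j) * a + cx (cnj (z a j i)) * adj a)" for i j
 have ZA: "Z i j \<in> Ac" for i j unfolding Z_def using F by (intro Ac_scaleR Ac_sum Ac_add Ac_mult_right) auto
 have her: "adj (Z i j) = Z j i" for i j
  unfolding Z_def adj_scaleR adj_sum
  by (intro arg_cong[where f = "%x. (1/2) *\<^sub>R x"] sum.cong refl)
   (simp add: adj_add adj_mult adj_cx cx_comm[symmetric] add.commute)
 have qZ: "qform I Z d = (1/2) *\<^sub>R (wsum F I z d + adj (wsum F I z d))" for d
 proof -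
  have "adj (wsum F I z d) = (\<Sum>a\<in>F. \<Sum>i\<in>I. \<Sum>j\<in>I. cx (cnj (z a i j)) * (adj (d j) * adj a * d i))"
   unfolding wsum_def adj_sum by (intro sum.cong refl) (simp add: adj_mult adj_cx cx_comm[symmetric] mult.assoc)
  also have "... = (\<Sum>a\<in>F. \<Sum>i\<in>I. \<Sum>j\<in>I. cx (cnj (z a j i)) * (adj (d i) * adj a * d j))"
   by (intro sum.cong refl sum.swap)
  also have "... = (\<Sum>i\<in>I. \<Sum>j\<in>I. \<Sum>a\<in>F. cx (cnj (z a j i)) * (adj (d i) * adj a * d j))" by (rule sum_rotate)
  finally have 1: "adj (wsum F I z d) = ..." .
  have 2: "wsum F I z d = (\<Sum>i\<in>I. \<Sum>j\<in>I. \<Sum>a\<in>F. cx (z a i j) * (adj (d i) * a * d j))"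
   unfolding wsum_def by (rule sum_rotate)
  have "adj (d i) * Z i j * d j = (1/2) *\<^sub>R ((\<Sum>a\<in>F. cx (z a i j) * (adj (d i) * a * d j))
    + (\<Sum>a\<in>F. cx (cnj (z a j i)) * (adj (d i) * adj a * d j)))" for i j
   unfolding Z_def by (simp add: sum_distrib_left sum_distrib_right distrib_left distrib_right sum.distrib mult.assoc cx_left)
  then have "qform I Z d = (1/2) *\<^sub>R ((\<Sum>i\<in>I. \<Sum>j\<in>I. \<Sum>a\<in>F. cx (z a i j) * (adj (d i) * a * d j))
    + (\<Sum>i\<in>I. \<Sum>j\<in>I. \<Sum>a\<in>F. cx (cnj (z a j i)) * (adj (d i) * adj a * d j)))"
   by (simp only: qform_def sum.distrib scaleR_sum_right[symmetric])
  then show ?thesis unfolding 1 by (simp only: 2)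
 qed
 have qp: "qform I Z d = qform I Z (%i. p * d i)" for d
 proof -
  have "adj (p * d i) * Z i j * (p * d j) = adj (d i) * Z i j * d j" for i j
  proof -
   have "adj (p * d i) * Z i j * (p * d j) = adj (d i) * (p * Z i j * p) * d j"
    by (simp only: adj_mult ap mult.assoc)
   then show ?thesis using ZA by (simp add: Ac_left Ac_right)
  qed
  then show ?thesis by (simp add: qform_def)
 qed
 have form: "psd (qform I Z d + \<eta> *\<^sub>R sqnorm I d)" for d
 proof -
  have "psd (qform I Z (%i. p * d i) + \<eta> *\<^sub>R sqnorm I (%i. p * d i))"
   unfolding qZ using \<eta> by (intro wform_psd[OF F finI _ bd]) (auto simp: Ac_mult_left)
  moreover have "psd (\<eta> *\<^sub>R (sqnorm I d - sqnorm I (%i. p * d i)))"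
  proof -
   have "adj (d i) * d i - adj (p * d i) * (p * d i) = adj ((1 - p) * d i) * ((1 - p) * d i)" for i
   proof -
    have "p * (p * x) = p * x" for x using pp by (simp flip: mult.assoc)
    then show ?thesis by (simp add: adj_mult adj_diff ap algebra_simps)
   qed
   then have "psd (sqnorm I d - sqnorm I (%i. p * d i))"
    unfolding sqnorm_def sum_subtractf[symmetric] by (simp only: psd_sum psd_adj_mult)
   then show ?thesis using \<eta> by (intro psd_scaleR) auto
  qed
  ultimately have "psd ((qform I Z (%i. p * d i) + \<eta> *\<^sub>R sqnorm I (%i. p * d i)) + \<eta> *\<^sub>R (sqnorm I d - sqnorm I (%i. p * d i)))"
   by (rule psd_add)
  then show ?thesis by (simp add: qp[of d] scaleR_diff_right)
 qed
 define Z' where "Z' i j = Z i j + (2 * \<eta>) *\<^sub>R mone i j" for i j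
 have "\<exists>c. \<forall>i\<in>I. \<forall>j\<in>I. Z' i j = (\<Sum>q\<in>I. adj (c q i) * c q j)"
 proof (rule hermitian_factorization[OF finI \<eta>])
  show "adj (Z' i j) = Z' j i" for i j by (simp add: Z'_def adj_add her adj_scaleR mone_def)
  show "psd (qform I Z' d - \<eta> *\<^sub>R sqnorm I d)" for d
  proof -
   have "qform I Z' d - \<eta> *\<^sub>R sqnorm I d = qform I Z d + \<eta> *\<^sub>R sqnorm I d"
    unfolding Z'_def[abs_def] qform_add_scalar[OF finI] by (simp add: algebra_simps flip: scaleR_add_left)
   then show ?thesis using form by simp
  qed
 qed
 then obtain c where c: "!!i j. i \<in> I ==> j \<in> I ==> Z' i j = (\<Sum>q\<in>I. adj (c q i) * c q j)" by blast
 \<comment> \<open>The factors are found in the ambient algebra, but \<open>U_pos\<close> speaks of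
   the corner; \<open>p\<close> acts trivially on \<open>Z\<close>.\<close>
 define b where "b q i = p * c q i" for q i
 have bA: "b q i \<in> Ac" for q i by (simp add: b_def Ac_mult_left)
 have Zb: "Z i j + (if i = j then (2 * \<eta>) *\<^sub>R p else 0) = (\<Sum>q\<in>I. adj (b q i) * b q j)" if "i \<in> I" "j \<in> I" for i j
 proof -
  have "(\<Sum>q\<in>I. adj (b q i) * b q j) = p * (\<Sum>q\<in>I. adj (c q i) * c q j)"
  proof -
   have "adj (b q i) * b q j = p * (adj (c q i) * c q j)" for q
   proof -
    have "adj (b q i) * b q j = adj (c q i) * (p * p) * c q j" by (simp only: b_def adj_mult ap mult.assoc)
    also have "... = p * (adj (c q i) * c q j)" unfolding pp pc[of "adj (c q i)"] by (simp only: mult.assoc)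
    finally show ?thesis .
   qed
   then show ?thesis by (simp add: sum_distrib_left)
  qed
  also have "... = p * Z' i j" using c that by simp
  also have "... = Z i j + (if i = j then (2 * \<eta>) *\<^sub>R p else 0)"
   using ZA by (simp add: Z'_def mone_def distrib_left Ac_left)
  finally show ?thesis by simp
 qed
 have "(\<Sum>i\<in>I. \<Sum>j\<in>I. U (Z i j + (if i = j then (2 * \<eta>) *\<^sub>R p else 0)) i j)
   = (\<Sum>q\<in>I. \<Sum>i\<in>I. \<Sum>j\<in>I. U (adj (b q i) * b q j) i j)"
 proof -
  have "(\<Sum>i\<in>I. \<Sum>j\<in>I. U (Z i j + (if i = j then (2 * \<eta>) *\<^sub>R p else 0)) i j)
   = (\<Sum>i\<in>I. \<Sum>j\<in>I. \<Sum>q\<in>I. U (adj (b q i) * b q j) i j)"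
   by (intro sum.cong refl) (simp add: Zb U_sum bA Ac_mult_right)
  also have "... = (\<Sum>q\<in>I. \<Sum>i\<in>I. \<Sum>j\<in>I. U (adj (b q i) * b q j) i j)" by (rule sum_rotate[symmetric])
  finally show ?thesis .
 qed
 moreover have "(\<Sum>q\<in>I. \<Sum>i\<in>I. \<Sum>j\<in>I. U (adj (b q i) * b q j) i j) \<in> \<real>\<^sub>\<ge>\<^sub>0"
  by (rule sum_in_nonneg_Reals) (intro U_pos bA)
 ultimately have nn: "Re (\<Sum>i\<in>I. \<Sum>j\<in>I. U (Z i j + (if i = j then (2 * \<eta>) *\<^sub>R p else 0)) i j) >= 0"
  by (simp add: complex_nonneg_Reals_iff)
 have "U (Z i j + (if i = j then (2 * \<eta>) *\<^sub>R p else 0)) i j = U (Z i j) i j + (if i = j then of_real (2 * \<eta>) * U p i i else 0)" for i j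
  using ZA by (simp add: U_add U_scaleR Ac_scaleR U_0)
 then have s: "(\<Sum>i\<in>I. \<Sum>j\<in>I. U (Z i j + (if i = j then (2 * \<eta>) *\<^sub>R p else 0)) i j)
   = (\<Sum>i\<in>I. \<Sum>j\<in>I. U (Z i j) i j) + of_real (2 * \<eta>) * (\<Sum>i\<in>I. U p i i)"
  unfolding sum_distrib_left using finI by (simp only: sum.distrib sum.delta' if_True cong: sum.cong)
 have "Re (\<Sum>i\<in>I. \<Sum>j\<in>I. U (Z i j) i j) = Re (\<Sum>a\<in>F. \<Sum>i\<in>I. \<Sum>j\<in>I. z a i j * U a i j)"
 proof -
  have U1: "U (Z i j) i j = (1/2) * (\<Sum>a\<in>F. z a i j * U a i j + cnj (z a j i * U a j i))" if "i \<in> I" "j \<in> I" for i j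
  proof -
   have A1: "cx (z a i j) * a + cx (cnj (z a j i)) * adj a \<in> Ac" if "a \<in> F" for a using that F by (intro Ac_add Ac_mult_right) auto
   have "U (Z i j) i j = of_real (1/2) * (\<Sum>a\<in>F. U (cx (z a i j) * a + cx (cnj (z a j i)) * adj a) i j)"
    unfolding Z_def using A1 by (simp only: U_scaleR[OF Ac_sum] U_sum)
   also have "(\<Sum>a\<in>F. U (cx (z a i j) * a + cx (cnj (z a j i)) * adj a) i j) = (\<Sum>a\<in>F. z a i j * U a i j + cnj (z a j i * U a j i))"
   proof (intro sum.cong refl)
    fix a assume "a \<in> F"
    then have a: "a \<in> Ac" using F by blast
    show "U (cx (z a i j) * a + cx (cnj (z a j i)) * adj a) i j = z a i j * U a i j + cnj (z a j i * U a j i)"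
     using a that by (simp add: U_add Ac_mult_right Ac_adj U_cx U_adj)
   qed
   finally show ?thesis by simp
  qed
  have "(\<Sum>i\<in>I. \<Sum>j\<in>I. U (Z i j) i j) = (1/2) * ((\<Sum>i\<in>I. \<Sum>j\<in>I. \<Sum>a\<in>F. z a i j * U a i j) + (\<Sum>i\<in>I. \<Sum>j\<in>I. \<Sum>a\<in>F. cnj (z a j i * U a j i)))"
   by (simp add: U1 sum.distrib sum_distrib_left distrib_left cong: sum.cong)
  also have "(\<Sum>i\<in>I. \<Sum>j\<in>I. \<Sum>a\<in>F. cnj (z a j i * U a j i)) = cnj (\<Sum>i\<in>I. \<Sum>j\<in>I. \<Sum>a\<in>F. z a i j * U a i j)"
   by (simp add: cnj_sum) (rule sum.swap)
  finally have S: "(\<Sum>i\<in>I. \<Sum>j\<in>I. U (Z i j) i j) = (1/2) * ((\<Sum>i\<in>I. \<Sum>j\<in>I. \<Sum>a\<in>F. z a i j * U a i j)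
    + cnj (\<Sum>i\<in>I. \<Sum>j\<in>I. \<Sum>a\<in>F. z a i j * U a i j))" .
  have "Re ((1/2) * (w + cnj w)) = Re w" for w by simp
  then have "Re (\<Sum>i\<in>I. \<Sum>j\<in>I. U (Z i j) i j) = Re (\<Sum>i\<in>I. \<Sum>j\<in>I. \<Sum>a\<in>F. z a i j * U a i j)"
   unfolding S .
  also have "(\<Sum>i\<in>I. \<Sum>j\<in>I. \<Sum>a\<in>F. z a i j * U a i j) = (\<Sum>a\<in>F. \<Sum>i\<in>I. \<Sum>j\<in>I. z a i j * U a i j)"
   by (rule sum_rotate[symmetric])
  finally show ?thesis .
 qed
 then show ?thesis using nn unfolding s by simp
qed

text \<open>Separation from the cone of excisable families, run with an almost nearest point instead of
 the nearest one, so that neither closedness nor local compactness is needed.\<close>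

lemma excisable_dense:
 assumes small and \<omega>: "free_ultrafilter \<omega>" and F: "finite F" "F \<subseteq> Ac" and \<epsilon>: "\<epsilon> > 0"
 shows "\<exists>u. excisable F I u \<and> (\<forall>a\<in>F. \<forall>i\<in>I. \<forall>j\<in>I. cmod (u a i j - U a i j) <= \<epsilon>)"
proof -
 define ip where "ip z u = Re (\<Sum>a\<in>F. \<Sum>i\<in>I. \<Sum>j\<in>I. cnj (z a i j) * u a i j)"
  for z u :: "'a => 'i => 'i => complex"
 define nq where "nq u = (\<Sum>a\<in>F. \<Sum>i\<in>I. \<Sum>j\<in>I. cmod (u a i j) ^ 2)" for u :: "'a => 'i => 'i => complex"
 have nq0: "nq u >= 0" for u by (simp add: nq_def sum_nonneg)
 have expand: "nq (%a i j. z a i j + of_real t * u a i j) = nq z + 2 * t * ip z u + t^2 * nq u" for z u t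
 proof -
  have "cmod (w + of_real t * v) ^ 2 = cmod w ^ 2 + 2 * t * Re (cnj w * v) + t^2 * cmod v ^ 2" for w v :: complex
   unfolding cmod_power2 by (simp add: power2_eq_square algebra_simps)
  then show ?thesis by (simp only: nq_def ip_def Re_sum sum_distrib_left sum.distrib)
 qed
 define X where "X = {nq (%a i j. u a i j - U a i j) |u. excisable F I u}"
 define D where "D = Inf X"
 have Xne: "X ~= {}" unfolding X_def using excisable_0[of F I] by blast
 have bdd: "bdd_below X" by (rule bdd_belowI[of _ 0]) (auto simp: X_def nq0)
 have Dle: "D <= nq (%a i j. u a i j - U a i j)" if "excisable F I u" for u
  unfolding D_def using bdd by (rule cInf_lower[rotated]) (use that in \<open>auto simp: X_def\<close>)
 have "D <= 0"
 proof (rule ccontr)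
  assume "\<not> D <= 0"
  then have D: "D > 0" by simp
  \<comment> \<open>\<open>Y0\<close> bounds \<open>nq\<close> of every family coming from a column
    of contractions and \<open>C0\<close> that of every almost nearest \<open>c\<close>; neither
    depends on \<open>\<eta>\<close>.\<close>
  define Y0 where "Y0 = (\<Sum>a\<in>F. \<Sum>i\<in>I. \<Sum>j\<in>I. norm a ^ 2)"
  define C0 where "C0 = 2 * nq U + 2 * (D + 1)"
  define tr where "tr = Re (\<Sum>i\<in>I. U p i i)"
  have Y0: "Y0 >= 0" by (simp add: Y0_def sum_nonneg)
  have C0: "C0 >= 0" using nq0 D by (simp add: C0_def)
  have key: "D <= \<eta> * ((1 + C0) / 2 + 2 * (1 + Y0) * tr)" if \<eta>: "0 < \<eta>" "\<eta> < 1" for \<eta>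
  proof -
   \<comment> \<open>Nearest up to \<open>\<eta>^2\<close>: moving by \<open>\<eta>\<close> inside
     the cone can then gain only second order, so the first-order conditions of a nearest point hold
     up to \<open>O(\<eta>)\<close>.\<close>
   have "\<exists>x\<in>X. x < D + \<eta>^2" unfolding D_def by (rule cInf_lessD[OF Xne]) (use \<eta> in simp)
   then obtain c where c: "excisable F I c" "nq (%a i j. c a i j - U a i j) < D + \<eta>^2"
    by (auto simp: X_def)
   define z where "z a i j = c a i j - U a i j" for a i j
   have nz: "nq z < D + \<eta>^2" "D <= nq z"
    using c Dle[OF c(1)] by (simp_all add: z_def[abs_def])
   have 1: "ip z y >= - \<eta> * (1 + nq y) / 2" if y: "excisable F I y" for y
   proof -
    have "excisable F I (%a i j. c a i j + of_real \<eta> * y a i j)"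
     by (rule excisable_add[OF assms(1) F finI c(1) excisable_scale[OF y]]) (use \<eta> in simp)
    from Dle[OF this] have "D <= nq (%a i j. z a i j + of_real \<eta> * y a i j)"
     by (simp add: z_def algebra_simps)
    then have "0 < \<eta>^2 + 2 * \<eta> * ip z y + \<eta>^2 * nq y" using nz by (simp add: expand)
    also have "... = \<eta> * (\<eta> + 2 * ip z y + \<eta> * nq y)" by (simp add: algebra_simps power2_eq_square)
    finally have "0 < \<eta> + 2 * ip z y + \<eta> * nq y" using \<eta> by (simp add: zero_less_mult_iff)
    then show ?thesis by (simp add: algebra_simps)
   qed
   \<comment> \<open>Moving towards the apex of the cone; for an exact nearest point
     \<open>ip z c\<close> would vanish.\<close>
   have 2: "ip z c <= \<eta> * (1 + nq c) / 2"
   proof -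
    have "excisable F I (%a i j. of_real (1 - \<eta>) * c a i j)"
     by (rule excisable_scale[OF c(1)]) (use \<eta> in simp)
    from Dle[OF this] have "D <= nq (%a i j. z a i j + of_real (- \<eta>) * c a i j)"
     by (simp add: z_def algebra_simps)
    then have "0 < \<eta>^2 - 2 * \<eta> * ip z c + \<eta>^2 * nq c" using nz unfolding expand by simp
    also have "... = \<eta> * (\<eta> - 2 * ip z c + \<eta> * nq c)" by (simp add: algebra_simps power2_eq_square)
    finally have "0 < \<eta> - 2 * ip z c + \<eta> * nq c" using \<eta> by (simp add: zero_less_mult_iff)
    then show ?thesis by (simp add: algebra_simps)
   qed
   have nc: "nq c <= C0"
   proof -
    have "cmod (c a i j) ^ 2 <= 2 * cmod (U a i j) ^ 2 + 2 * cmod (z a i j) ^ 2" for a i j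
    proof -
     have "cmod (c a i j) <= cmod (U a i j) + cmod (z a i j)"
      using norm_triangle_ineq[of "U a i j" "z a i j"] by (simp add: z_def)
     then have "cmod (c a i j) ^ 2 <= (cmod (U a i j) + cmod (z a i j)) ^ 2" by (intro power_mono) auto
     also have "... <= 2 * cmod (U a i j) ^ 2 + 2 * cmod (z a i j) ^ 2"
      using sum_squares_bound[of "cmod (U a i j)" "cmod (z a i j)"] by (simp add: power2_sum)
     finally show ?thesis .
    qed
    then have "nq c <= 2 * nq U + 2 * nq z"
     unfolding nq_def sum_distrib_left sum.distrib[symmetric] by (intro sum_mono)
    moreover have "\<eta>^2 <= 1" using \<eta> by (simp add: power_le_one)
    ultimately show ?thesis using nz by (simp add: C0_def)
   qed
   \<comment> \<open>Chosen so that a column on which the form falls below \<open>- \<eta>'\<close>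
     would yield an excisable family contradicting 1.\<close>
   define \<eta>' where "\<eta>' = \<eta> * (1 + Y0)"
   have \<eta>': "\<eta>' > 0" using \<eta> Y0 by (simp add: \<eta>'_def add_pos_nonneg)
   have "Re (\<Sum>a\<in>F. \<Sum>i\<in>I. \<Sum>j\<in>I. cnj (z a i j) * U a i j) + 2 * \<eta>' * tr >= 0"
    unfolding tr_def
   proof (rule wform_pairing[OF F \<eta>'])
    fix d :: "'i => 'a"
    assume d: "!!i. d i \<in> Ac" "!!i. i \<in> I ==> norm (d i) <= 1"
    show "psd ((1/2) *\<^sub>R (wsum F I (%a i j. cnj (z a i j)) d + adj (wsum F I (%a i j. cnj (z a i j)) d)) + \<eta>' *\<^sub>R p)"
    proof (rule ccontr)
     assume neg: "\<not> ?thesis"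
     obtain y where y: "excisable F I y" "\<forall>a\<in>F. \<forall>i\<in>I. \<forall>j\<in>I. cmod (y a i j) <= norm (adj (d i) * a * d j)"
      "ip z y <= - \<eta>'"
      unfolding ip_def using excisable_vector[OF \<omega> F finI d(1) neg] by blast
     have "nq y <= Y0" unfolding nq_def Y0_def
     proof (intro sum_mono power_mono)
      fix a i j assume aij: "a \<in> F" "i \<in> I" "j \<in> I"
      have "norm (adj (d i) * a) <= 1 * norm a"
       by (rule order_trans[OF norm_mult_ineq], rule mult_right_mono) (use d(2) aij in auto)
      moreover have "norm (adj (d i) * a * d j) <= norm (adj (d i) * a) * norm (d j)" by (rule norm_mult_ineq)
      moreover have "norm (adj (d i) * a) * norm (d j) <= norm (adj (d i) * a)"
       by (rule mult_left_le) (use d(2) aij in auto)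
      ultimately show "cmod (y a i j) <= norm a" using y(2) aij by fastforce
     qed simp
     then have "\<eta> * (1 + nq y) <= \<eta>'" using \<eta> by (simp add: \<eta>'_def)
     then show False using 1[OF y(1)] y(3) \<eta>' by simp
    qed
   qed
   moreover have "ip z U = ip z c - nq z"
   proof -
    have "cnj (z a i j) * U a i j = cnj (z a i j) * c a i j - of_real (cmod (z a i j) ^ 2)" for a i j
     unfolding complex_norm_square by (simp add: z_def algebra_simps)
    then have "ip z U = Re (\<Sum>a\<in>F. \<Sum>i\<in>I. \<Sum>j\<in>I. cnj (z a i j) * c a i j - of_real (cmod (z a i j) ^ 2))"
     unfolding ip_def by simp
    then show ?thesis by (simp add: ip_def nq_def sum_subtractf Re_sum del: of_real_power)
   qed
   ultimately have "0 <= ip z c - nq z + 2 * \<eta>' * tr" by (simp add: ip_def)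
   moreover have "\<eta> * (1 + nq c) <= \<eta> * (1 + C0)" using nc \<eta> by simp
   ultimately have "D <= \<eta> * (1 + C0) / 2 + 2 * \<eta>' * tr" using 2 nz by simp
   also have "... = \<eta> * ((1 + C0) / 2 + 2 * (1 + Y0) * tr)" by (simp add: \<eta>'_def algebra_simps add_divide_distrib)
   finally show ?thesis .
  qed
  \<comment> \<open>\<open>D <= \<eta> * B\<close> for all small \<open>\<eta>\<close> with
    \<open>B\<close> fixed is impossible for \<open>D > 0\<close>.\<close>
  define B where "B = (1 + C0) / 2 + 2 * (1 + Y0) * tr"
  have "D <= (1/2) * B" using key[of "1/2"] by (simp add: B_def)
  then have B: "B > 0" using D by simp
  define \<eta> where "\<eta> = min (1/2) (D / (2 * B))"
  have "0 < \<eta>" "\<eta> < 1" using D B by (auto simp: \<eta>_def)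
  then have "D <= \<eta> * B" using key unfolding B_def by blast
  also have "... <= D / (2 * B) * B" using B by (intro mult_right_mono) (auto simp: \<eta>_def)
  also have "... = D / 2" using B by simp
  finally show False using D by simp
 qed
 moreover have "\<epsilon>^2 > 0" using \<epsilon> by simp
 ultimately have "Inf X < \<epsilon>^2" unfolding D_def by linarith
 then have "\<exists>x\<in>X. x < \<epsilon>^2" by (rule cInf_lessD[OF Xne])
 then obtain u where u: "excisable F I u" "nq (%a i j. u a i j - U a i j) < \<epsilon>^2" by (auto simp: X_def)
 have "cmod (u a i j - U a i j) <= \<epsilon>" if a: "a \<in> F" "i \<in> I" "j \<in> I" for a i j
 proof -
  let ?f = "%a i j. cmod (u a i j - U a i j) ^ 2"
  have "?f a i j <= (\<Sum>j\<in>I. ?f a i j)" using a finI by (intro member_le_sum) auto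
  also have "... <= (\<Sum>i\<in>I. \<Sum>j\<in>I. ?f a i j)"
   using a finI by (intro member_le_sum[of i I "%i. \<Sum>j\<in>I. ?f a i j"]) (auto intro!: sum_nonneg)
  also have "... <= nq (%a i j. u a i j - U a i j)"
   unfolding nq_def using a F by (intro member_le_sum[of a F "%a. \<Sum>i\<in>I. \<Sum>j\<in>I. ?f a i j"]) (auto intro!: sum_nonneg)
  finally have "?f a i j <= \<epsilon>^2" using u by simp
  then show ?thesis using \<epsilon> by (simp add: power2_le_iff_abs_le)
 qed
 then show ?thesis using u by blast
qed

end

section \<open>Asymptotically central sequences\<close>

lemma norm_mult_le: "norm x <= A ==> norm y <= B ==> norm (x * y) <= A * (B::real)"
 for x y :: "'a::real_normed_algebra"
 by (rule order_trans[OF norm_mult_ineq mult_mono]) (auto intro: order_trans[OF norm_ge_zero])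

lemma tendsto_mult_bounded_right:
 fixes f g :: "'b => 'a::real_normed_algebra"
 assumes "(f \<longlongrightarrow> 0) F" "!!n. norm (g n) <= B"
 shows "((%n. f n * g n) \<longlongrightarrow> 0) F"
proof (rule Lim_null_comparison)
 show "\<forall>\<^sub>F n in F. norm (f n * g n) <= norm (f n) * B"
  by (intro always_eventually allI order_trans[OF norm_mult_ineq] mult_left_mono assms(2) norm_ge_zero)
 show "((%n. norm (f n) * B) \<longlongrightarrow> 0) F"
  by (rule tendsto_mult_left_zero[OF tendsto_norm_zero[OF assms(1)]])
qed

lemma tendsto_mult_bounded_left:
 fixes f g :: "'b => 'a::real_normed_algebra"
 assumes "(f \<longlongrightarrow> 0) F" "!!n. norm (g n) <= B"
 shows "((%n. g n * f n) \<longlongrightarrow> 0) F"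
proof (rule Lim_null_comparison)
 show "\<forall>\<^sub>F n in F. norm (g n * f n) <= B * norm (f n)"
  by (intro always_eventually allI order_trans[OF norm_mult_ineq] mult_right_mono assms(2) norm_ge_zero)
 show "((%n. B * norm (f n)) \<longlongrightarrow> 0) F"
  by (rule tendsto_mult_right_zero[OF tendsto_norm_zero[OF assms(1)]])
qed

lemma norm_peval_bound: "\<exists>B. \<forall>x::'a::real_normed_algebra_1. norm x <= R --> norm (peval q x) <= B"
proof (induction q)
 case (pCons c q)
 then obtain B where B: "\<forall>x::'a. norm x <= R --> norm (peval q x) <= B" by blast
 have "norm (peval (pCons c q) x) <= \<bar>c\<bar> + R * B" if x: "norm x <= R" for x :: 'a
 proof -
  have "R >= 0" using x norm_ge_zero[of x] by linarith
  then have "norm (x * peval q x) <= R * B"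
   using B x by (intro order_trans[OF norm_mult_ineq] mult_mono) auto
  moreover have "norm (peval (pCons c q) x) <= \<bar>c\<bar> + norm (x * peval q x)"
   using norm_triangle_ineq[of "of_real c" "x * peval q x"] by simp
  ultimately show ?thesis by linarith
 qed
 then show ?case by blast
qed (auto intro: exI[of _ 0])

text \<open>Induction for polynomials; then one Weierstrass polynomial on \<open>{-R..R}\<close>
  serves all \<open>n\<close>, as the norms are uniformly bounded.\<close>

lemma cfc_asymptotically_commute:
 fixes x :: "'b => 'a::cstar"
 assumes f: "continuous_on UNIV f" and x: "!!n. adj (x n) = x n" "!!n. norm (x n) <= R"
  and c: "((%n. x n * a - a * x n) \<longlongrightarrow> 0) F"
 shows "((%n. cfc f (x n) * a - a * cfc f (x n)) \<longlongrightarrow> 0) F"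
proof -
 have poly: "((%n. peval q (x n) * a - a * peval q (x n)) \<longlongrightarrow> 0) F" for q
 proof (induction q)
  case (pCons r q)
  obtain B where B: "!!n. norm (peval q (x n)) <= B" using norm_peval_bound[of R q] x(2) by blast
  have "((%n. x n * (peval q (x n) * a - a * peval q (x n)) + (x n * a - a * x n) * peval q (x n)) \<longlongrightarrow> 0 + 0) F"
   by (intro tendsto_add tendsto_mult_bounded_left[OF pCons(2) x(2)] tendsto_mult_bounded_right[OF c B])
  then show ?case by (simp add: algebra_simps of_real_def)
 qed simp
 show ?thesis
 proof (rule tendstoI)
  fix \<epsilon> :: real assume \<epsilon>: "\<epsilon> > 0"
  define \<theta> where "\<theta> = \<epsilon> / (4 * (norm a + 1))"
  have \<theta>: "\<theta> > 0" using \<epsilon> by (simp add: \<theta>_def add_nonneg_pos)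
  have na: "\<theta> * norm a <= \<epsilon> / 4"
  proof -
   have "\<theta> * norm a <= \<theta> * (norm a + 1)" using \<theta> by simp
   also have "... = \<epsilon> / 4" unfolding \<theta>_def by (simp add: field_simps add_nonneg_eq_0_iff)
   finally show ?thesis .
  qed
  obtain q where q: "\<forall>t\<in>{-R..R}. \<bar>f t - poly q t\<bar> < \<theta>" using weierstrass_poly[OF f \<theta>] by blast
  have d: "norm (cfc f (x n) - peval q (x n)) <= \<theta>" for n
  proof (rule cfc_peval_dist[OF f x(1)])
   fix t assume "t \<in> {- norm (x n)..norm (x n)}"
   then have "t \<in> {-R..R}" using x(2)[of n] by auto
   then show "\<bar>f t - poly q t\<bar> <= \<theta>" using q by fastforce
  qed
  have "eventually (%n. norm (peval q (x n) * a - a * peval q (x n)) < \<epsilon>/4) F"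
   using tendstoD[OF poly, of "\<epsilon>/4"] \<epsilon> by (simp add: dist_norm)
  then show "\<forall>\<^sub>F n in F. dist (cfc f (x n) * a - a * cfc f (x n)) 0 < \<epsilon>"
  proof eventually_elim
   case (elim n)
   let ?e = "cfc f (x n) - peval q (x n)"
   have eq: "cfc f (x n) * a - a * cfc f (x n) = ?e * a + (peval q (x n) * a - a * peval q (x n)) - a * ?e"
    by (simp add: algebra_simps)
   have "norm (?e * a) <= \<theta> * norm a"
    by (intro order_trans[OF norm_mult_ineq] mult_right_mono d) auto
   moreover have "norm (a * ?e) <= norm a * \<theta>"
    by (intro order_trans[OF norm_mult_ineq] mult_left_mono d) auto
   moreover have "norm (?e * a + (peval q (x n) * a - a * peval q (x n)) - a * ?e)
     <= norm (?e * a) + norm (peval q (x n) * a - a * peval q (x n)) + norm (a * ?e)"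
    by (intro order_trans[OF norm_triangle_ineq4] add_right_mono norm_triangle_ineq)
   ultimately have "norm (?e * a + (peval q (x n) * a - a * peval q (x n)) - a * ?e) < \<epsilon>"
    using elim na mult.commute[of "norm a" \<theta>] \<epsilon> by linarith
   then show ?case by (simp only: dist_norm diff_0_right eq)
  qed
 qed
qed

text \<open>The hypotheses on \<open>e\<close> and \<open>f\<close> at the level of representatives.
  In \<open>f_big\<close> the constant \<open>\<kappa>\<close> does not depend on the power
  \<open>m\<close>.\<close>

locale central_sequences = tracial_core +
 fixes \<omega> :: "nat filter" and e f :: "nat => 'a" and \<kappa> :: real
 assumes ultra: "free_ultrafilter \<omega>"
  and e: "e n \<in> Ac" "psd (e n)" "norm (e n) <= 1"
  and f: "f n \<in> Ac" "psd (f n)" "norm (f n) <= 1"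
  and e_comm: "a \<in> Ac ==> ((%n. e n * a - a * e n) \<longlongrightarrow> 0) \<omega>"
  and f_comm: "a \<in> Ac ==> ((%n. f n * a - a * f n) \<longlongrightarrow> 0) \<omega>"
  and e_small: "\<delta> > 0 ==> eventually (%n. \<forall>t\<in>T. t (e n) <= \<delta>) \<omega>"
  and \<kappa>: "\<kappa> > 0"
  and f_big: "m >= 1 ==> eventually (%n. \<forall>t\<in>T. t (f n ^ m) >= \<kappa>) \<omega>"
begin

lemma f_power_Ac: "m >= 1 ==> f n ^ m \<in> Ac"
 using f(1)[of n] by (cases m) (auto simp: Ac_mult_left)

lemma f_power: "adj (f n ^ m) = f n ^ m" "norm (f n ^ m) <= 1"
proof -
 show "adj (f n ^ m) = f n ^ m" by (simp add: adj_power psd_sa[OF f(2)])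
 show "norm (f n ^ m) <= 1"
  using norm_power_ineq[of "f n" m] power_le_one[OF norm_ge_zero f(3)] by (rule order_trans)
qed

lemma f_power_comm: "a \<in> Ac ==> ((%n. f n ^ m * a - a * f n ^ m) \<longlongrightarrow> 0) \<omega>"
proof -
 assume a: "a \<in> Ac"
 have c: "continuous_on UNIV (%t::real. t ^ m)" by (intro continuous_intros)
 have "cfc (%t. t ^ m) (f n) = f n ^ m" for n
  using cfc_power[OF continuous_on_id, of "f n" m] cfc_id[of "f n"] psd_sa[OF f(2)] by (simp add: id_def)
 then show ?thesis using cfc_asymptotically_commute[OF c psd_sa[OF f(2)] f(3) f_comm[OF a]] by simp
qed

text \<open>Fullness of \<open>g\<close> and centrality of \<open>(f\<^sub>n)\<close> keep the traces of \<open>g f\<^sub>n\<^sup>2\<^sup>l g\<close> away from \<open>0\<close>,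
 uniformly in \<open>l\<close>.\<close>

lemma cut_trace_lower:
 assumes g: "g \<in> Ac" "adj g = g" "g ~= 0"
 shows "\<exists>c>0. \<forall>l\<ge>1. eventually (%n. \<forall>t\<in>T. t (g * f n ^ (2 * l) * g) >= c) \<omega>"
proof -
 have "norm (g * g) = norm g ^ 2" by (rule norm_sa_sq[OF g(2)])
 then have gg: "g * g \<in> Ac" "psd (g * g)" "g * g ~= 0" using g(1,3) psd_sq[OF g(2)] by (auto intro: Ac_mult)
 obtain N w where w: "\<forall>i<N::nat. w i \<in> Ac" "psd ((\<Sum>i<N. adj (w i) * (g * g) * w i) - p)"
  using full[OF gg] by blast
 define W where "W = (\<Sum>i<N. norm (w i) ^ 2) + 1"
 have W: "W > 0" by (simp add: W_def add_nonneg_pos sum_nonneg)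
 \<comment> \<open>The price of moving \<open>f n ^ l\<close> past the elements \<open>w i\<close>;
   it tends to 0 along the ultrafilter for each fixed \<open>l\<close>, so \<open>c\<close> need not
   depend on \<open>l\<close>.\<close>
 define E where "E l n = (\<Sum>i<N. 2 * norm g ^ 2 * norm (w i) * norm (f n ^ l * w i - w i * f n ^ l))" for l n
 have "t (f n ^ (2 * l)) <= W * t (g * f n ^ (2 * l) * g) + E l n" if t: "t \<in> T" and l: "l >= 1" for t n l
 proof -
  define y where "y = f n ^ l"
  have y: "y \<in> Ac" "adj y = y" "norm y <= 1" unfolding y_def using f_power f_power_Ac[OF l] by auto
  have yy: "f n ^ (2 * l) = y * y" by (simp add: y_def mult_2 power_add)
  have b: "t (y * (adj (w i) * (g * g) * w i) * y) <= norm (w i) ^ 2 * t (g * (y * y) * g)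
    + 2 * norm g ^ 2 * norm (w i) * norm (y * w i - w i * y)" if i: "i < N" for i
  proof -
   have wi: "w i \<in> Ac" using w i by blast
   define b b' where "b = g * w i * y" "b' = g * y * w i"
   have bA: "b \<in> Ac" "b' \<in> Ac" using g wi y by (auto simp: b_b'_def)
   have "t (y * (adj (w i) * (g * g) * w i) * y) = t (adj b * b)"
    by (simp add: b_b'_def adj_mult g(2) y(2) mult.assoc)
   also have "... = t (b * adj b)" using bA by (intro T_comm t) auto
   also have "... = t (b' * adj b') + t (b * adj b - b' * adj b')"
    using T_diff[OF t, of "b * adj b" "b' * adj b'"] bA by (simp add: Ac_mult_left)
   also have "t (b * adj b - b' * adj b') <= 2 * norm g ^ 2 * norm (w i) * norm (y * w i - w i * y)"
   proof -
    have nb: "norm b <= norm g * norm (w i)" "norm b' <= norm g * norm (w i)"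
    proof -
     have "norm b <= norm (g * w i) * norm y" unfolding b_b'_def by (rule norm_mult_ineq)
     also have "... <= norm (g * w i)" by (rule mult_left_le[OF y(3) norm_ge_zero])
     also have "... <= norm g * norm (w i)" by (rule norm_mult_ineq)
     finally show "norm b <= norm g * norm (w i)" .
     have "norm b' <= norm (g * y) * norm (w i)" unfolding b_b'_def by (rule norm_mult_ineq)
     also have "norm (g * y) <= norm g" using norm_mult_ineq[of g y] mult_left_le[OF y(3) norm_ge_zero[of g]] by linarith
     finally show "norm b' <= norm g * norm (w i)" by (simp add: mult_right_mono)
    qed
    have bb: "norm (b - b') <= norm g * norm (y * w i - w i * y)"
    proof -
     have "b - b' = - (g * (y * w i - w i * y))" by (simp add: b_b'_def algebra_simps)
     then show ?thesis using norm_mult_ineq[of g "y * w i - w i * y"] by (simp only: norm_minus_cancel)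
    qed
    have "t (b * adj b - b' * adj b') <= norm (b * adj b - b' * adj b')"
     by (rule T_le_norm[OF t _ _ order_refl]) (simp_all add: Ac_diff Ac_mult_left bA adj_diff adj_mult)
    also have "... = norm ((b - b') * adj b + b' * adj (b - b'))" by (simp add: algebra_simps adj_diff)
    also have "... <= norm (b - b') * norm b + norm b' * norm (b - b')"
     using norm_mult_ineq[of "b - b'" "adj b"] norm_mult_ineq[of b' "adj (b - b')"]
      norm_triangle_ineq[of "(b - b') * adj b" "b' * adj (b - b')"] unfolding norm_adj by linarith
    also have "... <= (norm g * norm (y * w i - w i * y)) * (norm g * norm (w i)) + (norm g * norm (w i)) * (norm g * norm (y * w i - w i * y))"
     using nb bb by (intro add_mono mult_mono) auto
    finally show ?thesis by (simp add: power2_eq_square mult_ac)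
   qed
   also have "t (b' * adj b') <= norm (w i) ^ 2 * t (g * (y * y) * g)"
   proof -
    have "b' * adj b' = adj (adj (w i) * (y * g)) * (adj (w i) * (y * g))"
     by (simp add: b_b'_def adj_mult g(2) y(2) mult.assoc)
    then have "t (b' * adj b') <= norm (adj (w i)) ^ 2 * t (adj (y * g) * (y * g))"
     using T_conj_le[OF t, of "adj (w i)" "y * g"] wi y g by (simp add: Ac_adj Ac_mult_left)
    also have "adj (y * g) * (y * g) = g * (y * y) * g" by (simp add: adj_mult y g mult.assoc)
    finally show ?thesis by simp
   qed
   finally show ?thesis by simp
  qed
  have wA: "y * (adj (w i) * (g * g) * w i) * y \<in> Ac" for i using y by (auto simp: Ac_mult_left)
  have "psd (adj y * ((\<Sum>i<N. adj (w i) * (g * g) * w i) - p) * y)" by (rule psd_conj[OF w(2)])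
  also have "adj y * ((\<Sum>i<N. adj (w i) * (g * g) * w i) - p) * y = (\<Sum>i<N. y * (adj (w i) * (g * g) * w i) * y) - y * y"
   unfolding y(2) right_diff_distrib left_diff_distrib Ac_right[OF y(1)] sum_distrib_left sum_distrib_right by (rule refl)
  finally have "t (y * y) <= t (\<Sum>i<N. y * (adj (w i) * (g * g) * w i) * y)"
   using y by (intro T_mono t Ac_sum wA) auto
  also have "... = (\<Sum>i<N. t (y * (adj (w i) * (g * g) * w i) * y))" by (rule T_sum[OF t wA])
  also have "... <= (\<Sum>i<N. norm (w i) ^ 2 * t (g * (y * y) * g) + 2 * norm g ^ 2 * norm (w i) * norm (y * w i - w i * y))"
   by (intro sum_mono b) simp
  also have "... = (W - 1) * t (g * (y * y) * g) + E l n"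
   by (simp add: sum.distrib W_def E_def y_def sum_distrib_right)
  also have "... <= W * t (g * (y * y) * g) + E l n"
  proof -
   have "psd (g * (y * y) * g)" using psd_conj[OF psd_sq[OF y(2)], of g] g by simp
   then have "t (g * (y * y) * g) >= 0" using g y by (intro T_pos t) auto
   then show ?thesis by (simp add: algebra_simps)
  qed
  finally show ?thesis by (simp add: yy)
 qed
 then have main: "t (f n ^ (2 * l)) - E l n <= W * t (g * f n ^ (2 * l) * g)" if "t \<in> T" "l >= 1" for t n l
  using that by (simp add: algebra_simps)
 have E: "eventually (%n. E l n < \<kappa> / 2) \<omega>" for l
 proof -
  have "(E l \<longlongrightarrow> (\<Sum>i<N. 2 * norm g ^ 2 * norm (w i) * 0)) \<omega>"
   unfolding E_def using w by (intro tendsto_sum tendsto_mult tendsto_const tendsto_norm_zero f_power_comm) auto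
  then show ?thesis using \<kappa> by (intro order_tendstoD(2)) auto
 qed
 show ?thesis
 proof (intro exI[of _ "\<kappa> / (2 * W)"] conjI allI impI)
  show "\<kappa> / (2 * W) > 0" using \<kappa> W by simp
  fix l :: nat assume l: "l >= 1"
  then have "eventually (%n. \<forall>t\<in>T. t (f n ^ (2 * l)) >= \<kappa>) \<omega>" by (intro f_big) simp
  with E[of l] show "eventually (%n. \<forall>t\<in>T. t (g * f n ^ (2 * l) * g) >= \<kappa> / (2 * W)) \<omega>"
  proof eventually_elim
   case (elim n)
   show ?case
   proof
    fix t assume t: "t \<in> T"
    have "\<kappa> / 2 <= W * t (g * f n ^ (2 * l) * g)" using main[OF t l, of n] elim t by fastforce
    then show "\<kappa> / (2 * W) <= t (g * f n ^ (2 * l) * g)" using W by (simp add: field_simps)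
   qed
  qed
 qed
qed

text \<open>Comparison is applied to cut-downs: \<open>a\<close> is \<open>x\<close> cut at
  \<open>\<epsilon>/2\<close>, with a unit \<open>q <= (2/\<epsilon>) *\<^sub>R x\<close> of small
  trace, and \<open>d\<close> is \<open>b\<close> cut at \<open>\<theta>\<close>. As
  \<open>d = k * b * k\<close> with \<open>k * k <= (1/\<theta>) *\<^sub>R d\<close>, the element
  \<open>v = k * r\<close> is bounded although \<open>r\<close> is not controlled.\<close>

lemma cutdown_solution:
 assumes b: "b \<in> Ac" "psd b" "norm b <= 1" and \<theta>: "\<theta> > 0" and tb: "!!t. t \<in> T ==> t b >= 3 * \<theta>"
  and x: "x \<in> Ac" "psd x" "norm x <= 1" and \<epsilon>: "0 < \<epsilon>" "\<epsilon> <= 1"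
  and tx: "!!t. t \<in> T ==> t x <= \<epsilon> * \<theta> / (2 * \<gamma>)"
 shows "\<exists>v\<in>Ac. norm v <= sqrt (2 / \<theta>) \<and> norm (adj v * b * v - x) <= \<epsilon>"
proof -
 have sx: "adj x = x" and sb: "adj b = b" using x b psd_sa by auto
 have cid: "continuous_on UNIV (%t::real. t)" by (intro continuous_intros)
 let ?c = "%t::real. max 0 (t - \<epsilon>/2)" and ?q = "%t::real. min 1 (max 0 (2 / \<epsilon> * t))"
  and ?d = "%t::real. max 0 (t - \<theta>)" and ?k = "%t::real. sqrt (max 0 (t - \<theta>) / max \<theta> t)"
 have cc: "continuous_on UNIV ?c" and cq: "continuous_on UNIV ?q" and cd: "continuous_on UNIV ?d"
  by (intro continuous_intros)+
 have ck: "continuous_on UNIV ?k" using \<theta> by (intro continuous_intros) (auto simp: max_def)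
 define a where "a = cfc ?c x"
 define q where "q = cfc ?q x"
 define d where "d = cfc ?d b"
 define k where "k = cfc ?k b"
 have a: "a \<in> Ac" "psd a" "norm a <= 1"
  unfolding a_def using Ac_cfc[OF cc sx _ x(1)] \<epsilon> x
  by (auto intro!: cfc_psd[OF cc x(2)] cfc_psd_norm_le[OF cc x(2)])
 have q: "q \<in> Ac" "psd q" "norm q <= 1"
 proof -
  show "q \<in> Ac" unfolding q_def using Ac_cfc[OF cq sx _ x(1)] by simp
  show "psd q" unfolding q_def by (rule cfc_psd[OF cq x(2)]) simp
  show "norm q <= 1" unfolding q_def by (rule cfc_psd_norm_le[OF cq x(2)]) simp
 qed
 have d: "d \<in> Ac" "psd d" "norm d <= 1"
  unfolding d_def using Ac_cfc[OF cd sb _ b(1)] \<theta> b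
  by (auto intro!: cfc_psd[OF cd b(2)] cfc_psd_norm_le[OF cd b(2)])
 have k: "k \<in> Ac" "adj k = k"
  unfolding k_def using Ac_cfc[OF ck sb _ b(1)] adj_cfc[OF ck sb] \<theta> by auto
 have qa: "q * a = a"
 proof -
  have "q * a = cfc (%t. ?q t * ?c t) x" unfolding q_def a_def by (rule cfc_mult[OF cq cc sx, symmetric])
  also have "... = a" unfolding a_def
  proof (rule cfc_psd_cong[OF continuous_on_mult[OF cq cc] cc x(2)])
   fix t :: real assume "0 <= t"
   show "?q t * ?c t = ?c t"
   proof (cases "t <= \<epsilon>/2")
    case False
    then have "2 / \<epsilon> * t >= 1" using \<epsilon> by (simp add: field_simps)
    then show ?thesis by simp
   qed simp
  qed
  finally show ?thesis .
 qed
 have qx: "psd ((2 / \<epsilon>) *\<^sub>R x - q)"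
 proof -
  have "psd (cfc (%t. 2 / \<epsilon> * t) x - cfc ?q x)"
   by (rule cfc_psd_mono[OF cq _ x(2)]) (use \<epsilon> in \<open>auto intro!: continuous_intros\<close>)
  then show ?thesis unfolding q_def using cfc_scale[OF cid sx, of "2 / \<epsilon>"] by (simp add: cfc_id sx)
 qed
 have tq: "t q <= \<theta> / \<gamma>" if t: "t \<in> T" for t
 proof -
  have "t q <= (2 / \<epsilon>) * t x" using T_mono[OF t q(1) Ac_scaleR[OF x(1)] qx] T_scale[OF t x(1)] by simp
  also have "... <= (2 / \<epsilon>) * (\<epsilon> * \<theta> / (2 * \<gamma>))" using tx[OF t] \<epsilon> by (intro mult_left_mono) auto
  also have "... = \<theta> / \<gamma>" using \<epsilon> by simp
  finally show ?thesis .
 qed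
 have td: "t d >= 2 * \<theta>" if t: "t \<in> T" for t
 proof -
  have "psd (cfc ?d b - cfc (%t. t - \<theta>) b)"
   by (rule cfc_psd_mono[OF _ cd b(2)]) (auto intro!: continuous_intros)
  then have "psd (d - (b - of_real \<theta>))"
   using cfc_diff[OF cid continuous_on_const sb, of \<theta>] by (simp add: d_def cfc_id cfc_const sb)
  then have "psd (p * (d - (b - of_real \<theta>)))" by (intro psd_mult psd_p pc[symmetric])
  then have "psd (d - (b - \<theta> *\<^sub>R p))" by (simp add: right_diff_distrib Ac_left d b mult_of_real_right)
  then have "t (b - \<theta> *\<^sub>R p) <= t d" using b d by (intro T_mono t Ac_diff Ac_scaleR Ac_p)
  then show ?thesis using T_diff[OF t b(1) Ac_scaleR[OF Ac_p]] T_scale[OF t Ac_p] T_one[OF t] tb[OF t] by simp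
 qed
 \<comment> \<open>\<open>t q <= \<theta> / \<gamma>\<close> and \<open>t d >= 2 * \<theta>\<close>:
   the assumed 3 leaves room for the cut by \<open>\<theta>\<close> and for strictness.\<close>
 have "\<gamma> * (\<theta> / \<gamma>) < 2 * \<theta>" using gamma \<theta> by simp
 then obtain r where r: "r \<in> Ac" "norm (adj r * d * r - a) <= \<epsilon>/2"
  using comparison[OF a(1) d(1) q(1) a(2) d(2) q(2) a(3) d(3) q(3) qa, of "\<theta> / \<gamma>" "2 * \<theta>" "\<epsilon>/2"] tq td \<epsilon> by auto
 have kbk: "k * b * k = d"
 proof -
  have "k * b * k = cfc (%t. ?k t * t * ?k t) b"
   unfolding k_def using cfc_mult[OF continuous_on_mult[OF ck cid] ck sb] cfc_mult[OF ck cid sb] by (simp add: cfc_id sb)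
  also have "... = d" unfolding d_def
  proof (rule cfc_psd_cong[OF _ cd b(2)])
   fix t :: real assume "0 <= t"
   have "?k t * ?k t = max 0 (t - \<theta>) / max \<theta> t" using \<theta> by simp
   then have "?k t * t * ?k t = max 0 (t - \<theta>) / max \<theta> t * t" by (simp add: mult_ac)
   also have "... = ?d t" using \<theta> by (auto simp: max_def)
   finally show "?k t * t * ?k t = ?d t" .
  qed (intro continuous_on_mult ck cid)
  finally show ?thesis .
 qed
 have kk: "psd ((1/\<theta>) *\<^sub>R d - k * k)"
 proof -
  have "psd (cfc (%t. 1/\<theta> * ?d t) b - cfc (%t. ?k t * ?k t) b)"
  proof (rule cfc_psd_mono[OF continuous_on_mult[OF ck ck] _ b(2)])
   fix t :: real
   have "max 0 (t - \<theta>) / max \<theta> t <= max 0 (t - \<theta>) / \<theta>" using \<theta> by (intro divide_left_mono) auto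
   then show "?k t * ?k t <= 1/\<theta> * ?d t" using \<theta> by simp
  qed (intro continuous_intros)
  then show ?thesis unfolding d_def k_def by (simp only: cfc_scale[OF cd sb] cfc_mult[OF ck ck sb])
 qed
 define v where "v = k * r"
 have v: "v \<in> Ac" using k r by (simp add: v_def Ac_mult_left)
 have vbv: "adj v * b * v = adj r * d * r" unfolding kbk[symmetric] by (simp add: v_def adj_mult k mult.assoc)
 have "norm (a - x) <= \<epsilon>/2"
 proof -
  have "norm (cfc (%t. ?c t - t) x) <= \<epsilon>/2"
   by (rule cfc_psd_norm_le[OF continuous_on_diff[OF cc cid] x(2)]) (use \<epsilon> in \<open>auto simp: max_def\<close>)
  then show ?thesis using cfc_diff[OF cc cid sx] by (simp add: a_def cfc_id sx)
 qed
 then have 1: "norm (adj v * b * v - x) <= \<epsilon>"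
  using norm_triangle_ineq[of "adj r * d * r - a" "a - x"] r unfolding vbv by simp
 have "norm v ^ 2 <= 2 / \<theta>"
 proof -
  have "psd (adj r * ((1/\<theta>) *\<^sub>R d - k * k) * r)" by (rule psd_conj[OF kk])
  then have "psd ((1/\<theta>) *\<^sub>R (adj r * d * r) - adj v * v)"
   by (simp add: v_def adj_mult k right_diff_distrib left_diff_distrib mult.assoc)
  then have "norm (adj v * v) <= norm ((1/\<theta>) *\<^sub>R (adj r * d * r))" by (rule psd_norm_mono[OF psd_adj_mult])
  also have "... = (1/\<theta>) * norm (adj v * b * v)" using \<theta> by (simp add: vbv)
  also have "norm (adj v * b * v) <= norm (adj v * b * v - x) + norm x"
   using norm_triangle_ineq[of "adj v * b * v - x" x] by simp
  also have "... <= 2" using 1 x \<epsilon> by simp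
  finally show ?thesis using \<theta> by (simp add: norm_adj_mult divide_simps)
 qed
 then have "norm v <= sqrt (2 / \<theta>)" by (rule real_le_rsqrt)
 then show ?thesis using v 1 by blast
qed

text \<open>\<open>z n\<close> is a function of \<open>f n\<close> that vanishes where
  \<open>f n\<close> is not near 1 and satisfies
  \<open>z n * z n >= f n ^ (2 * l) - \<theta>\<close>. So \<open>g * (z n * z n) * g\<close> keeps
  a trace bounded below and dominates \<open>e n\<close> by comparison. The bound \<open>C\<close>
  on \<open>v\<close> is independent of \<open>n\<close>.\<close>

lemma central_solution:
 assumes g: "g \<in> Ac" "adj g = g" "g ~= 0" "norm g <= 1" and \<epsilon>: "0 < \<epsilon>" "\<epsilon> <= 1"
 shows "\<exists>C z. (\<forall>n. z n \<in> Ac \<and> adj (z n) = z n \<and> norm (z n) <= 1) \<and>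
  (\<forall>a\<in>Ac. ((%n. z n * a - a * z n) \<longlongrightarrow> 0) \<omega>) \<and>
  eventually (%n. \<exists>v\<in>Ac. norm v <= C \<and> norm (adj (z n * g * v) * (z n * g * v) - e n) <= \<epsilon> \<and>
   norm ((1 - f n) * (z n * g * v)) <= \<epsilon>) \<omega>"
proof -
 obtain c where c: "c > 0" and ev: "\<forall>l\<ge>1. eventually (%n. \<forall>t\<in>T. t (g * f n ^ (2 * l) * g) >= c) \<omega>"
  using cut_trace_lower[OF g(1-3)] by blast
 \<comment> \<open>Of the trace \<open>c = 4 * \<theta>\<close> at most \<open>\<theta>\<close> is
   lost in passing to \<open>z n\<close>, leaving the \<open>3 * \<theta>\<close> that
   \<open>cutdown_solution\<close> requires.\<close>
 define \<theta> where "\<theta> = c / 4"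
 have \<theta>: "\<theta> > 0" using c by (simp add: \<theta>_def)
 define \<delta> where "\<delta> = \<epsilon> / 2"
 have \<delta>: "0 < \<delta>" "\<delta> <= 1/2" using \<epsilon> by (auto simp: \<delta>_def)
 \<comment> \<open>With this exponent \<open>t ^ (2 * l) - \<theta>\<close> is not positive for
   \<open>0 <= t <= 1 - \<delta>\<close>, so \<open>z n\<close> lives where \<open>f n\<close> is
   within \<open>\<delta>\<close> of 1.\<close>
 obtain l0 where l0: "(1 - \<delta>) ^ l0 < \<theta>" using real_arch_pow_inv[OF \<theta>, of "1 - \<delta>"] \<delta> by auto
 define l where "l = Suc l0"
 have l: "l >= 1" "(1 - \<delta>) ^ (2 * l) <= \<theta>"
 proof -
  have "(1 - \<delta>) ^ (2 * l) <= (1 - \<delta>) ^ l0" using \<delta> by (intro power_decreasing) (auto simp: l_def)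
  then show "(1 - \<delta>) ^ (2 * l) <= \<theta>" using l0 by simp
 qed (simp add: l_def)
 let ?m = "%t::real. max 0 (\<bar>t\<bar> ^ (2 * l) - \<theta>)"
 let ?s = "%t::real. sqrt (if t <= 0 then 0 else max 0 (t ^ (2 * l) - \<theta>))"
 have s_eq: "?s = (%t. sqrt (max 0 (max 0 t ^ (2 * l) - \<theta>)))"
  using l \<theta> by (auto simp: fun_eq_iff max_def power_0_left)
 have cs: "continuous_on UNIV ?s" unfolding s_eq by (intro continuous_intros)
 define z where "z n = cfc ?s (f n)" for n
 have sf: "adj (f n) = f n" for n using f psd_sa by blast
 have z: "z n \<in> Ac" "adj (z n) = z n" "norm (z n) <= 1" for n
 proof -
  show "z n \<in> Ac" unfolding z_def by (rule Ac_cfc[OF cs sf _ f(1)]) simp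
  show "adj (z n) = z n" unfolding z_def by (rule adj_cfc[OF cs sf])
  show "norm (z n) <= 1" unfolding z_def
  proof (rule cfc_psd_norm_le[OF cs f(2)])
   fix t assume t: "0 <= t" "t <= norm (f n)"
   then have "t ^ (2 * l) <= 1" using f(3)[of n] by (intro power_le_one) auto
   then show "\<bar>?s t\<bar> <= 1" using \<theta> by (auto simp: max_def)
  qed
 qed
 have zc: "\<forall>a\<in>Ac. ((%n. z n * a - a * z n) \<longlongrightarrow> 0) \<omega>"
  unfolding z_def using cfc_asymptotically_commute[OF cs sf f(3) f_comm] by blast
 have zz: "psd (z n * z n - (f n ^ (2 * l) - \<theta> *\<^sub>R p))" for n
 proof -
  have c1: "continuous_on UNIV (%t::real. t ^ (2 * l) - \<theta>)" "continuous_on UNIV (%t::real. t ^ (2 * l))" by (intro continuous_intros)+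
  have "psd (cfc (%t. ?s t * ?s t) (f n) - cfc (%t. t ^ (2 * l) - \<theta>) (f n))"
   by (rule cfc_psd_mono[OF c1(1) continuous_on_mult[OF cs cs] f(2)]) (use l \<theta> in \<open>auto simp: max_def power_0_left\<close>)
  then have "psd (z n * z n - (f n ^ (2 * l) - of_real \<theta>))"
   unfolding z_def cfc_mult[OF cs cs sf] cfc_diff[OF c1(2) continuous_on_const sf] cfc_const[OF sf]
   using cfc_power[OF continuous_on_id sf, of "2 * l" n] cfc_id[OF sf] by (simp add: id_def)
  then have "psd (p * (z n * z n - (f n ^ (2 * l) - of_real \<theta>)))" by (intro psd_mult psd_p pc[symmetric])
  moreover have "f n ^ (2 * l) \<in> Ac" using f_power_Ac[of "2 * l" n] l by simp
  ultimately show ?thesis using z(1)[of n] by (simp add: right_diff_distrib Ac_left Ac_mult_left mult_of_real_right)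
 qed
 define b where "b n = g * (z n * z n) * g" for n
 have b: "b n \<in> Ac" "psd (b n)" "norm (b n) <= 1" for n
 proof -
  show "b n \<in> Ac" unfolding b_def using g by (simp add: Ac_mult_left)
  show "psd (b n)" unfolding b_def using psd_conj[OF psd_sq[OF z(2)], of g] g by simp
  have "b n = adj (z n * g) * (z n * g)" by (simp add: b_def adj_mult z g mult.assoc)
  then have "norm (b n) = norm (z n * g) ^ 2" by (simp only: norm_adj_mult)
  moreover have "norm (z n * g) <= 1 * 1" using z(3)[of n] g(4) by (intro order_trans[OF norm_mult_ineq] mult_mono) auto
  ultimately show "norm (b n) <= 1" by (simp add: power_le_one)
 qed
 have tb: "t (b n) >= 3 * \<theta>" if t: "t \<in> T" and ge: "t (g * f n ^ (2 * l) * g) >= c" for t n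
 proof -
  have fA: "f n ^ (2 * l) \<in> Ac" using f_power_Ac[of "2 * l" n] l by simp
  have "psd (adj g * (z n * z n - (f n ^ (2 * l) - \<theta> *\<^sub>R p)) * g)" by (rule psd_conj[OF zz])
  then have "psd (b n - (g * f n ^ (2 * l) * g - \<theta> *\<^sub>R (g * g)))"
   unfolding b_def g(2) by (simp add: right_diff_distrib left_diff_distrib Ac_right[OF g(1)])
  then have "t (g * f n ^ (2 * l) * g - \<theta> *\<^sub>R (g * g)) <= t (b n)"
   using b g fA by (intro T_mono t) auto
  moreover have "t (g * f n ^ (2 * l) * g - \<theta> *\<^sub>R (g * g)) = t (g * f n ^ (2 * l) * g) - \<theta> * t (g * g)"
   by (simp only: T_diff[OF t Ac_mult_right[OF g(1)] Ac_scaleR[OF Ac_mult_right[OF g(1)]]] T_scale[OF t Ac_mult_right[OF g(1)]])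
  moreover have "t (g * g) <= 1"
  proof (rule T_le_norm[OF t])
   show "norm (g * g) <= 1" using norm_sa_sq[OF g(2)] g(4) by (simp add: power_le_one)
  qed (use g in \<open>auto simp: adj_mult\<close>)
  then have "\<theta> * t (g * g) <= \<theta>" using \<theta> by simp
  ultimately show ?thesis using ge by (simp add: \<theta>_def)
 qed
 have "\<epsilon> * \<theta> / (2 * \<gamma>) > 0" using \<epsilon> \<theta> gamma by simp
 then have ev2: "eventually (%n. \<forall>t\<in>T. t (e n) <= \<epsilon> * \<theta> / (2 * \<gamma>)) \<omega>" by (rule e_small)
 have ev1: "eventually (%n. \<forall>t\<in>T. t (g * f n ^ (2 * l) * g) >= c) \<omega>" using ev l by blast
 have "eventually (%n. \<exists>v\<in>Ac. norm v <= sqrt (2 / \<theta>) \<and> norm (adj (z n * g * v) * (z n * g * v) - e n) <= \<epsilon> \<and>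
   norm ((1 - f n) * (z n * g * v)) <= \<epsilon>) \<omega>"
  using ev1 ev2
 proof eventually_elim
  case (elim n)
  obtain v where v: "v \<in> Ac" "norm v <= sqrt (2 / \<theta>)" "norm (adj v * b n * v - e n) <= \<epsilon>"
   using cutdown_solution[OF b[of n] \<theta> _ e(1-3)[of n] \<epsilon>] tb elim by meson
  let ?t = "z n * g * v"
  have tt: "adj ?t * ?t = adj v * b n * v" by (simp add: b_def adj_mult z g mult.assoc)
  have "norm ?t ^ 2 <= norm (adj v * b n * v - e n) + norm (e n)"
   using norm_triangle_ineq[of "adj v * b n * v - e n" "e n"] norm_adj_mult[of ?t] tt by simp
  also have "... <= 2^2" using v e(3)[of n] \<epsilon> by simp
  finally have "norm ?t <= 2" by (rule power2_le_imp_le) simp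
  moreover have "norm ((1 - f n) * ?t) <= \<delta> * norm ?t"
   unfolding z_def mult.assoc
  proof (rule norm_bump_mult[OF cs f(2,3)])
   fix t assume t: "t <= 1 - \<delta>"
   show "?s t = 0"
   proof (cases "t <= 0")
    case False
    then have "t ^ (2 * l) <= (1 - \<delta>) ^ (2 * l)" using t by (intro power_mono) auto
    then show ?thesis using l by simp
   qed simp
  qed (use \<delta> in simp)
  ultimately have "norm ((1 - f n) * ?t) <= \<delta> * 2" using \<delta> by (meson mult_left_mono order_trans less_imp_le)
  then show ?case using v tt by (intro bexI[of _ v]) (auto simp: \<delta>_def)
 qed
 then show ?thesis using z zc by (intro exI[of _ "sqrt (2 / \<theta>)"] exI[of _ z]) auto
qed

text \<open>If norm-one positive elements have some trace above \<open>\<delta>\<close>, normalising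
  gives \<open>\<delta> * norm (e n) < t (e n)\<close> for some \<open>t\<close>, and the traces of
  \<open>e n\<close> tend to 0 uniformly.\<close>

lemma not_small_e:
 assumes "\<not> small" "\<epsilon> > 0"
 shows "eventually (%n. norm (e n) <= \<epsilon>) \<omega>"
proof -
 obtain \<delta> where \<delta>: "\<delta> > 0" and big: "!!b. [|b \<in> Ac; psd b; norm b = 1|] ==> \<exists>t\<in>T. t b > \<delta>"
  using assms(1) unfolding small_def by (meson not_le)
 have "eventually (%n. \<forall>t\<in>T. t (e n) <= \<delta> * \<epsilon>) \<omega>" using \<delta> assms(2) by (intro e_small) simp
 then show ?thesis
 proof eventually_elim
  case (elim n)
  show ?case
  proof (cases "e n = 0")
   case False
   let ?b = "(1 / norm (e n)) *\<^sub>R e n"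
   have "?b \<in> Ac" "psd ?b" "norm ?b = 1" using False e by (auto intro: psd_scaleR)
   then obtain t where t: "t \<in> T" "t ?b > \<delta>" using big by blast
   then have "\<delta> * norm (e n) < t (e n)" using False T_scale[OF t(1) e(1), of "1 / norm (e n)" n] by (simp add: field_simps)
   also have "... <= \<delta> * \<epsilon>" using elim t by blast
   finally show ?thesis using \<delta> by simp
  qed (use assms(2) in simp)
 qed
qed

end

section \<open>Assembling the approximate excision\<close>

locale cp_excision = central_sequences p T \<gamma> \<omega> e f \<kappa> + cp_coeffs p T \<gamma> I U
 for p :: "'a::cstar" and T \<gamma> \<omega> e f \<kappa> and I :: "'i set" and U +
 fixes c :: "'i => 'a"
 assumes c: "c i \<in> Ac"
begin

definition cp_map :: "'a => 'a" where
 "cp_map a = (\<Sum>i\<in>I. \<Sum>j\<in>I. cx (U a i j) * (adj (c i) * c j))"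

text \<open>With \<open>t\<^sup>* x\<^sub>i\<^sup>* a x\<^sub>j t\<close> close to \<open>u\<^sub>i\<^sub>j t\<^sup>* t\<close> and \<open>t\<^sup>* t\<close> close to the almost central \<open>e\<close>, the element
 \<open>s = \<Sum>\<^sub>i x\<^sub>i t c\<^sub>i\<close> excises the map with coefficients \<open>u\<close>.\<close>

lemma assemble:
 fixes x :: "'i => 'a" and t e0 a :: 'a
 assumes y: "!!i j. [|i \<in> I; j \<in> I|] ==> norm (adj t * (adj (x i) * a * x j - cx (U a i j)) * t) <= \<epsilon>1"
  and tt: "norm (adj t * t - e0) <= \<epsilon>2"
  and ec: "!!j. j \<in> I ==> norm (e0 * c j - c j * e0) <= \<epsilon>3"
 shows "norm (adj (\<Sum>i\<in>I. x i * t * c i) * a * (\<Sum>i\<in>I. x i * t * c i) - cp_map a * e0)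
  <= (\<epsilon>1 * (\<Sum>i\<in>I. \<Sum>j\<in>I. norm (c i) * norm (c j)) + \<epsilon>2 * (\<Sum>i\<in>I. \<Sum>j\<in>I. cmod (U a i j) * (norm (c i) * norm (c j))))
   + \<epsilon>3 * (\<Sum>i\<in>I. \<Sum>j\<in>I. cmod (U a i j) * norm (c i))"
proof -
 define y where "y i j = adj t * (adj (x i) * a * x j - cx (U a i j)) * t" for i j
 have "adj (\<Sum>i\<in>I. x i * t * c i) * a * (\<Sum>i\<in>I. x i * t * c i)
   = (\<Sum>i\<in>I. \<Sum>j\<in>I. adj (x i * t * c i) * a * (x j * t * c j))"
  by (simp only: adj_sum sum_distrib_right) (simp only: sum_distrib_left)
 moreover have "adj (x i * t * c i) * a * (x j * t * c j) = (adj (c i) * y i j * c j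
   + cx (U a i j) * (adj (c i) * (adj t * t - e0) * c j)) + cx (U a i j) * (adj (c i) * (e0 * c j - c j * e0))
   + cx (U a i j) * (adj (c i) * c j) * e0" for i j
  by (simp add: y_def adj_mult right_diff_distrib left_diff_distrib mult.assoc cx_left)
 ultimately have "adj (\<Sum>i\<in>I. x i * t * c i) * a * (\<Sum>i\<in>I. x i * t * c i) - cp_map a * e0
   = (\<Sum>i\<in>I. \<Sum>j\<in>I. (adj (c i) * y i j * c j + cx (U a i j) * (adj (c i) * (adj t * t - e0) * c j))
    + cx (U a i j) * (adj (c i) * (e0 * c j - c j * e0)))"
  by (simp add: cp_map_def sum_distrib_right sum.distrib)
 then have "norm (adj (\<Sum>i\<in>I. x i * t * c i) * a * (\<Sum>i\<in>I. x i * t * c i) - cp_map a * e0)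
   = norm (\<Sum>i\<in>I. \<Sum>j\<in>I. (adj (c i) * y i j * c j + cx (U a i j) * (adj (c i) * (adj t * t - e0) * c j))
    + cx (U a i j) * (adj (c i) * (e0 * c j - c j * e0)))"
  by (rule arg_cong)
 also have "... <= (\<Sum>i\<in>I. \<Sum>j\<in>I. (\<epsilon>1 * (norm (c i) * norm (c j)) + \<epsilon>2 * (cmod (U a i j) * (norm (c i) * norm (c j))))
   + \<epsilon>3 * (cmod (U a i j) * norm (c i)))"
 proof (intro order_trans[OF norm_sum] sum_mono order_trans[OF norm_triangle_ineq] add_mono)
  fix i j assume ij: "i \<in> I" "j \<in> I"
  have m: "norm (adj (c i) * w * c j) <= norm w * (norm (c i) * norm (c j))" for w
   using norm_mult_ineq[of "adj (c i) * w" "c j"] mult_right_mono[OF norm_mult_ineq[of "adj (c i)" w] norm_ge_zero[of "c j"]]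
   by (simp add: mult_ac)
  show "norm (adj (c i) * y i j * c j) <= \<epsilon>1 * (norm (c i) * norm (c j))"
   by (rule order_trans[OF m]) (use assms(1)[OF ij] in \<open>auto simp: y_def intro!: mult_right_mono\<close>)
  have "norm (adj (c i) * (adj t * t - e0) * c j) <= \<epsilon>2 * (norm (c i) * norm (c j))"
   by (rule order_trans[OF m]) (use tt in \<open>auto intro!: mult_right_mono\<close>)
  then show "norm (cx (U a i j) * (adj (c i) * (adj t * t - e0) * c j)) <= \<epsilon>2 * (cmod (U a i j) * (norm (c i) * norm (c j)))"
   unfolding norm_cx_mult using mult_left_mono[OF _ norm_ge_zero[of "U a i j"]] by (fastforce simp: mult_ac)
  have "norm (adj (c i) * (e0 * c j - c j * e0)) <= norm (c i) * \<epsilon>3"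
   by (rule order_trans[OF norm_mult_ineq]) (use ec[OF ij(2)] in \<open>auto intro!: mult_left_mono\<close>)
  then show "norm (cx (U a i j) * (adj (c i) * (e0 * c j - c j * e0))) <= \<epsilon>3 * (cmod (U a i j) * norm (c i))"
   unfolding norm_cx_mult using mult_left_mono[OF _ norm_ge_zero[of "U a i j"]] by (fastforce simp: mult_ac)
 qed
 also have "... = (\<epsilon>1 * (\<Sum>i\<in>I. \<Sum>j\<in>I. norm (c i) * norm (c j)) + \<epsilon>2 * (\<Sum>i\<in>I. \<Sum>j\<in>I. cmod (U a i j) * (norm (c i) * norm (c j))))
   + \<epsilon>3 * (\<Sum>i\<in>I. \<Sum>j\<in>I. cmod (U a i j) * norm (c i))"
  by (simp add: sum.distrib sum_distrib_left)
 finally show ?thesis .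
qed

text \<open>\<open>z * g * v\<close> differs from \<open>s = g * z * v\<close> by a commutator times
  \<open>v\<close>, and \<open>s = h * m * s\<close> holds exactly, so \<open>y\<close> is seen only
  through \<open>h * y * h\<close>. The constant is \<open>36 = 3 * 2 * 2 * 3\<close>, and the
  commutator contributes 2 + 3.\<close>

lemma compress_bound:
 fixes h m g z v y :: 'a
 assumes m: "adj m = m" "m * h = h * m" "norm m <= 2" and h: "adj h = h" and g: "h * m * g = g"
  and t: "norm (z * g * v) <= 2" and D: "norm (z * g - g * z) * norm v <= \<eta>" "\<eta> <= 1"
  and y: "norm (h * y * h) <= \<theta>"
 shows "norm (adj (z * g * v) * y * (z * g * v)) <= 36 * \<theta> + 5 * \<eta> * norm y"
proof -
 define t s where "t = z * g * v" "s = g * z * v"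
 have ts: "norm (t - s) <= \<eta>"
 proof -
  have "t - s = (z * g - g * z) * v" by (simp add: t_s_def left_diff_distrib)
  then show ?thesis using norm_mult_ineq[of "z * g - g * z" v] D(1) by simp
 qed
 have nt: "norm t <= 2" using t by (simp add: t_s_def)
 have ns: "norm s <= 3" using norm_triangle_ineq[of t "s - t"] ts nt D(2) by (simp add: norm_minus_commute)
 have s1: "s = h * m * s" using g by (simp add: t_s_def flip: mult.assoc)
 have "adj s = adj s * m * h" using arg_cong[OF s1, of adj] by (simp add: adj_mult m h mult.assoc)
 then have "adj s * y * s = adj s * m * h * y * (h * m * s)" using s1 by metis
 also have "... = adj s * (m * (h * y * h) * m) * s" by (simp only: mult.assoc)
 finally have ss: "adj s * y * s = adj s * (m * (h * y * h) * m) * s" .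
 have t0: "\<theta> >= 0" using y norm_ge_zero order_trans by blast
 have as: "norm (adj s) <= 3" "norm (adj (t - s)) <= \<eta>" using ns ts by (simp_all only: norm_adj)
 have 1: "norm (adj s * y * s) <= 3 * (2 * \<theta> * 2) * 3"
  unfolding ss by (intro norm_mult_le[OF norm_mult_le[OF as(1) norm_mult_le[OF norm_mult_le[OF m(3) y] m(3)]] ns])
 have 2: "norm (adj (t - s) * y * t) <= \<eta> * norm y * 2"
  by (intro norm_mult_le[OF norm_mult_le[OF as(2) order_refl] nt])
 have 3: "norm (adj s * y * (t - s)) <= 3 * norm y * \<eta>"
  by (intro norm_mult_le[OF norm_mult_le[OF as(1) order_refl] ts])
 have "adj t * y * t = adj (t - s) * y * t + adj s * y * (t - s) + adj s * y * s"
  by (simp add: adj_diff algebra_simps)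
 also have "norm ... <= \<eta> * norm y * 2 + 3 * norm y * \<eta> + 3 * (2 * \<theta> * 2) * 3"
  using 1 2 3 by (intro order_trans[OF norm_triangle_ineq] add_mono) auto
 finally show ?thesis by (simp add: t_s_def algebra_simps)
qed

text \<open>The order of choices matters: \<open>u\<close>, \<open>h\<close> and \<open>x\<close>
  depend on the finite data only, \<open>g\<close> is the flat top of \<open>h\<close>, and
  \<open>g\<close> determines \<open>z\<close> and the bound \<open>C\<close>. Only then are the
  commutators with \<open>z n\<close>, \<open>e n\<close> and \<open>f n\<close> made small against
  all these constants.\<close>

lemma approx_excision:
 assumes F: "finite F" "F \<subseteq> Ac" and \<epsilon>: "\<epsilon> > 0"
 shows "eventually (%n. \<exists>s\<in>Ac. norm (f n * s - s) <= \<epsilon> \<and>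
  (\<forall>a\<in>F. norm (adj s * a * s - cp_map a * e n) <= \<epsilon>)) \<omega>"
proof (cases small)
 case False
 define B where "B = (\<Sum>a\<in>F. norm (cp_map a)) + 1"
 have B: "B > 0" by (simp add: B_def add_nonneg_pos sum_nonneg)
 have "eventually (%n. norm (e n) <= \<epsilon> / B) \<omega>" using not_small_e[OF False] \<epsilon> B by simp
 then show ?thesis
 proof eventually_elim
  case (elim n)
  have "norm (adj 0 * a * 0 - cp_map a * e n) <= \<epsilon>" if "a \<in> F" for a
  proof -
   have "norm (cp_map a) <= B" using member_le_sum[of a F "%a. norm (cp_map a)"] that F by (simp add: B_def)
   then have "norm (cp_map a * e n) <= B * (\<epsilon> / B)"
    using elim B by (intro order_trans[OF norm_mult_ineq] mult_mono) auto
   then show ?thesis using B by simp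
  qed
  then show ?case using \<epsilon> by (intro bexI[of _ 0]) auto
 qed
next
 case True
 define K where "K = (\<Sum>i\<in>I. \<Sum>j\<in>I. norm (c i) * norm (c j)) + 1"
 define V where "V = (\<Sum>a\<in>F. (\<Sum>i\<in>I. \<Sum>j\<in>I. cmod (U a i j) * (norm (c i) * norm (c j)))) + 1"
 define V' where "V' = (\<Sum>a\<in>F. (\<Sum>i\<in>I. \<Sum>j\<in>I. cmod (U a i j) * norm (c i))) + 1"
 have Kp: "K > 0" "V > 0" "V' > 0"
  by (auto simp: K_def V_def V'_def intro!: add_nonneg_pos sum_nonneg mult_nonneg_nonneg)
 \<comment> \<open>\<open>hy\<close> loses a factor 2, \<open>compress_bound\<close> a factor 36 and
   summation over pairs a factor \<open>K\<close>; what remains is one of four quarters of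
   \<open>\<epsilon>\<close>.\<close>
 define \<epsilon>1 where "\<epsilon>1 = \<epsilon> / (4 * 36 * 2 * K)"
 have \<epsilon>1: "\<epsilon>1 > 0" using \<epsilon> Kp by (simp add: \<epsilon>1_def)
 obtain u where u: "excisable F I u" "\<forall>a\<in>F. \<forall>i\<in>I. \<forall>j\<in>I. cmod (u a i j - U a i j) <= \<epsilon>1"
  using excisable_dense[OF True ultra F \<epsilon>1] by blast
 obtain h x where h: "h \<in> Ac" "psd h" "norm h = 1" and x: "\<forall>i. x i \<in> Ac"
  and hx: "\<forall>a\<in>F. \<forall>i\<in>I. \<forall>j\<in>I. norm (h * (adj (x i) * a * x j - cx (u a i j)) * h) <= \<epsilon>1"
  using u(1) \<epsilon>1 unfolding excisable_def by meson
 have ah: "adj h = h" using h psd_sa by blast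
 define y where "y a i j = adj (x i) * a * x j - cx (U a i j)" for a i j
 have hy: "norm (h * y a i j * h) <= 2 * \<epsilon>1" if "a \<in> F" "i \<in> I" "j \<in> I" for a i j
 proof -
  have "h * y a i j * h = h * (adj (x i) * a * x j - cx (u a i j)) * h + cx (u a i j - U a i j) * (h * h)"
   by (simp add: y_def right_diff_distrib left_diff_distrib cx_diff cx_mid)
  also have "norm ... <= \<epsilon>1 + \<epsilon>1 * 1"
  proof (intro order_trans[OF norm_triangle_ineq] add_mono)
   show "norm (h * (adj (x i) * a * x j - cx (u a i j)) * h) <= \<epsilon>1" using hx that by blast
   have "norm (h * h) = 1" using norm_sa_sq[OF ah] h by simp
   then show "norm (cx (u a i j - U a i j) * (h * h)) <= \<epsilon>1 * 1" using u(2) that by (simp add: norm_cx_mult)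
  qed
  finally show ?thesis by simp
 qed
 obtain m g where m: "adj m = m" "m * h = h * m" "norm m <= 2"
  and g: "g \<in> Ac" "psd g" "norm g = 1" "h * m * g = g"
  using flat_top[OF h] by blast
 have ag: "adj g = g" "g ~= 0" "norm g <= 1" using g psd_sa by auto
 define X where "X = (\<Sum>i\<in>I. norm (x i) * norm (c i)) + 1"
 define C' where "C' = (\<Sum>i\<in>I. norm (c i)) + 1"
 define M where "M = (\<Sum>a\<in>F. \<Sum>i\<in>I. \<Sum>j\<in>I. norm (y a i j)) + 1"
 have Xp: "X > 0" "C' > 0" "M > 0" by (auto simp: X_def C'_def M_def intro!: add_nonneg_pos sum_nonneg mult_nonneg_nonneg)
 have yM: "norm (y a i j) <= M" if "a \<in> F" "i \<in> I" "j \<in> I" for a i j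
 proof -
  have "norm (y a i j) <= (\<Sum>j\<in>I. norm (y a i j))" using that finI by (intro member_le_sum) auto
  also have "... <= (\<Sum>i\<in>I. \<Sum>j\<in>I. norm (y a i j))"
   using that finI by (intro member_le_sum[of i I "%i. \<Sum>j\<in>I. norm (y a i j)"]) (auto intro!: sum_nonneg)
  also have "... <= (\<Sum>a\<in>F. \<Sum>i\<in>I. \<Sum>j\<in>I. norm (y a i j))"
   using that F by (intro member_le_sum[of a F "%a. \<Sum>i\<in>I. \<Sum>j\<in>I. norm (y a i j)"]) (auto intro!: sum_nonneg)
  finally show ?thesis by (simp add: M_def)
 qed
 define \<epsilon>2 where "\<epsilon>2 = min 1 (min (\<epsilon> / (4 * V)) (\<epsilon> / (2 * X)))"
 have \<epsilon>2: "0 < \<epsilon>2" "\<epsilon>2 <= 1" "\<epsilon>2 * V <= \<epsilon> / 4" "\<epsilon>2 * X <= \<epsilon> / 2"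
 proof -
  have "\<epsilon>2 * V <= \<epsilon> / (4 * V) * V" using Kp by (intro mult_right_mono) (auto simp: \<epsilon>2_def)
  then show "\<epsilon>2 * V <= \<epsilon> / 4" using Kp by simp
  have "\<epsilon>2 * X <= \<epsilon> / (2 * X) * X" using Xp by (intro mult_right_mono) (auto simp: \<epsilon>2_def)
  then show "\<epsilon>2 * X <= \<epsilon> / 2" using Xp by simp
 qed (use \<epsilon> Kp Xp in \<open>auto simp: \<epsilon>2_def\<close>)
 obtain C z where z: "\<forall>n. z n \<in> Ac \<and> adj (z n) = z n \<and> norm (z n) <= 1"
  and zc: "\<forall>a\<in>Ac. ((%n. z n * a - a * z n) \<longlongrightarrow> 0) \<omega>"
  and ev: "eventually (%n. \<exists>v\<in>Ac. norm v <= C \<and> norm (adj (z n * g * v) * (z n * g * v) - e n) <= \<epsilon>2 \<and>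
   norm ((1 - f n) * (z n * g * v)) <= \<epsilon>2) \<omega>"
  using central_solution[OF g(1) ag \<epsilon>2(1,2)] by blast
 define \<eta> where "\<eta> = min 1 (\<epsilon> / (20 * M * K))"
 have \<eta>: "0 < \<eta>" "\<eta> <= 1" "5 * \<eta> * M * K <= \<epsilon> / 4"
 proof -
  show "0 < \<eta>" using \<epsilon> Kp Xp by (simp add: \<eta>_def)
  have "\<eta> * (M * K) <= \<epsilon> / (20 * M * K) * (M * K)" using Kp Xp by (intro mult_right_mono) (auto simp: \<eta>_def)
  also have "... = \<epsilon> / 20" using Kp Xp by simp
  finally show "5 * \<eta> * M * K <= \<epsilon> / 4" by (simp add: mult_ac)
 qed (simp add: \<eta>_def)
 have lim: "eventually (%n. norm (w n) <= \<delta>) \<omega>" if "(w \<longlongrightarrow> 0) \<omega>" "\<delta> > 0" for w :: "nat => 'a" and \<delta>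
  using tendstoD[OF that] by eventually_elim (simp add: dist_norm)
 have ev1: "eventually (%n. norm (z n * g - g * z n) <= \<eta> / (\<bar>C\<bar> + 1)) \<omega>"
  using zc g(1) \<eta> by (intro lim) (auto intro!: divide_pos_pos add_nonneg_pos)
 have ev2: "eventually (%n. \<forall>j\<in>I. norm (e n * c j - c j * e n) <= \<epsilon> / (4 * V')) \<omega>"
  using finI c \<epsilon> Kp by (intro eventually_ball_finite ballI lim e_comm) auto
 have ev3: "eventually (%n. \<forall>i\<in>I. norm (f n * x i - x i * f n) <= \<epsilon> / (4 * C')) \<omega>"
  using finI x \<epsilon> Xp by (intro eventually_ball_finite ballI lim f_comm) auto
 show ?thesis
  using ev ev1 ev2 ev3
 proof eventually_elim
  case (elim n)
  then obtain v where v: "v \<in> Ac" "norm v <= C" "norm (adj (z n * g * v) * (z n * g * v) - e n) <= \<epsilon>2"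
   "norm ((1 - f n) * (z n * g * v)) <= \<epsilon>2" by blast
  define t where "t = z n * g * v"
  have nt: "norm t <= 2"
  proof -
   have "norm t ^ 2 <= norm (adj t * t - e n) + norm (e n)"
    using norm_triangle_ineq[of "adj t * t - e n" "e n"] norm_adj_mult[of t] by simp
   also have "... <= 2^2" using v(3) e(3)[of n] \<epsilon>2 by (simp add: t_def)
   finally show ?thesis by (rule power2_le_imp_le) simp
  qed
  have D: "norm (z n * g - g * z n) * norm v <= \<eta>"
  proof -
   have "norm (z n * g - g * z n) * norm v <= \<eta> / (\<bar>C\<bar> + 1) * (\<bar>C\<bar> + 1)"
    using elim(2) v(2) \<eta> by (intro mult_mono) auto
   then show ?thesis by simp
  qed
  define s where "s = (\<Sum>i\<in>I. x i * t * c i)"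
  have sA: "s \<in> Ac" unfolding s_def using c by (intro Ac_sum Ac_mult_right)
  have main: "norm (adj s * a * s - cp_map a * e n) <= \<epsilon>" if a: "a \<in> F" for a
  proof -
   have yb: "norm (adj t * y a i j * t) <= 36 * (2 * \<epsilon>1) + 5 * \<eta> * M" if ij: "i \<in> I" "j \<in> I" for i j
   proof -
    have "norm (adj t * y a i j * t) <= 36 * (2 * \<epsilon>1) + 5 * \<eta> * norm (y a i j)"
     unfolding t_def by (rule compress_bound[OF m ah g(4) nt[unfolded t_def] D \<eta>(2) hy[OF a ij]])
    also have "5 * \<eta> * norm (y a i j) <= 5 * \<eta> * M" using yM[OF a ij] \<eta> by (intro mult_left_mono) auto
    finally show ?thesis by simp
   qed
   have "norm (adj s * a * s - cp_map a * e n)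
    <= ((36 * (2 * \<epsilon>1) + 5 * \<eta> * M) * (\<Sum>i\<in>I. \<Sum>j\<in>I. norm (c i) * norm (c j))
     + \<epsilon>2 * (\<Sum>i\<in>I. \<Sum>j\<in>I. cmod (U a i j) * (norm (c i) * norm (c j))))
     + \<epsilon> / (4 * V') * (\<Sum>i\<in>I. \<Sum>j\<in>I. cmod (U a i j) * norm (c i))"
    unfolding s_def by (rule assemble) (use yb v(3) elim(3) in \<open>auto simp: y_def t_def\<close>)
   also have "... <= ((36 * (2 * \<epsilon>1) + 5 * \<eta> * M) * K + \<epsilon>2 * V) + \<epsilon> / (4 * V') * V'"
   proof (intro add_mono mult_left_mono)
    show "(\<Sum>i\<in>I. \<Sum>j\<in>I. cmod (U a i j) * (norm (c i) * norm (c j))) <= V"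
     unfolding V_def using F a member_le_sum[of a F "%a. \<Sum>i\<in>I. \<Sum>j\<in>I. cmod (U a i j) * (norm (c i) * norm (c j))"]
     by (fastforce intro!: sum_nonneg)
    show "(\<Sum>i\<in>I. \<Sum>j\<in>I. cmod (U a i j) * norm (c i)) <= V'"
     unfolding V'_def using F a member_le_sum[of a F "%a. \<Sum>i\<in>I. \<Sum>j\<in>I. cmod (U a i j) * norm (c i)"]
     by (fastforce intro!: sum_nonneg)
   qed (use \<epsilon> \<epsilon>1 \<epsilon>2 \<eta> Kp Xp in \<open>auto simp: K_def\<close>)
   also have "(36 * (2 * \<epsilon>1) + 5 * \<eta> * M) * K = \<epsilon>/4 + 5 * \<eta> * M * K"
    using Kp by (simp add: \<epsilon>1_def field_simps)
   also have "\<epsilon> / (4 * V') * V' = \<epsilon>/4" using Kp by simp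
   finally show ?thesis using \<epsilon>2 \<eta> by linarith
  qed
  have "norm (f n * s - s) <= \<epsilon>"
  proof -
   have "f n * s - s = (\<Sum>i\<in>I. (f n * x i - x i * f n) * t * c i - x i * ((1 - f n) * t) * c i)"
    unfolding s_def sum_distrib_left sum_subtractf[symmetric] by (simp add: algebra_simps)
   also have "norm ... <= (\<Sum>i\<in>I. \<epsilon> / (4 * C') * 2 * norm (c i) + norm (x i) * \<epsilon>2 * norm (c i))"
   proof (intro order_trans[OF norm_sum] sum_mono order_trans[OF norm_triangle_ineq4] add_mono)
    fix i assume i: "i \<in> I"
    have xf: "norm (f n * x i - x i * f n) <= \<epsilon> / (4 * C')" using elim(4) i by blast
    show "norm ((f n * x i - x i * f n) * t * c i) <= \<epsilon> / (4 * C') * 2 * norm (c i)"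
     by (rule norm_mult_le[OF norm_mult_le[OF xf nt] order_refl])
    show "norm (x i * ((1 - f n) * t) * c i) <= norm (x i) * \<epsilon>2 * norm (c i)"
     by (rule norm_mult_le[OF norm_mult_le[OF order_refl v(4)[folded t_def]] order_refl])
   qed
   also have "... = \<epsilon> / (4 * C') * 2 * (C' - 1) + \<epsilon>2 * (X - 1)"
   proof -
    have "C' - 1 = (\<Sum>i\<in>I. norm (c i))" "X - 1 = (\<Sum>i\<in>I. norm (x i) * norm (c i))" by (simp_all add: C'_def X_def)
    then show ?thesis by (simp only: sum.distrib sum_distrib_left) (simp add: mult_ac)
   qed
   also have "... <= \<epsilon> / (4 * C') * 2 * C' + \<epsilon>2 * X"
    using \<epsilon> \<epsilon>2 Xp by (intro add_mono mult_left_mono) auto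
   also have "\<epsilon> / (4 * C') * 2 * C' = \<epsilon> / 2" using Xp by simp
   finally show ?thesis using \<epsilon>2 by linarith
  qed
  then show ?case using sA main by blast
 qed
qed

end

section \<open>A type of sections over all C*-algebras\<close>

text \<open>Takes the norm laws one by one, because completeness of matrix algebras is proved before
  they are known to be C*-algebras.\<close>

lemma metric_space_alg_dist:
 assumes "ring A" and nonneg: "!!x. x \<in> carrier A ==> 0 <= nrm A x"
  and zero: "!!x. x \<in> carrier A ==> nrm A x = 0 \<longleftrightarrow> x = \<zero>\<^bsub>A\<^esub>"
  and triangle: "!!x y. x \<in> carrier A ==> y \<in> carrier A ==> nrm A (x \<oplus>\<^bsub>A\<^esub> y) <= nrm A x + nrm A y"
  and uminus: "!!x. x \<in> carrier A ==> nrm A (\<ominus>\<^bsub>A\<^esub> x) = nrm A x"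
 shows "Metric_space (carrier A) (alg_dist A)"
proof
 interpret ring A by fact
 fix x y z
 show "0 <= alg_dist A x y" by (simp add: alg_dist_def nonneg)
 show "alg_dist A x y = alg_dist A y x"
 proof (cases "x \<in> carrier A \<and> y \<in> carrier A")
  case True
  then have "y \<ominus>\<^bsub>A\<^esub> x = \<ominus>\<^bsub>A\<^esub> (x \<ominus>\<^bsub>A\<^esub> y)" by (simp add: minus_eq minus_add a_comm)
  then show ?thesis using True by (simp add: alg_dist_def uminus)
 qed (auto simp: alg_dist_def)
 assume x: "x \<in> carrier A" and y: "y \<in> carrier A"
 have "x \<ominus>\<^bsub>A\<^esub> y = \<zero>\<^bsub>A\<^esub> \<longleftrightarrow> x = y"
  using x y by (metis minus_eq r_neg minus_equality minus_minus a_inv_closed)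
 then show "alg_dist A x y = 0 \<longleftrightarrow> x = y" using x y by (simp add: alg_dist_def zero)
 assume z: "z \<in> carrier A"
 have "x \<ominus>\<^bsub>A\<^esub> z = (x \<ominus>\<^bsub>A\<^esub> y) \<oplus>\<^bsub>A\<^esub> (y \<ominus>\<^bsub>A\<^esub> z)" using x y z
  by (simp add: minus_eq a_assoc) (metis a_assoc a_inv_closed l_neg l_zero)
 then show "alg_dist A x z <= alg_dist A x y + alg_dist A y z"
  using triangle[of "x \<ominus>\<^bsub>A\<^esub> y" "y \<ominus>\<^bsub>A\<^esub> z"] x y z by (simp add: alg_dist_def)
qed

context cstar_algebra
begin

lemma ring_A: "ring A" by (rule ring_axioms)

lemma smult_cl: "x \<in> carrier A ==> smult A z x \<in> carrier A"
 using smult_closed[of z x] by (simp add: complex_ring_def)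

lemma smult_add_left: "x \<in> carrier A ==> smult A (z + w) x = add A (smult A z x) (smult A w x)"
 using smult_l_distr[of z w x] by (simp add: complex_ring_def)

lemma smult_add_right: "x \<in> carrier A ==> y \<in> carrier A ==> smult A z (add A x y) = add A (smult A z x) (smult A z y)"
 using smult_r_distr[of z x y] by (simp add: complex_ring_def)

lemma smult_smult: "x \<in> carrier A ==> smult A (z * w) x = smult A z (smult A w x)"
 using smult_assoc1[of z w x] by (simp add: complex_ring_def)

lemma smult_1: "x \<in> carrier A ==> smult A 1 x = x"
 using smult_one[of x] by (simp add: complex_ring_def)

lemma smult_0: "x \<in> carrier A ==> smult A 0 x = \<zero>"
proof -
 assume x: "x \<in> carrier A"
 have "smult A 0 x = smult A 0 x \<oplus> smult A 0 x" using smult_add_left[OF x, of 0 0] by simp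
 then show ?thesis using smult_cl[OF x] by (metis M.r_neg1 M.a_assoc M.r_neg M.r_zero a_inv_closed)
qed

lemma smult_minus_one: "x \<in> carrier A ==> smult A (- 1) x = \<ominus> x"
proof -
 assume x: "x \<in> carrier A"
 have "x \<oplus> smult A (- 1) x = \<zero>" using smult_add_left[OF x, of 1 "-1"] by (simp add: smult_1 x smult_0)
 then show ?thesis using x smult_cl[OF x] by (metis M.minus_equality M.a_comm)
qed

lemma smult_minus: "x \<in> carrier A ==> smult A (- z) x = \<ominus> smult A z x"
 using smult_minus_one[of "smult A z x"] smult_smult[of x "-1" z] by (simp add: smult_cl)

lemma smult_zero: "smult A z \<zero> = \<zero>"
 using smult_smult[of "\<zero>" z 0] smult_0[of "\<zero>"] by simp

lemma nrm_zero: "nrm A \<zero> = 0"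
 using nrm_eq_0_iff by simp

lemma nrm_uminus: "x \<in> carrier A ==> nrm A (\<ominus> x) = nrm A x"
 using nrm_smult[of x "-1"] by (simp add: smult_minus_one)

lemma star_zero: "star A \<zero> = \<zero>"
 using star_smult[of "\<zero>" 0] by (simp add: smult_0 star_closed)

lemma star_one: "star A \<one> = \<one>"
proof -
 have "star A (star A \<one> \<otimes> \<one>) = star A \<one> \<otimes> star A (star A \<one>)"
  by (rule star_mult) (simp_all add: star_closed)
 then show ?thesis by (simp add: star_closed star_star)
qed

text \<open>The C*-identity makes the norm of the unit idempotent; the value 0 occurs for the zero
  algebra.\<close>

lemma nrm_one_le: "nrm A \<one> <= 1"
proof -
 have "nrm A \<one> = nrm A \<one> * nrm A \<one>" using nrm_star_mult[of \<one>] by (simp add: star_one power2_eq_square)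
 then show ?thesis by (metis mult_cancel_right1 order_refl zero_le_one)
qed

lemma nrm_star:
 assumes x: "x \<in> carrier A"
 shows "nrm A (star A x) = nrm A x"
proof -
 have *: "nrm A y <= nrm A (star A y)" if y: "y \<in> carrier A" for y
 proof (cases "nrm A y = 0")
  case False
  have "nrm A y * nrm A y <= nrm A (star A y) * nrm A y"
   using nrm_mult[OF star_closed[OF y] y] nrm_star_mult[OF y] by (simp add: power2_eq_square)
  then show ?thesis using False nrm_nonneg[OF y] by simp
 qed (simp add: nrm_nonneg star_closed y)
 show ?thesis using *[OF x] *[OF star_closed[OF x]] x by (simp add: star_star)
qed

lemma metric_space: "Metric_space (carrier A) (alg_dist A)"
 by (rule metric_space_alg_dist[OF ring_A nrm_nonneg nrm_eq_0_iff nrm_triangle nrm_uminus])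

lemma limitin_iff: "limitin (alg_top A) s l sequentially \<longleftrightarrow>
  l \<in> carrier A \<and> (\<forall>\<epsilon>>0. \<exists>N. \<forall>n\<ge>N. s n \<in> carrier A \<and> nrm A (s n \<ominus> l) < \<epsilon>)"
 unfolding alg_top_def Metric_space.limit_metric_sequentially[OF metric_space]
 by (auto simp: alg_dist_def) (metis order_refl)+

lemma complete_seq:
 fixes s :: "nat => 'a"
 assumes "!!n. s n \<in> carrier A" "!!\<epsilon>. \<epsilon> > 0 ==> \<exists>N. \<forall>m\<ge>N. \<forall>n\<ge>N. nrm A (s m \<ominus> s n) < \<epsilon>"
 shows "\<exists>l\<in>carrier A. \<forall>\<epsilon>>0. \<exists>N. \<forall>n\<ge>N. nrm A (s n \<ominus> l) < \<epsilon>"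
proof -
 have "Metric_space.MCauchy (carrier A) (alg_dist A) s"
  unfolding Metric_space.MCauchy_def[OF metric_space] using assms by (auto simp: alg_dist_def) (metis)?
 then obtain l where "limitin (alg_top A) s l sequentially"
  using complete unfolding Metric_space.mcomplete_def[OF metric_space] alg_top_def by blast
 then show ?thesis unfolding limitin_iff by metis
qed

end

text \<open>Operations on a carrier become operations on a type by taking all C*-algebras on the ground type
 at once; each of them is then a corner of one algebra. The scalar component makes \<open>1 ~= 0\<close>.\<close>

typedef 'a alg_section = "{x :: ('a star_alg => 'a) \<times> complex.
  (\<forall>A. if cstar_algebra A then fst x A \<in> carrier A else fst x A = undefined) \<and>
  (\<exists>B. \<forall>A. cstar_algebra A --> nrm A (fst x A) <= B)}"
proof (intro exI CollectI conjI allI)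
 show "if cstar_algebra A then fst (%A. if cstar_algebra A then zero A else undefined, 0) A \<in> carrier A
   else fst (%A. if cstar_algebra A then zero A else undefined, 0) A = undefined" for A :: "'a star_alg"
  by (simp add: ring.ring_simprules[OF cstar_algebra.ring_A])
 show "cstar_algebra A --> nrm A (fst (%A. if cstar_algebra A then zero A else undefined, 0) A) <= 0" for A :: "'a star_alg"
  by (simp add: cstar_algebra.nrm_zero)
qed

definition sec_at :: "'a alg_section => 'a star_alg => 'a" where "sec_at x = fst (Rep_alg_section x)"
definition sec_scalar :: "'a alg_section => complex" where "sec_scalar x = snd (Rep_alg_section x)"
definition section_of :: "('a star_alg => 'a) => complex => 'a alg_section" where
 "section_of s z = Abs_alg_section (%A. if cstar_algebra A then s A else undefined, z)"

lemma sec_at_closed: "cstar_algebra A ==> sec_at x A \<in> carrier A"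
 using Rep_alg_section[of x] by (auto simp: sec_at_def split: if_splits)

lemma sec_at_bounded: "\<exists>B. \<forall>A. cstar_algebra A --> nrm A (sec_at x A) <= B"
 using Rep_alg_section[of x] by (auto simp: sec_at_def)

lemma section_eqI:
 assumes "!!A. cstar_algebra A ==> sec_at x A = sec_at y A" "sec_scalar x = sec_scalar y"
 shows "x = y"
proof -
 have "fst (Rep_alg_section x) A = fst (Rep_alg_section y) A" for A
  using Rep_alg_section[of x] Rep_alg_section[of y] assms(1)[of A] by (cases "cstar_algebra A") (auto simp: sec_at_def)
 then have "Rep_alg_section x = Rep_alg_section y" using assms(2) by (auto simp: sec_scalar_def prod_eq_iff)
 then show ?thesis by (simp add: Rep_alg_section_inject)
qed

lemma section_of:
 assumes "!!A. cstar_algebra A ==> s A \<in> carrier A" "!!A. cstar_algebra A ==> nrm A (s A) <= B"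
 shows "cstar_algebra A ==> sec_at (section_of s z) A = s A" "sec_scalar (section_of s z) = z"
proof -
 have "(%A. if cstar_algebra A then s A else undefined, z) \<in> {x :: ('a star_alg => 'a) \<times> complex.
  (\<forall>A. if cstar_algebra A then fst x A \<in> carrier A else fst x A = undefined) \<and>
  (\<exists>B. \<forall>A. cstar_algebra A --> nrm A (fst x A) <= B)}"
  using assms by (auto intro!: exI[of _ B])
 then have "Rep_alg_section (section_of s z) = (%A. if cstar_algebra A then s A else undefined, z)"
  unfolding section_of_def by (rule Abs_alg_section_inverse)
 then show "cstar_algebra A ==> sec_at (section_of s z) A = s A" "sec_scalar (section_of s z) = z"
  by (simp_all add: sec_at_def sec_scalar_def)
qed

text \<open>The index \<open>None\<close> is the scalar component; records that are not C*-algebras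
  contribute 0, so the supremum can run over a whole type.\<close>

definition sn :: "'a alg_section => 'a star_alg option => real" where
 "sn x k = (case k of None => cmod (sec_scalar x) | Some A => if cstar_algebra A then nrm A (sec_at x A) else 0)"

lemma bdd_above_sn: "bdd_above (range (sn x))"
proof -
 obtain B where B: "\<forall>A. cstar_algebra A --> nrm A (sec_at x A) <= B" using sec_at_bounded by blast
 have "sn x k <= max (max 0 B) (cmod (sec_scalar x))" for k
 proof (cases k)
  case None
  then show ?thesis by (simp add: sn_def)
 next
  case (Some A)
  then show ?thesis using B[rule_format, of A] by (simp add: sn_def le_max_iff_disj)
 qed
 then show ?thesis by (intro bdd_aboveI) auto
qed

lemma sn_nonneg: "sn x k >= 0"
 by (auto simp: sn_def cstar_algebra.nrm_nonneg sec_at_closed split: option.splits)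

instantiation alg_section :: (type) real_normed_algebra_1
begin

definition "0 = section_of (%A. zero A) 0"
definition "1 = section_of (%A. one A) 1"
definition "x + y = section_of (%A. add A (sec_at x A) (sec_at y A)) (sec_scalar x + sec_scalar y)"
definition "- x = section_of (%A. a_inv A (sec_at x A)) (- sec_scalar x)"
definition "x - y = (x :: 'a alg_section) + - y"
definition "x * y = section_of (%A. mult A (sec_at x A) (sec_at y A)) (sec_scalar x * sec_scalar y)"
definition "r *\<^sub>R x = section_of (%A. smult A (of_real r) (sec_at x A)) (of_real r * sec_scalar x)"
definition "norm x = (SUP k. sn x k)"
definition "dist x y = norm (x - y :: 'a alg_section)"
definition "sgn (x :: 'a alg_section) = inverse (norm x) *\<^sub>R x"
definition "(uniformity :: ('a alg_section \<times> 'a alg_section) filter) = (INF e\<in>{0<..}. principal {(x, y). dist x y < e})"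
definition "open (U :: 'a alg_section set) \<longleftrightarrow> (\<forall>x\<in>U. eventually (%(x', y). x' = x --> y \<in> U) uniformity)"

lemma sn_le_norm: "sn x k <= norm x"
 unfolding norm_alg_section_def by (rule cSUP_upper[OF UNIV_I bdd_above_sn])

lemma norm_le: "(!!k. sn x k <= B) ==> norm x <= B"
 unfolding norm_alg_section_def by (rule cSUP_least) auto

lemma nrm_sec_at_le: "cstar_algebra A ==> nrm A (sec_at x A) <= norm x"
 using sn_le_norm[of x "Some A"] by (simp add: sn_def)

lemma sec_at_0: "cstar_algebra A ==> sec_at 0 A = zero A" and sec_scalar_0: "sec_scalar 0 = 0"
 unfolding zero_alg_section_def
 by (subst section_of[where B = 0]; simp add: ring.ring_simprules[OF cstar_algebra.ring_A] cstar_algebra.nrm_zero)+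

lemma sec_at_add: "cstar_algebra A ==> sec_at (x + y) A = add A (sec_at x A) (sec_at y A)"
 and sec_scalar_add: "sec_scalar (x + y) = sec_scalar x + sec_scalar y"
proof -
 have *: "add A (sec_at x A) (sec_at y A) \<in> carrier A" "nrm A (add A (sec_at x A) (sec_at y A)) <= norm x + norm y"
  if A: "cstar_algebra A" for A
 proof -
  interpret cstar_algebra A by (rule A)
  show "add A (sec_at x A) (sec_at y A) \<in> carrier A" by (simp add: sec_at_closed A)
  show "nrm A (add A (sec_at x A) (sec_at y A)) <= norm x + norm y"
   using nrm_triangle[OF sec_at_closed[OF A] sec_at_closed[OF A], of x y] nrm_sec_at_le[OF A, of x] nrm_sec_at_le[OF A, of y]
   by linarith
 qed
 show "cstar_algebra A ==> sec_at (x + y) A = add A (sec_at x A) (sec_at y A)" "sec_scalar (x + y) = sec_scalar x + sec_scalar y"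
  unfolding plus_alg_section_def using section_of[OF *] by blast+
qed

lemma sec_at_uminus: "cstar_algebra A ==> sec_at (- x) A = a_inv A (sec_at x A)"
 and sec_scalar_uminus: "sec_scalar (- x) = - sec_scalar x"
proof -
 have *: "a_inv A (sec_at x A) \<in> carrier A" "nrm A (a_inv A (sec_at x A)) <= norm x"
  if A: "cstar_algebra A" for A
 proof -
  interpret cstar_algebra A by (rule A)
  show "a_inv A (sec_at x A) \<in> carrier A" by (simp add: sec_at_closed A)
  show "nrm A (a_inv A (sec_at x A)) <= norm x" by (simp add: nrm_uminus sec_at_closed A nrm_sec_at_le)
 qed
 show "cstar_algebra A ==> sec_at (- x) A = a_inv A (sec_at x A)" "sec_scalar (- x) = - sec_scalar x"
  unfolding uminus_alg_section_def using section_of[OF *] by blast+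
qed

lemma sec_at_mult: "cstar_algebra A ==> sec_at (x * y) A = mult A (sec_at x A) (sec_at y A)"
 and sec_scalar_mult: "sec_scalar (x * y) = sec_scalar x * sec_scalar y"
proof -
 have *: "mult A (sec_at x A) (sec_at y A) \<in> carrier A" "nrm A (mult A (sec_at x A) (sec_at y A)) <= norm x * norm y"
  if A: "cstar_algebra A" for A
 proof -
  interpret cstar_algebra A by (rule A)
  show "mult A (sec_at x A) (sec_at y A) \<in> carrier A" by (simp add: sec_at_closed A)
  show "nrm A (mult A (sec_at x A) (sec_at y A)) <= norm x * norm y"
   by (rule order_trans[OF nrm_mult])
    (auto simp: sec_at_closed A nrm_nonneg intro!: mult_mono nrm_sec_at_le intro: order_trans[OF nrm_nonneg nrm_sec_at_le])
 qed
 show "cstar_algebra A ==> sec_at (x * y) A = mult A (sec_at x A) (sec_at y A)" "sec_scalar (x * y) = sec_scalar x * sec_scalar y"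
  unfolding times_alg_section_def using section_of[OF *] by blast+
qed

lemma sec_at_scaleR: "cstar_algebra A ==> sec_at (r *\<^sub>R x) A = smult A (of_real r) (sec_at x A)"
 and sec_scalar_scaleR: "sec_scalar (r *\<^sub>R x) = of_real r * sec_scalar x"
proof -
 have *: "smult A (of_real r) (sec_at x A) \<in> carrier A" "nrm A (smult A (of_real r) (sec_at x A)) <= \<bar>r\<bar> * norm x"
  if A: "cstar_algebra A" for A
  using that by (auto simp: cstar_algebra.smult_cl sec_at_closed cstar_algebra.nrm_smult intro: mult_left_mono nrm_sec_at_le)
 show "cstar_algebra A ==> sec_at (r *\<^sub>R x) A = smult A (of_real r) (sec_at x A)" "sec_scalar (r *\<^sub>R x) = of_real r * sec_scalar x"
  unfolding scaleR_alg_section_def using section_of[OF *] by blast+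
qed

lemma sec_at_1: "cstar_algebra A ==> sec_at 1 A = one A" and sec_scalar_1: "sec_scalar 1 = 1"
 unfolding one_alg_section_def
 by (subst section_of[where B = 1]; simp add: ring.ring_simprules[OF cstar_algebra.ring_A] cstar_algebra.nrm_one_le)+

lemmas sec_at_ring_simps = sec_at_0 sec_at_add sec_at_uminus sec_at_mult sec_at_scaleR sec_at_1
lemmas sec_scalar_ring_simps = sec_scalar_0 sec_scalar_add sec_scalar_uminus sec_scalar_mult sec_scalar_scaleR sec_scalar_1

lemma norm_mult_section: "norm (x * y) <= norm x * norm (y :: 'a alg_section)"
proof (rule norm_le)
 fix k
 have "sn (x * y) k <= sn x k * sn y k"
  by (auto simp: sn_def norm_mult sec_at_ring_simps sec_scalar_ring_simps cstar_algebra.nrm_mult sec_at_closed split: option.splits)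
 also have "... <= norm x * norm y"
  by (intro mult_mono sn_le_norm sn_nonneg order_trans[OF sn_nonneg sn_le_norm])
 finally show "sn (x * y) k <= norm x * norm y" .
qed

lemma norm_scaleR_le: "norm (r *\<^sub>R x) <= \<bar>r\<bar> * norm (x :: 'a alg_section)"
proof (rule norm_le)
 fix k
 have "sn (r *\<^sub>R x) k <= \<bar>r\<bar> * sn x k"
  by (auto simp: sn_def norm_mult sec_at_ring_simps sec_scalar_ring_simps cstar_algebra.nrm_smult sec_at_closed split: option.splits)
 also have "... <= \<bar>r\<bar> * norm x" by (intro mult_left_mono sn_le_norm) auto
 finally show "sn (r *\<^sub>R x) k <= \<bar>r\<bar> * norm x" .
qed

instance
proof
 fix x y z :: "'a alg_section" and r s :: real
 note rs = ring.ring_simprules[OF cstar_algebra.ring_A]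
 note cs = sec_at_ring_simps sec_at_closed rs
 show "x + y + z = x + (y + z)" by (rule section_eqI) (simp_all add: cs sec_scalar_ring_simps)
 show xy: "x + y = y + x" by (rule section_eqI) (simp_all add: cs sec_scalar_ring_simps)
 show "0 + x = x" by (rule section_eqI) (simp_all add: cs sec_scalar_ring_simps)
 show "- x + x = 0" by (rule section_eqI) (simp_all add: cs sec_scalar_ring_simps)
 show "x - y = x + - y" by (simp add: minus_alg_section_def)
 show "x * y * z = x * (y * z)" by (rule section_eqI) (simp_all add: cs sec_scalar_ring_simps)
 show "(x + y) * z = x * z + y * z" by (rule section_eqI) (simp_all add: cs sec_scalar_ring_simps algebra_simps)
 show "x * (y + z) = x * y + x * z" by (rule section_eqI) (simp_all add: cs sec_scalar_ring_simps algebra_simps)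
 show "1 * x = x" by (rule section_eqI) (simp_all add: cs sec_scalar_ring_simps)
 show "x * 1 = x"
  by (rule section_eqI) (simp_all add: sec_at_ring_simps sec_at_closed sec_scalar_ring_simps monoid.r_one[OF ring.is_monoid[OF cstar_algebra.ring_A]])
 show "(0::'a alg_section) ~= 1" using sec_scalar_0 sec_scalar_1 by (metis zero_neq_one)
 show "r *\<^sub>R (x + y) = r *\<^sub>R x + r *\<^sub>R y"
  by (rule section_eqI) (simp_all add: cs sec_scalar_ring_simps algebra_simps cstar_algebra.smult_add_right)
 show "(r + s) *\<^sub>R x = r *\<^sub>R x + s *\<^sub>R x"
  by (rule section_eqI) (simp_all add: cs sec_scalar_ring_simps algebra_simps cstar_algebra.smult_add_left)
 show "r *\<^sub>R s *\<^sub>R x = (r * s) *\<^sub>R x"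
  by (rule section_eqI) (simp_all add: cs sec_scalar_ring_simps cstar_algebra.smult_smult)
 show "1 *\<^sub>R x = x" by (rule section_eqI) (simp_all add: cs sec_scalar_ring_simps cstar_algebra.smult_1)
 show "r *\<^sub>R x * y = r *\<^sub>R (x * y)"
  by (rule section_eqI) (simp_all add: cs sec_scalar_ring_simps cstar_algebra.smult_mult_left)
 show "x * r *\<^sub>R y = r *\<^sub>R (x * y)"
  by (rule section_eqI) (simp_all add: cs sec_scalar_ring_simps cstar_algebra.smult_mult_right)
 show "dist x y = norm (x - y)" by (simp add: dist_alg_section_def)
 show "sgn x = inverse (norm x) *\<^sub>R x" by (simp add: sgn_alg_section_def)
 show "uniformity = (INF e\<in>{0<..}. principal {(x, y :: 'a alg_section). dist x y < e})"
  by (simp add: uniformity_alg_section_def)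
 show "open U \<longleftrightarrow> (\<forall>x\<in>U. eventually (%(x', y). x' = x --> y \<in> U) uniformity)" for U :: "'a alg_section set"
  by (simp add: open_alg_section_def)
 show "norm x = 0 \<longleftrightarrow> x = 0"
 proof
  assume n: "norm x = 0"
  have s: "sn x k = 0" for k using sn_le_norm[of x k] sn_nonneg[of x k] n by simp
  show "x = 0"
  proof (rule section_eqI)
   fix A :: "'a star_alg" assume A: "cstar_algebra A"
   then show "sec_at x A = sec_at 0 A"
    using s[of "Some A"] by (simp add: sn_def sec_at_ring_simps cstar_algebra.nrm_eq_0_iff sec_at_closed)
  next
   show "sec_scalar x = sec_scalar 0" using s[of None] by (simp add: sn_def sec_scalar_ring_simps)
  qed
 next
  assume "x = 0"
  then have "sn x k = 0" for k
   by (auto simp: sn_def sec_scalar_ring_simps sec_at_ring_simps cstar_algebra.nrm_zero split: option.splits)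
  then show "norm x = 0" by (simp add: norm_alg_section_def)
 qed
 show "norm (x + y) <= norm x + norm y"
 proof (rule norm_le)
  fix k
  have "sn (x + y) k <= sn x k + sn y k"
   by (auto simp: sn_def norm_triangle_ineq sec_at_ring_simps sec_scalar_ring_simps cstar_algebra.nrm_triangle sec_at_closed split: option.splits)
  then show "sn (x + y) k <= norm x + norm y" using sn_le_norm[of x k] sn_le_norm[of y k] by linarith
 qed
 show "norm (r *\<^sub>R x) = \<bar>r\<bar> * norm x"
 proof (cases "r = 0")
  case True
  have "0 <= norm (0 *\<^sub>R x)" by (rule order_trans[OF sn_nonneg sn_le_norm])
  then show ?thesis using True norm_scaleR_le[of 0 x] by simp
 next
  case False
  have "(1 / r) *\<^sub>R r *\<^sub>R x = x"
   by (rule section_eqI) (use False in \<open>simp_all add: cs sec_scalar_ring_simps cstar_algebra.smult_1 flip: cstar_algebra.smult_smult of_real_mult\<close>)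
  then have "norm x <= \<bar>1 / r\<bar> * norm (r *\<^sub>R x)" by (metis norm_scaleR_le)
  then have "\<bar>r\<bar> * norm x <= norm (r *\<^sub>R x)" using False by (simp add: field_simps abs_divide)
  then show ?thesis using norm_scaleR_le[of r x] by simp
 qed
 show "norm (x * y) <= norm x * norm y" by (rule norm_mult_section)
 show "norm (1::'a alg_section) = 1"
 proof (rule antisym)
  show "norm (1::'a alg_section) <= 1"
   by (rule norm_le) (auto simp: sn_def sec_scalar_ring_simps sec_at_ring_simps cstar_algebra.nrm_one_le split: option.splits)
  show "1 <= norm (1::'a alg_section)" using sn_le_norm[of 1 None] by (simp add: sn_def sec_scalar_ring_simps)
 qed
qed

end

instantiation alg_section :: (type) cstar
begin

definition "adj x = section_of (%A. star A (sec_at x A)) (cnj (sec_scalar x))"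
definition "imag = section_of (%A. smult A \<i> (one A)) \<i>"

lemma sec_at_imag: "cstar_algebra A ==> sec_at imag A = smult A \<i> (one A)" and sec_scalar_imag: "sec_scalar imag = \<i>"
 unfolding imag_alg_section_def
 by (subst section_of[where B = 1]; simp add: ring.ring_simprules[OF cstar_algebra.ring_A] cstar_algebra.nrm_one_le
   cstar_algebra.smult_cl cstar_algebra.nrm_smult)+

lemma sec_at_adj: "cstar_algebra A ==> sec_at (adj x) A = star A (sec_at x A)" and sec_scalar_adj: "sec_scalar (adj x) = cnj (sec_scalar x)"
 unfolding adj_alg_section_def
 by (subst section_of[where B = "norm x"]; simp add: cstar_algebra.star_closed sec_at_closed cstar_algebra.nrm_star nrm_sec_at_le)+

lemma sec_at_diff: "cstar_algebra A ==> sec_at (x - y) A = sec_at x A \<ominus>\<^bsub>A\<^esub> sec_at y A"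
 and sec_scalar_diff: "sec_scalar (x - y) = sec_scalar x - sec_scalar y"
 by (simp_all only: minus_alg_section_def sec_at_ring_simps sec_scalar_ring_simps a_minus_def) simp

lemmas sec_at_simps = sec_at_ring_simps sec_at_diff sec_at_imag sec_at_adj
lemmas sec_scalar_simps = sec_scalar_ring_simps sec_scalar_diff sec_scalar_imag sec_scalar_adj

lemma norm_adj_mult_section: "norm (adj x * x) = norm (x :: 'a alg_section) ^ 2"
proof (rule antisym)
 have sq: "sn (adj x * x) k = sn x k ^ 2" for k
  by (cases k) (simp_all add: sn_def norm_mult sec_at_adj sec_at_mult sec_scalar_adj sec_scalar_mult cstar_algebra.nrm_star_mult sec_at_closed power2_eq_square)
 show "norm (adj x * x) <= norm x ^ 2"
  by (rule norm_le) (simp add: sq power_mono sn_nonneg sn_le_norm)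
 have "norm x <= sqrt (norm (adj x * x))"
  by (rule norm_le, rule real_le_rsqrt) (use sn_le_norm[of "adj x * x"] in \<open>simp add: sq\<close>)
 then have "norm x ^ 2 <= sqrt (norm (adj x * x)) ^ 2"
  by (intro power_mono order_trans[OF sn_nonneg sn_le_norm])
 then show "norm x ^ 2 <= norm (adj x * x)"
  using order_trans[OF sn_nonneg sn_le_norm[of "adj x * x"]] by simp
qed

instance
proof
 fix x y z :: "'a alg_section" and r s :: real
 note rs = ring.ring_simprules[OF cstar_algebra.ring_A]
 note cs = sec_at_simps sec_at_closed rs
 show "imag * imag = (- 1 :: 'a alg_section)"
  by (rule section_eqI) (simp_all add: cs sec_scalar_simps cstar_algebra.smult_cl cstar_algebra.smult_mult_left
    cstar_algebra.smult_minus_one flip: cstar_algebra.smult_smult)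
 show "imag * x = x * imag"
  by (rule section_eqI) (simp_all add: cs sec_scalar_simps cstar_algebra.smult_mult_left cstar_algebra.smult_mult_right
    monoid.r_one[OF ring.is_monoid[OF cstar_algebra.ring_A]])
 show "adj imag = (- imag :: 'a alg_section)"
 proof (rule section_eqI)
  fix A :: "'a star_alg" assume A: "cstar_algebra A"
  then show "sec_at (adj imag) A = sec_at (- imag) A"
   by (simp add: sec_at_simps cstar_algebra.star_smult cstar_algebra.star_one cstar_algebra.smult_minus rs)
 qed (simp add: sec_scalar_simps)
 show "adj (x + y) = adj x + adj y"
  by (rule section_eqI) (simp_all add: cs sec_scalar_simps cstar_algebra.star_add)
 show "adj (x * y) = adj y * adj x"
  by (rule section_eqI) (simp_all add: cs sec_scalar_simps cstar_algebra.star_mult)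
 show "adj (adj x) = x"
  by (rule section_eqI) (simp_all add: cs sec_scalar_simps cstar_algebra.star_star)
 show "adj (r *\<^sub>R x) = r *\<^sub>R adj x"
  by (rule section_eqI) (simp_all add: cs sec_scalar_simps cstar_algebra.star_smult)
 show "norm (adj x * x) = norm x ^ 2" by (rule norm_adj_mult_section)
 fix X :: "nat => 'a alg_section"
 assume "Cauchy X"
 then have C: "\<exists>N. \<forall>m\<ge>N. \<forall>n\<ge>N. norm (X m - X n) < e" if "e > 0" for e
  using that unfolding Cauchy_def dist_alg_section_def by blast
 have sdN: "cmod (sec_scalar (X m) - sec_scalar (X n)) <= norm (X m - X n)" for m n
  using sn_le_norm[of "X m - X n" None] by (simp add: sn_def sec_scalar_simps)
 have cl: "\<exists>l\<in>carrier A. \<forall>e>0. \<exists>N. \<forall>n\<ge>N. nrm A (sec_at (X n) A \<ominus>\<^bsub>A\<^esub> l) < e" if A: "cstar_algebra A" for A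
 proof (rule cstar_algebra.complete_seq[OF A sec_at_closed[OF A]])
  fix e :: real assume "e > 0"
  then obtain N where "\<forall>m\<ge>N. \<forall>n\<ge>N. norm (X m - X n) < e" using C by blast
  then show "\<exists>N. \<forall>m\<ge>N. \<forall>n\<ge>N. nrm A (sec_at (X m) A \<ominus>\<^bsub>A\<^esub> sec_at (X n) A) < e"
   unfolding sec_at_diff[OF A, symmetric] by (meson le_less_trans nrm_sec_at_le[OF A])
 qed
 have "Cauchy (%n. sec_scalar (X n))"
 proof (rule CauchyI)
  fix e :: real assume "e > 0"
  then obtain N where "\<forall>m\<ge>N. \<forall>n\<ge>N. norm (X m - X n) < e" using C by blast
  then show "\<exists>M. \<forall>m\<ge>M. \<forall>n\<ge>M. cmod (sec_scalar (X m) - sec_scalar (X n)) < e"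
   using sdN by (meson le_less_trans)
 qed
 then obtain zl where zl: "(%n. sec_scalar (X n)) \<longlonglongrightarrow> zl" using Cauchy_convergent_iff convergent_def by blast
 define s where "s A = (SOME l. l \<in> carrier A \<and> (\<forall>e>0. \<exists>N. \<forall>n\<ge>N. nrm A (sec_at (X n) A \<ominus>\<^bsub>A\<^esub> l) < e))" for A
 have s: "s A \<in> carrier A \<and> (\<forall>e>0. \<exists>N. \<forall>n\<ge>N. nrm A (sec_at (X n) A \<ominus>\<^bsub>A\<^esub> s A) < e)" if "cstar_algebra A" for A
  unfolding s_def by (rule someI_ex) (use cl[OF that] in blast)
 \<comment> \<open>\<open>N\<close> comes from the norm and is the same for all algebras, so the
   componentwise limits form a bounded section and convergence is uniform.\<close>
 have lim: "nrm A (sec_at (X m) A \<ominus>\<^bsub>A\<^esub> s A) <= e" if A: "cstar_algebra A" and N: "\<forall>n\<ge>N. norm (X m - X n) < e" for A m N e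
 proof (rule field_le_epsilon)
  fix d :: real assume "d > 0"
  then obtain N' where N': "\<forall>n\<ge>N'. nrm A (sec_at (X n) A \<ominus>\<^bsub>A\<^esub> s A) < d" using s[OF A] by blast
  let ?n = "max N N'"
  interpret cstar_algebra A by (rule A)
  have cc: "sec_at (X m) A \<in> carrier A" "sec_at (X ?n) A \<in> carrier A" "s A \<in> carrier A" using sec_at_closed[OF A] s[OF A] by auto
  have "sec_at (X m) A \<ominus>\<^bsub>A\<^esub> s A = (sec_at (X m) A \<ominus>\<^bsub>A\<^esub> sec_at (X ?n) A) \<oplus>\<^bsub>A\<^esub> (sec_at (X ?n) A \<ominus>\<^bsub>A\<^esub> s A)"
   using cc by (simp add: M.minus_eq M.a_assoc) (metis M.a_assoc M.a_inv_closed M.l_neg M.l_zero)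
  then have "nrm A (sec_at (X m) A \<ominus>\<^bsub>A\<^esub> s A) <= nrm A (sec_at (X m) A \<ominus>\<^bsub>A\<^esub> sec_at (X ?n) A) + nrm A (sec_at (X ?n) A \<ominus>\<^bsub>A\<^esub> s A)"
   using nrm_triangle cc by (metis M.minus_closed)
  moreover have "nrm A (sec_at (X m) A \<ominus>\<^bsub>A\<^esub> sec_at (X ?n) A) <= norm (X m - X ?n)"
   using nrm_sec_at_le[OF A, of "X m - X ?n"] by (simp add: sec_at_simps A)
  moreover have "norm (X m - X ?n) < e" "nrm A (sec_at (X ?n) A \<ominus>\<^bsub>A\<^esub> s A) < d" using N N' by auto
  ultimately show "nrm A (sec_at (X m) A \<ominus>\<^bsub>A\<^esub> s A) <= e + d" by linarith
 qed
 obtain N0 where N0: "\<forall>m\<ge>N0. \<forall>n\<ge>N0. norm (X m - X n) < 1" using C[of 1] by auto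
 have bd: "nrm A (s A) <= norm (X N0) + 1" if A: "cstar_algebra A" for A
 proof -
  interpret cstar_algebra A by (rule A)
  have cc: "sec_at (X N0) A \<in> carrier A" "s A \<in> carrier A" using sec_at_closed[OF A] s[OF A] by auto
  have "s A = sec_at (X N0) A \<oplus>\<^bsub>A\<^esub> \<ominus>\<^bsub>A\<^esub> (sec_at (X N0) A \<ominus>\<^bsub>A\<^esub> s A)"
   using cc by (simp add: M.minus_eq M.minus_add M.r_neg1 M.r_neg2)
  then have "nrm A (s A) <= nrm A (sec_at (X N0) A) + nrm A (\<ominus>\<^bsub>A\<^esub> (sec_at (X N0) A \<ominus>\<^bsub>A\<^esub> s A))"
   using nrm_triangle cc by (metis M.minus_closed M.a_inv_closed)
  also have "nrm A (\<ominus>\<^bsub>A\<^esub> (sec_at (X N0) A \<ominus>\<^bsub>A\<^esub> s A)) <= 1" using lim[OF A, of N0 N0 1] N0 cc by (simp add: nrm_uminus)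
  finally show ?thesis using nrm_sec_at_le[OF A, of "X N0"] by linarith
 qed
 define L where "L = section_of s zl"
 have L: "!!A. cstar_algebra A ==> sec_at L A = s A" "sec_scalar L = zl"
  unfolding L_def by (rule section_of[where B = "norm (X N0) + 1"]; use s bd in blast)+
 have "X \<longlonglongrightarrow> L"
  unfolding lim_sequentially dist_alg_section_def
 proof (intro allI impI)
  fix e :: real assume e: "e > 0"
  then obtain N where N: "\<forall>m\<ge>N. \<forall>n\<ge>N. norm (X m - X n) < e/2" using C[of "e/2"] by auto
  have "norm (X m - L) < e" if m: "m >= N" for m
  proof -
   have "norm (X m - L) <= e/2"
   proof (rule norm_le)
    fix k
    show "sn (X m - L) k <= e/2"
    proof (cases k)
     case None
     have "(%n. cmod (sec_scalar (X m) - sec_scalar (X n))) \<longlonglongrightarrow> cmod (sec_scalar (X m) - zl)" by (intro tendsto_intros zl)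
     moreover have "\<forall>n\<ge>N. cmod (sec_scalar (X m) - sec_scalar (X n)) <= e/2"
      using sdN N m by (meson le_less_trans less_imp_le)
     ultimately have "cmod (sec_scalar (X m) - zl) <= e/2" by (meson LIMSEQ_le_const2)
     then show ?thesis using None by (simp add: sn_def sec_scalar_simps L)
    next
     case (Some A)
     then show ?thesis using lim[of A N m "e/2"] N m e by (simp add: sn_def sec_at_simps L)
    qed
   qed
   then show ?thesis using e by simp
  qed
  then show "\<exists>N. \<forall>n\<ge>N. norm (X n - L) < e" by blast
 qed
 then show "convergent X" by (auto simp: convergent_def)
qed

end

section \<open>Embedding a C*-algebra as a corner\<close>

context cstar_algebra
begin

text \<open>Zero in every other algebra and in the scalar component. Hence the unit goes to a
  central projection and not to 1.\<close>

definition emb :: "'a => 'a alg_section" where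
 "emb x = section_of (%B. if B = A then x else zero B) 0"

definition proj :: "'a alg_section => 'a" where
 "proj b = sec_at b A"

lemma self: "cstar_algebra A" by (rule cstar_algebra_axioms)

lemma sec_at_emb:
 assumes x: "x \<in> carrier A"
 shows "cstar_algebra B ==> sec_at (emb x) B = (if B = A then x else zero B)" "sec_scalar (emb x) = 0"
 unfolding emb_def
 by (rule section_of[where B = "nrm A x"];
   use x in \<open>simp add: ring.ring_simprules[OF cstar_algebra.ring_A] cstar_algebra.nrm_zero nrm_nonneg\<close>)+

lemma proj_closed [simp]: "proj b \<in> carrier A"
 by (simp add: proj_def sec_at_closed self)

lemma proj_emb [simp]: "x \<in> carrier A ==> proj (emb x) = x"
 by (simp add: proj_def sec_at_emb self)

lemma proj_add: "proj (b + c) = proj b \<oplus> proj c"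
 and proj_mult: "proj (b * c) = proj b \<otimes> proj c"
 and proj_uminus: "proj (- b) = \<ominus> proj b"
 and proj_adj: "proj (adj b) = star A (proj b)"
 and proj_0: "proj 0 = \<zero>"
 and proj_1: "proj 1 = \<one>"
 by (simp_all add: proj_def sec_at_simps self)

lemma proj_diff: "proj (b - c) = proj b \<ominus> proj c"
 using proj_add[of b "- c"] by (simp add: proj_uminus M.minus_eq)

lemma proj_scaleR: "proj (r *\<^sub>R b) = of_real r \<odot> proj b"
 by (simp add: proj_def sec_at_simps self)

lemma proj_cx: "proj (cx z * b) = z \<odot> proj b"
proof -
 have "cx z * b = Re z *\<^sub>R b + Im z *\<^sub>R (imag * b)"
  by (simp add: cx_def algebra_simps mult_of_real_left)
 then have "proj (cx z * b) = (of_real (Re z) \<odot> proj b) \<oplus> (of_real (Im z) \<odot> (\<i> \<odot> proj b))"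
  by (simp add: proj_add proj_scaleR proj_mult) (simp add: proj_def sec_at_simps self smult_mult_left sec_at_closed)
 also have "... = z \<odot> proj b"
  by (simp only: smult_smult[symmetric] smult_add_left[symmetric] proj_closed mult.commute complex_eq[symmetric])
 finally show ?thesis .
qed

lemma proj_power: "proj (b ^ n) = proj b [^] n"
 by (induction n) (simp_all add: proj_1 proj_mult power_Suc2 del: power_Suc)

lemma proj_sum: "proj (sum f I) = (\<Oplus>i\<in>I. proj (f i))"
 by (induction I rule: infinite_finite_induct) (simp_all add: proj_0 proj_add)

lemma emb_proj: "emb (proj b) = emb \<one> * b"
proof (rule section_eqI)
 fix B :: "'a star_alg" assume B: "cstar_algebra B"
 interpret B: ring B by (rule cstar_algebra.ring_A[OF B])
 show "sec_at (emb (proj b)) B = sec_at (emb \<one> * b) B"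
  using sec_at_closed[OF B, of b] B sec_at_closed[OF self, of b] by (simp add: sec_at_emb sec_at_simps) (simp add: proj_def)
qed (simp add: sec_at_emb sec_scalar_simps)

lemma emb_unit: "x \<in> carrier A ==> emb \<one> * emb x = emb x"
 using emb_proj[of "emb x"] by simp

lemma emb_one_central: "emb \<one> * b = b * emb \<one>"
proof (rule section_eqI)
 fix B :: "'a star_alg" assume B: "cstar_algebra B"
 interpret B: ring B by (rule cstar_algebra.ring_A[OF B])
 show "sec_at (emb \<one> * b) B = sec_at (b * emb \<one>) B"
  using sec_at_closed[OF B, of b] B sec_at_closed[OF self, of b] by (simp add: sec_at_emb sec_at_simps)
qed (simp add: sec_at_emb sec_scalar_simps)

lemma emb_adj_one: "adj (emb \<one>) = emb \<one>"
proof (rule section_eqI)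
 fix B :: "'a star_alg" assume B: "cstar_algebra B"
 then show "sec_at (adj (emb \<one>)) B = sec_at (emb \<one>) B"
  by (simp add: sec_at_emb sec_at_simps star_one cstar_algebra.star_zero)
qed (simp add: sec_at_emb sec_scalar_simps)

sublocale E: corner_algebra "emb \<one>"
 by unfold_locales (rule emb_unit[OF one_closed] emb_adj_one emb_one_central[symmetric])+

abbreviation Ec :: "'a alg_section set" where "Ec \<equiv> E.Ac"

lemma emb_in [simp]: "x \<in> carrier A ==> emb x \<in> Ec"
 by (simp add: E.Ac_def emb_unit)

lemma emb_proj_id: "b \<in> Ec ==> emb (proj b) = b"
 by (simp add: emb_proj E.Ac_left)

lemma emb_eqI: "b \<in> Ec ==> proj b = x ==> emb x = b"
 using emb_proj_id by blast

lemma emb_inj: "x \<in> carrier A ==> y \<in> carrier A ==> emb x = emb y \<longleftrightarrow> x = y"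
 using proj_emb by metis

lemma emb_add: "x \<in> carrier A ==> y \<in> carrier A ==> emb (x \<oplus> y) = emb x + emb y"
 and emb_mult: "x \<in> carrier A ==> y \<in> carrier A ==> emb (x \<otimes> y) = emb x * emb y"
 and emb_diff: "x \<in> carrier A ==> y \<in> carrier A ==> emb (x \<ominus> y) = emb x - emb y"
 by (rule emb_eqI; simp add: proj_add proj_mult proj_diff E.Ac_add E.Ac_mult E.Ac_diff)+

lemma emb_uminus: "x \<in> carrier A ==> emb (\<ominus> x) = - emb x"
 and emb_smult: "x \<in> carrier A ==> emb (z \<odot> x) = cx z * emb x"
 and emb_star: "x \<in> carrier A ==> emb (star A x) = adj (emb x)"
 and emb_zero: "emb \<zero> = 0"
 by (rule emb_eqI; simp add: proj_uminus proj_cx proj_adj proj_0 E.Ac_uminus E.Ac_cx E.Ac_adj)+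

lemma emb_finsum: "(!!i. i \<in> I ==> f i \<in> carrier A) ==> emb (\<Oplus>i\<in>I. f i) = (\<Sum>i\<in>I. emb (f i))"
 by (rule emb_eqI) (auto simp: E.Ac_sum proj_sum intro!: M.finsum_cong')

lemma emb_pow: "x \<in> carrier A ==> n > 0 ==> emb (x [^] n) = emb x ^ n"
proof (rule emb_eqI)
 assume x: "x \<in> carrier A" "n > 0"
 then obtain m where "n = Suc m" by (cases n) auto
 then show "emb x ^ n \<in> Ec" using x by (simp add: E.Ac_mult_left)
qed (simp add: proj_power)

lemma norm_emb: "x \<in> carrier A ==> norm (emb x) = nrm A x"
proof (rule antisym)
 assume x: "x \<in> carrier A"
 show "norm (emb x) <= nrm A x"
  by (rule norm_le) (use x in \<open>auto simp: sn_def sec_at_emb cstar_algebra.nrm_zero nrm_nonneg split: option.splits\<close>)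
 show "nrm A x <= norm (emb x)"
  using nrm_sec_at_le[OF self, of "emb x"] x by (simp add: sec_at_emb self)
qed

lemma nrm_proj: "b \<in> Ec ==> nrm A (proj b) = norm b"
 using norm_emb[OF proj_closed, of b] by (simp add: emb_proj_id)

text \<open>Off the corner \<open>x\<close> vanishes and \<open>of_real t + x\<close> is the scalar
  \<open>t\<close>, so the inverse there is \<open>1 / t\<close>.\<close>

lemma corner_inverse:
 assumes "y \<in> Ec" "(of_real t + x) * y = emb \<one>" "x \<in> Ec" "t ~= 0"
 shows "(of_real t + x) * (y + (1 / t) *\<^sub>R (1 - emb \<one>)) = 1"
proof -
 have "x * emb \<one> = x" by (rule E.Ac_right[OF assms(3)])
 then have "(of_real t + x) * ((1 / t) *\<^sub>R (1 - emb \<one>)) = 1 - emb \<one>"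
  using assms(4) by (simp add: distrib_right mult_of_real_left right_diff_distrib scaleR_diff_right scaleR_add_right of_real_def)
 then show ?thesis using assms(2) by (simp add: distrib_left)
qed

lemma Units_iff: "u \<in> Units A \<longleftrightarrow> u \<in> carrier A \<and> (\<exists>y\<in>carrier A. u \<otimes> y = \<one> \<and> y \<otimes> u = \<one>)"
 by (auto simp: Units_def)

text \<open>The bridge between the spectrum in \<open>A\<close> and squares in the ambient algebra.
  Forwards only negative reals are tested, by \<open>psd_of_invertible\<close>; backwards
  \<open>psd_resolvent\<close> gives inverses, which \<open>proj\<close> carries to
  \<open>A\<close>.\<close>

lemma positive_iff: "positive A a \<longleftrightarrow> a \<in> carrier A \<and> psd (emb a)"
proof
 assume p: "positive A a"
 then have a: "a \<in> carrier A" "star A a = a" by (auto simp: positive_def self_adjoint_def)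
 have "psd (emb a)"
 proof (rule psd_of_invertible)
  show "adj (emb a) = emb a" using a emb_star[of a] by simp
  fix t :: real assume t: "t > 0"
  then have "of_real (- t) \<notin> alg_spectrum A a"
   using p by (auto simp: positive_def nonneg_Reals_of_real_iff simp del: of_real_minus)
  then obtain y where y: "y \<in> carrier A" "((of_real (- t) \<odot> \<one>) \<ominus> a) \<otimes> y = \<one>"
   by (auto simp: alg_spectrum_def Units_def)
  have "emb (((of_real (- t) \<odot> \<one>) \<ominus> a) \<otimes> y) = (cx (of_real (- t)) * emb \<one> - emb a) * emb y"
   using a y(1) by (simp add: emb_mult emb_diff emb_smult smult_cl del: of_real_minus)
  then have "(of_real t + emb a) * (- emb y) = emb \<one>"
   unfolding y(2) using y(1) by (simp add: algebra_simps cx_uminus cx_of_real mult.assoc emb_unit)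
  then show "\<exists>y. (of_real t + emb a) * y = 1"
   using corner_inverse[of "- emb y" t "emb a"] y a t by (auto simp: E.Ac_uminus)
 qed
 then show "a \<in> carrier A \<and> psd (emb a)" using a by simp
next
 assume a: "a \<in> carrier A \<and> psd (emb a)"
 have "z \<in> \<real>\<^sub>\<ge>\<^sub>0" if z: "z \<in> alg_spectrum A a" for z
 proof (rule ccontr)
  assume "z \<notin> \<real>\<^sub>\<ge>\<^sub>0"
  then obtain y where y: "(cx z - emb a) * y = 1" "y * (cx z - emb a) = 1"
   using psd_resolvent a by blast
  have "proj (cx z - emb a) = (z \<odot> \<one>) \<ominus> a"
   using a proj_cx[of z 1] by (simp add: proj_diff proj_1)
  then have "((z \<odot> \<one>) \<ominus> a) \<otimes> proj y = \<one>" "proj y \<otimes> ((z \<odot> \<one>) \<ominus> a) = \<one>"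
   using arg_cong[OF y(1), of proj] arg_cong[OF y(2), of proj] by (simp_all add: proj_mult proj_1)
  then have "(z \<odot> \<one>) \<ominus> a \<in> Units A"
   using a smult_cl[of \<one> z] by (auto simp: Units_iff intro!: bexI[of _ "proj y"])
  then show False using z by (simp add: alg_spectrum_def)
 qed
 moreover have "star A a = a" using a psd_sa[of "emb a"] emb_star[of a] emb_inj[of "star A a" a] star_closed by simp
 ultimately show "positive A a" using a by (auto simp: positive_def self_adjoint_def)
qed

lemma positive_proj: "b \<in> Ec ==> psd b ==> positive A (proj b)"
 by (simp add: positive_iff emb_proj_id)

section \<open>Roots, dimension functions and comparison\<close>

lemma continuous_root: "continuous_on UNIV (root n)"
 by (rule continuous_on_real_root) (rule continuous_on_id)

lemma cfc_root_power: "psd b ==> n > 0 ==> cfc (root n) b ^ n = (b::'b::cstar)"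
proof -
 assume b: "psd b" "n > 0"
 have "cfc (root n) b ^ n = cfc (%t. root n t ^ n) b"
  using b by (simp add: cfc_power continuous_root psd_sa)
 also have "... = cfc (%t. t) b"
  by (rule cfc_psd_cong) (use b in \<open>auto intro!: continuous_intros continuous_root\<close>)
 finally show ?thesis using b by (simp add: cfc_id psd_sa)
qed

lemma cfc_root_of_power: "psd b ==> n > 0 ==> cfc (root n) (b ^ n) = (b::'b::cstar)"
proof -
 assume b: "psd b" "n > 0"
 have "peval (monom 1 n) b = b ^ n"
  by (induction n) (simp_all add: monom_0 monom_Suc)
 then have "cfc (root n) (b ^ n) = cfc (%t. root n (poly (monom 1 n) t)) b"
  using cfc_pcompose[OF continuous_root psd_sa[OF b(1)], of n "monom 1 n"] by simp
 also have "... = cfc (%t. t) b"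
  by (rule cfc_psd_cong) (use b in \<open>auto intro!: continuous_intros continuous_root simp: poly_monom real_root_power_cancel\<close>)
 finally show ?thesis using b by (simp add: cfc_id psd_sa)
qed

text \<open>The description defining \<open>alg_root\<close> is settled by
  \<open>cfc_root_of_power\<close>: any positive \<open>b\<close> is recovered from its power by
  functional calculus.\<close>

lemma alg_root_eq:
 assumes a: "positive A a" and n: "n > 0"
 shows "alg_root A n a = proj (cfc (root n) (emb a))" "cfc (root n) (emb a) \<in> Ec" "psd (cfc (root n) (emb a))"
proof -
 have a': "a \<in> carrier A" "psd (emb a)" using a by (auto simp: positive_iff)
 show Ec: "cfc (root n) (emb a) \<in> Ec" by (rule E.Ac_cfc) (use a' n in \<open>auto simp: continuous_root psd_sa\<close>)
 show p: "psd (cfc (root n) (emb a))" by (rule cfc_psd) (use a' n in \<open>auto simp: continuous_root\<close>)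
 show "alg_root A n a = proj (cfc (root n) (emb a))"
  unfolding alg_root_def
 proof (rule the_equality)
  show "positive A (proj (cfc (root n) (emb a))) \<and> proj (cfc (root n) (emb a)) [^] n = a"
   using Ec p a' n by (simp add: positive_proj cfc_root_power flip: proj_power)
  fix b assume b: "positive A b \<and> b [^] n = a"
  then have "psd (emb b)" "emb a = emb b ^ n" using emb_pow[of b n] n by (auto simp: positive_iff)
  then show "b = proj (cfc (root n) (emb a))" using b n by (simp add: cfc_root_of_power positive_iff)
 qed
qed

end

section \<open>Traces, dimension functions and fullness\<close>

context cstar_algebra
begin

definition Tr :: "('a alg_section => real) set" where
 "Tr = (%\<tau> b. Re (\<tau> (proj b))) ` tracial_states A"

lemma tracial_state:
 assumes "\<tau> \<in> tracial_states A"
 shows "x \<in> carrier A ==> y \<in> carrier A ==> \<tau> (x \<oplus> y) = \<tau> x + \<tau> y"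
  "x \<in> carrier A ==> \<tau> (z \<odot> x) = z * \<tau> x" "\<tau> \<one> = 1" "positive A x ==> \<tau> x \<in> \<real>\<^sub>\<ge>\<^sub>0"
  "x \<in> carrier A ==> y \<in> carrier A ==> \<tau> (x \<otimes> y) = \<tau> (y \<otimes> x)"
 using assms by (auto simp: tracial_states_def linear_map_def complex_alg_def)

lemma Tr_cases: "t \<in> Tr ==> (!!\<tau>. \<tau> \<in> tracial_states A ==> t = (%b. Re (\<tau> (proj b))) ==> P) ==> P"
 by (auto simp: Tr_def)

lemma Tr_add: "t \<in> Tr ==> t (x + y) = t x + t y"
 by (erule Tr_cases) (simp add: proj_add tracial_state)

lemma Tr_scale: "t \<in> Tr ==> t (r *\<^sub>R x) = r * t x"
 by (erule Tr_cases) (simp add: proj_scaleR tracial_state)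

lemma Tr_comm: "t \<in> Tr ==> t (x * y) = t (y * x)"
 by (erule Tr_cases) (simp add: proj_mult tracial_state(5)[of _ "proj x" "proj y"])

lemma Tr_pos: "t \<in> Tr ==> x \<in> Ec ==> psd x ==> t x >= 0"
 using tracial_state(4) positive_proj by (erule_tac Tr_cases) (fastforce simp: nonneg_Reals_def)

lemma Tr_one: "t \<in> Tr ==> t (emb \<one>) = 1"
 by (erule Tr_cases) (simp add: tracial_state)

lemma Tr_diff: "t \<in> Tr ==> t (x - y) = t x - t y"
 using Tr_add[of t x "- y"] Tr_scale[of t "-1" y] by simp

lemma Tr_mono: "t \<in> Tr ==> x \<in> Ec ==> y \<in> Ec ==> psd (y - x) ==> t x <= t y"
 using Tr_pos[of t "y - x"] Tr_diff[of t y x] E.Ac_diff by simp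

text \<open>\<open>q - r = q * (1 - q) + q * (1 - r) * q\<close>, because \<open>q\<close> is a unit
  for \<open>r\<close> on both sides.\<close>

lemma psd_unit_diff:
 assumes "psd q" "norm q <= 1" "psd r" "norm r <= 1" "q * r = (r::'b::cstar)"
 shows "psd (q - r)"
proof -
 have "r * q = r" using arg_cong[OF assms(5), of adj] by (simp add: adj_mult psd_sa assms(1,3))
 then have "q - r = q * (1 - q) + adj q * (1 - r) * q"
  using assms(5) by (simp add: algebra_simps psd_sa[OF assms(1)])
 moreover have "psd (q * (1 - q))"
  by (rule psd_mult[OF assms(1)]) (use assms psd_upper[of q 1] in \<open>simp_all add: algebra_simps\<close>)
 moreover have "psd (1 - r)" using assms psd_upper[of r 1] by simp
 ultimately show ?thesis by (simp add: psd_add psd_conj)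
qed

text \<open>For a positive contraction the roots increase from \<open>a\<close> and stay below every
  positive contractive unit \<open>q\<close> of \<open>a\<close>. Monotonicity also supplies the
  limit.\<close>

lemma dim_fun_bounds:
 assumes \<tau>: "\<tau> \<in> tracial_states A" and a: "a \<in> Ec" "psd a" "norm a <= 1"
  and q: "q \<in> Ec" "psd q" "norm q <= 1" "q * a = a"
 shows "Re (\<tau> (proj a)) <= dim_fun A \<tau> (proj a)" "dim_fun A \<tau> (proj a) <= Re (\<tau> (proj q))"
proof -
 define r where "r n = cfc (root n) a" for n
 let ?X = "%n. Re (\<tau> (alg_root A n (proj a)))"
 have t: "(%b. Re (\<tau> (proj b))) \<in> Tr" using \<tau> by (simp add: Tr_def)
 have root: "?X n = Re (\<tau> (proj (r n)))" "r n \<in> Ec" "psd (r n)" if "n > 0" for n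
  using alg_root_eq[OF positive_proj[OF a(1,2)] that] a by (auto simp: r_def emb_proj_id)
 have r1: "norm (r n) <= 1" if "n > 0" for n unfolding r_def
  by (rule cfc_psd_norm_le[OF continuous_root a(2)]) (use that a in auto)
 \<comment> \<open>Indices are shifted, since \<open>alg_root A 0\<close> is not a root.\<close>
 have "?X (Suc n) <= ?X (Suc (Suc n))" for n
 proof -
  have "psd (r (Suc (Suc n)) - r (Suc n))" unfolding r_def
   by (rule cfc_psd_mono[OF continuous_root continuous_root a(2)]) (use a in \<open>auto intro: real_root_increasing\<close>)
  then show ?thesis using Tr_mono[OF t root(2) root(2)] by (simp add: root(1))
 qed
 then have inc: "incseq (%n. ?X (Suc n))" by (rule incseq_SucI)
 have le: "?X (Suc n) <= Re (\<tau> (proj q))" for n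
 proof -
  have "q * r (Suc n) = r (Suc n)" unfolding r_def
   by (rule cfc_unit_left[OF continuous_root psd_sa[OF a(2)]]) (use q in auto)
  then have "psd (q - r (Suc n))" by (intro psd_unit_diff q root(3) r1) auto
  then show ?thesis using Tr_mono[OF t root(2) q(1)] by (simp add: root(1))
 qed
 then obtain L where L: "(%n. ?X (Suc n)) \<longlonglongrightarrow> L" "\<forall>n. ?X (Suc n) <= L"
  using incseq_convergent[OF inc, of "Re (\<tau> (proj q))"] by blast
 have d: "dim_fun A \<tau> (proj a) = L" unfolding dim_fun_def by (rule limI[OF LIMSEQ_imp_Suc[where f = ?X, OF L(1)]])
 have "r 1 = a" unfolding r_def using cfc_root_power[OF a(2), of 1] by simp
 then show "Re (\<tau> (proj a)) <= dim_fun A \<tau> (proj a)" using L(2)[rule_format, of 0] root(1)[of 1] d by simp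
 show "dim_fun A \<tau> (proj a) <= Re (\<tau> (proj q))" unfolding d by (rule LIMSEQ_le_const2[OF L(1)]) (use le in auto)
qed

lemma cuntz_comparison:
 assumes cmp: "!!a b. positive A a ==> positive A b ==>
     ereal \<gamma> * (SUP \<tau>\<in>tracial_states A. ereal (dim_fun A \<tau> a))
      < (INF \<tau>\<in>tracial_states A. ereal (dim_fun A \<tau> b)) ==> cuntz_below A a b"
  and g: "\<gamma> >= 1"
  and a: "a \<in> Ec" "psd a" "norm a <= 1" and b: "b \<in> Ec" "psd b" "norm b <= 1"
  and q: "q \<in> Ec" "psd q" "norm q <= 1" "q * a = a"
  and k1: "!!t. t \<in> Tr ==> t q <= k1" and k2: "!!t. t \<in> Tr ==> t b >= k2" and k: "\<gamma> * k1 < k2" and e: "\<epsilon> > 0"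
 shows "\<exists>r\<in>Ec. norm (adj r * b * r - a) <= \<epsilon>"
proof -
 have "(SUP \<tau>\<in>tracial_states A. ereal (dim_fun A \<tau> (proj a))) <= ereal k1"
 proof (rule SUP_least)
  fix \<tau> assume \<tau>: "\<tau> \<in> tracial_states A"
  then have "Re (\<tau> (proj q)) <= k1" using k1[of "%b. Re (\<tau> (proj b))"] by (simp add: Tr_def)
  then show "ereal (dim_fun A \<tau> (proj a)) <= ereal k1" using dim_fun_bounds(2)[OF \<tau> a q] by simp
 qed
 then have "ereal \<gamma> * (SUP \<tau>\<in>tracial_states A. ereal (dim_fun A \<tau> (proj a))) <= ereal \<gamma> * ereal k1"
  using g by (intro ereal_mult_left_mono) auto
 also have "... < ereal k2" using k by simp
 also have "ereal k2 <= (INF \<tau>\<in>tracial_states A. ereal (dim_fun A \<tau> (proj b)))"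
 proof (rule INF_greatest)
  fix \<tau> assume \<tau>: "\<tau> \<in> tracial_states A"
  have "norm (emb \<one>) <= 1" using nrm_one_le by (simp add: norm_emb)
  then have "Re (\<tau> (proj b)) <= dim_fun A \<tau> (proj b)"
   by (intro dim_fun_bounds(1)[OF \<tau> b E.Ac_p E.psd_p]) (simp_all add: E.Ac_left b)
  then show "ereal k2 <= ereal (dim_fun A \<tau> (proj b))" using k2 \<tau> by (force simp: Tr_def)
 qed
 finally have "cuntz_below A (proj a) (proj b)" using cmp positive_proj a b by blast
 then obtain r where r: "range r \<subseteq> carrier A"
  "limitin (alg_top A) (%n. star A (r n) \<otimes> proj b \<otimes> r n) (proj a) sequentially"
  unfolding cuntz_below_def by blast
 then obtain N where N: "nrm A ((star A (r N) \<otimes> proj b \<otimes> r N) \<ominus> proj a) < \<epsilon>"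
  unfolding limitin_iff using e by blast
 have rN: "r N \<in> carrier A" using r by auto
 then have "nrm A ((star A (r N) \<otimes> proj b \<otimes> r N) \<ominus> proj a) = norm (emb ((star A (r N) \<otimes> proj b \<otimes> r N) \<ominus> proj a))"
  by (simp add: norm_emb star_closed)
 also have "emb ((star A (r N) \<otimes> proj b \<otimes> r N) \<ominus> proj a) = adj (emb (r N)) * b * emb (r N) - a"
  using rN a b by (simp add: emb_diff emb_mult emb_star star_closed emb_proj_id)
 finally show ?thesis using N rN by (intro bexI[of _ "emb (r N)"]) auto
qed

text \<open>The closure of the sums of \<open>u * g * v\<close> gives a nonzero closed ideal, so
  some such sum \<open>s\<close> is close to the unit. Expanding
  \<open>adj (adj u - v) * g * (adj u - v) >= 0\<close> dominates \<open>s + adj s\<close> by a sum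
  of terms \<open>adj w * g * w\<close>.\<close>

lemma full_of_simple:
 assumes simple: "simple_alg A" and g: "g \<in> Ec" "psd g" "g ~= 0"
 shows "\<exists>n w. (\<forall>i<n::nat. w i \<in> Ec) \<and> psd ((\<Sum>i<n. adj (w i) * g * w i) - emb \<one>)"
proof -
 define S where "S = {\<Sum>(u, v)\<leftarrow>xs. u * g * v |xs. set xs \<subseteq> Ec \<times> Ec}"
 define J where "J = {x \<in> carrier A. emb x \<in> closure S}"
 have SI: "u \<in> Ec ==> v \<in> Ec ==> u * g * v \<in> S" for u v
  unfolding S_def by (intro CollectI exI[of _ "[(u, v)]"]) auto
 have S_add: "x + y \<in> S" if "x \<in> S" "y \<in> S" for x y
 proof -
  obtain xs ys where "set xs \<subseteq> Ec \<times> Ec" "set ys \<subseteq> Ec \<times> Ec"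
   "x = (\<Sum>(u, v)\<leftarrow>xs. u * g * v)" "y = (\<Sum>(u, v)\<leftarrow>ys. u * g * v)" using \<open>x \<in> S\<close> \<open>y \<in> S\<close> by (auto simp: S_def)
  then show ?thesis unfolding S_def by (intro CollectI exI[of _ "xs @ ys"]) auto
 qed
 have S_left: "c * x \<in> S" if "c \<in> Ec" "x \<in> S" for c x
 proof -
  obtain xs where xs: "set xs \<subseteq> Ec \<times> Ec" "x = (\<Sum>(u, v)\<leftarrow>xs. u * g * v)" using \<open>x \<in> S\<close> by (auto simp: S_def)
  have "c * x = (\<Sum>(u, v)\<leftarrow>map (%(u, v). (c * u, v)) xs. u * g * v)"
   unfolding xs(2) by (induction xs) (auto simp: algebra_simps)
  then show ?thesis unfolding S_def using xs \<open>c \<in> Ec\<close>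
   by (intro CollectI exI[of _ "map (%(u, v). (c * u, v)) xs"]) auto
 qed
 have S_right: "x * c \<in> S" if "c \<in> Ec" "x \<in> S" for c x
 proof -
  obtain xs where xs: "set xs \<subseteq> Ec \<times> Ec" "x = (\<Sum>(u, v)\<leftarrow>xs. u * g * v)" using \<open>x \<in> S\<close> by (auto simp: S_def)
  have "x * c = (\<Sum>(u, v)\<leftarrow>map (%(u, v). (u, v * c)) xs. u * g * v)"
   unfolding xs(2) by (induction xs) (auto simp: algebra_simps)
  then show ?thesis unfolding S_def using xs \<open>c \<in> Ec\<close>
   by (intro CollectI exI[of _ "map (%(u, v). (u, v * c)) xs"]) auto
 qed
 have cl_add: "x + y \<in> closure S" if "x \<in> closure S" "y \<in> closure S" for x y
 proof -
  obtain f h where "\<forall>n. f n \<in> S" "f \<longlonglongrightarrow> x" "\<forall>n. h n \<in> S" "h \<longlonglongrightarrow> y"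
   using \<open>x \<in> closure S\<close> \<open>y \<in> closure S\<close> unfolding closure_sequential by blast
  then show ?thesis unfolding closure_sequential using S_add tendsto_add by (intro exI[of _ "%n. f n + h n"]) blast
 qed
 have cl_left: "c * x \<in> closure S" if "c \<in> Ec" "x \<in> closure S" for c x
 proof -
  obtain f where "\<forall>n. f n \<in> S" "f \<longlonglongrightarrow> x" using \<open>x \<in> closure S\<close> unfolding closure_sequential by blast
  then show ?thesis unfolding closure_sequential using S_left[OF \<open>c \<in> Ec\<close>]
   by (intro exI[of _ "%n. c * f n"]) (auto intro: tendsto_mult)
 qed
 have cl_right: "x * c \<in> closure S" if "c \<in> Ec" "x \<in> closure S" for c x
 proof -
  obtain f where "\<forall>n. f n \<in> S" "f \<longlonglongrightarrow> x" using \<open>x \<in> closure S\<close> unfolding closure_sequential by blast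
  then show ?thesis unfolding closure_sequential using S_right[OF \<open>c \<in> Ec\<close>]
   by (intro exI[of _ "%n. f n * c"]) (auto intro: tendsto_mult)
 qed
 have zero: "0 \<in> closure S" using SI[of 0 0] closure_subset by auto
 have neg: "- x \<in> closure S" if "x \<in> closure S" for x
 proof -
  have "emb (proj x) \<in> closure S" unfolding emb_proj by (rule cl_left[OF E.Ac_p that])
  then have "(- emb \<one>) * x \<in> closure S" by (intro cl_left that) auto
  moreover have "emb \<one> * x = x"
  proof -
   obtain f where f: "\<forall>n. f n \<in> S" "f \<longlonglongrightarrow> x" using \<open>x \<in> closure S\<close> unfolding closure_sequential by blast
   have "emb \<one> * f n = f n" for n
   proof -
    obtain xs where xs: "set xs \<subseteq> Ec \<times> Ec" "f n = (\<Sum>(u, v)\<leftarrow>xs. u * g * v)" using f(1) unfolding S_def by blast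
    show ?thesis unfolding xs(2) using xs(1)
     by (induction xs) (auto simp: distrib_left E.Ac_left simp flip: mult.assoc)
   qed
   then have "f \<longlonglongrightarrow> emb \<one> * x" using tendsto_mult[OF tendsto_const f(2), of "emb \<one>"] by simp
   then show ?thesis using f(2) LIMSEQ_unique by blast
  qed
  ultimately show ?thesis by simp
 qed
 have "ideal J A"
 proof (rule idealI)
  show "ring A" by (rule ring_A)
  show "subgroup J (add_monoid A)"
   by (rule M.add.subgroupI)
    (auto simp: J_def emb_add emb_zero emb_uminus zero cl_add neg a_inv_def[symmetric] intro: exI[of _ "\<zero>"])
  fix a x assume "a \<in> J" "x \<in> carrier A"
  then show "x \<otimes> a \<in> J" "a \<otimes> x \<in> J" by (auto simp: J_def emb_mult cl_left cl_right)
 qed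
 moreover have "closedin (alg_top A) J"
  unfolding alg_top_def Metric_space.closedin_metric[OF metric_space]
 proof (intro conjI allI impI)
  show "J \<subseteq> carrier A" by (auto simp: J_def)
  fix x assume x: "x \<in> carrier A - J"
  then have "emb x \<in> - closure S" by (auto simp: J_def)
  then obtain r where r: "r > 0" "ball (emb x) r \<subseteq> - closure S"
   using open_contains_ball[of "- closure S"] by auto
  have "disjnt J (Metric_space.mball (carrier A) (alg_dist A) x r)"
  proof -
   have "y \<notin> Metric_space.mball (carrier A) (alg_dist A) x r" if "y \<in> J" for y
   proof
    assume "y \<in> Metric_space.mball (carrier A) (alg_dist A) x r"
    then have "y \<in> carrier A" "nrm A (x \<ominus> y) < r"
     using x unfolding Metric_space.mball_def[OF metric_space] by (auto simp: alg_dist_def)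
    then have "emb y \<in> ball (emb x) r" using x by (simp add: dist_norm norm_emb flip: emb_diff)
    then show False using r \<open>y \<in> J\<close> by (auto simp: J_def)
   qed
   then show ?thesis by (auto simp: disjnt_def)
  qed
  then show "\<exists>r>0. disjnt J (Metric_space.mball (carrier A) (alg_dist A) x r)" using r by blast
 qed
 ultimately have "J = {\<zero>} \<or> J = carrier A" using simple by (auto simp: simple_alg_def)
 moreover have "proj g \<in> J"
 proof -
  have "emb \<one> * g * emb \<one> \<in> S" by (rule SI) auto
  then show ?thesis using g closure_subset[of S] by (auto simp: J_def emb_proj_id E.Ac_left E.Ac_right)
 qed
 moreover have "proj g ~= \<zero>" using g emb_proj_id[of g] emb_zero by auto
 ultimately have "\<one> \<in> J" by auto
 then have "emb \<one> \<in> closure S" by (simp add: J_def)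
 then obtain s where s: "s \<in> S" "dist s (emb \<one>) < 1/2" unfolding closure_approachable by (metis half_gt_zero zero_less_one)
 then obtain xs where xs: "set xs \<subseteq> Ec \<times> Ec" "s = (\<Sum>(u, v)\<leftarrow>xs. u * g * v)" by (auto simp: S_def)
 \<comment> \<open>Each product \<open>u * g * v\<close> contributes two vectors,
   \<open>adj u\<close> and \<open>v\<close>.\<close>
 define ws where "ws = concat (map (%(u, v). [adj u, v]) xs)"
 have ws: "set ws \<subseteq> Ec" using xs(1) by (auto simp: ws_def E.Ac_adj)
 have "psd ((\<Sum>w\<leftarrow>ws. adj w * g * w) - (s + adj s)) \<and> s \<in> Ec" unfolding xs(2) ws_def using xs(1)
 proof (induction xs)
  case (Cons x xs)
  obtain u v where x: "x = (u, v)" by (cases x)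
  let ?a = "(\<Sum>w\<leftarrow>concat (map (%(u, v). [adj u, v]) xs). adj w * g * w)" and ?b = "\<Sum>(u, v)\<leftarrow>xs. u * g * v"
  have IH: "psd (?a - (?b + adj ?b))" "?b \<in> Ec" using Cons by auto
  have "psd ((?a - (?b + adj ?b)) + adj (adj u - v) * g * (adj u - v))"
   by (intro psd_add IH psd_conj g)
  then show ?case using IH(2) Cons.prems g psd_sa[OF g(2)]
   by (auto simp: x algebra_simps adj_add adj_mult adj_diff)
 qed (simp add: psd_0)
 then have 1: "psd ((\<Sum>w\<leftarrow>ws. adj w * g * w) - (s + adj s))" and sE: "s \<in> Ec" by auto
 \<comment> \<open>Distance below 1/2 from the unit gives \<open>s + adj s >= emb \<one>\<close>,
   with no factor to be adjusted.\<close>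
 have "norm (emb \<one> - s + adj (emb \<one> - s)) <= 1"
  using s(2) norm_triangle_ineq[of "emb \<one> - s" "adj (emb \<one> - s)"] by (simp add: dist_norm norm_minus_commute norm_adj)
 then have "psd (1 *\<^sub>R emb \<one> - (emb \<one> - s + adj (emb \<one> - s)))"
  using sE by (intro E.psd_corner_upper) (auto simp: adj_add adj_diff add.commute intro!: E.Ac_add E.Ac_adj E.Ac_diff)
 then have "psd ((\<Sum>w\<leftarrow>ws. adj w * g * w) - (s + adj s) + (1 *\<^sub>R emb \<one> - (emb \<one> - s + adj (emb \<one> - s))))"
  by (rule psd_add[OF 1])
 then have "psd ((\<Sum>w\<leftarrow>ws. adj w * g * w) - emb \<one>)"
  by (simp add: adj_diff emb_adj_one algebra_simps)
 moreover have "(\<Sum>w\<leftarrow>ws. adj w * g * w) = (\<Sum>i<length ws. adj (ws ! i) * g * (ws ! i))"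
  by (simp add: sum_list_sum_nth atLeast0LessThan)
 ultimately show ?thesis using ws by (intro exI[of _ "length ws"] exI[of _ "nth ws"]) (auto simp: nth_mem subset_iff)
qed

lemma tracial_core_of_simple:
 assumes "simple_alg A" "local_weak_comparison A" "quasi_traces A = tracial_states A" "tracial_states A ~= {}"
 shows "\<exists>\<gamma>. tracial_core (emb \<one>) Tr \<gamma>"
proof -
 obtain \<gamma> where \<gamma>: "\<gamma> >= 1" "!!a b. positive A a ==> positive A b ==>
     ereal \<gamma> * (SUP \<tau>\<in>tracial_states A. ereal (dim_fun A \<tau> a))
      < (INF \<tau>\<in>tracial_states A. ereal (dim_fun A \<tau> b)) ==> cuntz_below A a b"
  using assms(2,3) unfolding local_weak_comparison_def by auto
 have "tracial_core (emb \<one>) Tr \<gamma>"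
 proof unfold_locales
  show "Tr ~= {}" using assms(4) by (simp add: Tr_def)
  show "!!t x y. t \<in> Tr ==> t (x + y) = t x + t y" "!!t x y. t \<in> Tr ==> t (x * y) = t (y * x)"
   "!!t x r. t \<in> Tr ==> t (r *\<^sub>R x) = r * t x" "!!t. t \<in> Tr ==> t (emb \<one>) = 1"
   "!!t x. t \<in> Tr ==> x \<in> Ec ==> psd x ==> t x >= 0"
   by (rule Tr_add Tr_comm Tr_scale Tr_one Tr_pos; assumption)+
  show "!!g. g \<in> Ec ==> psd g ==> g ~= 0 ==>
    \<exists>n w. (\<forall>i<n::nat. w i \<in> Ec) \<and> psd ((\<Sum>i<n. adj (w i) * g * w i) - emb \<one>)"
   by (rule full_of_simple[OF assms(1)])
  show "\<gamma> >= 1" by (rule \<gamma>)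
  show "\<exists>r\<in>Ec. norm (adj r * b * r - a) <= \<epsilon>"
   if "a \<in> Ec" "b \<in> Ec" "q \<in> Ec" "psd a" "psd b" "psd q" "norm a <= 1" "norm b <= 1" "norm q <= 1" "q * a = a"
    "!!t. t \<in> Tr ==> t q <= k1" "!!t. t \<in> Tr ==> t b >= k2" "\<gamma> * k1 < k2" "\<epsilon> > 0" for a b q k1 k2 \<epsilon>
   by (rule cuntz_comparison[OF \<gamma>(2,1), of a b q k1 k2]) (use that in auto)
 qed
 then show ?thesis by blast
qed

end

section \<open>Hilbert modules and matrix algebras\<close>

definition colnorm :: "nat => (nat => 'a::cstar) => real" where
 "colnorm n v = sqrt (norm (\<Sum>i<n. adj (v i) * v i))"

lemma colnorm_nonneg: "colnorm n v >= 0"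
 by (simp add: colnorm_def)

lemma colnorm_sq: "colnorm n v ^ 2 = norm (\<Sum>i<n. adj (v i) * v i)"
 by (simp add: colnorm_def)

lemma colnorm_cong: "(!!i. i < n ==> v i = w i) ==> colnorm n v = colnorm n w"
 by (simp add: colnorm_def)

lemma norm_le_colnorm: "i < n ==> norm (v i) <= colnorm n v"
proof -
 assume i: "i < n"
 have "psd ((\<Sum>i<n. adj (v i) * v i) - adj (v i) * v i)"
  using i by (simp add: sum.remove psd_sum psd_adj_mult)
 then have "norm (v i) ^ 2 <= colnorm n v ^ 2"
  using psd_norm_mono[OF psd_adj_mult] by (simp add: colnorm_sq norm_adj_mult)
 then show ?thesis using colnorm_nonneg power2_le_imp_le by blast
qed

lemma colnorm_le_sum: "colnorm n v <= (\<Sum>i<n. norm (v i))"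
proof -
 let ?s = "\<Sum>i<n. norm (v i)"
 have "norm (\<Sum>i<n. adj (v i) * v i) <= (\<Sum>i<n. norm (v i) ^ 2)"
  by (rule sum_norm_le) (simp add: norm_adj_mult)
 also have "... <= (\<Sum>i<n. norm (v i) * ?s)"
  by (intro sum_mono) (simp add: power2_eq_square mult_left_mono member_le_sum[where f = "%i. norm (v i)"])
 also have "... = ?s ^ 2" by (simp add: power2_eq_square sum_distrib_right)
 finally show ?thesis unfolding colnorm_def by (intro real_le_lsqrt) (auto intro: sum_nonneg)
qed

lemma colnorm_cx: "colnorm n (%i. cx z * v i) = cmod z * colnorm n v"
proof -
 have "adj (cx z * v i) * (cx z * v i) = cx (cnj z * z) * (adj (v i) * v i)" for i
  by (simp only: adj_mult adj_cx cx_mult mult.assoc cx_left[of "adj (v i)"])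
 then have "colnorm n (%i. cx z * v i) ^ 2 = (cmod z * colnorm n v) ^ 2"
  unfolding colnorm_sq power_mult_distrib
  by (simp add: norm_cx_mult norm_mult power2_eq_square flip: sum_distrib_left)
 then show ?thesis by (simp add: colnorm_nonneg power2_eq_iff_nonneg)
qed

text \<open>As for Hilbert modules: expand the square of \<open>w - v * c / a\<close>, where
  \<open>c\<close> is the inner product and \<open>a\<close> the norm of the square of
  \<open>v\<close>.\<close>

lemma Cauchy_Schwarz_colnorm: "norm (\<Sum>i<n. adj (v i) * w i) <= colnorm n v * colnorm n (w :: nat => 'a::cstar)"
proof (cases "colnorm n v = 0")
 case True
 then have "v i = 0" if "i < n" for i using norm_le_colnorm[OF that, of v] by simp
 then show ?thesis using True by simp
next
 case False
 define a where "a = norm (\<Sum>i<n. adj (v i) * v i)"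
 have a: "a > 0" using False by (simp add: a_def colnorm_def)
 define c where "c = (\<Sum>i<n. adj (v i) * w i)"
 have ac: "adj c = (\<Sum>i<n. adj (w i) * v i)" by (simp add: c_def adj_sum adj_mult)
 let ?V = "\<Sum>i<n. adj (v i) * v i" and ?W = "\<Sum>i<n. adj (w i) * w i"
 have "(\<Sum>i<n. adj (w i - (1/a) *\<^sub>R (v i * c)) * (w i - (1/a) *\<^sub>R (v i * c)))
   = (\<Sum>i<n. adj (w i) * w i - (1/a) *\<^sub>R (adj (w i) * v i * c) - (1/a) *\<^sub>R (adj c * (adj (v i) * w i))
    + (1/a) *\<^sub>R (1/a) *\<^sub>R (adj c * (adj (v i) * v i) * c))"
  by (intro sum.cong refl) (simp add: adj_diff adj_scaleR adj_mult algebra_simps)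
 also have "... = ?W - (1/a) *\<^sub>R (adj c * c) - (1/a) *\<^sub>R (adj c * c) + (1/a) *\<^sub>R (1/a) *\<^sub>R (adj c * ?V * c)"
  unfolding sum.distrib sum_subtractf scaleR_sum_right[symmetric] sum_distrib_left[symmetric] sum_distrib_right[symmetric]
  by (simp only: ac[symmetric] c_def[symmetric])
 finally have s: "(\<Sum>i<n. adj (w i - (1/a) *\<^sub>R (v i * c)) * (w i - (1/a) *\<^sub>R (v i * c))) = ..." .
 have "psd (adj c * (of_real a - ?V) * c)"
  by (intro psd_conj psd_upper psd_sum psd_adj_mult) (simp add: a_def)
 then have "psd (?W - (1/a) *\<^sub>R (adj c * c) - (1/a) *\<^sub>R (adj c * c) + (1/a) *\<^sub>R (1/a) *\<^sub>R (adj c * ?V * c)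
   + (1/a) *\<^sub>R (1/a) *\<^sub>R (adj c * (of_real a - ?V) * c))"
  unfolding s[symmetric] using a by (intro psd_add psd_sum psd_adj_mult psd_scaleR) auto
 also have "(1/a) *\<^sub>R (1/a) *\<^sub>R (adj c * (of_real a - ?V) * c) = (1/a) *\<^sub>R (adj c * c) - (1/a) *\<^sub>R (1/a) *\<^sub>R (adj c * ?V * c)"
  using a by (simp add: right_diff_distrib left_diff_distrib mult_of_real_right scaleR_diff_right)
 finally have "psd (?W - (1/a) *\<^sub>R (adj c * c))" by simp
 then have "norm ((1/a) *\<^sub>R (adj c * c)) <= norm ?W"
  using a by (intro psd_norm_mono psd_scaleR psd_adj_mult) auto
 then have "norm c ^ 2 <= a * norm ?W" using a by (simp add: norm_adj_mult field_simps)
 then have "norm c ^ 2 <= (colnorm n v * colnorm n w) ^ 2" by (simp add: power_mult_distrib colnorm_sq a_def)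
 then show ?thesis unfolding c_def by (rule power2_le_imp_le) (simp add: colnorm_nonneg)
qed

lemma colnorm_triangle: "colnorm n (%i. v i + w i) <= colnorm n v + colnorm n (w :: nat => 'a::cstar)"
proof -
 have "(\<Sum>i<n. adj (v i + w i) * (v i + w i)) = (\<Sum>i<n. adj (v i) * v i) + (\<Sum>i<n. adj (v i) * w i)
   + (\<Sum>i<n. adj (w i) * v i) + (\<Sum>i<n. adj (w i) * w i)"
  by (simp add: adj_add distrib_left distrib_right sum.distrib add_ac)
 also have "norm ... <= colnorm n v ^ 2 + colnorm n v * colnorm n w + colnorm n w * colnorm n v + colnorm n w ^ 2"
  by (intro norm_triangle_le add_mono Cauchy_Schwarz_colnorm) (simp_all add: colnorm_sq)
 finally have "colnorm n (%i. v i + w i) ^ 2 <= (colnorm n v + colnorm n w) ^ 2"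
  unfolding colnorm_sq[of n "%i. v i + w i"] by (simp add: power2_eq_square algebra_simps)
 then show ?thesis by (rule power2_le_imp_le) (simp add: colnorm_nonneg)
qed

lemma complex_ring_cring: "cring complex_ring"
 by (intro cringI abelian_groupI comm_monoidI)
  (auto simp: complex_ring_def algebra_simps intro: exI[of _ "- x" for x])

context cstar_algebra
begin

abbreviation Mt where "Mt n \<equiv> mat_alg n A"

definition mv :: "nat => (nat => nat => 'a) => (nat => 'a alg_section) => nat => 'a alg_section" where
 "mv n x v i = (\<Sum>j<n. emb (x i j) * v j)"

lemma mat_entry: "x \<in> carrier (Mt n) ==> i < n ==> j < n ==> x i j \<in> carrier A"
 by (auto simp: mat_alg_def PiE_iff)

lemma mat_carrierI: "(!!i j. i < n ==> j < n ==> x i j \<in> carrier A) ==> (\<lambda>i\<in>{..<n}. \<lambda>j\<in>{..<n}. x i j) \<in> carrier (Mt n)"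
 by (auto simp: mat_alg_def)

lemma mat_eqI:
 assumes "x \<in> carrier (Mt n)" "y \<in> carrier (Mt n)" "!!i j. i < n ==> j < n ==> emb (x i j) = emb (y i j)"
 shows "x = y"
proof
 fix i
 show "x i = y i"
 proof (cases "i < n")
  case True
  then have "x i \<in> extensional {..<n}" "y i \<in> extensional {..<n}" using assms(1,2) by (auto simp: mat_alg_def PiE_iff)
  moreover have "x i j = y i j" if "j < n" for j using assms True that mat_entry emb_inj by metis
  ultimately show ?thesis by (intro extensionalityI[of _ "{..<n}"]) auto
 next
  case False
  then show ?thesis using assms(1,2) by (simp add: mat_alg_def PiE_iff extensional_def)
 qed
qed

lemma mat_closed:
 "\<one>\<^bsub>Mt n\<^esub> \<in> carrier (Mt n)" "\<zero>\<^bsub>Mt n\<^esub> \<in> carrier (Mt n)"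
 "x \<in> carrier (Mt n) ==> y \<in> carrier (Mt n) ==> x \<otimes>\<^bsub>Mt n\<^esub> y \<in> carrier (Mt n)"
 "x \<in> carrier (Mt n) ==> y \<in> carrier (Mt n) ==> x \<oplus>\<^bsub>Mt n\<^esub> y \<in> carrier (Mt n)"
 "x \<in> carrier (Mt n) ==> z \<odot>\<^bsub>Mt n\<^esub> x \<in> carrier (Mt n)"
 "x \<in> carrier (Mt n) ==> star (Mt n) x \<in> carrier (Mt n)"
 by (auto simp: mat_alg_def PiE_iff smult_cl star_closed intro!: M.finsum_closed m_closed)

lemma mat_emb:
 assumes "i < n" "j < n"
 shows "x \<in> carrier (Mt n) ==> y \<in> carrier (Mt n) ==> emb ((x \<otimes>\<^bsub>Mt n\<^esub> y) i j) = (\<Sum>k<n. emb (x i k) * emb (y k j))"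
  "emb (\<one>\<^bsub>Mt n\<^esub> i j) = emb \<one> * mone i j" "emb (\<zero>\<^bsub>Mt n\<^esub> i j) = 0"
  "x \<in> carrier (Mt n) ==> y \<in> carrier (Mt n) ==> emb ((x \<oplus>\<^bsub>Mt n\<^esub> y) i j) = emb (x i j) + emb (y i j)"
  "x \<in> carrier (Mt n) ==> emb ((z \<odot>\<^bsub>Mt n\<^esub> x) i j) = cx z * emb (x i j)"
  "x \<in> carrier (Mt n) ==> emb (star (Mt n) x i j) = adj (emb (x j i))"
proof -
 assume x: "x \<in> carrier (Mt n)" and y: "y \<in> carrier (Mt n)"
 have "emb (\<Oplus>k\<in>{..<n}. x i k \<otimes> y k j) = (\<Sum>k<n. emb (x i k \<otimes> y k j))"
  by (rule emb_finsum) (use assms mat_entry[OF x] mat_entry[OF y] in auto)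
 also have "... = (\<Sum>k<n. emb (x i k) * emb (y k j))"
  using assms mat_entry[OF x] mat_entry[OF y] by (intro sum.cong refl) (simp add: emb_mult)
 finally show "emb ((x \<otimes>\<^bsub>Mt n\<^esub> y) i j) = (\<Sum>k<n. emb (x i k) * emb (y k j))"
  using assms by (simp add: mat_alg_def)
qed (use assms mat_entry[of x n] mat_entry[of y n] in \<open>auto simp: mat_alg_def mone_def emb_zero emb_add emb_smult emb_star\<close>)

lemma mat_ring: "ring (Mt n)"
proof (intro ringI abelian_groupI monoidI)
 fix x y z assume x: "x \<in> carrier (Mt n)" and y: "y \<in> carrier (Mt n)" and z: "z \<in> carrier (Mt n)"
 note c = x y z mat_closed
 show "x \<otimes>\<^bsub>Mt n\<^esub> y \<otimes>\<^bsub>Mt n\<^esub> z = x \<otimes>\<^bsub>Mt n\<^esub> (y \<otimes>\<^bsub>Mt n\<^esub> z)"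
 proof (rule mat_eqI[where n = n])
  fix i j assume ij: "i < n" "j < n"
  have "emb ((x \<otimes>\<^bsub>Mt n\<^esub> y \<otimes>\<^bsub>Mt n\<^esub> z) i j) = (\<Sum>k<n. \<Sum>l<n. emb (x i l) * (emb (y l k) * emb (z k j)))"
   by (simp add: c ij mat_emb sum_distrib_right mult.assoc cong: sum.cong_simp)
  also have "... = (\<Sum>l<n. \<Sum>k<n. emb (x i l) * (emb (y l k) * emb (z k j)))" by (rule sum.swap)
  also have "... = emb ((x \<otimes>\<^bsub>Mt n\<^esub> (y \<otimes>\<^bsub>Mt n\<^esub> z)) i j)"
   by (simp add: c ij mat_emb sum_distrib_left cong: sum.cong_simp)
  finally show "emb ((x \<otimes>\<^bsub>Mt n\<^esub> y \<otimes>\<^bsub>Mt n\<^esub> z) i j) = emb ((x \<otimes>\<^bsub>Mt n\<^esub> (y \<otimes>\<^bsub>Mt n\<^esub> z)) i j)" .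
 qed (simp_all add: c)
 show "(x \<oplus>\<^bsub>Mt n\<^esub> y) \<otimes>\<^bsub>Mt n\<^esub> z = x \<otimes>\<^bsub>Mt n\<^esub> z \<oplus>\<^bsub>Mt n\<^esub> y \<otimes>\<^bsub>Mt n\<^esub> z"
  "z \<otimes>\<^bsub>Mt n\<^esub> (x \<oplus>\<^bsub>Mt n\<^esub> y) = z \<otimes>\<^bsub>Mt n\<^esub> x \<oplus>\<^bsub>Mt n\<^esub> z \<otimes>\<^bsub>Mt n\<^esub> y"
  "x \<oplus>\<^bsub>Mt n\<^esub> y \<oplus>\<^bsub>Mt n\<^esub> z = x \<oplus>\<^bsub>Mt n\<^esub> (y \<oplus>\<^bsub>Mt n\<^esub> z)"
  by (rule mat_eqI[where n = n]; simp add: c mat_emb distrib_left distrib_right sum.distrib add.assoc)+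
next
 fix x assume x: "x \<in> carrier (Mt n)"
 show "\<one>\<^bsub>Mt n\<^esub> \<otimes>\<^bsub>Mt n\<^esub> x = x"
 proof (rule mat_eqI[where n = n])
  fix i j assume ij: "i < n" "j < n"
  have "emb ((\<one>\<^bsub>Mt n\<^esub> \<otimes>\<^bsub>Mt n\<^esub> x) i j) = (\<Sum>k<n. mone i k * emb (x k j))"
   unfolding mat_emb(1)[OF ij mat_closed(1) x]
   by (intro sum.cong refl) (use ij mat_entry[OF x] in \<open>auto simp: mat_emb mone_def emb_unit\<close>)
  then show "emb ((\<one>\<^bsub>Mt n\<^esub> \<otimes>\<^bsub>Mt n\<^esub> x) i j) = emb (x i j)" using ij by (simp add: sum_mone)
 qed (auto intro: x mat_closed)
 show "x \<otimes>\<^bsub>Mt n\<^esub> \<one>\<^bsub>Mt n\<^esub> = x"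
 proof (rule mat_eqI[where n = n])
  fix i j assume ij: "i < n" "j < n"
  have "emb ((x \<otimes>\<^bsub>Mt n\<^esub> \<one>\<^bsub>Mt n\<^esub>) i j) = (\<Sum>k<n. emb (x i k) * mone k j)"
   unfolding mat_emb(1)[OF ij x mat_closed(1)]
   by (intro sum.cong refl) (use ij mat_entry[OF x] in \<open>auto simp: mat_emb mone_def E.Ac_right\<close>)
  then show "emb ((x \<otimes>\<^bsub>Mt n\<^esub> \<one>\<^bsub>Mt n\<^esub>) i j) = emb (x i j)" using ij by (simp add: sum_mone)
 qed (auto intro: x mat_closed)
 show "\<zero>\<^bsub>Mt n\<^esub> \<oplus>\<^bsub>Mt n\<^esub> x = x" by (rule mat_eqI[where n = n]) (simp_all add: x mat_closed mat_emb)
 have "(- 1 \<odot>\<^bsub>Mt n\<^esub> x) \<oplus>\<^bsub>Mt n\<^esub> x = \<zero>\<^bsub>Mt n\<^esub>"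
  by (rule mat_eqI[where n = n]) (simp_all add: x mat_closed mat_emb cx_uminus)
 then show "\<exists>y\<in>carrier (Mt n). y \<oplus>\<^bsub>Mt n\<^esub> x = \<zero>\<^bsub>Mt n\<^esub>" using mat_closed(5)[OF x] by blast
 fix y assume y: "y \<in> carrier (Mt n)"
 show "x \<oplus>\<^bsub>Mt n\<^esub> y = y \<oplus>\<^bsub>Mt n\<^esub> x" by (rule mat_eqI[where n = n]) (simp_all add: x y mat_closed mat_emb)
qed (rule mat_closed; assumption)+

lemma mat_uminus:
 assumes "x \<in> carrier (Mt n)" "i < n" "j < n"
 shows "emb ((\<ominus>\<^bsub>Mt n\<^esub> x) i j) = - emb (x i j)"
proof -
 interpret MR: ring "Mt n" by (rule mat_ring)
 have "emb ((\<ominus>\<^bsub>Mt n\<^esub> x \<oplus>\<^bsub>Mt n\<^esub> x) i j) = 0" using assms by (simp add: MR.l_neg mat_emb)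
 then show ?thesis using assms by (simp add: mat_emb(4) eq_neg_iff_add_eq_0)
qed

lemma column_norm_eq: "(!!i. i < n ==> v i \<in> carrier A) ==> column_norm n A v = colnorm n (%i. emb (v i))"
proof -
 assume v: "!!i. i < n ==> v i \<in> carrier A"
 have "nrm A (\<Oplus>i\<in>{..<n}. star A (v i) \<otimes> v i) = norm (emb (\<Oplus>i\<in>{..<n}. star A (v i) \<otimes> v i))"
  using v by (intro norm_emb[symmetric] M.finsum_closed) (auto intro!: m_closed star_closed)
 also have "emb (\<Oplus>i\<in>{..<n}. star A (v i) \<otimes> v i) = (\<Sum>i<n. emb (star A (v i) \<otimes> v i))"
  using v by (intro emb_finsum) (auto intro!: m_closed star_closed)
 also have "... = (\<Sum>i<n. adj (emb (v i)) * emb (v i))"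
  using v by (intro sum.cong refl) (simp add: emb_mult emb_star star_closed)
 finally show ?thesis by (simp add: column_norm_def colnorm_def)
qed

lemma colnorm_mv_le_sum: "colnorm n (mv n x v) <= (\<Sum>i<n. \<Sum>j<n. norm (emb (x i j))) * colnorm n v"
proof -
 have "colnorm n (mv n x v) <= (\<Sum>i<n. \<Sum>j<n. norm (emb (x i j)) * colnorm n v)"
  unfolding mv_def
  by (intro order_trans[OF colnorm_le_sum] sum_mono order_trans[OF norm_sum] norm_mult_le) (auto intro: norm_le_colnorm)
 then show ?thesis by (simp add: sum_distrib_right)
qed

text \<open>Exchanges extensional columns over \<open>A\<close> for functions into the corner that
  are arbitrary beyond \<open>n\<close>, so that ordinary sums can be used.\<close>

lemma nrm_mat:
 assumes x: "x \<in> carrier (Mt n)"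
 shows "nrm (Mt n) x = (SUP v\<in>{v. (\<forall>i. v i \<in> Ec) \<and> colnorm n v <= 1}. colnorm n (mv n x v))"
proof -
 let ?W = "{v \<in> {..<n} \<rightarrow>\<^sub>E carrier A. column_norm n A v <= 1}" and ?V = "{v. (\<forall>i. v i \<in> Ec) \<and> colnorm n v <= 1}"
 let ?p = "%v. \<lambda>i\<in>{..<n}. proj (v i)"
 have "?W = ?p ` ?V"
 proof (intro Set.set_eqI iffI)
  fix v assume v: "v \<in> ?W"
  have vc: "v i \<in> carrier A" if "i < n" for i using v that by auto
  let ?u = "%i. if i < n then emb (v i) else 0"
  have "column_norm n A v = colnorm n (%i. emb (v i))" by (rule column_norm_eq) (rule vc)
  also have "... = colnorm n ?u" by (rule colnorm_cong) simp
  finally have "colnorm n ?u = column_norm n A v" by simp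
  then have "?u \<in> ?V" using v vc by auto
  moreover have "v = ?p ?u" using v vc by (auto simp: PiE_iff extensional_def)
  ultimately show "v \<in> ?p ` ?V" by (rule image_eqI[of v ?p ?u ?V, rotated])
 next
  fix v assume "v \<in> ?p ` ?V"
  then obtain u where u: "u \<in> ?V" "v = ?p u" by blast
  then have "column_norm n A v = colnorm n u"
   by (subst column_norm_eq) (auto simp: emb_proj_id intro!: colnorm_cong)
  then show "v \<in> ?W" using u by auto
 qed
 then have "nrm (Mt n) x = (SUP v\<in>?V. column_norm n A (\<lambda>i\<in>{..<n}. \<Oplus>j\<in>{..<n}. x i j \<otimes> ?p v j))"
  by (simp add: mat_alg_def image_image del: restrict_apply)
 moreover have "column_norm n A (\<lambda>i\<in>{..<n}. \<Oplus>j\<in>{..<n}. x i j \<otimes> ?p v j) = colnorm n (mv n x v)" if v: "v \<in> ?V" for v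
 proof -
  have c: "(\<Oplus>j\<in>{..<n}. x i j \<otimes> ?p v j) \<in> carrier A" if "i < n" for i
   using mat_entry[OF x that] by (intro M.finsum_closed) auto
  have "emb (\<Oplus>j\<in>{..<n}. x i j \<otimes> ?p v j) = mv n x v i" if "i < n" for i
   using mat_entry[OF x that] v unfolding mv_def
   by (subst emb_finsum) (auto simp: emb_mult emb_proj_id intro!: sum.cong)
  then show ?thesis using c by (subst column_norm_eq) (auto intro!: colnorm_cong)
 qed
 ultimately show ?thesis by (simp only: cong: SUP_cong)
qed

lemma nrm_mat_upper:
 assumes x: "x \<in> carrier (Mt n)" and v: "!!i. v i \<in> Ec" "colnorm n v <= 1"
 shows "colnorm n (mv n x v) <= nrm (Mt n) x"
 unfolding nrm_mat[OF x]
proof (rule cSUP_upper)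
 show "bdd_above ((%v. colnorm n (mv n x v)) ` {v. (\<forall>i. v i \<in> Ec) \<and> colnorm n v <= 1})"
  by (rule bdd_aboveI[of _ "\<Sum>i<n. \<Sum>j<n. norm (emb (x i j))"])
   (auto intro!: order_trans[OF colnorm_mv_le_sum] mult_left_le sum_nonneg)
qed (use v in auto)

lemma nrm_mat_nonneg: "x \<in> carrier (Mt n) ==> nrm (Mt n) x >= 0"
 by (rule order_trans[OF colnorm_nonneg nrm_mat_upper[where v = "%i. 0"]]) (auto simp: colnorm_def)

lemma colnorm_mv:
 assumes x: "x \<in> carrier (Mt n)" and v: "!!i. v i \<in> Ec"
 shows "colnorm n (mv n x v) <= nrm (Mt n) x * colnorm n v"
proof (cases "colnorm n v = 0")
 case True
 then show ?thesis using colnorm_mv_le_sum[of n x v] by simp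
next
 case False
 define r where "r = 1 / colnorm n v"
 have r: "r > 0" "r * colnorm n v = 1" using False colnorm_nonneg[of n v] by (simp_all add: r_def)
 let ?u = "%i. cx (of_real r) * v i"
 have "colnorm n ?u = 1" unfolding colnorm_cx using r by simp
 then have "colnorm n (mv n x ?u) <= nrm (Mt n) x" by (intro nrm_mat_upper[OF x] E.Ac_cx v) simp
 moreover have "mv n x ?u = (%i. cx (of_real r) * mv n x v i)"
  by (simp add: mv_def fun_eq_iff cx_left sum_distrib_left)
 ultimately have le: "r * colnorm n (mv n x v) <= nrm (Mt n) x" using r(1) by (simp add: colnorm_cx)
 have "colnorm n (mv n x v) = (r * colnorm n v) * colnorm n (mv n x v)" using r(2) by simp
 also have "... = r * colnorm n (mv n x v) * colnorm n v" by (simp only: mult_ac)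
 also have "... <= nrm (Mt n) x * colnorm n v" by (intro mult_right_mono le colnorm_nonneg)
 finally show ?thesis .
qed

lemma nrm_mat_le:
 assumes x: "x \<in> carrier (Mt n)" and B: "!!v. (!!i. v i \<in> Ec) ==> colnorm n (mv n x v) <= B * colnorm n v" "B >= 0"
 shows "nrm (Mt n) x <= B"
 unfolding nrm_mat[OF x]
proof (rule cSUP_least)
 show "{v. (\<forall>i. v i \<in> Ec) \<and> colnorm n v <= 1} ~= {}" by (auto intro!: exI[of _ "%i. 0"] simp: colnorm_def)
 fix v assume "v \<in> {v. (\<forall>i. v i \<in> Ec) \<and> colnorm n v <= 1}"
 then show "colnorm n (mv n x v) <= B" using order_trans[OF B(1) mult_left_le[OF _ B(2)]] by simp
qed

lemma norm_entry_le:
 assumes x: "x \<in> carrier (Mt n)" and ij: "i < n" "j < n"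
 shows "norm (emb (x i j)) <= nrm (Mt n) x"
proof -
 let ?v = "%k. emb \<one> * mone k j"
 have "(\<Sum>k<n. adj (?v k) * ?v k) = (\<Sum>k<n. emb \<one> * mone k j)"
  by (intro sum.cong refl) (simp add: mone_def emb_adj_one E.pp)
 then have "(\<Sum>k<n. adj (?v k) * ?v k) = emb \<one>" using ij(2) by (simp add: sum_mone)
 then have v: "colnorm n ?v <= 1" using nrm_one_le by (simp add: colnorm_def norm_emb)
 have "mv n x ?v i = (\<Sum>k<n. emb (x i k) * mone k j)" unfolding mv_def
  by (intro sum.cong refl) (use mat_entry[OF x ij(1)] in \<open>simp add: mone_def E.Ac_right\<close>)
 then have "norm (emb (x i j)) <= colnorm n (mv n x ?v)"
  using norm_le_colnorm[OF ij(1), of "mv n x ?v"] ij by (simp add: sum_mone)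
 also have "... <= nrm (Mt n) x * colnorm n ?v" by (rule colnorm_mv[OF x]) (simp add: mone_def)
 also have "... <= nrm (Mt n) x"
  using v nrm_mat_nonneg[OF x] by (simp add: mult_left_le)
 finally show ?thesis .
qed

lemma mv_in: "(!!j. v j \<in> Ec) ==> mv n x v i \<in> Ec"
 unfolding mv_def by (intro E.Ac_sum E.Ac_mult_right)

lemma nrm_mat_add:
 assumes x: "x \<in> carrier (Mt n)" and y: "y \<in> carrier (Mt n)"
 shows "nrm (Mt n) (x \<oplus>\<^bsub>Mt n\<^esub> y) <= nrm (Mt n) x + nrm (Mt n) y"
proof (rule nrm_mat_le[OF mat_closed(4)[OF x y]])
 fix v :: "nat => 'a alg_section" assume v: "!!i. v i \<in> Ec"
 have "colnorm n (mv n (x \<oplus>\<^bsub>Mt n\<^esub> y) v) = colnorm n (%i. mv n x v i + mv n y v i)"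
  by (rule colnorm_cong) (simp add: mv_def mat_emb x y distrib_right sum.distrib)
 also have "... <= nrm (Mt n) x * colnorm n v + nrm (Mt n) y * colnorm n v"
  by (intro order_trans[OF colnorm_triangle] add_mono colnorm_mv x y v)
 finally show "colnorm n (mv n (x \<oplus>\<^bsub>Mt n\<^esub> y) v) <= (nrm (Mt n) x + nrm (Mt n) y) * colnorm n v"
  by (simp add: distrib_right)
qed (simp add: nrm_mat_nonneg x y)

lemma nrm_mat_smult:
 assumes x: "x \<in> carrier (Mt n)"
 shows "nrm (Mt n) (z \<odot>\<^bsub>Mt n\<^esub> x) = cmod z * nrm (Mt n) x"
proof -
 have le: "nrm (Mt n) (z \<odot>\<^bsub>Mt n\<^esub> x) <= cmod z * nrm (Mt n) x" if x: "x \<in> carrier (Mt n)" for x z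
 proof (rule nrm_mat_le[OF mat_closed(5)[OF x]])
  fix v :: "nat => 'a alg_section" assume v: "!!i. v i \<in> Ec"
  have "colnorm n (mv n (z \<odot>\<^bsub>Mt n\<^esub> x) v) = colnorm n (%i. cx z * mv n x v i)"
   by (rule colnorm_cong) (simp add: mv_def mat_emb x sum_distrib_left mult.assoc)
  then show "colnorm n (mv n (z \<odot>\<^bsub>Mt n\<^esub> x) v) <= cmod z * nrm (Mt n) x * colnorm n v"
   using colnorm_mv[OF x v] by (simp add: colnorm_cx mult.assoc mult_left_mono)
 qed (simp add: nrm_mat_nonneg x)
 show ?thesis
 proof (cases "z = 0")
  case True
  then show ?thesis using le[OF x, of 0] nrm_mat_nonneg[OF mat_closed(5)[OF x, of 0]] by simp
 next
  case False
  have "(1 / z) \<odot>\<^bsub>Mt n\<^esub> (z \<odot>\<^bsub>Mt n\<^esub> x) = x"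
   by (rule mat_eqI[where n = n]) (use False in \<open>simp_all add: mat_closed x mat_emb flip: mult.assoc cx_mult\<close>)
  then have "nrm (Mt n) x <= nrm (Mt n) (z \<odot>\<^bsub>Mt n\<^esub> x) / cmod z"
   using le[OF mat_closed(5)[OF x], of "1 / z" z] by (simp add: norm_divide)
  then show ?thesis using le[OF x, of z] False by (simp add: field_simps)
 qed
qed

lemma nrm_mat_mult:
 assumes x: "x \<in> carrier (Mt n)" and y: "y \<in> carrier (Mt n)"
 shows "nrm (Mt n) (x \<otimes>\<^bsub>Mt n\<^esub> y) <= nrm (Mt n) x * nrm (Mt n) y"
proof (rule nrm_mat_le[OF mat_closed(3)[OF x y]])
 fix v :: "nat => 'a alg_section" assume v: "!!i. v i \<in> Ec"
 have "colnorm n (mv n (x \<otimes>\<^bsub>Mt n\<^esub> y) v) = colnorm n (mv n x (mv n y v))"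
  by (rule colnorm_cong)
   (simp add: mv_def mat_emb x y sum_distrib_left sum_distrib_right mult.assoc, rule sum.swap)
 also have "... <= nrm (Mt n) x * (nrm (Mt n) y * colnorm n v)"
  by (intro order_trans[OF colnorm_mv[OF x]] mult_left_mono colnorm_mv y nrm_mat_nonneg x mv_in v)
 finally show "colnorm n (mv n (x \<otimes>\<^bsub>Mt n\<^esub> y) v) <= nrm (Mt n) x * nrm (Mt n) y * colnorm n v" by (simp add: mult.assoc)
qed (simp add: nrm_mat_nonneg x y)

text \<open>The square of \<open>x v\<close> is the inner product of \<open>v\<close> with
  \<open>adj x * x\<close> applied to \<open>v\<close>, so Cauchy-Schwarz bounds it; equality of the
  norms of \<open>x\<close> and its adjoint follows from that inequality.\<close>

lemma nrm_mat_star_mult: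
 assumes x: "x \<in> carrier (Mt n)"
 shows "nrm (Mt n) (star (Mt n) x \<otimes>\<^bsub>Mt n\<^esub> x) = nrm (Mt n) x ^ 2"
proof -
 have sq: "nrm (Mt n) x ^ 2 <= nrm (Mt n) (star (Mt n) x \<otimes>\<^bsub>Mt n\<^esub> x)" if x: "x \<in> carrier (Mt n)" for x
 proof -
  let ?y = "star (Mt n) x \<otimes>\<^bsub>Mt n\<^esub> x"
  have y: "?y \<in> carrier (Mt n)" by (intro mat_closed x)
  have "nrm (Mt n) x <= sqrt (nrm (Mt n) ?y)"
  proof (rule nrm_mat_le[OF x])
   fix v :: "nat => 'a alg_section" assume v: "!!i. v i \<in> Ec"
   have "(\<Sum>i<n. adj (mv n x v i) * mv n x v i)
     = (\<Sum>i<n. \<Sum>k<n. \<Sum>j<n. adj (v j) * (adj (emb (x i j)) * (emb (x i k) * v k)))"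
    by (simp add: mv_def adj_sum adj_mult sum_distrib_left sum_distrib_right mult.assoc)
   also have "... = (\<Sum>k<n. \<Sum>j<n. \<Sum>i<n. adj (v j) * (adj (emb (x i j)) * (emb (x i k) * v k)))"
    by (rule sum_rotate)
   also have "... = (\<Sum>j<n. adj (v j) * mv n ?y v j)"
    by (subst sum.swap)
     (simp add: mv_def mat_emb mat_closed x sum_distrib_left sum_distrib_right mult.assoc cong: sum.cong_simp)
   finally have "colnorm n (mv n x v) ^ 2 <= colnorm n v * colnorm n (mv n ?y v)"
    unfolding colnorm_sq by (simp only: Cauchy_Schwarz_colnorm)
   also have "... <= colnorm n v * (nrm (Mt n) ?y * colnorm n v)"
    by (intro mult_left_mono colnorm_mv y v colnorm_nonneg)
   also have "... = (sqrt (nrm (Mt n) ?y) * colnorm n v) ^ 2"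
    using nrm_mat_nonneg[OF y] by (simp add: power2_eq_square)
   finally show "colnorm n (mv n x v) <= sqrt (nrm (Mt n) ?y) * colnorm n v"
    by (rule power2_le_imp_le) (simp add: nrm_mat_nonneg[OF y] colnorm_nonneg)
  qed (simp add: nrm_mat_nonneg[OF y])
  then have "nrm (Mt n) x ^ 2 <= sqrt (nrm (Mt n) ?y) ^ 2" by (intro power_mono nrm_mat_nonneg x)
  then show ?thesis using nrm_mat_nonneg[OF y] by simp
 qed
 have le: "nrm (Mt n) x <= nrm (Mt n) (star (Mt n) x)" if x: "x \<in> carrier (Mt n)" for x
 proof (cases "nrm (Mt n) x = 0")
  case False
  have "nrm (Mt n) x * nrm (Mt n) x <= nrm (Mt n) (star (Mt n) x) * nrm (Mt n) x"
   using order_trans[OF sq[OF x] nrm_mat_mult[OF mat_closed(6)[OF x] x]] by (simp add: power2_eq_square)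
  then show ?thesis using False nrm_mat_nonneg[OF x] by simp
 qed (simp add: nrm_mat_nonneg mat_closed x)
 have "star (Mt n) (star (Mt n) x) = x"
  by (rule mat_eqI[where n = n]) (simp_all add: mat_closed x mat_emb)
 then have "nrm (Mt n) (star (Mt n) x) = nrm (Mt n) x" using le[OF x] le[OF mat_closed(6)[OF x]] by simp
 then show ?thesis using sq[OF x] nrm_mat_mult[OF mat_closed(6)[OF x] x] by (simp add: power2_eq_square)
qed

lemma nrm_mat_le_sum: "x \<in> carrier (Mt n) ==> nrm (Mt n) x <= (\<Sum>i<n. \<Sum>j<n. norm (emb (x i j)))"
 by (rule nrm_mat_le) (auto intro!: colnorm_mv_le_sum sum_nonneg)

lemma nrm_mat_eq_0: "x \<in> carrier (Mt n) ==> nrm (Mt n) x = 0 \<longleftrightarrow> x = \<zero>\<^bsub>Mt n\<^esub>"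
proof
 assume x: "x \<in> carrier (Mt n)" "nrm (Mt n) x = 0"
 show "x = \<zero>\<^bsub>Mt n\<^esub>"
  by (rule mat_eqI[OF x(1) mat_closed(2)]) (use norm_entry_le[OF x(1)] x(2) in \<open>simp add: mat_emb\<close>)
next
 assume "x \<in> carrier (Mt n)" "x = \<zero>\<^bsub>Mt n\<^esub>"
 then have "nrm (Mt n) x <= 0" using nrm_mat_le_sum[of x n] by (simp add: mat_emb)
 then show "nrm (Mt n) x = 0" using nrm_mat_nonneg[OF \<open>x \<in> carrier (Mt n)\<close>] by simp
qed

lemma mat_diff: "x \<in> carrier (Mt n) ==> y \<in> carrier (Mt n) ==> i < n ==> j < n ==>
  emb ((x \<ominus>\<^bsub>Mt n\<^esub> y) i j) = emb (x i j) - emb (y i j)"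
proof -
 interpret MR: ring "Mt n" by (rule mat_ring)
 show "x \<in> carrier (Mt n) ==> y \<in> carrier (Mt n) ==> i < n ==> j < n ==> ?thesis"
  by (simp add: a_minus_def mat_emb(4) mat_uminus)
qed

text \<open>Makes the positivity theory available for matrices, in particular that positive means
  \<open>adj b * b\<close>. Completeness is entrywise: the norm dominates each entry and is
  dominated by the sum of their norms.\<close>

lemma cstar_algebra_mat: "cstar_algebra (Mt n)"
proof (intro cstar_algebra.intro cstar_algebra_axioms.intro mat_ring module.intro module_axioms.intro complex_ring_cring
  ring.is_abelian_group mat_closed nrm_mat_nonneg nrm_mat_eq_0 nrm_mat_add nrm_mat_smult nrm_mat_mult nrm_mat_star_mult)
 show "Metric_space.mcomplete (carrier (Mt n)) (alg_dist (Mt n))"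
 proof -
  interpret MR: ring "Mt n" by (rule mat_ring)
  have "\<ominus>\<^bsub>Mt n\<^esub> x = - 1 \<odot>\<^bsub>Mt n\<^esub> x" if "x \<in> carrier (Mt n)" for x
   by (rule mat_eqI[where n = n]) (simp_all add: that mat_closed mat_uminus mat_emb cx_uminus)
  then have um: "nrm (Mt n) (\<ominus>\<^bsub>Mt n\<^esub> x) = nrm (Mt n) x" if "x \<in> carrier (Mt n)" for x
   using nrm_mat_smult[OF that, of "-1"] that by simp
  have MS: "Metric_space (carrier (Mt n)) (alg_dist (Mt n))"
   by (rule metric_space_alg_dist[OF mat_ring]) (simp_all add: nrm_mat_nonneg nrm_mat_eq_0 nrm_mat_add um)
  show ?thesis unfolding Metric_space.mcomplete_def[OF MS]
  proof (intro allI impI)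
   fix s assume "Metric_space.MCauchy (carrier (Mt n)) (alg_dist (Mt n)) s"
   then have s: "s k \<in> carrier (Mt n)"
    and C: "\<epsilon> > 0 ==> \<exists>N. \<forall>k\<ge>N. \<forall>l\<ge>N. nrm (Mt n) (s k \<ominus>\<^bsub>Mt n\<^esub> s l) < \<epsilon>" for k \<epsilon>
    unfolding Metric_space.MCauchy_def[OF MS] by (auto simp: alg_dist_def image_subset_iff) (metis)?
   have "\<exists>l\<in>carrier A. \<forall>\<epsilon>>0. \<exists>N. \<forall>k\<ge>N. nrm A (s k i j \<ominus> l) < \<epsilon>" if ij: "i < n" "j < n" for i j
   proof (rule complete_seq)
    show sc: "s k i j \<in> carrier A" for k using mat_entry[OF s ij] .
    fix \<epsilon> :: real assume "\<epsilon> > 0"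
    then obtain N where N: "\<forall>k\<ge>N. \<forall>l\<ge>N. nrm (Mt n) (s k \<ominus>\<^bsub>Mt n\<^esub> s l) < \<epsilon>" using C by blast
    have "nrm A (s k i j \<ominus> s l i j) <= nrm (Mt n) (s k \<ominus>\<^bsub>Mt n\<^esub> s l)" for k l
     using norm_entry_le[OF MR.minus_closed[OF s s] ij, of k l] norm_emb[of "s k i j \<ominus> s l i j"] sc
     by (simp add: mat_diff s ij emb_diff)
    then show "\<exists>N. \<forall>k\<ge>N. \<forall>l\<ge>N. nrm A (s k i j \<ominus> s l i j) < \<epsilon>" using N by (meson le_less_trans)
   qed
   then obtain l where l: "!!i j. i < n ==> j < n ==> l i j \<in> carrier A"
    "!!i j \<epsilon>. i < n ==> j < n ==> \<epsilon> > 0 ==> \<exists>N. \<forall>k\<ge>N. nrm A (s k i j \<ominus> l i j) < \<epsilon>" by metis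
   define L where "L = (\<lambda>i\<in>{..<n}. \<lambda>j\<in>{..<n}. l i j)"
   have L: "L \<in> carrier (Mt n)" unfolding L_def by (rule mat_carrierI) (rule l)
   have "(%k. norm (emb ((s k \<ominus>\<^bsub>Mt n\<^esub> L) i j))) \<longlonglongrightarrow> 0" if ij: "i < n" "j < n" for i j
   proof -
    have "norm (emb ((s k \<ominus>\<^bsub>Mt n\<^esub> L) i j)) = nrm A (s k i j \<ominus> l i j)" for k
     using norm_emb[of "s k i j \<ominus> l i j"] mat_entry[OF s ij] l(1)[OF ij] ij
     by (simp add: mat_diff s L emb_diff) (simp add: L_def)
    then show ?thesis using l(2)[OF ij] nrm_nonneg[OF M.minus_closed[OF mat_entry[OF s ij] l(1)[OF ij]]]
     by (simp add: lim_sequentially)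
   qed
   then have "(%k. \<Sum>i<n. \<Sum>j<n. norm (emb ((s k \<ominus>\<^bsub>Mt n\<^esub> L) i j))) \<longlonglongrightarrow> (\<Sum>i<n. \<Sum>j<n. 0)"
    by (intro tendsto_sum) auto
   then have lim: "(%k. \<Sum>i<n. \<Sum>j<n. norm (emb ((s k \<ominus>\<^bsub>Mt n\<^esub> L) i j))) \<longlonglongrightarrow> 0" by simp
   have "\<exists>N. \<forall>k\<ge>N. nrm (Mt n) (s k \<ominus>\<^bsub>Mt n\<^esub> L) < \<epsilon>" if "\<epsilon> > 0" for \<epsilon>
    using order_tendstoD(2)[OF lim that] nrm_mat_le_sum[OF MR.minus_closed[OF s L]]
    unfolding eventually_sequentially by (meson le_less_trans)
   then show "\<exists>x. limitin (Metric_space.mtopology (carrier (Mt n)) (alg_dist (Mt n))) s x sequentially"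
    unfolding Metric_space.limit_metric_sequentially[OF MS] using s L by (intro exI[of _ L]) (simp add: alg_dist_def)
  qed
 qed
qed (assumption | rule mat_eqI[where n = n]; simp add: complex_ring_def mat_closed mat_emb cx_add cx_mult adj_add adj_mult adj_cx
  distrib_left distrib_right mult.assoc cx_left[of "emb w" for w] sum_distrib_left sum_distrib_right sum.distrib
  cx_comm[symmetric, where x = "adj (emb w)" for w] adj_sum cong: sum.cong_simp)+

lemma positive_iff_square: "positive A x \<longleftrightarrow> (\<exists>b\<in>carrier A. x = star A b \<otimes> b)"
proof
 assume "positive A x"
 then have x: "x \<in> carrier A" "psd (emb x)" by (auto simp: positive_iff)
 then obtain b where b: "adj b = b" "b * b = emb x" using psd_sqrt by blast
 have "x = star A (proj b) \<otimes> proj b"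
  using proj_emb[OF x(1)] by (simp add: b(1) b(2)[symmetric] proj_mult flip: proj_adj)
 then show "\<exists>b\<in>carrier A. x = star A b \<otimes> b" using proj_closed by blast
qed (auto simp: positive_iff emb_mult emb_star star_closed psd_adj_mult)

lemma positive_matD:
 assumes "positive (Mt n) x"
 shows "\<exists>b\<in>carrier (Mt n). \<forall>i<n. \<forall>j<n. emb (x i j) = (\<Sum>k<n. adj (emb (b k i)) * emb (b k j))"
proof -
 obtain b where "b \<in> carrier (Mt n)" "x = star (Mt n) b \<otimes>\<^bsub>Mt n\<^esub> b"
  using assms cstar_algebra.positive_iff_square[OF cstar_algebra_mat] by blast
 then show ?thesis by (intro bexI[of _ b]) (auto simp: mat_emb mat_closed)
qed

lemma positive_gram_mat:
 assumes c: "!!i. i < n ==> c i \<in> carrier A" and n: "n >= 1"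
 shows "positive (Mt n) (\<lambda>i\<in>{..<n}. \<lambda>j\<in>{..<n}. star A (c i) \<otimes> c j)"
proof -
 \<comment> \<open>The matrix with \<open>c\<close> as its first row and zeros below.\<close>
 define b where "b = (\<lambda>k\<in>{..<n}. \<lambda>j\<in>{..<n}. if k = 0 then c j else \<zero>)"
 have b: "b \<in> carrier (Mt n)" unfolding b_def by (rule mat_carrierI) (simp add: c)
 have "(\<lambda>i\<in>{..<n}. \<lambda>j\<in>{..<n}. star A (c i) \<otimes> c j) = star (Mt n) b \<otimes>\<^bsub>Mt n\<^esub> b"
 proof (rule mat_eqI[where n = n])
  fix i j assume ij: "i < n" "j < n"
  have "emb ((star (Mt n) b \<otimes>\<^bsub>Mt n\<^esub> b) i j) = (\<Sum>k<n. if k = 0 then adj (emb (c i)) * emb (c j) else 0)"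
   unfolding mat_emb(1)[OF ij mat_closed(6)[OF b] b]
   by (intro sum.cong refl) (use ij b in \<open>simp add: mat_emb\<close>, simp add: b_def emb_zero)
  then show "emb ((\<lambda>i\<in>{..<n}. \<lambda>j\<in>{..<n}. star A (c i) \<otimes> c j) i j) = emb ((star (Mt n) b \<otimes>\<^bsub>Mt n\<^esub> b) i j)"
   using ij n c by (simp add: emb_mult emb_star star_closed)
 qed (use b c in \<open>auto intro!: mat_closed mat_carrierI m_closed star_closed\<close>)
 then show ?thesis using cstar_algebra.positive_iff_square[OF cstar_algebra_mat] b by blast
qed

end

section \<open>Completely positive maps through matrix algebras\<close>

lemma complex_alg_ops [simp]:
 "carrier complex_alg = UNIV" "x \<otimes>\<^bsub>complex_alg\<^esub> y = x * y" "\<one>\<^bsub>complex_alg\<^esub> = 1" "\<zero>\<^bsub>complex_alg\<^esub> = 0"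
 "x \<oplus>\<^bsub>complex_alg\<^esub> y = x + y" "z \<odot>\<^bsub>complex_alg\<^esub> x = z * x" "star complex_alg x = cnj x" "nrm complex_alg x = cmod x"
 by (simp_all add: complex_alg_def)

lemma ring_complex_alg: "ring complex_alg"
 by (intro ringI abelian_groupI monoidI) (auto simp: algebra_simps intro: exI[of _ "- x" for x])

interpretation CR: ring complex_alg by (rule ring_complex_alg)

lemma complex_alg_minus [simp]: "\<ominus>\<^bsub>complex_alg\<^esub> y = - y" "x \<ominus>\<^bsub>complex_alg\<^esub> y = x - y"
proof -
 show "\<ominus>\<^bsub>complex_alg\<^esub> y = - y" by (rule CR.minus_equality) auto
 then show "x \<ominus>\<^bsub>complex_alg\<^esub> y = x - y" by (simp add: a_minus_def)
qed

lemma complex_alg_finsum [simp]: "finsum complex_alg f K = sum f K"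
 by (induction K rule: infinite_finite_induct) auto

lemma cstar_algebra_complex: "cstar_algebra complex_alg"
proof (intro cstar_algebra.intro cstar_algebra_axioms.intro ring_complex_alg module.intro module_axioms.intro complex_ring_cring
  ring.is_abelian_group)
 have MS: "Metric_space (carrier complex_alg) (alg_dist complex_alg)"
  by (rule metric_space_alg_dist[OF ring_complex_alg]) (auto intro: norm_triangle_ineq)
 show "Metric_space.mcomplete (carrier complex_alg) (alg_dist complex_alg)"
  unfolding Metric_space.mcomplete_def[OF MS]
 proof (intro allI impI)
  fix s assume "Metric_space.MCauchy (carrier complex_alg) (alg_dist complex_alg) s"
  then have "Cauchy s" unfolding Metric_space.MCauchy_def[OF MS] Cauchy_def by (simp add: alg_dist_def dist_norm)
  then obtain l where "s \<longlonglongrightarrow> l" using Cauchy_convergent convergentD by blast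
  then show "\<exists>l. limitin (Metric_space.mtopology (carrier complex_alg) (alg_dist complex_alg)) s l sequentially"
   unfolding Metric_space.limit_metric_sequentially[OF MS]
   by (intro exI[of _ l]) (simp add: alg_dist_def lim_sequentially dist_norm)
 qed
qed (auto simp: complex_ring_def algebra_simps norm_mult power2_eq_square intro: norm_triangle_ineq)

interpretation C: cstar_algebra complex_alg by (rule cstar_algebra_complex)
interpretation CM: cstar_algebra "C.Mt n" for n by (rule C.cstar_algebra_mat)

lemma complex_mat_ops:
 assumes "i < n" "j < n"
 shows "(x \<otimes>\<^bsub>C.Mt n\<^esub> y) i j = (\<Sum>k<n. x i k * y k j)" "\<zero>\<^bsub>C.Mt n\<^esub> i j = 0"
  "(x \<oplus>\<^bsub>C.Mt n\<^esub> y) i j = x i j + y i j" "(z \<odot>\<^bsub>C.Mt n\<^esub> x) i j = z * x i j" "star (C.Mt n) x i j = cnj (x j i)"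
 using assms by (auto simp: mat_alg_def)

lemma complex_mat_eqI: "x \<in> carrier (C.Mt n) ==> y \<in> carrier (C.Mt n) ==> (!!i j. i < n ==> j < n ==> x i j = y i j) ==> x = y"
 by (rule C.mat_eqI) auto

lemma complex_mat_finsum:
 assumes "!!k. k \<in> K ==> f k \<in> carrier (C.Mt n)" "i < n" "j < n"
 shows "finsum (C.Mt n) f K i j = (\<Sum>k\<in>K. f k i j)"
 using assms(1)
proof (induction K rule: infinite_finite_induct)
 case (insert k K)
 then have "f \<in> K \<rightarrow> carrier (C.Mt n)" "f k \<in> carrier (C.Mt n)" by auto
 then show ?case using insert assms(2,3) by (simp add: complex_mat_ops)
qed (use assms(2,3) in \<open>simp_all add: complex_mat_ops\<close>)

text \<open>The value of the positive matrix at the vector \<open>\<Sum> e_i \<otimes> e_i\<close>: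
  block \<open>i j\<close> contributes its entry \<open>i j\<close>. Writing \<open>x\<close> as
  \<open>adj b * b\<close> leaves a sum of squared moduli.\<close>

lemma trace_pairing_nonneg:
 assumes "positive (mat_alg n (C.Mt n)) x"
 shows "(\<Sum>i<n. \<Sum>j<n. x i j i j) \<in> \<real>\<^sub>\<ge>\<^sub>0"
proof -
 obtain b where b: "b \<in> carrier (mat_alg n (C.Mt n))" and x: "x = star (mat_alg n (C.Mt n)) b \<otimes>\<^bsub>mat_alg n (C.Mt n)\<^esub> b"
  using assms cstar_algebra.positive_iff_square[OF CM.cstar_algebra_mat] by blast
 have bc: "b i j \<in> carrier (C.Mt n)" if "i < n" "j < n" for i j by (rule CM.mat_entry[OF b that])
 have "x i j i j = (\<Sum>k<n. \<Sum>m<n. cnj (b k i m i) * b k j m j)" if ij: "i < n" "j < n" for i j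
 proof -
  have e: "x i j = (\<Oplus>\<^bsub>C.Mt n\<^esub>k\<in>{..<n}. star (C.Mt n) (b k i) \<otimes>\<^bsub>C.Mt n\<^esub> b k j)"
   unfolding x by (subst mat_alg_def) (use ij in \<open>auto simp: mat_alg_def[of n "C.Mt n"] intro!: CM.M.finsum_cong' C.mat_closed bc\<close>)
  have "x i j i j = (\<Sum>k<n. (star (C.Mt n) (b k i) \<otimes>\<^bsub>C.Mt n\<^esub> b k j) i j)"
   unfolding e by (rule complex_mat_finsum) (use ij in \<open>auto intro!: C.mat_closed bc\<close>)
  then show ?thesis using ij by (simp add: complex_mat_ops cong: sum.cong_simp)
 qed
 then have "(\<Sum>i<n. \<Sum>j<n. x i j i j) = (\<Sum>i<n. \<Sum>j<n. \<Sum>k<n. \<Sum>m<n. cnj (b k i m i) * b k j m j)" by simp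
 also have "... = (\<Sum>k<n. \<Sum>i<n. \<Sum>j<n. \<Sum>m<n. cnj (b k i m i) * b k j m j)" by (rule sum_rotate[symmetric])
 also have "... = (\<Sum>k<n. \<Sum>m<n. \<Sum>i<n. \<Sum>j<n. cnj (b k i m i) * b k j m j)"
  by (rule sum.cong[OF refl], rule sum_rotate[symmetric])
 also have "... = (\<Sum>k<n. \<Sum>m<n. of_real ((cmod (\<Sum>i<n. b k i m i))\<^sup>2))"
 proof (intro sum.cong refl)
  show "(\<Sum>i<n. \<Sum>j<n. cnj (b k i m i) * b k j m j) = of_real ((cmod (\<Sum>i<n. b k i m i))\<^sup>2)" for k m
   unfolding complex_norm_square by (subst sum.swap) (simp add: sum_product mult.commute)
 qed
 also have "... \<in> \<real>\<^sub>\<ge>\<^sub>0" by (intro sum_in_nonneg_Reals) auto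
 finally show ?thesis .
qed

definition matrix_unit :: "nat => nat => nat => nat => nat => complex" where
 "matrix_unit n i j = (\<lambda>a\<in>{..<n}. \<lambda>b\<in>{..<n}. mone a i * mone b j)"

lemma matrix_unit: "matrix_unit n i j \<in> carrier (C.Mt n)"
 "a < n ==> b < n ==> matrix_unit n i j a b = mone a i * mone b j"
 by (auto simp: matrix_unit_def intro: C.mat_carrierI)

text \<open>The matrix units form a Gram matrix: \<open>E_ij\<close> is the adjoint of
  \<open>E_0i\<close> times \<open>E_0j\<close>.\<close>

lemma positive_choi:
 assumes n: "n >= 1"
 shows "positive (mat_alg n (C.Mt n)) (\<lambda>i\<in>{..<n}. \<lambda>j\<in>{..<n}. matrix_unit n i j)"
proof -
 have "star (C.Mt n) (matrix_unit n 0 i) \<otimes>\<^bsub>C.Mt n\<^esub> matrix_unit n 0 j = matrix_unit n i j" for i j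
 proof (rule complex_mat_eqI)
  fix a b assume ab: "a < n" "b < n"
  have "(star (C.Mt n) (matrix_unit n 0 i) \<otimes>\<^bsub>C.Mt n\<^esub> matrix_unit n 0 j) a b = (\<Sum>k<n. (mone a i * mone b j) * mone k 0)"
   unfolding complex_mat_ops(1)[OF ab]
   by (intro sum.cong refl) (use ab in \<open>simp add: complex_mat_ops matrix_unit mone_def\<close>)
  also have "... = mone a i * mone b j" using n by (simp add: sum_mone)
  finally show "(star (C.Mt n) (matrix_unit n 0 i) \<otimes>\<^bsub>C.Mt n\<^esub> matrix_unit n 0 j) a b = matrix_unit n i j a b"
   using ab by (simp add: matrix_unit)
 qed (intro C.mat_closed matrix_unit)+
 then show ?thesis using CM.positive_gram_mat[of n "matrix_unit n 0" n] n matrix_unit(1) by simp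
qed

context cstar_algebra
begin

lemma form_psd_of_cp:
 assumes \<phi>: "completely_positive A A \<phi>" and a: "a \<in> Ec" "psd a"
 shows "psd (emb (\<phi> (proj a)))"
proof -
 obtain b where b: "b \<in> carrier A" "proj a = star A b \<otimes> b" using positive_iff_square positive_proj[OF a] by blast
 let ?x = "\<lambda>i\<in>{..<1::nat}. \<lambda>j\<in>{..<1::nat}. star A b \<otimes> b"
 have "positive (Mt 1) (mat_map 1 \<phi> ?x)"
  using \<phi> positive_gram_mat[of 1 "%_. b"] b unfolding completely_positive_def by simp
 then show ?thesis
  using positive_matD[of 1 "mat_map 1 \<phi> ?x"] by (auto simp: mat_map_def b(2) lessThan_Suc psd_adj_mult)
qed

lemma linear_map_emb:
 assumes "linear_map A A \<phi>"
 shows "emb (\<phi> (proj (x + y))) = emb (\<phi> (proj x)) + emb (\<phi> (proj y))"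
  "emb (\<phi> (proj (cx z * x))) = cx z * emb (\<phi> (proj x))"
 using assms by (auto simp: linear_map_def proj_add proj_cx emb_add emb_smult Pi_iff)

text \<open>Positivity applied to \<open>- norm a <= a <= norm a\<close> bounds self-adjoint
  elements; real and imaginary part cost a factor 2. Needed to pass from a dense sequence to all of
  \<open>A\<close>.\<close>

lemma cp_bounded:
 assumes \<phi>: "completely_positive A A \<phi>"
 shows "\<exists>K. \<forall>a\<in>Ec. norm (emb (\<phi> (proj a))) <= K * norm a"
proof -
 let ?F = "%a. emb (\<phi> (proj a))"
 have lin: "linear_map A A \<phi>" using \<phi> by (simp add: completely_positive_def)
 note F = linear_map_emb[OF lin]
 have Fs: "?F (r *\<^sub>R x) = r *\<^sub>R ?F x" for r x using F(2)[of "of_real r" x] by (simp add: cx_of_real mult_of_real_left)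
 have Fd: "?F (x - y) = ?F x - ?F y" for x y using F(1)[of x "- y"] Fs[of "-1" y] by simp
 define K where "K = norm (?F (emb \<one>))"
 have K0: "K >= 0" by (simp add: K_def)
 have sa: "norm (?F a) <= K * norm a" if a: "a \<in> Ec" "adj a = a" for a
 proof -
  have p: "?F (emb \<one>) = emb (\<phi> \<one>)" by simp
  have sF: "psd (norm a *\<^sub>R ?F (emb \<one>) - ?F a)" "psd (norm a *\<^sub>R ?F (emb \<one>) + ?F a)"
  proof -
   have 1: "psd (norm a *\<^sub>R emb \<one> - a)" by (rule E.psd_corner_upper[OF a order_refl])
   have 2: "psd (norm a *\<^sub>R emb \<one> - (- a))" by (rule E.psd_corner_upper) (use a in auto)
   show "psd (norm a *\<^sub>R ?F (emb \<one>) - ?F a)"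
    using form_psd_of_cp[OF \<phi> E.Ac_diff[OF E.Ac_scaleR[OF E.Ac_p] a(1)] 1] unfolding Fd Fs .
   have "?F (- a) = - ?F a" using Fs[of "-1" a] by simp
   then show "psd (norm a *\<^sub>R ?F (emb \<one>) + ?F a)"
    using form_psd_of_cp[OF \<phi> E.Ac_diff[OF E.Ac_scaleR[OF E.Ac_p] E.Ac_uminus[OF a(1)]] 2] unfolding Fd Fs by simp
  qed
  have "psd (?F (emb \<one>))" by (rule form_psd_of_cp[OF \<phi> E.Ac_p E.psd_p])
  then have up: "psd (of_real (norm a * K) - norm a *\<^sub>R ?F (emb \<one>))"
   using psd_scaleR[OF psd_upper[OF _ order_refl, of "?F (emb \<one>)"], of "norm a"]
   by (simp add: K_def scaleR_diff_right of_real_def)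
  have "adj (?F a) = ?F a"
   using psd_sa[OF sF(2)] psd_sa[OF \<open>psd (?F (emb \<one>))\<close>] by (simp add: adj_add adj_scaleR)
  then have "norm (?F a) <= norm a * K"
   by (rule norm_le_of_psd) (use psd_add[OF up sF(1)] psd_add[OF up sF(2)] in \<open>simp_all add: algebra_simps\<close>)
  then show ?thesis by (simp add: mult.commute)
 qed
 have "norm (?F a) <= (2 * K) * norm a" if a: "a \<in> Ec" for a
 proof -
  define h where "h = (1/2) *\<^sub>R (a + adj a)"
  define k where "k = cx (- \<i> / 2) * (a - adj a)"
  have hk: "h \<in> Ec" "k \<in> Ec" using a by (auto simp: h_def k_def intro: E.Ac_cx)
  have sa': "adj h = h" "adj k = k"
   by (auto simp: h_def k_def adj_scaleR adj_add adj_mult adj_cx adj_diff add.commute cx_comm[symmetric] cx_uminus algebra_simps)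
  have nh: "norm h <= norm a" using norm_triangle_ineq[of a "adj a"] by (simp add: h_def norm_adj)
  have nk: "norm k <= norm a" using norm_triangle_ineq4[of a "adj a"] by (simp add: k_def norm_adj norm_cx_mult norm_divide)
  have "cx \<i> * k = (1/2) *\<^sub>R (a - adj a)"
   by (simp add: k_def mult.assoc[symmetric] cx_mult[symmetric]) (simp add: cx_def mult_of_real_left del: of_real_divide)
  then have "a = h + cx \<i> * k" by (simp add: h_def flip: scaleR_add_right)
  then have "?F a = ?F h + cx \<i> * ?F k" using F(1)[of h "cx \<i> * k"] F(2)[of \<i> k] by simp
  then have "norm (?F a) <= norm (?F h) + norm (?F k)"
   using norm_triangle_ineq[of "?F h" "cx \<i> * ?F k"] by (simp add: norm_cx_mult)
  also have "... <= K * norm a + K * norm a"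
   using sa[OF hk(1) sa'(1)] sa[OF hk(2) sa'(2)] mult_left_mono[OF nh K0] mult_left_mono[OF nk K0] by linarith
  finally show ?thesis by simp
 qed
 then show ?thesis by blast
qed

lemma linear_map_finsum:
 assumes V: "linear_map (C.Mt n) A V" and "finite K" "!!k. k \<in> K ==> f k \<in> carrier (C.Mt n)"
 shows "emb (V (finsum (C.Mt n) f K)) = (\<Sum>k\<in>K. emb (V (f k)))"
 using assms(2,3)
proof (induction K rule: finite_induct)
 case empty
 let ?R = "C.Mt n"
 have "\<zero>\<^bsub>?R\<^esub> = 0 \<odot>\<^bsub>?R\<^esub> \<zero>\<^bsub>?R\<^esub>" by (rule complex_mat_eqI[where n = n]) (auto simp: complex_mat_ops intro: C.mat_closed)
 then have "V \<zero>\<^bsub>?R\<^esub> = 0 \<odot> V \<zero>\<^bsub>?R\<^esub>" using V C.mat_closed(2)[of n] unfolding linear_map_def by metis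
 moreover have "V \<zero>\<^bsub>?R\<^esub> \<in> carrier A" using V C.mat_closed(2)[of n] by (auto simp: linear_map_def)
 ultimately show ?case by (simp add: smult_0 emb_zero)
next
 case (insert k K)
 have f: "f \<in> K \<rightarrow> carrier (C.Mt n)" "f k \<in> carrier (C.Mt n)" using insert.prems by auto
 have "V (f k) \<in> carrier A" "V (finsum (C.Mt n) f K) \<in> carrier A"
  using V f CM.M.finsum_closed[OF f(1)] by (auto simp: linear_map_def)
 then show ?case using insert f V CM.M.finsum_closed[OF f(1)] by (simp add: linear_map_def emb_add)
qed

lemma linear_map_matrix_units:
 assumes V: "linear_map (C.Mt n) A V" and x: "x \<in> carrier (C.Mt n)"
 shows "emb (V x) = (\<Sum>i<n. \<Sum>j<n. cx (x i j) * emb (V (matrix_unit n i j)))"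
proof -
 let ?R = "C.Mt n" and ?I = "{..<n} \<times> {..<n}"
 let ?f = "%q. x (fst q) (snd q) \<odot>\<^bsub>?R\<^esub> matrix_unit n (fst q) (snd q)"
 have f: "?f q \<in> carrier ?R" for q by (intro C.mat_closed matrix_unit)
 have "x = finsum ?R ?f ?I"
 proof (rule complex_mat_eqI[OF x])
  show "finsum ?R ?f ?I \<in> carrier ?R" by (rule CM.M.finsum_closed) (use f in auto)
  show "x a b = finsum ?R ?f ?I a b" if "a < n" "b < n" for a b
  proof -
   have "finsum ?R ?f ?I a b = (\<Sum>q\<in>?I. x (fst q) (snd q) * (mone a (fst q) * mone b (snd q)))"
    using that by (subst complex_mat_finsum[OF f]) (simp_all add: complex_mat_ops matrix_unit)
   also have "... = (\<Sum>q\<in>?I. if q = (a, b) then x a b else 0)"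
    by (intro sum.cong refl) (auto simp: mone_def)
   finally show ?thesis using that by simp
  qed
 qed
 then have "emb (V x) = (\<Sum>q\<in>?I. emb (V (?f q)))" using linear_map_finsum[of n V ?I ?f, OF V _ f] by simp
 also have "... = (\<Sum>q\<in>?I. cx (x (fst q) (snd q)) * emb (V (matrix_unit n (fst q) (snd q))))"
  using V matrix_unit(1)[of n] by (intro sum.cong refl) (auto simp: linear_map_def emb_smult Pi_iff)
 finally show ?thesis by (simp add: sum.cartesian_product')
qed

text \<open>Choi's argument: the image of the positive matrix of matrix units is positive over
  \<open>A\<close>, hence a product \<open>adj b * b\<close>.\<close>

lemma cp_factorization:
 assumes V: "completely_positive (C.Mt n) A V" and n: "n >= 1"
 shows "\<exists>c. (\<forall>l i. c l i \<in> Ec) \<and> (\<forall>i<n. \<forall>j<n. emb (V (matrix_unit n i j)) = (\<Sum>l<n. adj (c l i) * c l j))"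
proof -
 have "positive (Mt n) (mat_map n V (\<lambda>i\<in>{..<n}. \<lambda>j\<in>{..<n}. matrix_unit n i j))"
  using V n positive_choi[OF n] unfolding completely_positive_def by blast
 then obtain b where b: "b \<in> carrier (Mt n)"
  "!!i j. i < n ==> j < n ==> emb (V (matrix_unit n i j)) = (\<Sum>k<n. adj (emb (b k i)) * emb (b k j))"
  by (auto simp: mat_map_def dest!: positive_matD)
 let ?c = "%l i. if l < n \<and> i < n then emb (b l i) else 0"
 show ?thesis
  by (rule exI[of _ ?c]) (use b(2) mat_entry[OF b(1)] in auto)
qed

text \<open>The factorisation of the Choi matrix has \<open>n\<close> rows, so the map is a sum over
  \<open>l\<close> of terms with the same coefficients. Indexing by pairs \<open>(l, i)\<close>
  absorbs this sum.\<close>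

lemma nuclear_coeffs:
 assumes core: "tracial_core (emb \<one>) Tr \<gamma>" and \<phi>: "nuclear_map A \<phi>"
  and \<phi>c: "\<phi> \<in> carrier A \<rightarrow> carrier A"
  and F: "finite F" "F \<subseteq> carrier A" and \<epsilon>: "\<epsilon> > 0"
 shows "\<exists>(I :: (nat \<times> nat) set) U c. cp_coeffs (emb \<one>) Tr \<gamma> I U \<and> (\<forall>i. c i \<in> Ec) \<and>
  (\<forall>a\<in>F. norm ((\<Sum>i\<in>I. \<Sum>j\<in>I. cx (U (emb a) i j) * (adj (c i) * c j)) - emb (\<phi> a)) <= \<epsilon>)"
proof -
 obtain n U V where n: "n >= 1" and U: "completely_positive A (C.Mt n) U"
  and V: "completely_positive (C.Mt n) A V"
  and UV: "!!a. a \<in> F ==> nrm A (\<phi> a \<ominus> V (U a)) < \<epsilon>"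
  using \<phi> F \<epsilon> unfolding nuclear_map_def by metis
 let ?R = "C.Mt n" and ?I = "{..<n} \<times> {..<n}"
 have Ul: "linear_map A ?R U" and Vl: "linear_map ?R A V" using U V by (auto simp: completely_positive_def)
 have Uc: "U a \<in> carrier ?R" if "a \<in> carrier A" for a using Ul that by (auto simp: linear_map_def)
 have Vc: "V x \<in> carrier A" if "x \<in> carrier ?R" for x using Vl that by (auto simp: linear_map_def)
 \<comment> \<open>Block diagonal, with \<open>n\<close> copies of the matrix of \<open>U\<close>:
   different rows \<open>l\<close> do not interact.\<close>
 define W where "W x q r = (if fst q = fst r \<and> q \<in> ?I \<and> r \<in> ?I then U (proj x) (snd q) (snd r) else 0)" for x :: "'a alg_section" and q r
 have W: "W x (l, i) (k, j) = (if l = k then U (proj x) i j else 0)" if "l < n" "i < n" "k < n" "j < n" for x l i k j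
  using that by (simp add: W_def)
 have sumI: "(\<Sum>q\<in>?I. \<Sum>r\<in>?I. if fst q = fst r then G q r else 0) = (\<Sum>l<n. \<Sum>i<n. \<Sum>j<n. G (l, i) (l, j))"
  for G :: "nat \<times> nat => nat \<times> nat => 'z::comm_monoid_add"
 proof -
  have 1: "(\<Sum>r\<in>?I. if l = fst r then G (l, i) r else 0) = (\<Sum>j<n. G (l, i) (l, j))" if "l < n" for l i
  proof -
   have "(\<Sum>r\<in>?I. if l = fst r then G (l, i) r else 0) = (\<Sum>k<n. if l = k then \<Sum>j<n. G (l, i) (l, j) else 0)"
    unfolding sum.cartesian_product' by (intro sum.cong refl) auto
   then show ?thesis using that by simp
  qed
  have "(\<Sum>q\<in>?I. H q) = (\<Sum>l<n. \<Sum>i<n. H (l, i))" for H :: "nat \<times> nat => 'z"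
   by (rule sum.cartesian_product')
  from this[of "%q. \<Sum>r\<in>?I. if fst q = fst r then G q r else 0"] show ?thesis by (simp add: 1)
 qed
 have coeffs: "cp_coeffs (emb \<one>) Tr \<gamma> ?I W"
 proof (intro cp_coeffs.intro core cp_coeffs_axioms.intro)
  show "finite ?I" by simp
  show "W (x + y) q r = W x q r + W y q r" for x y q r
   using Ul by (auto simp: W_def proj_add linear_map_def complex_mat_ops)
  show "W (cx z * x) q r = z * W x q r" for x q r z
   using Ul by (auto simp: W_def proj_cx linear_map_def complex_mat_ops)
  fix c :: "nat \<times> nat => 'a alg_section" assume c: "!!i. c i \<in> Ec"
  have "(\<Sum>q\<in>?I. \<Sum>r\<in>?I. W (adj (c q) * c r) q r)
    = (\<Sum>q\<in>?I. \<Sum>r\<in>?I. if fst q = fst r then U (proj (adj (c q) * c r)) (snd q) (snd r) else 0)"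
   by (intro sum.cong refl) (auto simp: W_def)
  also have "... = (\<Sum>l<n. \<Sum>i<n. \<Sum>j<n. U (proj (adj (c (l, i)) * c (l, j))) i j)" unfolding sumI by simp
  also have "... \<in> \<real>\<^sub>\<ge>\<^sub>0"
  proof (rule sum_in_nonneg_Reals)
   fix l
   let ?x = "\<lambda>i\<in>{..<n}. \<lambda>j\<in>{..<n}. proj (adj (c (l, i)) * c (l, j))"
   have "positive (mat_alg n ?R) (mat_map n U ?x)"
    using U n positive_gram_mat[of n "%i. proj (c (l, i))"] unfolding completely_positive_def proj_mult proj_adj by simp
   from trace_pairing_nonneg[OF this]
   show "(\<Sum>i<n. \<Sum>j<n. U (proj (adj (c (l, i)) * c (l, j))) i j) \<in> \<real>\<^sub>\<ge>\<^sub>0"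
    by (simp add: mat_map_def)
  qed
  finally show "(\<Sum>q\<in>?I. \<Sum>r\<in>?I. W (adj (c q) * c r) q r) \<in> \<real>\<^sub>\<ge>\<^sub>0" .
 qed
 obtain c where c: "\<forall>l i. c l i \<in> Ec" and ce: "!!i j. i < n ==> j < n ==>
   emb (V (matrix_unit n i j)) = (\<Sum>l<n. adj (c l i) * c l j)"
  using cp_factorization[OF V n] by blast
 have "norm ((\<Sum>q\<in>?I. \<Sum>r\<in>?I. cx (W (emb a) q r) * (adj (c (fst q) (snd q)) * c (fst r) (snd r))) - emb (\<phi> a)) <= \<epsilon>"
  (is "norm (?S - _) <= _") if a: "a \<in> F" for a
 proof -
  have aA: "a \<in> carrier A" using a F by auto
  have "?S = (\<Sum>q\<in>?I. \<Sum>r\<in>?I. if fst q = fst r then cx (U a (snd q) (snd r)) * (adj (c (fst q) (snd q)) * c (fst r) (snd r)) else 0)"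
   by (intro sum.cong refl) (auto simp: W_def aA)
  also have "... = (\<Sum>l<n. \<Sum>i<n. \<Sum>j<n. cx (U a i j) * (adj (c l i) * c l j))" unfolding sumI by simp
  also have "... = (\<Sum>i<n. \<Sum>j<n. \<Sum>l<n. cx (U a i j) * (adj (c l i) * c l j))"
   by (subst sum.swap, rule sum.cong[OF refl], rule sum.swap)
  also have "... = (\<Sum>i<n. \<Sum>j<n. cx (U a i j) * emb (V (matrix_unit n i j)))"
   by (intro sum.cong refl) (simp add: ce flip: sum_distrib_left)
  also have "... = emb (V (U a))" by (simp add: linear_map_matrix_units[OF Vl Uc[OF aA]])
  finally have S: "?S = emb (V (U a))" .
  have "norm (emb (\<phi> a) - emb (V (U a))) < \<epsilon>"
   using UV[OF a] Vc[OF Uc[OF aA]] funcset_mem[OF \<phi>c aA] by (simp add: norm_emb flip: emb_diff)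
  then show ?thesis by (simp only: S norm_minus_commute less_imp_le)
 qed
 then show ?thesis using coeffs c by (intro exI[of _ ?I] exI[of _ W] exI[of _ "%q. c (fst q) (snd q)"]) simp
qed

end

section \<open>Representing sequences\<close>

locale cstar_ultrapower = cstar_algebra A for A :: "'a star_alg" (structure) +
 fixes \<omega> :: "nat filter"
 assumes ultra: "free_ultrafilter \<omega>"
begin

text \<open>Representatives live in the ambient type, so operations are pointwise and null sequences
  are limits in a topological space; \<open>cl\<close> is the class in the ultrapower.\<close>

definition BS :: "(nat => 'a alg_section) set" where
 "BS = {x. (\<forall>n. x n \<in> Ec) \<and> (\<exists>B. \<forall>n. norm (x n) <= B)}"

definition cl :: "(nat => 'a alg_section) => (nat => 'a) set" where
 "cl x = ultra_proj \<omega> A (%n. proj (x n))"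

definition sim :: "(nat => 'a alg_section) => (nat => 'a alg_section) => bool" where
 "sim x y \<longleftrightarrow> ((%n. x n - y n) \<longlongrightarrow> 0) \<omega>"

abbreviation U where "U \<equiv> ultrapower \<omega> A"

lemma not_bot: "\<omega> ~= bot"
 by (rule free_ultrafilter_not_bot[OF ultra])

lemma BS_I: "(!!n. x n \<in> Ec) ==> (!!n. norm (x n) <= B) ==> x \<in> BS"
 by (auto simp: BS_def)

lemma BS_in: "x \<in> BS ==> x n \<in> Ec" and BS_bound: "x \<in> BS ==> \<exists>B. \<forall>n. norm (x n) <= B"
 by (auto simp: BS_def)

lemma BS_add: assumes "x \<in> BS" "y \<in> BS" shows "(%n. x n + y n) \<in> BS"
proof -
 obtain B C where "!!n. norm (x n) <= B" "!!n. norm (y n) <= C" using assms BS_bound by meson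
 then show ?thesis using assms
  by (intro BS_I[of _ "B + C"]) (auto simp: BS_in intro: E.Ac_add norm_triangle_le add_mono)
qed

lemma BS_mult: assumes "x \<in> BS" "y \<in> BS" shows "(%n. x n * y n) \<in> BS"
proof -
 obtain B C where "!!n. norm (x n) <= B" "!!n. norm (y n) <= C" using assms BS_bound by meson
 then show ?thesis using assms
  by (intro BS_I[of _ "B * C"]) (auto simp: BS_in intro: E.Ac_mult norm_mult_le)
qed

lemma BS_cx: assumes "x \<in> BS" shows "(%n. cx z * x n) \<in> BS"
proof -
 obtain B where "!!n. norm (x n) <= B" using assms BS_bound by meson
 then show ?thesis using assms
  by (intro BS_I[of _ "cmod z * B"]) (auto simp: BS_in norm_cx_mult intro: E.Ac_cx mult_left_mono)
qed

lemma BS_uminus: "x \<in> BS ==> (%n. - x n) \<in> BS"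
 using BS_cx[of x "-1"] by (simp add: cx_uminus)

lemma BS_diff: "x \<in> BS ==> y \<in> BS ==> (%n. x n - y n) \<in> BS"
 using BS_add[OF _ BS_uminus, of x y] by simp

lemma BS_adj: "x \<in> BS ==> (%n. adj (x n)) \<in> BS"
 by (auto simp: BS_def norm_adj intro: E.Ac_adj)

lemma BS_const: "a \<in> Ec ==> (%n. a) \<in> BS"
 by (auto simp: BS_def)

lemma BS_power: "x \<in> BS ==> (%n. x n ^ Suc m) \<in> BS"
proof (induction m)
 case (Suc m)
 then show ?case using BS_mult[of x "%n. x n ^ Suc m"] by simp
qed simp

lemma sim_refl: "sim x x"
 by (simp add: sim_def)

lemma sim_sym: "sim x y ==> sim y x"
 unfolding sim_def using tendsto_minus[of "%n. x n - y n" 0 \<omega>] by simp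

lemma sim_trans: "sim x y ==> sim y z ==> sim x z"
 unfolding sim_def using tendsto_add[of "%n. x n - y n" 0 \<omega> "%n. y n - z n" 0] by simp

lemma sim_add: "sim x y ==> sim x' y' ==> sim (%n. x n + x' n) (%n. y n + y' n)"
 unfolding sim_def using tendsto_add[of "%n. x n - y n" 0 \<omega> "%n. x' n - y' n" 0] by (simp add: algebra_simps)

lemma sim_cx: "sim x y ==> sim (%n. cx z * x n) (%n. cx z * y n)"
 unfolding sim_def using tendsto_mult[OF tendsto_const, of "%n. x n - y n" 0 \<omega> "cx z"] by (simp add: right_diff_distrib)

lemma sim_adj: "sim x y ==> sim (%n. adj (x n)) (%n. adj (y n))"
 unfolding sim_def using tendsto_adj[of "%n. x n - y n" 0 \<omega>] by (simp add: adj_diff)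

lemma sim_mult:
 assumes "sim x y" "sim x' y'" "x' \<in> BS" "y \<in> BS"
 shows "sim (%n. x n * x' n) (%n. y n * y' n)"
proof -
 obtain B C where "!!n. norm (x' n) <= B" "!!n. norm (y n) <= C" using assms BS_bound by meson
 then have "((%n. (x n - y n) * x' n + y n * (x' n - y' n)) \<longlongrightarrow> 0 + 0) \<omega>"
  using assms(1,2) unfolding sim_def
  by (intro tendsto_add tendsto_mult_bounded_right[where B = B] tendsto_mult_bounded_left[where B = C])
 then show ?thesis by (simp add: sim_def algebra_simps)
qed

lemma BS_of_ell: "a \<in> carrier (ell_infty A) ==> (%n. emb (a n)) \<in> BS \<and> (%n. proj (emb (a n))) = a"
 by (auto simp: ell_infty_def BS_def bdd_above_def norm_emb image_subset_iff)

lemma ell_of_BS: "x \<in> BS ==> (%n. proj (x n)) \<in> carrier (ell_infty A)"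
 by (auto simp: ell_infty_def BS_def bdd_above_def nrm_proj)

lemma mem_cl:
 assumes x: "x \<in> BS"
 shows "c \<in> cl x \<longleftrightarrow> (\<exists>z\<in>BS. c = (%n. proj (z n)) \<and> sim z x)"
proof -
 have "c \<in> cl x \<longleftrightarrow> (\<exists>h\<in>null_seqs \<omega> A. c = (%n. h n \<oplus> proj (x n)))"
  by (auto simp: cl_def ultra_proj_def a_r_coset_def' ell_infty_def)
 also have "... \<longleftrightarrow> (\<exists>z\<in>BS. c = (%n. proj (z n)) \<and> sim z x)"
 proof safe
  fix h assume h: "h \<in> null_seqs \<omega> A"
  then have hb: "(%n. emb (h n)) \<in> BS" "(%n. proj (emb (h n))) = h" using BS_of_ell[of h] by (auto simp: null_seqs_def)
  have hc: "h n \<in> carrier A" for n using fun_cong[OF hb(2), of n] proj_closed by metis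
  have "sim (%n. emb (h n) + x n) x"
   using h hc by (simp add: sim_def null_seqs_def norm_emb[symmetric] tendsto_norm_zero_iff)
  then show "\<exists>z\<in>BS. (%n. h n \<oplus> proj (x n)) = (%n. proj (z n)) \<and> sim z x"
   using BS_add[OF hb(1) x] hc by (intro bexI[of _ "%n. emb (h n) + x n"]) (simp_all add: proj_add)
 next
  fix z assume z: "z \<in> BS" "sim z x"
  let ?h = "%n. proj (z n - x n)"
  have d: "z n - x n \<in> Ec" for n using BS_in[OF z(1)] BS_in[OF x] by (rule E.Ac_diff)
  have "?h \<in> null_seqs \<omega> A"
   using z(2) ell_of_BS[OF BS_diff[OF z(1) x]] by (simp add: null_seqs_def nrm_proj[OF d] sim_def tendsto_norm_zero_iff)
  moreover have "(%n. proj (z n)) = (%n. ?h n \<oplus> proj (x n))" by (simp only: proj_add[symmetric] diff_add_cancel)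
  ultimately show "\<exists>h\<in>null_seqs \<omega> A. (%n. proj (z n)) = (%n. h n \<oplus> proj (x n))"
   by (rule bexI[of _ ?h, rotated])
 qed
 finally show ?thesis .
qed

lemma self_mem_cl: "x \<in> BS ==> (%n. proj (x n)) \<in> cl x"
 using mem_cl sim_refl by blast

lemma BS_proj_inj: "x \<in> BS ==> y \<in> BS ==> (%n. proj (x n)) = (%n. proj (y n)) ==> x = y"
 using emb_proj_id BS_in by (metis ext)

lemma cl_eq_iff: "x \<in> BS ==> y \<in> BS ==> cl x = cl y \<longleftrightarrow> sim x y"
proof
 assume xy: "x \<in> BS" "y \<in> BS" and "cl x = cl y"
 then have "(%n. proj (x n)) \<in> cl y" using self_mem_cl by blast
 then show "sim x y" using mem_cl[OF xy(2)] BS_proj_inj xy by metis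
next
 assume "x \<in> BS" "y \<in> BS" "sim x y"
 then show "cl x = cl y" using mem_cl sim_trans sim_sym by (intro Set.set_eqI) meson
qed

text \<open>Operations on cosets are unions over representatives, so well-definedness is what
  collapses the union.\<close>

lemma cl_Union:
 assumes x: "x \<in> BS" and f: "!!z. z \<in> BS ==> sim z x ==> f (%n. proj (z n)) = c"
 shows "(\<Union>a\<in>cl x. f a) = c"
 using self_mem_cl[OF x] f mem_cl[OF x] by auto metis

lemma carrier_U: "carrier U = cl ` BS"
proof -
 have "carrier U = ultra_proj \<omega> A ` carrier (ell_infty A)"
  by (auto simp: ultrapower_def quot_alg_def FactRing_def A_RCOSETS_def' ultra_proj_def)
 also have "carrier (ell_infty A) = (%x n. proj (x n)) ` BS"
  using BS_of_ell ell_of_BS by (auto simp: image_iff) metis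
 finally show ?thesis by (auto simp: image_image cl_def)
qed

lemma U_mult: "x \<in> BS ==> y \<in> BS ==> cl x \<otimes>\<^bsub>U\<^esub> cl y = cl (%n. x n * y n)"
proof -
 assume xy: "x \<in> BS" "y \<in> BS"
 have "cl x \<otimes>\<^bsub>U\<^esub> cl y = (\<Union>a\<in>cl x. \<Union>b\<in>cl y. ultra_proj \<omega> A (%n. a n \<otimes> b n))"
  by (simp add: ultrapower_def quot_alg_def FactRing_def rcoset_mult_def ultra_proj_def ell_infty_def)
 also have "... = cl (%n. x n * y n)"
 proof (rule cl_Union[OF xy(1)], rule cl_Union[OF xy(2)])
  fix z w assume zw: "z \<in> BS" "sim z x" "w \<in> BS" "sim w y"
  have "ultra_proj \<omega> A (%n. proj (z n) \<otimes> proj (w n)) = cl (%n. z n * w n)" by (simp add: cl_def proj_mult)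
  also have "... = cl (%n. x n * y n)" by (simp add: cl_eq_iff BS_mult zw xy sim_mult)
  finally show "ultra_proj \<omega> A (%n. proj (z n) \<otimes> proj (w n)) = cl (%n. x n * y n)" .
 qed
 finally show ?thesis .
qed

lemma U_smult: "x \<in> BS ==> z \<odot>\<^bsub>U\<^esub> cl x = cl (%n. cx z * x n)"
proof -
 assume x: "x \<in> BS"
 have "z \<odot>\<^bsub>U\<^esub> cl x = (\<Union>a\<in>cl x. ultra_proj \<omega> A (%n. z \<odot> a n))"
  by (simp add: ultrapower_def quot_alg_def ultra_proj_def ell_infty_def)
 also have "... = cl (%n. cx z * x n)"
 proof (rule cl_Union[OF x])
  fix w assume w: "w \<in> BS" "sim w x"
  have "ultra_proj \<omega> A (%n. z \<odot> proj (w n)) = cl (%n. cx z * w n)" by (simp add: cl_def proj_cx)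
  also have "... = cl (%n. cx z * x n)" by (simp add: cl_eq_iff BS_cx w x sim_cx)
  finally show "ultra_proj \<omega> A (%n. z \<odot> proj (w n)) = cl (%n. cx z * x n)" .
 qed
 finally show ?thesis .
qed

lemma U_star: "x \<in> BS ==> star U (cl x) = cl (%n. adj (x n))"
proof -
 assume x: "x \<in> BS"
 have "star U (cl x) = (\<Union>a\<in>cl x. ultra_proj \<omega> A (%n. star A (a n)))"
  by (simp add: ultrapower_def quot_alg_def ultra_proj_def ell_infty_def)
 also have "... = cl (%n. adj (x n))"
 proof (rule cl_Union[OF x])
  fix w assume w: "w \<in> BS" "sim w x"
  have "ultra_proj \<omega> A (%n. star A (proj (w n))) = cl (%n. adj (w n))" by (simp add: cl_def proj_adj)
  also have "... = cl (%n. adj (x n))" by (simp add: cl_eq_iff BS_adj w x sim_adj)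
  finally show "ultra_proj \<omega> A (%n. star A (proj (w n))) = cl (%n. adj (x n))" .
 qed
 finally show ?thesis .
qed

lemma U_add: "x \<in> BS ==> y \<in> BS ==> cl x \<oplus>\<^bsub>U\<^esub> cl y = cl (%n. x n + y n)"
proof -
 assume xy: "x \<in> BS" "y \<in> BS"
 have "cl x \<oplus>\<^bsub>U\<^esub> cl y = (\<Union>a\<in>cl x. \<Union>b\<in>cl y. {%n. a n \<oplus> b n})"
  by (simp add: ultrapower_def quot_alg_def FactRing_def set_add_defs ell_infty_def)
 also have "... = cl (%n. x n + y n)"
 proof (intro Set.set_eqI iffI)
  fix c assume "c \<in> (\<Union>a\<in>cl x. \<Union>b\<in>cl y. {%n. a n \<oplus> b n})"
  then obtain z w where "z \<in> BS" "w \<in> BS" "sim z x" "sim w y" "c = (%n. proj (z n) \<oplus> proj (w n))"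
   using mem_cl[OF xy(1)] mem_cl[OF xy(2)] by auto
  then show "c \<in> cl (%n. x n + y n)" unfolding mem_cl[OF BS_add[OF xy]]
   by (intro bexI[of _ "%n. z n + w n"]) (auto simp: proj_add sim_add BS_add)
 next
  fix c assume "c \<in> cl (%n. x n + y n)"
  then obtain z where z: "z \<in> BS" "c = (%n. proj (z n))" "sim z (%n. x n + y n)" using mem_cl[OF BS_add[OF xy]] by auto
  have "(%n. proj (z n - y n)) \<in> cl x" unfolding mem_cl[OF xy(1)]
   using z by (intro bexI[of _ "%n. z n - y n"]) (auto simp: sim_def algebra_simps BS_diff xy)
  moreover have "c = (%n. proj (z n - y n) \<oplus> proj (y n))" by (simp only: z(2) proj_add[symmetric] diff_add_cancel)
  ultimately show "c \<in> (\<Union>a\<in>cl x. \<Union>b\<in>cl y. {%n. a n \<oplus> b n})" using self_mem_cl[OF xy(2)] by blast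
 qed
 finally show ?thesis .
qed

lemma U_one: "\<one>\<^bsub>U\<^esub> = cl (%n. emb \<one>)"
 by (simp add: ultrapower_def quot_alg_def FactRing_def cl_def ultra_proj_def) (simp add: ell_infty_def)

lemma U_zero: "\<zero>\<^bsub>U\<^esub> = cl (%n. 0)"
proof -
 have "\<zero>\<^bsub>U\<^esub> = null_seqs \<omega> A" by (simp add: ultrapower_def quot_alg_def FactRing_def)
 also have "... = cl (%n. 0)"
 proof (intro Set.set_eqI iffI)
  fix c assume c: "c \<in> null_seqs \<omega> A"
  then have cb: "(%n. emb (c n)) \<in> BS" "(%n. proj (emb (c n))) = c" using BS_of_ell[of c] by (auto simp: null_seqs_def)
  then have "c n \<in> carrier A" for n using fun_cong[OF cb(2), of n] proj_closed by metis
  then have "sim (%n. emb (c n)) (%n. 0)"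
   using c by (simp add: sim_def null_seqs_def norm_emb[symmetric] tendsto_norm_zero_iff)
  then show "c \<in> cl (%n. 0)" using mem_cl[OF BS_const[of 0]] cb by force
 next
  fix c assume "c \<in> cl (%n. 0)"
  then obtain z where z: "z \<in> BS" "c = (%n. proj (z n))" "sim z (%n. 0)" using mem_cl[OF BS_const[of 0]] by auto
  then show "c \<in> null_seqs \<omega> A"
   using ell_of_BS[OF z(1)] by (simp add: null_seqs_def nrm_proj[OF BS_in[OF z(1)]] sim_def tendsto_norm_zero_iff)
 qed
 finally show ?thesis .
qed

text \<open>The inverse in a record is a description, which is checked directly here, without first
  proving that \<open>U\<close> is a ring.\<close>

lemma U_uminus: "x \<in> BS ==> \<ominus>\<^bsub>U\<^esub> cl x = cl (%n. - x n)"
 unfolding a_inv_def m_inv_def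
proof (rule the_equality)
 assume x: "x \<in> BS"
 show "cl (%n. - x n) \<in> carrier (add_monoid U) \<and> cl x \<otimes>\<^bsub>add_monoid U\<^esub> cl (%n. - x n) = \<one>\<^bsub>add_monoid U\<^esub> \<and>
   cl (%n. - x n) \<otimes>\<^bsub>add_monoid U\<^esub> cl x = \<one>\<^bsub>add_monoid U\<^esub>"
  using x BS_uminus[OF x] by (simp add: carrier_U U_add U_zero)
 fix Y assume "Y \<in> carrier (add_monoid U) \<and> cl x \<otimes>\<^bsub>add_monoid U\<^esub> Y = \<one>\<^bsub>add_monoid U\<^esub> \<and>
   Y \<otimes>\<^bsub>add_monoid U\<^esub> cl x = \<one>\<^bsub>add_monoid U\<^esub>"
 then obtain y where y: "y \<in> BS" "Y = cl y" "cl (%n. x n + y n) = cl (%n. 0)"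
  using x by (auto simp: carrier_U U_add U_zero)
 then have "sim y (%n. - x n)" using cl_eq_iff[OF BS_add[OF x y(1)] BS_const[of 0]] by (simp add: sim_def add.commute)
 then show "Y = cl (%n. - x n)" using y cl_eq_iff BS_uminus[OF x] by simp
qed

lemma U_minus: "x \<in> BS ==> y \<in> BS ==> cl x \<ominus>\<^bsub>U\<^esub> cl y = cl (%n. x n - y n)"
 by (simp add: a_minus_def U_uminus U_add BS_uminus)

text \<open>Positive exponents only: the ambient power with exponent 0 is 1, which is not the unit
  of the corner.\<close>

lemma U_pow: "x \<in> BS ==> cl x [^]\<^bsub>U\<^esub> Suc m = cl (%n. x n ^ Suc m)"
proof (induction m)
 case 0
 have "cl (%n. emb \<one>) \<otimes>\<^bsub>U\<^esub> cl x = cl (%n. emb \<one> * x n)" by (rule U_mult[OF BS_const 0]) simp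
 then show ?case using BS_in[OF 0] by (simp add: nat_pow_def U_one E.Ac_left)
next
 case (Suc m)
 have "cl x [^]\<^bsub>U\<^esub> Suc (Suc m) = cl x [^]\<^bsub>U\<^esub> Suc m \<otimes>\<^bsub>U\<^esub> cl x" by (simp add: nat_pow_def)
 then show ?case using Suc.IH[OF Suc.prems] U_mult[OF BS_power[OF Suc.prems, of m] Suc.prems]
  by (simp add: power_commutes mult.assoc)
qed

lemma ultra_const_cl: "a \<in> carrier A ==> ultra_const \<omega> A a = cl (%n. emb a)"
 by (simp add: ultra_const_def cl_def)

lemma eventually_norm_less:
 assumes x: "x \<in> BS" and n: "nrm U (cl x) < r"
 shows "eventually (%n. norm (x n) < r) \<omega>"
proof -
 have "nrm U (cl x) = (INF a\<in>cl x. nrm (ell_infty A) a)" by (simp add: ultrapower_def quot_alg_def)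
 moreover have "cl x ~= {}" using self_mem_cl[OF x] by auto
 ultimately obtain c where c: "c \<in> cl x" "nrm (ell_infty A) c < r"
  using n cInf_lessD[of "nrm (ell_infty A) ` cl x" r] by auto
 then obtain z where z: "z \<in> BS" "c = (%n. proj (z n))" "sim z x" using mem_cl[OF x] by auto
 obtain s where s: "(SUP n. nrm A (c n)) < s" "s < r" using c(2) dense by (auto simp: ell_infty_def)
 have "bdd_above (range (%n. nrm A (c n)))" using ell_of_BS[OF z(1)] z(2) by (auto simp: ell_infty_def)
 then have "nrm A (c n) < s" for n using s(1) cSUP_upper[OF UNIV_I, of "%n. nrm A (c n)" n] by simp
 then have zs: "norm (z n) < s" for n by (simp add: z(2) nrm_proj[OF BS_in[OF z(1)]])
 have "eventually (%n. norm (z n - x n) < r - s) \<omega>"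
  using tendstoD[OF z(3)[unfolded sim_def], of "r - s"] s by (simp add: dist_norm)
 then show ?thesis
 proof eventually_elim
  case (elim n)
  then show ?case using zs[of n] norm_triangle_sub[of "x n" "z n"] by (simp add: norm_minus_commute)
 qed
qed

text \<open>Inverses of \<open>t + X\<close> in the ultrapower lift to bounded approximate inverses,
  so the representatives are eventually above any \<open>- \<delta>\<close>. With the norm bound,
  clipping them to the interval from 0 to 1 changes them by a null sequence.\<close>

lemma positive_contraction_lift:
 assumes "positive_contraction U X"
 shows "\<exists>x\<in>BS. X = cl x \<and> (\<forall>n. psd (x n) \<and> norm (x n) <= 1)"
proof -
 have X: "X \<in> carrier U" "star U X = X" "alg_spectrum U X \<subseteq> \<real>\<^sub>\<ge>\<^sub>0" "nrm U X <= 1"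
  using assms by (auto simp: positive_contraction_def positive_def self_adjoint_def)
 then obtain a where a: "a \<in> BS" "X = cl a" by (auto simp: carrier_U)
 define x where "x n = (1/2) *\<^sub>R (a n + adj (a n))" for n
 have sa: "adj (x n) = x n" for n by (simp add: x_def adj_scaleR adj_add add.commute)
 have "sim (%n. adj (a n)) a" using X(2) a by (simp add: U_star cl_eq_iff BS_adj)
 then have "((%n. (1/2) *\<^sub>R (adj (a n) - a n)) \<longlongrightarrow> (1/2) *\<^sub>R 0) \<omega>" unfolding sim_def by (intro tendsto_intros)
 moreover have "x n - a n = (1/2) *\<^sub>R (adj (a n) - a n)" for n
  using scaleR_half_double[of "a n"] by (simp add: x_def scaleR_add_right scaleR_diff_right algebra_simps)
 ultimately have xa: "sim x a" by (simp add: sim_def)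
 have "x = (%n. (1/2) *\<^sub>R (a n + adj (a n)))" by (simp add: x_def fun_eq_iff)
 then have xB: "x \<in> BS" using BS_cx[OF BS_add[OF a(1) BS_adj[OF a(1)]], of "of_real (1/2)"]
  by (simp add: cx_of_real mult_of_real_left del: of_real_divide)
 have Xx: "X = cl x" using a xa xB cl_eq_iff sim_sym by simp
 obtain R where R: "!!n. norm (x n) <= R" using BS_bound[OF xB] by blast
 then have R0: "R >= 0" using norm_ge_zero order_trans by blast
 have psd: "eventually (%n. psd (x n + of_real \<delta>)) \<omega>" if "\<delta> > 0" for \<delta>
 proof (rule eventually_psd_of_invertible[OF sa R R0 _ that])
  fix t :: real assume t: "t > 0"
  then have "of_real (- t) \<notin> alg_spectrum U X"
   using X(3) by (auto simp: nonneg_Reals_of_real_iff simp del: of_real_minus)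
  then obtain Y where "Y \<in> carrier U" "((of_real (- t) \<odot>\<^bsub>U\<^esub> \<one>\<^bsub>U\<^esub>) \<ominus>\<^bsub>U\<^esub> X) \<otimes>\<^bsub>U\<^esub> Y = \<one>\<^bsub>U\<^esub>"
   by (auto simp: alg_spectrum_def Units_def)
  then obtain y where y: "y \<in> BS" "((of_real (- t) \<odot>\<^bsub>U\<^esub> \<one>\<^bsub>U\<^esub>) \<ominus>\<^bsub>U\<^esub> X) \<otimes>\<^bsub>U\<^esub> cl y = \<one>\<^bsub>U\<^esub>"
   by (auto simp: carrier_U)
  define w where "w n = cx (of_real (- t)) * emb \<one> - x n" for n
  have one: "(%n. emb \<one>) \<in> BS" by (rule BS_const) simp
  have w: "w \<in> BS" unfolding w_def by (intro BS_diff BS_cx one xB)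
  have "cl (%n. w n * y n) = cl (%n. emb \<one>)"
   using y(2) unfolding U_one Xx U_smult[OF one] U_minus[OF BS_cx[OF one] xB] w_def[symmetric] U_mult[OF w y(1)] .
  then have lim: "((%n. w n * y n - emb \<one>) \<longlongrightarrow> 0) \<omega>" using cl_eq_iff[OF BS_mult[OF w y(1)] one] by (simp add: sim_def)
  \<comment> \<open>The second summand inverts \<open>t\<close> off the corner, as in
    \<open>corner_inverse\<close>.\<close>
  let ?z = "%n. - y n + (1 / t) *\<^sub>R (1 - emb \<one>)"
  have eq: "(of_real t + x n) * ?z n - 1 = w n * y n - emb \<one>" for n
  proof -
   have "emb \<one> * y n = y n" "x n * emb \<one> = x n" using BS_in[OF y(1)] BS_in[OF xB] by (auto intro: E.Ac_left E.Ac_right)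
   then show ?thesis using t
    by (simp add: w_def cx_uminus cx_of_real distrib_left distrib_right left_diff_distrib right_diff_distrib
      scaleR_diff_right scaleR_add_right mult_of_real_left mult.assoc) (simp add: of_real_def)
  qed
  obtain C where C: "!!n. norm (y n) <= C" using BS_bound[OF y(1)] by blast
  have n1: "norm (?z n) <= C + norm ((1 / t) *\<^sub>R (1 - emb \<one>))" for n
   using norm_triangle_ineq[of "- y n" "(1 / t) *\<^sub>R (1 - emb \<one>)"] C[of n] by simp
  have n2: "eventually (%n. norm ((of_real t + x n) * ?z n - 1) <= 1/2) \<omega>"
   using tendstoD[OF lim, of "1/2"] unfolding eq by (simp add: eventually_mono less_imp_le)
  show "\<exists>C y. (\<forall>n. norm (y n) <= C) \<and> eventually (%n. norm ((of_real t + x n) * y n - 1) <= 1/2) \<omega>"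
   using n1 n2 by (intro exI[of _ "C + norm ((1 / t) *\<^sub>R (1 - emb \<one>))"] exI[of _ ?z]) simp
 qed
 let ?g = "%t::real. max 0 (min 1 t)"
 have g: "continuous_on UNIV ?g" by (intro continuous_intros)
 define v where "v n = cfc ?g (x n)" for n
 have v: "v n \<in> Ec" "psd (v n)" "norm (v n) <= 1" for n
  using E.Ac_cfc[OF g sa] cfc_nonneg[OF g psd_norm_bounds[OF sa]] cfc_norm_le[OF g psd_norm_bounds[OF sa], of n 1] BS_in[OF xB]
  by (auto simp: v_def)
 have "sim v x" unfolding sim_def
 proof (rule tendstoI)
  fix \<epsilon> :: real assume \<epsilon>: "\<epsilon> > 0"
  let ?d = "\<epsilon> / 2"
  have "eventually (%n. norm (x n) < 1 + ?d) \<omega>" by (rule eventually_norm_less[OF xB]) (use X(4) Xx \<epsilon> in simp)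
  moreover have "eventually (%n. psd (x n + of_real ?d)) \<omega>" by (rule psd) (use \<epsilon> in simp)
  ultimately show "eventually (%n. dist (v n - x n) 0 < \<epsilon>) \<omega>"
  proof eventually_elim
   case (elim n)
   have id: "continuous_on UNIV (%t::real. t)" by (rule continuous_on_id)
   have "norm (cfc (%t. ?g t - t) (x n)) <= ?d"
   proof (rule cfc_norm_le)
    show "continuous_on UNIV (%t. ?g t - t)" by (intro continuous_intros)
    show "psd (x n - of_real (- ?d))" using elim(2) by simp
    show "psd (of_real (1 + ?d) - x n)" by (rule psd_norm_minus[OF sa]) (use elim in simp)
   qed (use \<epsilon> in \<open>auto simp: max_def min_def abs_if\<close>)
   then show ?case using \<epsilon> unfolding v_def cfc_diff[OF g id sa] cfc_id[OF sa] by simp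
  qed
 qed
 moreover have "v \<in> BS" using v by (intro BS_I)
 ultimately show ?thesis using v Xx cl_eq_iff xB sim_sym by (intro bexI[of _ v]) auto
qed

end

text \<open>At \<open>n\<close> take a solution for the largest solvable \<open>m <= n\<close>. The
  bound by \<open>n\<close> keeps the set finite, and each fixed \<open>m\<close> is eventually
  below the maximum.\<close>

lemma ultrafilter_diagonal:
 fixes Q :: "nat => nat => 'b => bool"
 assumes \<omega>: "free_ultrafilter \<omega>" and ev: "!!m. eventually (%n. \<exists>s. Q m n s) \<omega>"
  and anti: "!!m m' n s. m <= m' ==> Q m' n s ==> Q m n s"
 shows "\<exists>s. \<forall>m. eventually (%n. Q m n (s n)) \<omega>"
proof -
 define S where "S n = {m. m <= n \<and> (\<exists>s. Q m n s)}" for n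
 have fin: "finite (S n)" for n by (rule finite_subset[of _ "{..n}"]) (auto simp: S_def)
 have "eventually (%n. Q m n (SOME s. Q (Max (S n)) n s)) \<omega>" for m
 proof -
  have "eventually (%n. m <= n) \<omega>"
   using free_ultrafilter_le[OF \<omega>] eventually_ge_at_top[of m] by (auto simp: le_filter_def)
  with ev[of m] show ?thesis
  proof eventually_elim
   case (elim n)
   then have "m \<in> S n" by (simp add: S_def)
   then have "m <= Max (S n)" "Max (S n) \<in> S n" using fin[of n] by (auto intro: Max_in)
   then have "Q (Max (S n)) n (SOME s. Q (Max (S n)) n s)" by (auto simp: S_def intro: someI_ex)
   then show ?case by (rule anti[OF \<open>m <= Max (S n)\<close>])
  qed
 qed
 then show ?thesis by (intro exI[of _ "%n. SOME s. Q (Max (S n)) n s"] allI)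
qed

section \<open>The trace seminorm and separability\<close>

context cstar_algebra
begin

lemma Tr_sq_le:
 assumes t: "t \<in> Tr" and b: "b \<in> Ec"
 shows "t (adj b * b) <= norm b ^ 2"
proof -
 have "adj b * b \<in> Ec" using b by (rule E.Ac_mult_right)
 moreover have "psd (norm b ^ 2 *\<^sub>R emb \<one> - adj b * b)"
  by (rule E.psd_corner_upper) (use calculation in \<open>simp_all add: adj_mult norm_adj_mult\<close>)
 ultimately show ?thesis using Tr_mono[OF t, of "adj b * b" "norm b ^ 2 *\<^sub>R emb \<one>"] t
  by (simp add: Tr_scale Tr_one E.Ac_scaleR)
qed

lemma Tr_diff_le:
 assumes t: "t \<in> Tr" and b: "b \<in> Ec" "adj b = b"
 shows "t b <= norm b"
 using Tr_mono[OF t b(1) E.Ac_scaleR[OF E.Ac_p] E.psd_corner_upper[OF b order_refl]] t by (simp add: Tr_scale Tr_one)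

lemma norm2_eq: "x \<in> Ec ==> norm2 A (proj x) = (SUP t\<in>Tr. sqrt (t (adj x * x)))"
 by (simp add: norm2_def Tr_def image_image proj_mult proj_adj)

context
 assumes T_ne: "Tr ~= {}"
begin

lemma norm2_bdd: "x \<in> Ec ==> bdd_above ((%t. sqrt (t (adj x * x))) ` Tr)"
 by (rule bdd_aboveI[of _ "norm x"]) (auto intro!: real_le_lsqrt Tr_sq_le)

lemma le_norm2: "x \<in> Ec ==> t \<in> Tr ==> t (adj x * x) <= norm2 A (proj x) ^ 2"
proof -
 assume x: "x \<in> Ec" "t \<in> Tr"
 have "sqrt (t (adj x * x)) <= norm2 A (proj x)"
  unfolding norm2_eq[OF x(1)] by (rule cSUP_upper[OF x(2) norm2_bdd[OF x(1)]])
 moreover have "t (adj x * x) >= 0" using x by (intro Tr_pos psd_adj_mult E.Ac_mult_right)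
 ultimately show ?thesis by (metis real_sqrt_ge_zero real_sqrt_pow2 power_mono)
qed

lemma norm2_nonneg: "x \<in> Ec ==> norm2 A (proj x) >= 0"
proof -
 assume x: "x \<in> Ec"
 obtain t where t: "t \<in> Tr" using T_ne by auto
 have "0 <= sqrt (t (adj x * x))" using x t by (intro real_sqrt_ge_zero Tr_pos psd_adj_mult E.Ac_mult_right)
 also have "... <= norm2 A (proj x)" unfolding norm2_eq[OF x] by (rule cSUP_upper[OF t norm2_bdd[OF x]])
 finally show ?thesis .
qed

lemma norm2_le: "x \<in> Ec ==> norm2 A (proj x) <= norm x"
 unfolding norm2_eq by (rule cSUP_least[OF T_ne]) (auto intro!: real_le_lsqrt Tr_sq_le)

text \<open>Compares the squares and uses subadditivity of the root, so no triangle inequality for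
  \<open>norm2\<close> is required.\<close>

lemma norm2_diff_le:
 assumes x: "x \<in> Ec" and y: "y \<in> Ec"
 shows "norm2 A (proj x) <= norm2 A (proj y) + sqrt (norm (adj x * x - adj y * y))"
 unfolding norm2_eq[OF x]
proof (rule cSUP_least[OF T_ne])
 fix t assume t: "t \<in> Tr"
 have sq: "adj x * x \<in> Ec" "adj y * y \<in> Ec" using x y by (auto intro: E.Ac_mult_right)
 have "t (adj x * x) = t (adj y * y) + t (adj x * x - adj y * y)" using Tr_diff[OF t] by simp
 also have "... <= norm2 A (proj y) ^ 2 + norm (adj x * x - adj y * y)"
  using sq by (intro add_mono le_norm2 y t Tr_diff_le E.Ac_diff) (auto simp: adj_diff adj_mult)
 finally have "sqrt (t (adj x * x)) <= sqrt (norm2 A (proj y) ^ 2 + norm (adj x * x - adj y * y))" by simp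
 also have "... <= sqrt (norm2 A (proj y) ^ 2) + sqrt (norm (adj x * x - adj y * y))"
  by (rule sqrt_add_le_add_sqrt) auto
 finally show "sqrt (t (adj x * x)) <= norm2 A (proj y) + sqrt (norm (adj x * x - adj y * y))"
  using norm2_nonneg[OF y] by simp
qed

end

lemma dense_sequence:
 assumes "separable_alg A"
 shows "\<exists>d. range d \<subseteq> Ec \<and> (\<forall>a\<in>Ec. \<forall>\<epsilon>>0. \<exists>k::nat. norm (a - d k) < \<epsilon>)"
proof -
 obtain C where C: "countable C" "C \<subseteq> topspace (alg_top A)" "alg_top A closure_of C = topspace (alg_top A)"
  using assms unfolding separable_alg_def separable_space_def by blast
 have top: "topspace (alg_top A) = carrier A"
  unfolding alg_top_def by (rule Metric_space.topspace_mtopology[OF metric_space])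
 have cl: "\<forall>x\<in>carrier A. \<forall>r>0. \<exists>y\<in>C. nrm A (x \<ominus> y) < r"
  using C(3) unfolding top unfolding alg_top_def Metric_space.metric_closure_of[OF metric_space]
  by (auto simp: Metric_space.mball_def[OF metric_space] alg_dist_def) (smt (verit) mem_Collect_eq)
 then have "C ~= {}" by (metis M.zero_closed empty_iff zero_less_one)
 have "\<exists>k. norm (a - emb (from_nat_into C k)) < \<epsilon>" if a: "a \<in> Ec" and "\<epsilon> > 0" for a \<epsilon>
 proof -
  obtain y where y: "y \<in> C" "nrm A (proj a \<ominus> y) < \<epsilon>" using cl[rule_format, OF proj_closed[of a] \<open>\<epsilon> > 0\<close>] by blast
  then have "norm (a - emb y) < \<epsilon>"
   using norm_emb[of "proj a \<ominus> y"] C(2) top emb_proj_id[OF a] by (auto simp: emb_diff subset_iff)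
  then show ?thesis using from_nat_into_surj[OF C(1) y(1)] by metis
 qed
 moreover have "range (%k. emb (from_nat_into C k)) \<subseteq> Ec"
  using subsetD[OF C(2) from_nat_into[OF \<open>C ~= {}\<close>]] unfolding top by auto
 ultimately show ?thesis by blast
qed

end

context cstar_ultrapower
begin

text \<open>Existence of the limit is the ultrafilter property; its independence of the
  representative, on which the description rests, is \<open>norm2_diff_le\<close>.\<close>

lemma norm2_ultra_limit:
 assumes T_ne: "Tr ~= {}" and x: "x \<in> BS"
 shows "((%n. norm2 A (proj (x n))) \<longlongrightarrow> norm2_ultra \<omega> A (cl x)) \<omega>"
proof -
 have lim: "\<exists>l. ((%n. norm2 A (proj (x n))) \<longlongrightarrow> l) \<omega>"
 proof (rule ultrafilter_limit[OF ultra])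
  obtain B where "!!n. norm (x n) <= B" using BS_bound[OF x] by blast
  then have "norm (norm2 A (proj (x n))) <= B" for n
   using norm2_nonneg[OF T_ne BS_in[OF x], of n] order_trans[OF norm2_le[OF T_ne BS_in[OF x, of n]]] by simp
  then show "bounded (range (%n. norm2 A (proj (x n))))" by (auto simp: bounded_iff)
 qed
 then obtain l where l: "((%n. norm2 A (proj (x n))) \<longlongrightarrow> l) \<omega>" by blast
 have "norm2_ultra \<omega> A (cl x) = l" unfolding norm2_ultra_def
 proof (rule the_equality)
  show "\<exists>a\<in>carrier (ell_infty A). cl x = ultra_proj \<omega> A a \<and> ((%n. norm2 A (a n)) \<longlongrightarrow> l) \<omega>"
   using l ell_of_BS[OF x] by (auto simp: cl_def)
  fix l' assume "\<exists>a\<in>carrier (ell_infty A). cl x = ultra_proj \<omega> A a \<and> ((%n. norm2 A (a n)) \<longlongrightarrow> l') \<omega>"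
  then obtain a where a: "a \<in> carrier (ell_infty A)" "cl x = ultra_proj \<omega> A a" "((%n. norm2 A (a n)) \<longlongrightarrow> l') \<omega>" by blast
  define y where "y n = emb (a n)" for n
  have y: "y \<in> BS" "a = (%n. proj (y n))" using BS_of_ell[OF a(1)] by (auto simp: y_def[abs_def])
  have "cl x = cl y" using a(2) y(2) by (simp add: cl_def)
  then have xy: "sim x y" using cl_eq_iff x y by blast
  have 1: "((%n. sqrt (norm (adj (x n) * x n - adj (y n) * y n))) \<longlongrightarrow> 0) \<omega>"
   using sim_mult[OF sim_adj[OF xy] xy x BS_adj[OF y(1)]] tendsto_real_sqrt[OF tendsto_norm_zero]
   unfolding sim_def by fastforce
  have "norm (norm2 A (proj (x n)) - norm2 A (proj (y n))) <= sqrt (norm (adj (x n) * x n - adj (y n) * y n))" for n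
   using norm2_diff_le[OF T_ne BS_in[OF x] BS_in[OF y(1)], of n n] norm2_diff_le[OF T_ne BS_in[OF y(1)] BS_in[OF x], of n n]
   by (simp add: norm_minus_commute)
  then have "((%n. norm2 A (proj (x n)) - norm2 A (proj (y n))) \<longlongrightarrow> 0) \<omega>"
   by (intro Lim_null_comparison[OF _ 1]) simp
  moreover have "((%n. norm2 A (proj (x n)) - norm2 A (proj (y n))) \<longlongrightarrow> l - l') \<omega>"
   using l a(3) unfolding y(2) by (rule tendsto_diff)
  ultimately show "l' = l" using tendsto_unique[OF not_bot] by force
 qed
 then show ?thesis using l by simp
qed

lemma central_lift:
 assumes "x \<in> BS" "cl x \<in> central_seq_alg \<omega> A" "a \<in> Ec"
 shows "((%n. x n * a - a * x n) \<longlongrightarrow> 0) \<omega>"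
proof -
 have "cl x \<otimes>\<^bsub>U\<^esub> cl (%n. a) = cl (%n. a) \<otimes>\<^bsub>U\<^esub> cl x"
  using assms(2) proj_closed[of a] unfolding central_seq_alg_def
  by (auto simp only: mem_Collect_eq ultra_const_cl[OF proj_closed] emb_proj_id[OF assms(3)] dest!: bspec[where x = "proj a"])
 then show ?thesis using cl_eq_iff assms BS_const[OF assms(3)] by (simp add: U_mult BS_mult sim_def)
qed

text \<open>From \<open>(e - \<delta>)^2 >= 0\<close> one gets
  \<open>2 * \<delta> * t e <= t (e * e) + \<delta>^2\<close>, which avoids Cauchy-Schwarz for
  traces.\<close>

lemma trace_kernel_small:
 assumes T_ne: "Tr ~= {}" and e: "e \<in> BS" "!!n. adj (e n) = e n" "cl e \<in> trace_kernel \<omega> A" and \<delta>: "\<delta> > 0"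
 shows "eventually (%n. \<forall>t\<in>Tr. t (e n) <= \<delta>) \<omega>"
proof -
 have "((%n. norm2 A (proj (e n))) \<longlongrightarrow> 0) \<omega>"
  using norm2_ultra_limit[OF T_ne e(1)] e(3) by (simp add: trace_kernel_def)
 from tendstoD[OF this \<delta>] have "eventually (%n. norm (norm2 A (proj (e n))) < \<delta>) \<omega>" by (simp add: dist_norm)
 then show ?thesis
 proof eventually_elim
  case (elim n)
  show ?case
  proof
   fix t assume t: "t \<in> Tr"
   have E: "e n \<in> Ec" by (rule BS_in[OF e(1)])
   have "t (e n * e n) <= norm2 A (proj (e n)) ^ 2" using le_norm2[OF T_ne E t] by (simp add: e(2))
   also have "... <= \<delta>^2" using elim norm2_nonneg[OF T_ne E] by (intro power_mono) auto
   finally have 1: "t (e n * e n) <= \<delta>^2" .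
   have "adj (e n - \<delta> *\<^sub>R emb \<one>) * (e n - \<delta> *\<^sub>R emb \<one>) = e n * e n - (2 * \<delta>) *\<^sub>R e n + \<delta>^2 *\<^sub>R emb \<one>"
    by (simp add: adj_diff adj_scaleR e(2) emb_adj_one left_diff_distrib right_diff_distrib E.Ac_left[OF E] E.Ac_right[OF E] E.pp
      power2_eq_square) (simp add: algebra_simps flip: scaleR_add_left)
   then have "0 <= t (e n * e n - (2 * \<delta>) *\<^sub>R e n + \<delta>^2 *\<^sub>R emb \<one>)"
    using Tr_pos[OF t _ psd_adj_mult, of "e n - \<delta> *\<^sub>R emb \<one>"] E by (metis E.Ac_diff E.Ac_mult_right E.Ac_p E.Ac_scaleR)
   then have "2 * \<delta> * t (e n) <= t (e n * e n) + \<delta>^2" using t by (simp add: Tr_add Tr_diff Tr_scale Tr_one)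
   then have "2 * \<delta> * t (e n) <= 2 * \<delta> * \<delta>" using 1 by (simp add: power2_eq_square)
   then show "t (e n) <= \<delta>" using \<delta> by simp
  qed
 qed
qed

lemma power_contraction: "psd b ==> norm b <= 1 ==> psd (b ^ m) \<and> norm (b ^ m) <= (1 :: real)" for b :: "'b::cstar"
proof (induction m)
 case (Suc m)
 then show ?case using norm_mult_le[of b 1 "b ^ m" 1] by (auto intro!: psd_mult simp: power_commutes)
qed simp

text \<open>With \<open>b = f n ^ m\<close>, expanding \<open>t ((1 - b)^2) <= \<rho>^2\<close> and
  dropping \<open>t (b * b)\<close> gives \<open>t b >= (1 - \<rho>^2) / 2\<close>. The bound is
  uniform in \<open>m\<close> because \<open>\<rho>\<close> lies between the supremum and 1.\<close>

lemma traces_of_powers_bounded_below: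
 assumes T_ne: "Tr ~= {}" and f: "f \<in> BS" "!!n. psd (f n)" "!!n. norm (f n) <= 1"
  and sup: "(SUP m\<in>{1..}. norm2_ultra \<omega> A (\<one>\<^bsub>U\<^esub> \<ominus>\<^bsub>U\<^esub> (cl f [^]\<^bsub>U\<^esub> (m::nat)))) < 1"
 shows "\<exists>\<kappa>>0. \<forall>m\<ge>1. eventually (%n. \<forall>t\<in>Tr. t (f n ^ m) >= \<kappa>) \<omega>"
proof -
 let ?g = "%m n. emb \<one> - f n ^ m"
 have one: "(%n. emb \<one>) \<in> BS" by (rule BS_const) simp
 have fE: "f n ^ m \<in> Ec" if "m >= 1" for n m using BS_in[OF BS_power[OF f(1), of "m - 1"]] that by simp
 have gB: "?g m \<in> BS" if "m >= 1" for m using BS_diff[OF one BS_power[OF f(1), of "m - 1"]] that by simp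
 have cg: "\<one>\<^bsub>U\<^esub> \<ominus>\<^bsub>U\<^esub> (cl f [^]\<^bsub>U\<^esub> m) = cl (?g m)" if "m >= 1" for m
  using U_pow[OF f(1), of "m - 1"] U_minus[OF one BS_power[OF f(1), of "m - 1"]] that by (simp add: U_one)
 let ?l = "%m. norm2_ultra \<omega> A (cl (?g m))"
 note lim = norm2_ultra_limit[OF T_ne gB]
 have gn: "norm (?g m n) <= 1" if "m >= 1" for m n
 proof -
  have pc: "psd (f n ^ m)" "norm (f n ^ m) <= 1" using power_contraction[OF f(2,3)] by auto
  have "psd (1 *\<^sub>R emb \<one> - f n ^ m)" by (rule E.psd_corner_upper[OF fE[OF that] psd_sa[OF pc(1)] pc(2)])
  moreover have "norm (emb \<one>) <= 1" using nrm_one_le by (simp add: norm_emb)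
  ultimately show ?thesis using psd_norm_mono[of "?g m n" "emb \<one>"] pc(1) by simp
 qed
 have l1: "?l m <= 1" if "m >= 1" for m
  by (rule tendsto_upperbound[OF lim[OF that] _ not_bot])
   (use norm2_le[OF T_ne BS_in[OF gB[OF that]]] gn[OF that] order_trans in \<open>blast intro: always_eventually\<close>)
 have l0: "?l m >= 0" if "m >= 1" for m
  by (rule tendsto_lowerbound[OF lim[OF that] _ not_bot])
   (use norm2_nonneg[OF T_ne BS_in[OF gB[OF that]]] in simp)
 define \<sigma> where "\<sigma> = (SUP m\<in>{1..}. ?l m)"
 have "(SUP m\<in>{1..}. norm2_ultra \<omega> A (\<one>\<^bsub>U\<^esub> \<ominus>\<^bsub>U\<^esub> (cl f [^]\<^bsub>U\<^esub> (m::nat)))) = \<sigma>"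
  unfolding \<sigma>_def by (rule SUP_cong) (use cg in auto)
 then have \<sigma>1: "\<sigma> < 1" using sup by simp
 \<comment> \<open>A real supremum bounds its family only if that is bounded above, which
   \<open>l1\<close> provides.\<close>
 have l\<sigma>: "?l m <= \<sigma>" if "m >= 1" for m unfolding \<sigma>_def
  by (rule cSUP_upper) (use that l1 in \<open>auto intro!: bdd_aboveI[of _ 1]\<close>)
 define \<rho> where "\<rho> = (\<sigma> + 1) / 2"
 have \<rho>: "0 <= \<rho>" "\<rho> < 1" "\<sigma> < \<rho>" using \<sigma>1 l0[of 1] l\<sigma>[of 1] by (auto simp: \<rho>_def)
 define \<kappa> where "\<kappa> = (1 - \<rho>^2) / 2"
 have "\<kappa> > 0" using \<rho> by (simp add: \<kappa>_def abs_square_less_1)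
 moreover have "eventually (%n. \<forall>t\<in>Tr. t (f n ^ m) >= \<kappa>) \<omega>" if m: "m >= 1" for m
 proof -
  have "eventually (%n. norm2 A (proj (?g m n)) < \<rho>) \<omega>"
   by (rule order_tendstoD(2)[OF lim[OF m]]) (use l\<sigma>[OF m] \<rho> in simp)
  then show ?thesis
  proof eventually_elim
   case (elim n)
   show ?case
   proof
    fix t assume t: "t \<in> Tr"
    have b: "f n ^ m \<in> Ec" "adj (f n ^ m) = f n ^ m" using fE[OF m] power_contraction[OF f(2,3)] psd_sa by blast+
    have "t (adj (?g m n) * ?g m n) <= norm2 A (proj (?g m n)) ^ 2" by (rule le_norm2[OF T_ne BS_in[OF gB[OF m]] t])
    also have "... <= \<rho>^2" using elim norm2_nonneg[OF T_ne BS_in[OF gB[OF m]]] by (intro power_mono) auto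
    also have "adj (?g m n) * ?g m n = emb \<one> - 2 *\<^sub>R f n ^ m + adj (f n ^ m) * f n ^ m"
     by (simp add: adj_diff b(2) emb_adj_one left_diff_distrib right_diff_distrib E.Ac_left[OF b(1)] E.Ac_right[OF b(1)] E.pp scaleR_2)
    finally have "1 - 2 * t (f n ^ m) + t (adj (f n ^ m) * f n ^ m) <= \<rho>^2"
     using t by (simp add: Tr_add Tr_diff Tr_scale Tr_one)
    moreover have "t (adj (f n ^ m) * f n ^ m) >= 0" by (rule Tr_pos[OF t E.Ac_mult_right[OF b(1)] psd_adj_mult])
    ultimately show "\<kappa> <= t (f n ^ m)" by (simp add: \<kappa>_def)
   qed
  qed
 qed
 ultimately show ?thesis by blast
qed

end

section \<open>From central sequences to an exact excising sequence\<close>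

context cstar_ultrapower
begin

lemma central_sequences_lift:
 assumes core: "tracial_core (emb \<one>) Tr \<gamma>"
  and e: "e \<in> BS" "!!n. psd (e n)" "!!n. norm (e n) <= 1" "cl e \<in> central_seq_alg \<omega> A" "cl e \<in> trace_kernel \<omega> A"
  and f: "f \<in> BS" "!!n. psd (f n)" "!!n. norm (f n) <= 1" "cl f \<in> central_seq_alg \<omega> A"
   "(SUP m\<in>{1..}. norm2_ultra \<omega> A (\<one>\<^bsub>U\<^esub> \<ominus>\<^bsub>U\<^esub> (cl f [^]\<^bsub>U\<^esub> (m::nat)))) < 1"
 shows "\<exists>\<kappa>. central_sequences (emb \<one>) Tr \<gamma> \<omega> e f \<kappa>"
proof -
 interpret tracial_core "emb \<one>" Tr \<gamma> by (rule core)
 obtain \<kappa> where \<kappa>: "\<kappa> > 0" "\<forall>m\<ge>1. eventually (%n. \<forall>t\<in>Tr. t (f n ^ m) >= \<kappa>) \<omega>"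
  using traces_of_powers_bounded_below[OF T_ne f(1,2,3,5)] by blast
 have "central_sequences (emb \<one>) Tr \<gamma> \<omega> e f \<kappa>"
  by (intro central_sequences.intro core central_sequences_axioms.intro ultra BS_in[OF e(1)] BS_in[OF f(1)] e(2,3) f(2,3) \<kappa>(1)
    trace_kernel_small[OF T_ne e(1) psd_sa[OF e(2)] e(5)] central_lift[OF e(1,4)] central_lift[OF f(1,4)])
   (use \<kappa>(2) in auto)
 then show ?thesis by blast
qed

lemma excision_sequence:
 assumes seqs: "central_sequences (emb \<one>) Tr \<gamma> \<omega> e f \<kappa>" and sep: "separable_alg A"
  and cp: "completely_positive A A \<phi>" and nuc: "nuclear_map A \<phi>"
 shows "\<exists>s\<in>BS. sim (%n. f n * s n) s \<and> (\<forall>a\<in>Ec. sim (%n. adj (s n) * a * s n) (%n. emb (\<phi> (proj a)) * e n))"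
proof -
 interpret central_sequences "emb \<one>" Tr \<gamma> \<omega> e f \<kappa> by (rule seqs)
 let ?F = "%a. emb (\<phi> (proj a))"
 have lin: "linear_map A A \<phi>" using cp by (simp add: completely_positive_def)
 then have \<phi>c: "\<phi> \<in> carrier A \<rightarrow> carrier A" by (simp add: linear_map_def)
 obtain d where d: "range d \<subseteq> Ec" "!!a \<epsilon>. a \<in> Ec ==> \<epsilon> > 0 ==> \<exists>k::nat. norm (a - d k) < \<epsilon>"
  using dense_sequence[OF sep] by blast
 \<comment> \<open>The unit is always included: its condition bounds \<open>norm (s n) ^ 2\<close>
   by \<open>norm (\<phi> 1) + 1\<close>, which makes the diagonal sequence bounded.\<close>
 define D where "D m = insert (emb \<one>) (d ` {..<m})" for m
 have D: "finite (D m)" "D m \<subseteq> Ec" for m using d(1) by (auto simp: D_def)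
 define Q where "Q m n s \<longleftrightarrow> s \<in> Ec \<and> norm (f n * s - s) <= 1 / real (Suc m) \<and>
  (\<forall>a\<in>D m. norm (adj s * a * s - ?F a * e n) <= 1 / real (Suc m))" for m n s
 have ev: "eventually (%n. \<exists>s. Q m n s) \<omega>" for m
 proof -
  define \<epsilon> where "\<epsilon> = 1 / (2 * real (Suc m))"
  have \<epsilon>: "\<epsilon> > 0" "\<epsilon> + \<epsilon> = 1 / real (Suc m)" "\<epsilon> <= 1 / real (Suc m)" by (auto simp: \<epsilon>_def field_simps)
  have P: "finite (proj ` D m)" "proj ` D m \<subseteq> carrier A" using D by auto
  obtain I :: "(nat \<times> nat) set" and W c where W: "cp_coeffs (emb \<one>) Tr \<gamma> I W" "\<forall>i. c i \<in> Ec"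
   and approx: "\<forall>a\<in>proj ` D m. norm ((\<Sum>i\<in>I. \<Sum>j\<in>I. cx (W (emb a) i j) * (adj (c i) * c j)) - emb (\<phi> a)) <= \<epsilon>"
   using nuclear_coeffs[OF tracial_core_axioms nuc \<phi>c P \<epsilon>(1)] by (elim exE conjE)
  interpret cp_excision "emb \<one>" Tr \<gamma> \<omega> e f \<kappa> I W c
   using W by (intro cp_excision.intro cp_excision_axioms.intro seqs) auto
  have near: "norm (cp_map a - ?F a) <= \<epsilon>" if "a \<in> D m" for a
   using approx that D(2)[of m] by (auto simp: cp_map_def emb_proj_id subset_iff)
  show ?thesis using approx_excision[OF D \<epsilon>(1), of m]
  proof eventually_elim
   case (elim n)
   then obtain s where s: "s \<in> Ec" "norm (f n * s - s) <= \<epsilon>" "\<forall>a\<in>D m. norm (adj s * a * s - cp_map a * e n) <= \<epsilon>" by blast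
   have "norm (adj s * a * s - ?F a * e n) <= 1 / real (Suc m)" if a: "a \<in> D m" for a
   proof -
    have "norm ((cp_map a - ?F a) * e n) <= \<epsilon> * 1" by (rule norm_mult_le[OF near[OF a] e(3)])
    then have "norm (adj s * a * s - cp_map a * e n + (cp_map a - ?F a) * e n) <= \<epsilon> + \<epsilon>"
     using s(3) a by (intro norm_triangle_le add_mono) auto
    moreover have "adj s * a * s - cp_map a * e n + (cp_map a - ?F a) * e n = adj s * a * s - ?F a * e n"
     by (simp add: algebra_simps)
    ultimately show ?thesis by (simp only: \<epsilon>(2))
   qed
   then show ?case using s \<epsilon>(3) unfolding Q_def by (intro exI[of _ s]) auto
  qed
 qed
 have anti: "Q m n s" if "m <= m'" "Q m' n s" for m m' n s
 proof -
  have "1 / real (Suc m') <= 1 / real (Suc m)" using that(1) by (simp add: frac_le)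
  moreover have "D m \<subseteq> D m'" using that(1) by (auto simp: D_def)
  ultimately show ?thesis using that(2) unfolding Q_def by (meson order_trans subsetD)
 qed
 have "\<exists>s. \<forall>m. eventually (%n. Q m n (s n)) \<omega>"
  by (rule ultrafilter_diagonal[OF ultra ev]) (rule anti)
 then obtain s0 where s0: "!!m. eventually (%n. Q m n (s0 n)) \<omega>" by blast
 \<comment> \<open>The default 0 makes the norm bound hold for every \<open>n\<close>, not only
   along the ultrafilter.\<close>
 define s where "s n = (if Q 0 n (s0 n) then s0 n else 0)" for n
 have sQ: "eventually (%n. Q m n (s n)) \<omega>" for m
  using s0[of m] s0[of 0] by eventually_elim (simp add: s_def)
 define C where "C = sqrt (norm (?F (emb \<one>)) + 1)"
 have sE: "s n \<in> Ec" for n by (simp add: s_def Q_def)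
 have sC: "norm (s n) <= C" for n
 proof (cases "Q 0 n (s0 n)")
  case True
  have "norm (adj (s0 n) * emb \<one> * s0 n - ?F (emb \<one>) * e n) <= 1" and "s0 n \<in> Ec" using True by (auto simp: Q_def D_def)
  then have "norm (adj (s0 n) * s0 n - ?F (emb \<one>) * e n) <= 1" by (simp add: mult.assoc E.Ac_left)
  moreover have "norm (?F (emb \<one>) * e n) <= norm (?F (emb \<one>)) * 1" by (rule norm_mult_le[OF order_refl e(3)])
  ultimately have "norm (adj (s0 n) * s0 n) <= norm (?F (emb \<one>)) + 1"
   using norm_triangle_sub[of "adj (s0 n) * s0 n" "?F (emb \<one>) * e n"] by simp
  then show ?thesis using True by (simp add: s_def C_def norm_adj_mult real_le_rsqrt)
 qed (simp add: s_def C_def)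
 have sB: "s \<in> BS" by (rule BS_I[OF sE sC])
 have C0: "C >= 0" by (simp add: C_def)
 have small: "\<exists>m. 1 / real (Suc m) < \<epsilon>" if "\<epsilon> > 0" for \<epsilon> :: real
  using reals_Archimedean[OF that] by (auto simp: inverse_eq_divide)
 have fs: "sim (%n. f n * s n) s" unfolding sim_def
 proof (rule tendstoI)
  fix \<epsilon> :: real assume "\<epsilon> > 0"
  then obtain m where m: "1 / real (Suc m) < \<epsilon>" using small by blast
  show "eventually (%n. dist (f n * s n - s n) 0 < \<epsilon>) \<omega>" using sQ[of m]
  proof eventually_elim
   case (elim n)
   then have "norm (f n * s n - s n) <= 1 / real (Suc m)" by (simp only: Q_def)
   then show ?case using m by (simp only: dist_norm diff_zero le_less_trans)
  qed
 qed
 obtain K where K: "!!a. a \<in> Ec ==> norm (?F a) <= K * norm a" using cp_bounded[OF cp] by blast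
 have "sim (%n. adj (s n) * a * s n) (%n. ?F a * e n)" if a: "a \<in> Ec" for a unfolding sim_def
 proof (rule tendstoI)
  fix \<epsilon> :: real assume \<epsilon>: "\<epsilon> > 0"
  \<comment> \<open>Replacing \<open>a\<close> by a member of the dense sequence costs
    \<open>C * C\<close> on the side of \<open>s\<close> and the bound \<open>K\<close> of the map
    on the other.\<close>
  define L where "L = C * C + \<bar>K\<bar> + 1"
  have L: "L > 0" using C0 by (simp add: L_def add_nonneg_pos)
  obtain k where k: "norm (a - d k) < \<epsilon> / (2 * L)" using d(2)[OF a, of "\<epsilon> / (2 * L)"] \<epsilon> L by auto
  obtain m0 where m0: "1 / real (Suc m0) < \<epsilon> / 2" using small[of "\<epsilon> / 2"] \<epsilon> by auto
  define m where "m = max m0 (Suc k)"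
  have "1 / real (Suc m) <= 1 / real (Suc m0)" by (simp add: m_def frac_le)
  then have m: "1 / real (Suc m) < \<epsilon> / 2" using m0 by linarith
  have dm: "d k \<in> D m" "d k \<in> Ec" using d(1) by (auto simp: D_def m_def)
  have FK: "norm (?F a - ?F (d k)) <= \<bar>K\<bar> * norm (a - d k)"
  proof -
   have "?F (a - d k) = ?F a - ?F (d k)"
    using linear_map_emb(1)[OF lin, of a "- d k"] linear_map_emb(2)[OF lin, of "-1" "d k"] by (simp add: cx_uminus)
   moreover have "norm (?F (a - d k)) <= \<bar>K\<bar> * norm (a - d k)"
    using K[OF E.Ac_diff[OF a dm(2)]] mult_right_mono[OF abs_ge_self norm_ge_zero, of K "a - d k"] by linarith
   ultimately show ?thesis by simp
  qed
  show "eventually (%n. dist (adj (s n) * a * s n - ?F a * e n) 0 < \<epsilon>) \<omega>" using sQ[of m]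
  proof eventually_elim
   case (elim n)
   then have 1: "norm (adj (s n) * d k * s n - ?F (d k) * e n) <= 1 / real (Suc m)" using dm by (simp only: Q_def)
   have "norm (adj (s n) * (a - d k) * s n) <= C * norm (a - d k) * C"
    by (intro norm_mult_le order_refl sC) (simp add: norm_adj sC)
   moreover have "norm ((?F a - ?F (d k)) * e n) <= \<bar>K\<bar> * norm (a - d k) * 1" by (rule norm_mult_le[OF FK e(3)])
   moreover have "C * norm (a - d k) * C + \<bar>K\<bar> * norm (a - d k) * 1 <= L * norm (a - d k)"
    by (simp add: L_def algebra_simps)
   moreover have "L * norm (a - d k) <= \<epsilon> / 2" using k L by (simp add: field_simps)
   moreover have "adj (s n) * a * s n - ?F a * e n
     = (adj (s n) * d k * s n - ?F (d k) * e n) + (adj (s n) * (a - d k) * s n - (?F a - ?F (d k)) * e n)"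
    by (simp add: algebra_simps)
   ultimately show ?case
    using 1 m norm_triangle_ineq[of "adj (s n) * d k * s n - ?F (d k) * e n" "adj (s n) * (a - d k) * s n - (?F a - ?F (d k)) * e n"]
     norm_triangle_ineq4[of "adj (s n) * (a - d k) * s n" "(?F a - ?F (d k)) * e n"]
    by (simp only: dist_norm diff_zero)
  qed
 qed
 then show ?thesis using sB fs by blast
qed

end

theorem proposition5p10:
  fixes A :: "'a star_alg" and \<omega> :: "nat filter" and \<phi> :: "'a \<Rightarrow> 'a"
  assumes "free_ultrafilter \<omega>"
    and "cstar_algebra A"
    and "simple_alg A"
    and "separable_alg A"
    and "local_weak_comparison A"
    and "quasi_traces A = tracial_states A"
    and "tracial_states A \<noteq> {}"
    and "completely_positive A A \<phi>"
    and "nuclear_map A \<phi>"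
  shows "excised_in_small_central_sequences \<omega> A \<phi>"
proof -
 interpret cstar_ultrapower A \<omega>
  using assms(1,2) by (intro cstar_ultrapower.intro cstar_ultrapower_axioms.intro)
 obtain \<gamma> where core: "tracial_core (emb \<one>\<^bsub>A\<^esub>) Tr \<gamma>"
  using tracial_core_of_simple[OF assms(3,5,6,7)] by blast
 show ?thesis
  unfolding excised_in_small_central_sequences_def Let_def
 proof (intro allI impI, elim conjE)
  fix X Y
  assume X: "X \<in> central_seq_alg \<omega> A" "positive_contraction U X" "X \<in> trace_kernel \<omega> A"
   and Y: "Y \<in> central_seq_alg \<omega> A" "positive_contraction U Y"
    "(SUP n\<in>{1..}. norm2_ultra \<omega> A (\<one>\<^bsub>U\<^esub> \<ominus>\<^bsub>U\<^esub> (Y [^]\<^bsub>U\<^esub> (n::nat)))) < 1"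
  obtain e where e: "e \<in> BS" "X = cl e" "!!n. psd (e n)" "!!n. norm (e n) <= 1"
   using positive_contraction_lift[OF X(2)] by blast
  obtain f where f: "f \<in> BS" "Y = cl f" "!!n. psd (f n)" "!!n. norm (f n) <= 1"
   using positive_contraction_lift[OF Y(2)] by blast
  obtain \<kappa> where seqs: "central_sequences (emb \<one>\<^bsub>A\<^esub>) Tr \<gamma> \<omega> e f \<kappa>"
   using central_sequences_lift[OF core e(1,3,4) _ _ f(1,3,4)] X(1,3) Y(1,3) unfolding e(2) f(2) by blast
  obtain s where s: "s \<in> BS" "sim (%n. f n * s n) s"
   "!!a. a \<in> Ec ==> sim (%n. adj (s n) * a * s n) (%n. emb (\<phi> (proj a)) * e n)"
   using excision_sequence[OF seqs assms(4,8,9)] by blast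
  have "star U (cl s) \<otimes>\<^bsub>U\<^esub> ultra_const \<omega> A a \<otimes>\<^bsub>U\<^esub> cl s = ultra_const \<omega> A (\<phi> a) \<otimes>\<^bsub>U\<^esub> X"
   if a: "a \<in> carrier A" for a
  proof -
   have \<phi>a: "\<phi> a \<in> carrier A" using assms(8) a by (auto simp: completely_positive_def linear_map_def)
   note B = BS_const[OF emb_in[OF a]] BS_const[OF emb_in[OF \<phi>a]] BS_adj[OF s(1)]
   have "star U (cl s) \<otimes>\<^bsub>U\<^esub> ultra_const \<omega> A a \<otimes>\<^bsub>U\<^esub> cl s = cl (%n. adj (s n) * emb a * s n)"
    by (simp add: U_star s(1) ultra_const_cl a U_mult B BS_mult)
   also have "... = cl (%n. emb (\<phi> a) * e n)"
    using s(3)[OF emb_in[OF a]] by (simp add: cl_eq_iff BS_mult B s(1) e(1) a)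
   also have "... = ultra_const \<omega> A (\<phi> a) \<otimes>\<^bsub>U\<^esub> X" by (simp add: ultra_const_cl \<phi>a e U_mult B)
   finally show ?thesis .
  qed
  moreover have "Y \<otimes>\<^bsub>U\<^esub> cl s = cl s" using s(1,2) f(1) by (simp add: f(2) U_mult cl_eq_iff BS_mult)
  moreover have "cl s \<in> carrier U" using s(1) by (simp add: carrier_U)
  ultimately show "\<exists>s\<in>carrier U. Y \<otimes>\<^bsub>U\<^esub> s = s \<and>
    (\<forall>a\<in>carrier A. star U s \<otimes>\<^bsub>U\<^esub> ultra_const \<omega> A a \<otimes>\<^bsub>U\<^esub> s = ultra_const \<omega> A (\<phi> a) \<otimes>\<^bsub>U\<^esub> X)"
   by blast
 qed
qed

end
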